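(* Let $\mathbf{k}$ be a unitary commutative ring, $\lambda\in\mathbf{k}$, and let $(A,d)$ be a commutative regular differential $\mathbf{k}$-algebra of weight $\lambda$ with a fixed quasi-antiderivative $Q$. Let $\mathrm{ID}(A)^*=A_\varepsilon\otimes_K A\otimes \mathrm{Sh}^+(A_T)$, with derivation $d_A$ and operator $\Pi_A$, be as defined in the context. Then the triple $(\mathrm{ID}(A)^*,d_A,\Pi_A)$, together with the natural embedding $i_A\colon A\to \mathrm{ID}(A)^*=A_\varepsilon\otimes_K A\otimes \mathrm{Sh}^+(A_T)$ into the second tensor factor, is the free commutative integro-differential algebra of weight $\lambda$ generated by $(A,d)$. That is: $(\mathrm{ID}(A)^*,d_A,\Pi_A)$ is a commutative integro-differential algebra of weight $\lambda$, $i_A\colon (A,d)\to(\mathrm{ID}(A)^*,d_A)$ is a homomorphism of differential algebras, and for every commutative integro-differential $\mathbf{k}$-algebra $(R,D,\Pi)$ of weight $\lambda$ and every homomorphism of differential algebras $f\colon (A,d)\to (R,D)$ there is a unique homomorphism of integro-differential algebras $\bar f\colon (\mathrm{ID}(A)^*,d_A,\Pi_A)\to (R,D,\Pi)$ with $\bar f\circ i_A=f$.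
   Context: Tensor products without subscript are over $\mathbf{k}$. Algebras are unitary and associative unless said to be nonunitary; homomorphisms of differential (resp. integro-differential) algebras are unital $\mathbf{k}$-algebra homomorphisms commuting with the derivations (resp. with both operators). A differential $\mathbf{k}$-algebra of weight $\lambda$ is a unitary $\mathbf{k}$-algebra $R$ with a $\mathbf{k}$-linear $d\colon R\to R$ such that $d(xy)=d(x)y+xd(y)+\lambda d(x)d(y)$ for all $x,y$ and $d(1)=0$. An integro-differential $\mathbf{k}$-algebra of weight $\lambda$ is a differential $\mathbf{k}$-algebra $(R,D)$ of weight $\lambda$ with a $\mathbf{k}$-linear $\Pi\colon R\to R$ such that $D\circ\Pi=\mathrm{id}_R$ and $\Pi(D(x))\Pi(D(y))=\Pi(D(x))y+x\Pi(D(y))-\Pi(D(xy))$ for all $x,y\in R$. A quasi-inverse of a linear map $L\colon M\to N$ is a linear map $\bar L\colon N\to M$ with $L\bar LL=L$ and $\bar LL\bar L=\bar L$. A differential algebra $(A,d)$ of weight $\lambda$ is regular if $d$ has a quasi-inverse $Q\colon A\to A$ (as a $\mathbf{k}$-linear map) which, in case $\lambda\neq0$, has the additional property that $\ker Q$ is a nonunitary $\mathbf{k}$-subalgebra of $A$ (closed under multiplication, not required to contain $1$). Such a $Q$ is called a quasi-antiderivative. Construction. Put $K=\ker d\supseteq\mathbf{k}$, $A_T=\ker Q$, $T=\mathrm{id}_A-d\circ Q$ (a projector onto $A_T$ along $\operatorname{im} d$). Free commutative Rota-Baxter algebra: $\mathrm{Sh}(A)=\bigoplus_{k\ge0}A^{\otimes(k+1)}$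 with bilinear product $\diamond$ defined as follows for $\mathfrak a=a_0\otimes\cdots\otimes a_m$ and $\mathfrak b=b_0\otimes\cdots\otimes b_n$: if $m=0$, $\mathfrak a\diamond\mathfrak b=a_0b_0\otimes b_1\otimes\cdots\otimes b_n$; if $n=0$, $\mathfrak a\diamond\mathfrak b=a_0b_0\otimes a_1\otimes\cdots\otimes a_m$; if $m,n>0$, recursively $$\mathfrak a\diamond\mathfrak b=a_0b_0\otimes\Big((a_1\otimes\cdots\otimes a_m)\diamond(1\otimes b_1\otimes\cdots\otimes b_n)+(1\otimes a_1\otimes\cdots\otimes a_m)\diamond(b_1\otimes\cdots\otimes b_n)+\lambda(a_1\otimes\cdots\otimes a_m)\diamond(b_1\otimes\cdots\otimes b_n)\Big).$$ It has the derivation of weight $\lambda$ given by $d_A(a_0)=d(a_0)$ and, for $n\ge1$, $$d_A(a_0\otimes\cdots\otimes a_n)=d(a_0)\otimes a_1\otimes\cdots\otimes a_n+a_0a_1\otimes a_2\otimes\cdots\otimes a_n+\lambda d(a_0)a_1\otimes a_2\otimes\cdots\otimes a_n.$$ Let $\mathrm{Sh}_T(A)=\bigoplus_{n\ge0}A\otimes A_T^{\otimes n}\subseteq\mathrm{Sh}(A)$, a subalgebra closed under $d_A$; it is also written $A\otimes\mathrm{Sh}^+(A_T)$ with $\mathrm{Sh}^+(A_T)=\bigoplus_{n\ge0}A_T^{\otimes n}$ the mixable shuffle algebra of weight $\lambda$ on $A_T$ (the ordinary shuffle algebra on the module $A_T$ if $\lambda=0$). A pure tensor $a\otimes\bar{\mathfrak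 a}\in A\otimes A_T^{\otimes n}$ has length $n+1$. Let $\varepsilon\colon A\to A_\varepsilon$ be an isomorphism of $K$-algebras onto a replica $A_\varepsilon=\{\varepsilon(a)\mid a\in A\}$ of $A$, endowed with the zero derivation, and identify $\varepsilon(K)$ with $K$, so $\varepsilon(c)=c$ for $c\in K$. Set $\mathrm{ID}(A)^*=A_\varepsilon\otimes_K\mathrm{Sh}_T(A)=A_\varepsilon\otimes_KA\otimes\mathrm{Sh}^+(A_T)$, the tensor product algebra, with the tensor product derivation (again denoted $d_A$; it vanishes on $A_\varepsilon$ and restricts to $d_A$ on $\mathrm{Sh}_T(A)$). The operator $\Pi_A$ on $\mathrm{ID}(A)^*$ is required to be linear over $A_\varepsilon$ and is given on pure tensors of $A\otimes\mathrm{Sh}^+(A_T)$ by induction on length: for $a\in A$, $$\Pi_A(a)=Q(a)-\varepsilon(Q(a))+1\otimes T(a),$$ and for $a\in A$, $\bar{\mathfrak a}\in A_T^{\otimes n}$, $n\ge1$, $$\Pi_A(a\otimes\bar{\mathfrak a})=Q(a)\otimes\bar{\mathfrak a}-\Pi_A(Q(a)\bar{\mathfrak a})-\lambda\,\Pi_A(d(Q(a))\bar{\mathfrak a})+1\otimes T(a)\otimes\bar{\mathfrak a},$$ where for $b\in A$ and $\bar{\mathfrak a}=a_1\otimes\cdots\otimes a_n$ one writes $b\bar{\mathfrak a}=ba_1\otimes a_2\otimes\cdots\otimes a_n\in A\otimes A_T^{\otimes(n-1)}$.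
   Formalization: Added assumption: the recursive formula for Π_A satisfies Π_A(ca⊗ā)=ε(c)Π_A(a⊗ā) for c in K. Without it no A_ε-linear Π_A need exist: for A=k[s], d=0, Q=0, it gives both s⊗1 and 1⊗s for Π_A(s). The condition holds whenever Π_A exists. *)

theory Defs
  imports "HOL-Algebra.Algebra"
begin

section \<open>Linear maps, differential and integro-differential algebras\<close>

definition linear_map ::
  "('k, 'x) ring_scheme \<Rightarrow> ('k, 'a, 'y) module_scheme \<Rightarrow> ('k, 'b, 'z) module_scheme \<Rightarrow> ('a \<Rightarrow> 'b) set"
  where "linear_map k M N = {L \<in> carrier M \<rightarrow> carrier N.
      (\<forall>x\<in>carrier M. \<forall>y\<in>carrier M. L (x \<oplus>\<^bsub>M\<^esub> y) = L x \<oplus>\<^bsub>N\<^esub> L y) \<and>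
      (\<forall>r\<in>carrier k. \<forall>x\<in>carrier M. L (r \<odot>\<^bsub>M\<^esub> x) = r \<odot>\<^bsub>N\<^esub> L x)}"

definition quasi_inverse ::
  "('k, 'x) ring_scheme \<Rightarrow> ('k, 'a, 'y) module_scheme \<Rightarrow> ('k, 'b, 'z) module_scheme
    \<Rightarrow> ('a \<Rightarrow> 'b) \<Rightarrow> ('b \<Rightarrow> 'a) \<Rightarrow> bool"
  where "quasi_inverse k M N L L' \<longleftrightarrow> L' \<in> linear_map k N M \<and>
      (\<forall>x\<in>carrier M. L (L' (L x)) = L x) \<and> (\<forall>y\<in>carrier N. L' (L (L' y)) = L' y)"

definition nonunital_subalgebra ::
  "('k, 'x) ring_scheme \<Rightarrow> ('k, 'a, 'y) module_scheme \<Rightarrow> 'a set \<Rightarrow> bool"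
  where "nonunital_subalgebra k A B \<longleftrightarrow>
      submodule B k A \<and> (\<forall>x\<in>B. \<forall>y\<in>B. x \<otimes>\<^bsub>A\<^esub> y \<in> B)"

text \<open>The locale \<open>algebra\<close> of HOL-Algebra already makes the algebra commutative.\<close>

locale comm_diff_algebra = algebra k A
  for k (structure) and A (structure) and lam and d +
  assumes lam_closed: "lam \<in> carrier k"
    and d_linear: "d \<in> linear_map k A A"
    and d_mult: "\<lbrakk>x \<in> carrier A; y \<in> carrier A\<rbrakk> \<Longrightarrow>
      d (x \<otimes>\<^bsub>A\<^esub> y) = d x \<otimes>\<^bsub>A\<^esub> y \<oplus>\<^bsub>A\<^esub> x \<otimes>\<^bsub>A\<^esub> d y \<oplus>\<^bsub>A\<^esub> lam \<odot>\<^bsub>A\<^esub> (d x \<otimes>\<^bsub>A\<^esub> d y)"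
    and d_one: "d \<one>\<^bsub>A\<^esub> = \<zero>\<^bsub>A\<^esub>"

locale comm_integro_diff_algebra = comm_diff_algebra k R lam D
  for k (structure) and R (structure) and lam and D and P +
  assumes P_linear: "P \<in> linear_map k R R"
    and D_P: "x \<in> carrier R \<Longrightarrow> D (P x) = x"
    and hybrid_Rota_Baxter: "\<lbrakk>x \<in> carrier R; y \<in> carrier R\<rbrakk> \<Longrightarrow>
      P (D x) \<otimes>\<^bsub>R\<^esub> P (D y) = P (D x) \<otimes>\<^bsub>R\<^esub> y \<oplus>\<^bsub>R\<^esub> x \<otimes>\<^bsub>R\<^esub> P (D y) \<ominus>\<^bsub>R\<^esub> P (D (x \<otimes>\<^bsub>R\<^esub> y))"

definition alg_hom ::
  "('k, 'x) ring_scheme \<Rightarrow> ('k, 'a, 'y) module_scheme \<Rightarrow> ('k, 'b, 'z) module_scheme \<Rightarrow> ('a \<Rightarrow> 'b) set"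
  where "alg_hom k A B = ring_hom A B \<inter> linear_map k A B"

definition diff_hom ::
  "('k, 'x) ring_scheme \<Rightarrow> ('k, 'a, 'y) module_scheme \<Rightarrow> ('a \<Rightarrow> 'a)
    \<Rightarrow> ('k, 'b, 'z) module_scheme \<Rightarrow> ('b \<Rightarrow> 'b) \<Rightarrow> ('a \<Rightarrow> 'b) set"
  where "diff_hom k A dA B dB = {f \<in> alg_hom k A B. \<forall>x\<in>carrier A. f (dA x) = dB (f x)}"

definition integro_diff_hom ::
  "('k, 'x) ring_scheme \<Rightarrow> ('k, 'a, 'y) module_scheme \<Rightarrow> ('a \<Rightarrow> 'a) \<Rightarrow> ('a \<Rightarrow> 'a)
    \<Rightarrow> ('k, 'b, 'z) module_scheme \<Rightarrow> ('b \<Rightarrow> 'b) \<Rightarrow> ('b \<Rightarrow> 'b) \<Rightarrow> ('a \<Rightarrow> 'b) set"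
  where "integro_diff_hom k A dA PA B dB PB =
      {f \<in> diff_hom k A dA B dB. \<forall>x\<in>carrier A. f (PA x) = PB (f x)}"


section \<open>Tensor products\<close>

text \<open>
  Abelian groups built from free abelian groups are written multiplicatively (as monoid records).
  Maps prescribed on a family \<open>p s\<close> of generators and extended additively are given by
  \<open>hom_ext\<close>; outside the carrier such a map is \<open>undefined\<close>.
\<close>

definition hom_ext ::
  "('g, 'x) monoid_scheme \<Rightarrow> ('h, 'y) monoid_scheme \<Rightarrow> 's set \<Rightarrow> ('s \<Rightarrow> 'g) \<Rightarrow> ('s \<Rightarrow> 'h) \<Rightarrow> 'g \<Rightarrow> 'h"
  where "hom_ext G H S p g =
      (THE h. h \<in> hom G H \<and> h \<in> extensional (carrier G) \<and> (\<forall>s\<in>S. h (p s) = g s))"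

definition biadd_ext ::
  "('g, 'x) monoid_scheme \<Rightarrow> 's set \<Rightarrow> ('s \<Rightarrow> 'g) \<Rightarrow> ('s \<Rightarrow> 's \<Rightarrow> 'g) \<Rightarrow> 'g \<Rightarrow> 'g \<Rightarrow> 'g"
  where "biadd_ext G S p g x y = hom_ext G G S p (\<lambda>s. hom_ext G G S p (g s) y) x"

subsection \<open>Tensor powers\<close>

definition words :: "('k, 'a, 'y) module_scheme \<Rightarrow> nat \<Rightarrow> 'a list set"
  where "words M n = {w. length w = n \<and> set w \<subseteq> carrier M}"

definition power_relations ::
  "('k, 'x) ring_scheme \<Rightarrow> ('k, 'a, 'y) module_scheme \<Rightarrow> nat \<Rightarrow> ('a list \<Rightarrow>\<^sub>0 int) set"
  where "power_relations k M n =
      {frag_of (u @ (a \<oplus>\<^bsub>M\<^esub> b) # v) - frag_of (u @ a # v) - frag_of (u @ b # v) | u v a b.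
        u @ a # v \<in> words M n \<and> b \<in> carrier M} \<union>
      {frag_of (u @ (r \<odot>\<^bsub>M\<^esub> a) # v @ b # w) - frag_of (u @ a # v @ (r \<odot>\<^bsub>M\<^esub> b) # w) | r u v w a b.
        u @ a # v @ b # w \<in> words M n \<and> r \<in> carrier k}"

definition power_kernel ::
  "('k, 'x) ring_scheme \<Rightarrow> ('k, 'a, 'y) module_scheme \<Rightarrow> nat \<Rightarrow> ('a list \<Rightarrow>\<^sub>0 int) set"
  where "power_kernel k M n = generate (free_Abelian_group (words M n)) (power_relations k M n)"

text \<open>The \<open>n\<close>-fold tensor power of the \<open>k\<close>-module \<open>M\<close>; only used for \<open>n \<ge> 1\<close>.\<close>

definition tensor_power ::
  "('k, 'x) ring_scheme \<Rightarrow> ('k, 'a, 'y) module_scheme \<Rightarrow> nat \<Rightarrow> ('a list \<Rightarrow>\<^sub>0 int) set monoid"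
  where "tensor_power k M n = free_Abelian_group (words M n) Mod power_kernel k M n"

definition power_pure ::
  "('k, 'x) ring_scheme \<Rightarrow> ('k, 'a, 'y) module_scheme \<Rightarrow> 'a list \<Rightarrow> ('a list \<Rightarrow>\<^sub>0 int) set"
  where "power_pure k M w =
      power_kernel k M (length w) #>\<^bsub>free_Abelian_group (words M (length w))\<^esub> frag_of w"

subsection \<open>Tensor product of two commutative algebras\<close>

definition tensor_relations ::
  "('c, 'x) ring_scheme \<Rightarrow> ('c, 'a, 'y) module_scheme \<Rightarrow> ('c, 'b, 'z) module_scheme
    \<Rightarrow> ('a \<times> 'b \<Rightarrow>\<^sub>0 int) set"
  where "tensor_relations K M N =
      {frag_of (m \<oplus>\<^bsub>M\<^esub> m', n) - frag_of (m, n) - frag_of (m', n) | m m' n.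
        m \<in> carrier M \<and> m' \<in> carrier M \<and> n \<in> carrier N} \<union>
      {frag_of (m, n \<oplus>\<^bsub>N\<^esub> n') - frag_of (m, n) - frag_of (m, n') | m n n'.
        m \<in> carrier M \<and> n \<in> carrier N \<and> n' \<in> carrier N} \<union>
      {frag_of (c \<odot>\<^bsub>M\<^esub> m, n) - frag_of (m, c \<odot>\<^bsub>N\<^esub> n) | c m n.
        c \<in> carrier K \<and> m \<in> carrier M \<and> n \<in> carrier N}"

definition tensor_kernel ::
  "('c, 'x) ring_scheme \<Rightarrow> ('c, 'a, 'y) module_scheme \<Rightarrow> ('c, 'b, 'z) module_scheme
    \<Rightarrow> ('a \<times> 'b \<Rightarrow>\<^sub>0 int) set"
  where "tensor_kernel K M N =
      generate (free_Abelian_group (carrier M \<times> carrier N)) (tensor_relations K M N)"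

definition tensor_group ::
  "('c, 'x) ring_scheme \<Rightarrow> ('c, 'a, 'y) module_scheme \<Rightarrow> ('c, 'b, 'z) module_scheme
    \<Rightarrow> ('a \<times> 'b \<Rightarrow>\<^sub>0 int) set monoid"
  where "tensor_group K M N =
      free_Abelian_group (carrier M \<times> carrier N) Mod tensor_kernel K M N"

definition tensor_pure ::
  "('c, 'x) ring_scheme \<Rightarrow> ('c, 'a, 'y) module_scheme \<Rightarrow> ('c, 'b, 'z) module_scheme
    \<Rightarrow> 'a \<Rightarrow> 'b \<Rightarrow> ('a \<times> 'b \<Rightarrow>\<^sub>0 int) set"
  where "tensor_pure K M N m n =
      tensor_kernel K M N #>\<^bsub>free_Abelian_group (carrier M \<times> carrier N)\<^esub> frag_of (m, n)"

definition tensor_ext ::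
  "('c, 'x) ring_scheme \<Rightarrow> ('c, 'a, 'y) module_scheme \<Rightarrow> ('c, 'b, 'z) module_scheme
    \<Rightarrow> ('a \<Rightarrow> 'b \<Rightarrow> ('a \<times> 'b \<Rightarrow>\<^sub>0 int) set) \<Rightarrow> ('a \<times> 'b \<Rightarrow>\<^sub>0 int) set \<Rightarrow> ('a \<times> 'b \<Rightarrow>\<^sub>0 int) set"
  where "tensor_ext K M N g =
      hom_ext (tensor_group K M N) (tensor_group K M N) (carrier M \<times> carrier N)
        (case_prod (tensor_pure K M N)) (case_prod g)"

definition tensor_algebra ::
  "('c, 'x) ring_scheme \<Rightarrow> ('c, 'a, 'y) module_scheme \<Rightarrow> ('c, 'b, 'z) module_scheme
    \<Rightarrow> ('c, ('a \<times> 'b \<Rightarrow>\<^sub>0 int) set) module"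
  where "tensor_algebra K M N =
      \<lparr>carrier = carrier (tensor_group K M N),
       monoid.mult = biadd_ext (tensor_group K M N) (carrier M \<times> carrier N)
         (case_prod (tensor_pure K M N))
         (\<lambda>(m, n) (m', n'). tensor_pure K M N (m \<otimes>\<^bsub>M\<^esub> m') (n \<otimes>\<^bsub>N\<^esub> n')),
       monoid.one = tensor_pure K M N \<one>\<^bsub>M\<^esub> \<one>\<^bsub>N\<^esub>,
       ring.zero = \<one>\<^bsub>tensor_group K M N\<^esub>,
       ring.add = monoid.mult (tensor_group K M N),
       module.smult = (\<lambda>c. tensor_ext K M N (\<lambda>m n. tensor_pure K M N (c \<odot>\<^bsub>M\<^esub> m) n))\<rparr>"

definition tensor_derivation ::
  "('c, 'x) ring_scheme \<Rightarrow> ('c, 'a, 'y) module_scheme \<Rightarrow> ('c, 'b, 'z) module_scheme \<Rightarrow> 'c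
    \<Rightarrow> ('a \<Rightarrow> 'a) \<Rightarrow> ('b \<Rightarrow> 'b) \<Rightarrow> ('a \<times> 'b \<Rightarrow>\<^sub>0 int) set \<Rightarrow> ('a \<times> 'b \<Rightarrow>\<^sub>0 int) set"
  where "tensor_derivation K M N mu dM dN = tensor_ext K M N (\<lambda>m n.
      tensor_pure K M N (dM m) n
        \<oplus>\<^bsub>tensor_algebra K M N\<^esub> tensor_pure K M N m (dN n)
        \<oplus>\<^bsub>tensor_algebra K M N\<^esub> mu \<odot>\<^bsub>tensor_algebra K M N\<^esub> tensor_pure K M N (dM m) (dN n))"

definition restrict_scalars ::
  "('r \<Rightarrow> 'c) \<Rightarrow> ('c, 'a, 'y) module_scheme \<Rightarrow> ('r, 'a) module"
  where "restrict_scalars phi M =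
      \<lparr>carrier = carrier M, monoid.mult = monoid.mult M, monoid.one = monoid.one M,
       ring.zero = ring.zero M, ring.add = ring.add M,
       module.smult = (\<lambda>r. module.smult M (phi r))\<rparr>"


section \<open>The algebra \<open>ID(A)\<^sup>*\<close>\<close>

datatype 'a replica = Eps (unEps: 'a)

locale regular_diff_algebra = comm_diff_algebra k A lam d
  for k (structure) and A (structure) and lam and d and Q +
  assumes Q_quasi_inverse: "quasi_inverse k A A d Q"
    and ker_Q_subalgebra: "lam \<noteq> \<zero>\<^bsub>k\<^esub> \<Longrightarrow> nonunital_subalgebra k A {a \<in> carrier A. Q a = \<zero>\<^bsub>A\<^esub>}"
begin

definition A_T :: "'c set"
  where "A_T = {a \<in> carrier A. Q a = \<zero>\<^bsub>A\<^esub>}"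

definition T :: "'c \<Rightarrow> 'c"
  where "T a = a \<ominus>\<^bsub>A\<^esub> d (Q a)"

definition K
  where "K = A\<lparr>carrier := {a \<in> carrier A. d a = \<zero>\<^bsub>A\<^esub>}\<rparr>"

subsection \<open>The free commutative Rota-Baxter algebra \<open>Sh(A)\<close>\<close>

definition Sh_group :: "(nat \<Rightarrow> ('c list \<Rightarrow>\<^sub>0 int) set) monoid"
  where "Sh_group = sum_group UNIV (\<lambda>n. tensor_power k A (Suc n))"

text \<open>The pure tensor \<open>a\<^sub>0 \<otimes> \<dots> \<otimes> a\<^sub>n\<close>, given as a nonempty list, lies in the summand with index \<open>n\<close>.\<close>

definition tens :: "'c list \<Rightarrow> nat \<Rightarrow> ('c list \<Rightarrow>\<^sub>0 int) set"
  where "tens w = (\<lambda>n. if Suc n = length w then power_pure k A w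
      else \<one>\<^bsub>tensor_power k A (Suc n)\<^esub>)"

definition Sh_ext where
  "Sh_ext = hom_ext Sh_group Sh_group {w. w \<noteq> [] \<and> set w \<subseteq> carrier A} tens"

definition Sh_smult where
  "Sh_smult r = Sh_ext (\<lambda>w. tens ((r \<odot>\<^bsub>A\<^esub> hd w) # tl w))"

text \<open>\<open>Sh_cons c x\<close> is \<open>c \<otimes> x\<close>.\<close>

definition Sh_cons where
  "Sh_cons c = Sh_ext (\<lambda>w. tens (c # w))"

fun shuffle :: "'c list \<Rightarrow> 'c list \<Rightarrow> nat \<Rightarrow> ('c list \<Rightarrow>\<^sub>0 int) set" where
  "shuffle [a] (b # bs) = tens ((a \<otimes>\<^bsub>A\<^esub> b) # bs)"
| "shuffle (a # a' # as) [b] = tens ((a \<otimes>\<^bsub>A\<^esub> b) # a' # as)"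
| "shuffle (a # a' # as) (b # b' # bs) = Sh_cons (a \<otimes>\<^bsub>A\<^esub> b)
    (shuffle (a' # as) (\<one>\<^bsub>A\<^esub> # b' # bs)
      \<otimes>\<^bsub>Sh_group\<^esub> shuffle (\<one>\<^bsub>A\<^esub> # a' # as) (b' # bs)
      \<otimes>\<^bsub>Sh_group\<^esub> Sh_smult lam (shuffle (a' # as) (b' # bs)))"
| "shuffle _ _ = \<one>\<^bsub>Sh_group\<^esub>"

definition Sh :: "('a, nat \<Rightarrow> ('c list \<Rightarrow>\<^sub>0 int) set) module"
  where "Sh =
      \<lparr>carrier = carrier Sh_group,
       monoid.mult = biadd_ext Sh_group {w. w \<noteq> [] \<and> set w \<subseteq> carrier A} tens shuffle,
       monoid.one = tens [\<one>\<^bsub>A\<^esub>],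
       ring.zero = \<one>\<^bsub>Sh_group\<^esub>,
       ring.add = monoid.mult Sh_group,
       module.smult = Sh_smult\<rparr>"

fun d_word :: "'c list \<Rightarrow> nat \<Rightarrow> ('c list \<Rightarrow>\<^sub>0 int) set" where
  "d_word [] = \<zero>\<^bsub>Sh\<^esub>"
| "d_word [a] = tens [d a]"
| "d_word (a # b # w) = tens (d a # b # w) \<oplus>\<^bsub>Sh\<^esub> tens ((a \<otimes>\<^bsub>A\<^esub> b) # w)
    \<oplus>\<^bsub>Sh\<^esub> lam \<odot>\<^bsub>Sh\<^esub> tens ((d a \<otimes>\<^bsub>A\<^esub> b) # w)"

definition d_Sh where
  "d_Sh = Sh_ext d_word"

subsection \<open>\<open>Sh\<^sub>T(A)\<close> and \<open>ID(A)\<^sup>*\<close>\<close>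

definition T_words :: "'c list set"
  where "T_words = {a # w | a w. a \<in> carrier A \<and> set w \<subseteq> A_T}"

text \<open>
  As \<open>A_T\<close> is a direct summand of \<open>A\<close>, the summand \<open>A \<otimes> A_T \<otimes> \<dots> \<otimes> A_T\<close> embeds into the
  corresponding tensor power of \<open>A\<close>; its image is spanned by its pure tensors.  \<open>K\<close> acts on
  \<open>Sh\<^sub>T(A)\<close> through the embedding \<open>K \<subseteq> A \<subseteq> Sh\<^sub>T(A)\<close>.
\<close>

definition Sh_T :: "('c, nat \<Rightarrow> ('c list \<Rightarrow>\<^sub>0 int) set) module"
  where "Sh_T =
      \<lparr>carrier = generate Sh_group (tens ` T_words),
       monoid.mult = monoid.mult Sh, monoid.one = monoid.one Sh,
       ring.zero = ring.zero Sh, ring.add = ring.add Sh,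
       module.smult = (\<lambda>c x. tens [c] \<otimes>\<^bsub>Sh\<^esub> x)\<rparr>"

text \<open>The replica as a \<open>K\<close>-algebra; \<open>c \<odot> Eps a = Eps (c \<otimes> a)\<close> encodes \<open>\<epsilon>(c) = c\<close> for \<open>c \<in> K\<close>.\<close>

definition A_eps :: "('c, 'c replica) module"
  where "A_eps =
      \<lparr>carrier = Eps ` carrier A,
       monoid.mult = (\<lambda>x y. Eps (unEps x \<otimes>\<^bsub>A\<^esub> unEps y)),
       monoid.one = Eps \<one>\<^bsub>A\<^esub>,
       ring.zero = Eps \<zero>\<^bsub>A\<^esub>,
       ring.add = (\<lambda>x y. Eps (unEps x \<oplus>\<^bsub>A\<^esub> unEps y)),
       module.smult = (\<lambda>c x. Eps (c \<otimes>\<^bsub>A\<^esub> unEps x))\<rparr>"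

definition ID where
  "ID = restrict_scalars (\<lambda>r. r \<odot>\<^bsub>A\<^esub> \<one>\<^bsub>A\<^esub>) (tensor_algebra K A_eps Sh_T)"

definition eps where
  "eps a = tensor_pure K A_eps Sh_T (Eps a) \<one>\<^bsub>Sh_T\<^esub>"

text \<open>The inclusion of \<open>A \<otimes> Sh\<^sup>+(A_T)\<close>, evaluated at a pure tensor.\<close>

definition incl where
  "incl w = tensor_pure K A_eps Sh_T \<one>\<^bsub>A_eps\<^esub> (tens w)"

definition i_A where
  "i_A a = incl [a]"

definition d_ID where
  "d_ID = tensor_derivation K A_eps Sh_T (lam \<odot>\<^bsub>A\<^esub> \<one>\<^bsub>A\<^esub>) (\<lambda>_. \<zero>\<^bsub>A_eps\<^esub>) d_Sh"

fun Pi_word where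
  "Pi_word [] = \<zero>\<^bsub>ID\<^esub>"
| "Pi_word [a] = incl [Q a] \<ominus>\<^bsub>ID\<^esub> eps (Q a) \<oplus>\<^bsub>ID\<^esub> incl [\<one>\<^bsub>A\<^esub>, T a]"
| "Pi_word (a # b # w) = incl (Q a # b # w)
    \<ominus>\<^bsub>ID\<^esub> Pi_word ((Q a \<otimes>\<^bsub>A\<^esub> b) # w)
    \<ominus>\<^bsub>ID\<^esub> lam \<odot>\<^bsub>ID\<^esub> Pi_word ((d (Q a) \<otimes>\<^bsub>A\<^esub> b) # w)
    \<oplus>\<^bsub>ID\<^esub> incl (\<one>\<^bsub>A\<^esub> # T a # b # w)"

definition Pi_ID where
  "Pi_ID = (THE P. P \<in> hom (add_monoid ID) (add_monoid ID) \<and> P \<in> extensional (carrier ID) \<and>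
      (\<forall>a\<in>carrier A. \<forall>x\<in>carrier ID. P (eps a \<otimes>\<^bsub>ID\<^esub> x) = eps a \<otimes>\<^bsub>ID\<^esub> P x) \<and>
      (\<forall>w\<in>T_words. P (incl w) = Pi_word w))"

text \<open>
  In \<open>ID(A)\<^sup>*\<close> one has \<open>\<epsilon>(c) = c\<close> for \<open>c \<in> K\<close>, so an operator that is linear over the
  replica satisfies \<open>P (c x) = \<epsilon>(c) P x\<close>.  The recursive formula must respect this for
  \<open>Pi_ID\<close> to exist.  This holds when \<open>K\<close> is the image of \<open>k\<close> and when \<open>d\<close> is onto, but it can fail
  because \<open>Q\<close> is only \<open>k\<close>-linear and the tensor factors of \<open>Sh\<^sup>+(A_T)\<close> are taken over \<open>k\<close>.
  For example it fails for a polynomial ring \<open>A = k[s]\<close> over a field with \<open>d = 0\<close> and \<open>Q = 0\<close>.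
\<close>

definition Pi_well_defined :: bool
  where "Pi_well_defined \<longleftrightarrow> (\<forall>c\<in>carrier K. \<forall>a w. a # w \<in> T_words \<longrightarrow>
      Pi_word ((c \<otimes>\<^bsub>A\<^esub> a) # w) = eps c \<otimes>\<^bsub>ID\<^esub> Pi_word (a # w))"

end

end

theory Submission
  imports Defs
begin

text \<open>
  For an integro-differential algebra \<open>(R, D, \<Pi>)\<close> put \<open>E = id - \<Pi> D\<close>.  The hybrid Rota-Baxter identity
  says precisely that \<open>E\<close> is multiplicative.  In \<open>ID(A)\<^sup>*\<close> the recursion gives \<open>d\<^sub>A \<Pi>\<^sub>A = id\<close> and
  \<open>\<Pi>\<^sub>A(b \<otimes> w) = 1 \<otimes> b \<otimes> w\<close> for \<open>b \<in> A\<^sub>T\<close>.  As \<open>E\<close> vanishes on the image of \<open>\<Pi>\<^sub>A\<close>, the splitting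
  \<open>a = Q(d a) + c\<close> with \<open>c \<in> K\<close> yields \<open>E(a) = \<epsilon>(a)\<close> for \<open>a \<in> A\<close>, while \<open>E\<close> kills every pure tensor of
  length at least two.  Hence \<open>E\<close> is multiplicative.

  A homomorphism extending \<open>f\<close> must send \<open>\<epsilon>(a) = E(a)\<close> to \<open>E(f(a))\<close> and \<open>a\<^sub>0 \<otimes> a\<^sub>1 \<otimes> \<dots> \<otimes> a\<^sub>n\<close> to
  \<open>f(a\<^sub>0) \<Pi>(f(a\<^sub>1) \<Pi>(\<dots>))\<close>, which gives uniqueness.  Conversely these formulas define a ring homomorphism
  by the Rota-Baxter identity, and it commutes with the integrals because of integration by parts,
  \<open>a \<Pi>(x) = \<Pi>(D(a) \<Pi>(x) + a x + \<lambda> D(a) x)\<close>.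
\<close>

text \<open>Most operations involved (products, scalar actions, \<open>d_Sh\<close>,
  \<open>Pi_ID\<close>) are definite descriptions of additive maps with prescribed values on pure
  tensors. They are meaningful only once a map with these values has been produced, so the work lies
  in existence: the values are shown to respect the relations of the tensor group, and equalities of
  additive maps are then tested on pure tensors. Two places resist. \<open>Sh_T\<close> is a span
  inside \<open>Sh\<close>, not a group given by generators and relations, so maps out of it are
  restrictions of maps on \<open>Sh\<close>. And \<open>ID\<close> is a tensor product over
  \<open>K\<close>, whereas the recursions are linear over \<open>k\<close> only: for each map out
  of \<open>ID\<close> it must be shown that a constant may cross the tensor sign. For the extension
  of \<open>f\<close> this follows from \<open>D (f c) = 0\<close>; for \<open>Pi_ID\<close> it is
  the content of \<open>Pi_well_defined\<close>. The algebra \<open>Sh\<close> is handled through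
  the operator \<open>Sh_cons \<one>\<close>: a pure tensor is a letter times this operator applied
  to a shorter tensor, and associativity, the Leibniz rule and the map to \<open>R\<close> all rest
  on Rota-Baxter identities.\<close>

lemma hom_eq_on_generate:
  assumes "group G" "group H" "h \<in> hom G H" "h' \<in> hom G H" "Y \<subseteq> carrier G"
    and "\<And>x. x \<in> Y \<Longrightarrow> h x = h' x" and "x \<in> generate G Y"
  shows "h x = h' x"
proof -
  interpret h: group_hom G H h
    by (simp add: assms group_hom_axioms_def group_hom_def)
  interpret h': group_hom G H h'
    by (simp add: assms group_hom_axioms_def group_hom_def)
  show ?thesis
    using assms(7)
  proof (induction rule: generate.induct)
    case (inv x)
    then show ?case
      using assms(5,6) h.hom_inv h'.hom_inv by (metis subsetD)
  next
    case (eng x y)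
    then show ?case
      using h.G.generate_in_carrier[OF assms(5)] by simp
  qed (use assms(6) in auto)
qed

lemma hom_comp_mult:
  assumes "comm_group H" "f \<in> hom G H" "g \<in> hom G H"
  shows "(\<lambda>x. f x \<otimes>\<^bsub>H\<^esub> g x) \<in> hom G H"
proof -
  interpret comm_group H by fact
  show ?thesis
    using assms(2,3) by (auto simp: hom_def Pi_iff m_ac)
qed

lemma hom_comp_inv:
  assumes "comm_group H" "f \<in> hom G H"
  shows "(\<lambda>x. inv\<^bsub>H\<^esub> f x) \<in> hom G H"
proof -
  interpret comm_group H by fact
  show ?thesis
    using assms(2) by (auto simp: hom_def Pi_iff inv_mult)
qed

lemma hom_compose': "\<lbrakk>f \<in> hom G H; g \<in> hom H I\<rbrakk> \<Longrightarrow> (\<lambda>x. g (f x)) \<in> hom G I"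
  using hom_compose[of f G H g I] by (simp add: comp_def)

lemma hom_id: "(\<lambda>x. x) \<in> hom G G"
  by (simp add: hom_def)

lemma hom_trivial:
  assumes "group H"
  shows "(\<lambda>x. \<one>\<^bsub>H\<^esub>) \<in> hom G H"
proof -
  interpret group H by fact
  show ?thesis by (auto simp: hom_def)
qed

section \<open>Groups with a generating family and biadditive extensions\<close>

text \<open>A common interface for the tensor powers, their direct sum and the tensor product.
  Nothing is assumed about relations between the \<open>p s\<close>; a map prescribed on generators
  always enters together with the fact that some homomorphism realizes it.\<close>

locale generated_comm_group = comm_group G for G (structure) +
  fixes S :: "'s set" and p :: "'s \<Rightarrow> 'a"
  assumes p_closed [simp]: "s \<in> S \<Longrightarrow> p s \<in> carrier G"
    and carrier_generated: "carrier G \<subseteq> generate G (p ` S)"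
begin

lemma generators_induct [consumes 1, case_names generator one mult inv]:
  assumes "x \<in> carrier G"
    and "\<And>s. s \<in> S \<Longrightarrow> P (p s)" and "P \<one>"
    and "\<And>x y. \<lbrakk>x \<in> carrier G; y \<in> carrier G; P x; P y\<rbrakk> \<Longrightarrow> P (x \<otimes> y)"
    and "\<And>x. \<lbrakk>x \<in> carrier G; P x\<rbrakk> \<Longrightarrow> P (inv x)"
  shows "P x"
proof -
  have "x \<in> generate G (p ` S)"
    using assms(1) carrier_generated by blast
  then show ?thesis
  proof (induction rule: generate.induct)
    case (eng x y)
    then show ?case
      using assms(4) generate_in_carrier[of "p ` S"] by (metis image_subsetI p_closed)
  qed (use assms(2,3,5) in auto)
qed

lemma hom_eqI:
  assumes "group H" "h \<in> hom G H" "h' \<in> hom G H" "\<And>s. s \<in> S \<Longrightarrow> h (p s) = h' (p s)"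
    and "x \<in> carrier G"
  shows "h x = h' x"
  by (rule hom_eq_on_generate[of G H h h' "p ` S"])
    (use assms carrier_generated is_group in auto)

text \<open>Values on generators fix a homomorphism on the carrier only. The clause on
  \<open>extensional\<close> fixes it outside, which makes the description unique and explains the
  restriction.\<close>

lemma hom_ext_eq:
  assumes "group H" "h \<in> hom G H" "\<And>s. s \<in> S \<Longrightarrow> h (p s) = g s"
  shows "hom_ext G H S p g = restrict h (carrier G)"
  unfolding hom_ext_def
proof (rule the_equality)
  show "restrict h (carrier G) \<in> hom G H \<and> restrict h (carrier G) \<in> extensional (carrier G) \<and>
      (\<forall>s\<in>S. restrict h (carrier G) (p s) = g s)"
    using assms by (auto simp: hom_def Pi_iff)
next
  fix h' assume h': "h' \<in> hom G H \<and> h' \<in> extensional (carrier G) \<and> (\<forall>s\<in>S. h' (p s) = g s)"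
  then show "h' = restrict h (carrier G)"
    using assms hom_eqI[of H h' h] by (auto simp: fun_eq_iff extensional_def)
qed

lemma hom_ext_props:
  assumes "group H" "\<exists>h\<in>hom G H. \<forall>s\<in>S. h (p s) = g s"
  shows "hom_ext G H S p g \<in> hom G H" "\<And>s. s \<in> S \<Longrightarrow> hom_ext G H S p g (p s) = g s"
proof -
  obtain h where h: "h \<in> hom G H" "\<And>s. s \<in> S \<Longrightarrow> h (p s) = g s"
    using assms(2) by blast
  show "hom_ext G H S p g \<in> hom G H"
    using h hom_ext_eq[OF assms(1) h] by (auto simp: hom_def Pi_iff)
  show "hom_ext G H S p g (p s) = g s" if "s \<in> S" for s
    using h hom_ext_eq[OF assms(1) h] that by simp
qed

context
  fixes g
  assumes left: "\<And>t. t \<in> S \<Longrightarrow> \<exists>h\<in>hom G G. \<forall>s\<in>S. h (p s) = g s t"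
    and right: "\<And>s. s \<in> S \<Longrightarrow> \<exists>h\<in>hom G G. \<forall>t\<in>S. h (p t) = g s t"
begin

text \<open>For a generator \<open>y = p t\<close> the prescribed values are \<open>g s t\<close>,
  realized by assumption. The set of \<open>y\<close> for which a realization exists is closed under
  products and inverses, because each inner extension is a homomorphism in \<open>y\<close>. This
  gives the outer \<open>hom_ext\<close> in \<open>biadd_ext\<close> a meaning for every
  \<open>y\<close>.\<close>

lemma biadd_ext_left_exists:
  assumes "y \<in> carrier G"
  shows "\<exists>h\<in>hom G G. \<forall>s\<in>S. h (p s) = hom_ext G G S p (g s) y"
  using assms
proof (induction rule: generators_induct)
  case (generator t)
  then show ?case
    using left[OF generator] hom_ext_props(2)[OF is_group right] by simp
next
  case one
  have "hom_ext G G S p (g s) \<one> = \<one>" if "s \<in> S" for s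
    using hom_one[OF hom_ext_props(1)[OF is_group right[OF that]] is_group is_group] .
  then show ?case
    by (intro bexI[of _ "\<lambda>x. \<one>"]) (auto simp: hom_trivial)
next
  case (mult x y)
  then obtain h h' where "h \<in> hom G G" "\<forall>s\<in>S. h (p s) = hom_ext G G S p (g s) x"
    and "h' \<in> hom G G" "\<forall>s\<in>S. h' (p s) = hom_ext G G S p (g s) y"
    by blast
  then show ?case
    using mult(1,2) hom_mult[OF hom_ext_props(1)[OF is_group right]]
    by (intro bexI[of _ "\<lambda>x. h x \<otimes> h' x"]) (simp_all add: hom_comp_mult comm_group_axioms)
next
  case (inv x)
  then obtain h where h: "h \<in> hom G G" "\<forall>s\<in>S. h (p s) = hom_ext G G S p (g s) x"
    by blast
  have "hom_ext G G S p (g s) (inv x) = inv (hom_ext G G S p (g s) x)" if "s \<in> S" for s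
  proof -
    interpret group_hom G G "hom_ext G G S p (g s)"
      using hom_ext_props(1)[OF is_group right[OF that]]
      by (simp add: group_hom_axioms_def group_hom_def)
    show ?thesis using inv(1) by simp
  qed
  then show ?case
    using h by (intro bexI[of _ "\<lambda>x. inv h x"]) (simp_all add: hom_comp_inv comm_group_axioms)
qed

lemma biadd_ext_hom_left:
  assumes "y \<in> carrier G"
  shows "(\<lambda>x. biadd_ext G S p g x y) \<in> hom G G"
  unfolding biadd_ext_def
  using hom_ext_props(1)[OF is_group biadd_ext_left_exists[OF assms]] by simp

lemma biadd_ext_generator_left:
  assumes "s \<in> S" "y \<in> carrier G"
  shows "biadd_ext G S p g (p s) y = hom_ext G G S p (g s) y"
  unfolding biadd_ext_def
  using hom_ext_props(2)[OF is_group biadd_ext_left_exists[OF assms(2)]] assms(1) by simp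

lemma biadd_ext_generators:
  assumes "s \<in> S" "t \<in> S"
  shows "biadd_ext G S p g (p s) (p t) = g s t"
  by (simp add: assms biadd_ext_generator_left hom_ext_props(2)[OF is_group right])

text \<open>For a generator \<open>x\<close> the map is an inner extension and hence a homomorphism.
  The property passes to products and inverses of such \<open>x\<close> because pointwise products
  and inverses of homomorphisms into a commutative group are homomorphisms.\<close>

lemma biadd_ext_hom_right:
  assumes "x \<in> carrier G"
  shows "(\<lambda>y. biadd_ext G S p g x y) \<in> hom G G"
  using assms
proof (induction rule: generators_induct)
  case (generator s)
  show ?case
    using hom_ext_props(1)[OF is_group right[OF generator]]
    by (auto simp: hom_def Pi_iff biadd_ext_generator_left[OF generator])
next
  case one
  have "biadd_ext G S p g \<one> y = \<one>" if "y \<in> carrier G" for y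
    using hom_one[OF biadd_ext_hom_left[OF that] is_group is_group] .
  then show ?case by (auto simp: hom_def)
next
  case (mult x y)
  have "biadd_ext G S p g (x \<otimes> y) z = biadd_ext G S p g x z \<otimes> biadd_ext G S p g y z"
    if "z \<in> carrier G" for z
    using hom_mult[OF biadd_ext_hom_left[OF that] mult(1,2)] .
  then show ?case
    using hom_comp_mult[OF comm_group_axioms mult(3,4)] by (auto simp: hom_def Pi_iff)
next
  case (inv x)
  have "biadd_ext G S p g (inv x) z = inv (biadd_ext G S p g x z)"
    if "z \<in> carrier G" for z
    using group_hom.hom_inv[of G G "\<lambda>x. biadd_ext G S p g x z" x] biadd_ext_hom_left[OF that] inv(1)
    by (simp add: group_hom_axioms_def group_hom_def)
  then show ?case
    using hom_comp_inv[OF comm_group_axioms inv(2)] by (auto simp: hom_def Pi_iff)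
qed

end

end

section \<open>Abelian groups given by generators and relations\<close>

lemma presented_generated:
  assumes "rels \<subseteq> carrier (free_Abelian_group S)"
  defines "N \<equiv> generate (free_Abelian_group S) rels"
  shows "generated_comm_group (free_Abelian_group S Mod N) S
    (\<lambda>s. N #>\<^bsub>free_Abelian_group S\<^esub> frag_of s)"
proof -
  interpret F: comm_group "free_Abelian_group S"
    by (rule abelian_free_Abelian_group)
  have N: "subgroup N (free_Abelian_group S)"
    unfolding N_def by (rule F.generate_is_subgroup[OF assms(1)])
  interpret N: normal N "free_Abelian_group S"
    using N F.subgroup_imp_normal by blast
  interpret Q: comm_group "free_Abelian_group S Mod N"
    by (rule F.abelian_FactGroup[OF N])
  let ?p = "\<lambda>s. N #>\<^bsub>free_Abelian_group S\<^esub> frag_of s"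
  have p: "?p s \<in> carrier (free_Abelian_group S Mod N)" if "s \<in> S" for s
    using that by (auto simp: carrier_FactGroup)
  interpret pi: group_hom "free_Abelian_group S" "free_Abelian_group S Mod N"
      "\<lambda>a. N #>\<^bsub>free_Abelian_group S\<^esub> a"
    using N.r_coset_hom_Mod by (simp add: group_hom_axioms_def group_hom_def Q.is_group)
  have sub: "subgroup (generate (free_Abelian_group S Mod N) (?p ` S)) (free_Abelian_group S Mod N)"
    by (rule Q.generate_is_subgroup) (use p in auto)
  have "N #>\<^bsub>free_Abelian_group S\<^esub> x \<in> generate (free_Abelian_group S Mod N) (?p ` S)"
    if "Poly_Mapping.keys x \<subseteq> S" for x
    using that
  proof (induction rule: free_Abelian_group_induct[consumes 1])
    case 1
    then show ?case
      using pi.hom_one subgroup.one_closed[OF sub] by (simp del: one_FactGroup)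
  next
    case (2 x y)
    have "N #>\<^bsub>free_Abelian_group S\<^esub> (x - y) =
      (N #>\<^bsub>free_Abelian_group S\<^esub> x) \<otimes>\<^bsub>free_Abelian_group S Mod N\<^esub>
        inv\<^bsub>free_Abelian_group S Mod N\<^esub> (N #>\<^bsub>free_Abelian_group S\<^esub> y)"
      using 2(1,2) pi.hom_mult[of x "- y"] pi.hom_inv[of y] by (simp del: mult_FactGroup)
    then show ?case
      using 2 subgroup.m_closed[OF sub] subgroup.m_inv_closed[OF sub] by metis
  next
    case (3 a)
    then show ?case by (simp add: generate.incl)
  qed
  then show ?thesis
    by unfold_locales (use p in \<open>auto simp: carrier_FactGroup\<close>)
qed

lemma presented_relation:
  assumes "rels \<subseteq> carrier (free_Abelian_group S)" "x - y \<in> rels"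
    and "Poly_Mapping.keys x \<subseteq> S" "Poly_Mapping.keys y \<subseteq> S"
  defines "N \<equiv> generate (free_Abelian_group S) rels"
  shows "N #>\<^bsub>free_Abelian_group S\<^esub> x = N #>\<^bsub>free_Abelian_group S\<^esub> y"
proof -
  interpret F: comm_group "free_Abelian_group S"
    by (rule abelian_free_Abelian_group)
  have N: "subgroup N (free_Abelian_group S)"
    unfolding N_def by (rule F.generate_is_subgroup[OF assms(1)])
  have "x \<otimes>\<^bsub>free_Abelian_group S\<^esub> inv\<^bsub>free_Abelian_group S\<^esub> y \<in> N"
    using assms(2,4) unfolding N_def by (simp add: generate.incl)
  then have "x \<in> N #>\<^bsub>free_Abelian_group S\<^esub> y"
    using F.subgroup_imp_normal[OF N] assms(3,4)
    unfolding r_coset_def by simp (metis add_diff_cancel_right' diff_add_cancel)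
  then show ?thesis
    using F.repr_independence[OF _ _ N] assms(3,4) by fastforce
qed

lemma presented_mult:
  assumes "rels \<subseteq> carrier (free_Abelian_group S)"
    and "Poly_Mapping.keys x \<subseteq> S" "Poly_Mapping.keys y \<subseteq> S"
  defines "N \<equiv> generate (free_Abelian_group S) rels"
  shows "(N #>\<^bsub>free_Abelian_group S\<^esub> x) \<otimes>\<^bsub>free_Abelian_group S Mod N\<^esub> (N #>\<^bsub>free_Abelian_group S\<^esub> y) =
    N #>\<^bsub>free_Abelian_group S\<^esub> (x + y)"
proof -
  interpret F: comm_group "free_Abelian_group S"
    by (rule abelian_free_Abelian_group)
  have N: "subgroup N (free_Abelian_group S)"
    unfolding N_def by (rule F.generate_is_subgroup[OF assms(1)])
  interpret N: normal N "free_Abelian_group S"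
    using N F.subgroup_imp_normal by blast
  show ?thesis
    using N.rcos_sum[of x y] assms by simp
qed

text \<open>The premise on relations speaks of every homomorphism extending \<open>g\<close>, so
  that it can be verified by computing with a homomorphism that is known only through its values on
  the free generators.\<close>

lemma presented_universal:
  assumes "rels \<subseteq> carrier (free_Abelian_group S)" "comm_group H" "g \<in> S \<rightarrow> carrier H"
    and rels: "\<And>h x. \<lbrakk>h \<in> hom (free_Abelian_group S) H; \<And>s. s \<in> S \<Longrightarrow> h (frag_of s) = g s; x \<in> rels\<rbrakk>
      \<Longrightarrow> h x = \<one>\<^bsub>H\<^esub>"
  defines "N \<equiv> generate (free_Abelian_group S) rels"
  shows "\<exists>h\<in>hom (free_Abelian_group S Mod N) H.
    \<forall>s\<in>S. h (N #>\<^bsub>free_Abelian_group S\<^esub> frag_of s) = g s"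
proof -
  interpret F: comm_group "free_Abelian_group S"
    by (rule abelian_free_Abelian_group)
  interpret H: comm_group H by fact
  obtain h where h: "h \<in> hom (free_Abelian_group S) H" "\<And>s. s \<in> S \<Longrightarrow> h (frag_of s) = g s"
    using H.free_Abelian_group_universal[of g S] assms(3) by blast
  interpret h: group_hom "free_Abelian_group S" H h
    using h(1) by (simp add: group_hom_axioms_def group_hom_def H.is_group)
  have "rels \<subseteq> kernel (free_Abelian_group S) H h"
    unfolding kernel_def using rels[OF h] assms(1) by blast
  then have "N \<subseteq> kernel (free_Abelian_group S) H h"
    unfolding N_def by (rule F.generate_subgroup_incl[OF _ h.subgroup_kernel])
  moreover have "N \<lhd> free_Abelian_group S"
    unfolding N_def using F.subgroup_imp_normal[OF F.generate_is_subgroup[OF assms(1)]] .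
  ultimately obtain h' where "h' \<in> hom (free_Abelian_group S Mod N) H"
      "\<And>x. x \<in> carrier (free_Abelian_group S) \<Longrightarrow> h' (N #>\<^bsub>free_Abelian_group S\<^esub> x) = h x"
    using h.FactGroup_universal_kernel by blast
  then show ?thesis
    using h(2) by (intro bexI[of _ h']) auto
qed

lemma hom_free_diff:
  assumes "group H" "h \<in> hom (free_Abelian_group S) H"
    and "Poly_Mapping.keys x \<subseteq> S" "Poly_Mapping.keys y \<subseteq> S"
  shows "h (x - y) = h x \<otimes>\<^bsub>H\<^esub> inv\<^bsub>H\<^esub> h y"
proof -
  interpret h: group_hom "free_Abelian_group S" H h
    using assms(1,2) by (simp add: group_hom_axioms_def group_hom_def)
  show ?thesis
    using h.hom_mult[of x "- y"] h.hom_inv[of y] assms(3,4) by simp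
qed

section \<open>Universal properties of tensor powers and tensor products\<close>

text \<open>The condition for factoring through a tensor power as an abelian group. The target
  carries no scalar action, so a scalar cannot be pulled out; it can only move from one position to
  a later one.\<close>

definition balanced_multiadditive where
  "balanced_multiadditive k M S H g \<longleftrightarrow> g \<in> S \<rightarrow> carrier H \<and>
    (\<forall>u v a b. u @ a # v \<in> S \<longrightarrow> b \<in> carrier M \<longrightarrow>
      g (u @ (a \<oplus>\<^bsub>M\<^esub> b) # v) = g (u @ a # v) \<otimes>\<^bsub>H\<^esub> g (u @ b # v)) \<and>
    (\<forall>u v w r a b. u @ a # v @ b # w \<in> S \<longrightarrow> r \<in> carrier k \<longrightarrow>
      g (u @ (r \<odot>\<^bsub>M\<^esub> a) # v @ b # w) = g (u @ a # v @ (r \<odot>\<^bsub>M\<^esub> b) # w))"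

lemma keys_diff_subset:
  "\<lbrakk>Poly_Mapping.keys x \<subseteq> S; Poly_Mapping.keys y \<subseteq> S\<rbrakk> \<Longrightarrow> Poly_Mapping.keys (x - y :: 'a \<Rightarrow>\<^sub>0 int) \<subseteq> S"
  using keys_diff[of x y] by blast

lemma keys_add_subset:
  "\<lbrakk>Poly_Mapping.keys x \<subseteq> S; Poly_Mapping.keys y \<subseteq> S\<rbrakk> \<Longrightarrow> Poly_Mapping.keys (x + y :: 'a \<Rightarrow>\<^sub>0 int) \<subseteq> S"
  using Poly_Mapping.keys_add[of x y] by blast

section \<open>Tensor powers of a module\<close>

context module
begin

lemma power_relations_closed:
  "power_relations R M n \<subseteq> carrier (free_Abelian_group (words M n))"
proof
  fix x assume "x \<in> power_relations R M n"
  then show "x \<in> carrier (free_Abelian_group (words M n))"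
    unfolding power_relations_def words_def
    by (elim UnE CollectE exE conjE) (simp_all add: keys_diff_subset)
qed

lemma tensor_power_generated:
  "generated_comm_group (tensor_power R M n) (words M n) (power_pure R M)"
proof -
  interpret generated_comm_group "tensor_power R M n" "words M n"
      "\<lambda>s. power_kernel R M n #>\<^bsub>free_Abelian_group (words M n)\<^esub> frag_of s"
    using presented_generated[OF power_relations_closed]
    by (simp add: tensor_power_def power_kernel_def)
  have *: "power_pure R M w = power_kernel R M n #>\<^bsub>free_Abelian_group (words M n)\<^esub> frag_of w"
    if "w \<in> words M n" for w
    using that by (simp add: power_pure_def words_def)
  show ?thesis
    using carrier_generated by unfold_locales (simp_all add: * cong: image_cong_simp)
qed

lemma power_pure_add:
  assumes "u @ a # v \<in> words M n" "b \<in> carrier M"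
  shows "power_pure R M (u @ (a \<oplus>\<^bsub>M\<^esub> b) # v) =
    power_pure R M (u @ a # v) \<otimes>\<^bsub>tensor_power R M n\<^esub> power_pure R M (u @ b # v)"
proof -
  have len: "length (u @ (a \<oplus>\<^bsub>M\<^esub> b) # v) = n" "length (u @ a # v) = n" "length (u @ b # v) = n"
    and w: "u @ (a \<oplus>\<^bsub>M\<^esub> b) # v \<in> words M n" "u @ b # v \<in> words M n"
    using assms by (auto simp: words_def)
  \<comment> \<open>The additivity relation has three terms; grouping the two subtracted ones turns
    it into an equality of two cosets.\<close>
  have "frag_of (u @ (a \<oplus>\<^bsub>M\<^esub> b) # v) - (frag_of (u @ a # v) + frag_of (u @ b # v)) \<in> power_relations R M n"
    unfolding power_relations_def diff_diff_add[symmetric] using assms by blast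
  from presented_relation[OF power_relations_closed this]
  show ?thesis
    unfolding power_pure_def tensor_power_def power_kernel_def len
    using presented_mult[OF power_relations_closed, where x = "frag_of (u @ a # v)" and y = "frag_of (u @ b # v)"]
      assms w by (simp add: keys_add_subset)
qed

lemma power_pure_balanced:
  assumes "u @ a # v @ b # w \<in> words M n" "r \<in> carrier R"
  shows "power_pure R M (u @ (r \<odot>\<^bsub>M\<^esub> a) # v @ b # w) = power_pure R M (u @ a # v @ (r \<odot>\<^bsub>M\<^esub> b) # w)"
proof -
  have len: "length (u @ (r \<odot>\<^bsub>M\<^esub> a) # v @ b # w) = n" "length (u @ a # v @ (r \<odot>\<^bsub>M\<^esub> b) # w) = n"
    and w: "u @ (r \<odot>\<^bsub>M\<^esub> a) # v @ b # w \<in> words M n" "u @ a # v @ (r \<odot>\<^bsub>M\<^esub> b) # w \<in> words M n"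
    using assms by (auto simp: words_def)
  have "frag_of (u @ (r \<odot>\<^bsub>M\<^esub> a) # v @ b # w) - frag_of (u @ a # v @ (r \<odot>\<^bsub>M\<^esub> b) # w) \<in> power_relations R M n"
    unfolding power_relations_def using assms by blast
  from presented_relation[OF power_relations_closed this]
  show ?thesis
    unfolding power_pure_def power_kernel_def len using w by simp
qed

lemma tensor_power_universal:
  assumes "comm_group H" "balanced_multiadditive R M (words M n) H g"
  shows "\<exists>h\<in>hom (tensor_power R M n) H. \<forall>w\<in>words M n. h (power_pure R M w) = g w"
proof -
  interpret H: comm_group H by fact
  have g: "g \<in> words M n \<rightarrow> carrier H"
    "\<And>u v a b. \<lbrakk>u @ a # v \<in> words M n; b \<in> carrier M\<rbrakk> \<Longrightarrow>
      g (u @ (a \<oplus>\<^bsub>M\<^esub> b) # v) = g (u @ a # v) \<otimes>\<^bsub>H\<^esub> g (u @ b # v)"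
    "\<And>u v w r a b. \<lbrakk>u @ a # v @ b # w \<in> words M n; r \<in> carrier R\<rbrakk> \<Longrightarrow>
      g (u @ (r \<odot>\<^bsub>M\<^esub> a) # v @ b # w) = g (u @ a # v @ (r \<odot>\<^bsub>M\<^esub> b) # w)"
    using assms(2) unfolding balanced_multiadditive_def by blast+
  have "\<exists>h\<in>hom (free_Abelian_group (words M n) Mod
      generate (free_Abelian_group (words M n)) (power_relations R M n)) H.
    \<forall>w\<in>words M n. h (generate (free_Abelian_group (words M n)) (power_relations R M n)
      #>\<^bsub>free_Abelian_group (words M n)\<^esub> frag_of w) = g w"
  proof (rule presented_universal[OF power_relations_closed assms(1) g(1)])
    have sum: "y \<otimes>\<^bsub>H\<^esub> z \<otimes>\<^bsub>H\<^esub> inv\<^bsub>H\<^esub> y \<otimes>\<^bsub>H\<^esub> inv\<^bsub>H\<^esub> z = \<one>\<^bsub>H\<^esub>" if "y \<in> carrier H" "z \<in> carrier H" for y z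
    proof -
      have "y \<otimes>\<^bsub>H\<^esub> z \<otimes>\<^bsub>H\<^esub> inv\<^bsub>H\<^esub> y \<otimes>\<^bsub>H\<^esub> inv\<^bsub>H\<^esub> z = (y \<otimes>\<^bsub>H\<^esub> z) \<otimes>\<^bsub>H\<^esub> inv\<^bsub>H\<^esub> (y \<otimes>\<^bsub>H\<^esub> z)"
        using that by (simp add: H.inv_mult H.m_assoc)
      then show ?thesis using that by simp
    qed
    fix h x
    assume h: "h \<in> hom (free_Abelian_group (words M n)) H" "\<And>w. w \<in> words M n \<Longrightarrow> h (frag_of w) = g w"
      and "x \<in> power_relations R M n"
    then consider (add) u a b v where "x = frag_of (u @ (a \<oplus>\<^bsub>M\<^esub> b) # v) - frag_of (u @ a # v) - frag_of (u @ b # v)"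
        "u @ a # v \<in> words M n" "b \<in> carrier M"
      | (smult) r u v w a b where "x = frag_of (u @ (r \<odot>\<^bsub>M\<^esub> a) # v @ b # w) - frag_of (u @ a # v @ (r \<odot>\<^bsub>M\<^esub> b) # w)"
        "u @ a # v @ b # w \<in> words M n" "r \<in> carrier R"
      unfolding power_relations_def by blast
    then show "h x = \<one>\<^bsub>H\<^esub>"
    proof cases
      case add
      then have w: "u @ (a \<oplus>\<^bsub>M\<^esub> b) # v \<in> words M n" "u @ b # v \<in> words M n"
        by (auto simp: words_def)
      have "h x = g (u @ (a \<oplus>\<^bsub>M\<^esub> b) # v) \<otimes>\<^bsub>H\<^esub> inv\<^bsub>H\<^esub> g (u @ a # v) \<otimes>\<^bsub>H\<^esub> inv\<^bsub>H\<^esub> g (u @ b # v)"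
        using add w h by (simp add: hom_free_diff[OF H.is_group h(1)] keys_diff_subset)
      then show ?thesis
        using g(2)[OF add(2,3)] funcset_mem[OF g(1) add(2)] funcset_mem[OF g(1) w(2)]
        by (simp add: sum)
    next
      case smult
      then have w: "u @ (r \<odot>\<^bsub>M\<^esub> a) # v @ b # w \<in> words M n" "u @ a # v @ (r \<odot>\<^bsub>M\<^esub> b) # w \<in> words M n"
        by (auto simp: words_def)
      then show ?thesis
        using smult w h g(3)[OF smult(2,3)] funcset_mem[OF g(1) w(2)]
        by (simp add: hom_free_diff[OF H.is_group h(1)])
    qed
  qed
  moreover have "power_pure R M w = generate (free_Abelian_group (words M n)) (power_relations R M n)
      #>\<^bsub>free_Abelian_group (words M n)\<^esub> frag_of w" if "w \<in> words M n" for w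
    using that by (simp add: power_pure_def words_def power_kernel_def)
  ultimately show ?thesis
    by (simp add: tensor_power_def power_kernel_def)
qed

end

section \<open>Tensor products of two modules\<close>

locale tensor_modules = M: module K M + N: module K N for K (structure) and M (structure) and N (structure)
begin

lemma tensor_relations_closed:
  "tensor_relations K M N \<subseteq> carrier (free_Abelian_group (carrier M \<times> carrier N))"
proof
  fix x assume "x \<in> tensor_relations K M N"
  then show "x \<in> carrier (free_Abelian_group (carrier M \<times> carrier N))"
    unfolding tensor_relations_def
    by (elim UnE CollectE exE conjE) (simp_all add: keys_diff_subset)
qed

sublocale tensor: generated_comm_group "tensor_group K M N" "carrier M \<times> carrier N"
    "case_prod (tensor_pure K M N)"
proof -
  have "case_prod (tensor_pure K M N) = (\<lambda>s. generate (free_Abelian_group (carrier M \<times> carrier N)) (tensor_relations K M N)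
      #>\<^bsub>free_Abelian_group (carrier M \<times> carrier N)\<^esub> frag_of s)"
    by (auto simp: fun_eq_iff tensor_pure_def tensor_kernel_def)
  then show "generated_comm_group (tensor_group K M N) (carrier M \<times> carrier N) (case_prod (tensor_pure K M N))"
    using presented_generated[OF tensor_relations_closed]
    by (simp add: tensor_group_def tensor_kernel_def)
qed

lemma tensor_pure_closed [simp]:
  "\<lbrakk>m \<in> carrier M; n \<in> carrier N\<rbrakk> \<Longrightarrow> tensor_pure K M N m n \<in> carrier (tensor_group K M N)"
  using tensor.p_closed[of "(m, n)"] by simp

lemma tensor_pure_add_left:
  assumes "m \<in> carrier M" "m' \<in> carrier M" "n \<in> carrier N"
  shows "tensor_pure K M N (m \<oplus>\<^bsub>M\<^esub> m') n =
    tensor_pure K M N m n \<otimes>\<^bsub>tensor_group K M N\<^esub> tensor_pure K M N m' n"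
proof -
  have "frag_of (m \<oplus>\<^bsub>M\<^esub> m', n) - (frag_of (m, n) + frag_of (m', n)) \<in> tensor_relations K M N"
    unfolding tensor_relations_def diff_diff_add[symmetric] using assms by blast
  from presented_relation[OF tensor_relations_closed this]
  show ?thesis
    unfolding tensor_pure_def tensor_group_def tensor_kernel_def
    using presented_mult[OF tensor_relations_closed, where x = "frag_of (m, n)" and y = "frag_of (m', n)"]
      assms by (simp add: keys_add_subset)
qed

lemma tensor_pure_add_right:
  assumes "m \<in> carrier M" "n \<in> carrier N" "n' \<in> carrier N"
  shows "tensor_pure K M N m (n \<oplus>\<^bsub>N\<^esub> n') =
    tensor_pure K M N m n \<otimes>\<^bsub>tensor_group K M N\<^esub> tensor_pure K M N m n'"
proof -
  have "frag_of (m, n \<oplus>\<^bsub>N\<^esub> n') - (frag_of (m, n) + frag_of (m, n')) \<in> tensor_relations K M N"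
    unfolding tensor_relations_def diff_diff_add[symmetric] using assms by blast
  from presented_relation[OF tensor_relations_closed this]
  show ?thesis
    unfolding tensor_pure_def tensor_group_def tensor_kernel_def
    using presented_mult[OF tensor_relations_closed, where x = "frag_of (m, n)" and y = "frag_of (m, n')"]
      assms by (simp add: keys_add_subset)
qed

lemma tensor_pure_balanced:
  assumes "c \<in> carrier K" "m \<in> carrier M" "n \<in> carrier N"
  shows "tensor_pure K M N (c \<odot>\<^bsub>M\<^esub> m) n = tensor_pure K M N m (c \<odot>\<^bsub>N\<^esub> n)"
proof -
  have "frag_of (c \<odot>\<^bsub>M\<^esub> m, n) - frag_of (m, c \<odot>\<^bsub>N\<^esub> n) \<in> tensor_relations K M N"
    unfolding tensor_relations_def using assms by blast
  from presented_relation[OF tensor_relations_closed this]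
  show ?thesis
    unfolding tensor_pure_def tensor_kernel_def using assms by simp
qed

lemma tensor_universal:
  assumes "comm_group H"
    and closed: "\<And>m n. \<lbrakk>m \<in> carrier M; n \<in> carrier N\<rbrakk> \<Longrightarrow> g m n \<in> carrier H"
    and add_left: "\<And>m m' n. \<lbrakk>m \<in> carrier M; m' \<in> carrier M; n \<in> carrier N\<rbrakk> \<Longrightarrow>
      g (m \<oplus>\<^bsub>M\<^esub> m') n = g m n \<otimes>\<^bsub>H\<^esub> g m' n"
    and add_right: "\<And>m n n'. \<lbrakk>m \<in> carrier M; n \<in> carrier N; n' \<in> carrier N\<rbrakk> \<Longrightarrow>
      g m (n \<oplus>\<^bsub>N\<^esub> n') = g m n \<otimes>\<^bsub>H\<^esub> g m n'"
    and balanced: "\<And>c m n. \<lbrakk>c \<in> carrier K; m \<in> carrier M; n \<in> carrier N\<rbrakk> \<Longrightarrow>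
      g (c \<odot>\<^bsub>M\<^esub> m) n = g m (c \<odot>\<^bsub>N\<^esub> n)"
  shows "\<exists>h\<in>hom (tensor_group K M N) H. \<forall>(m, n)\<in>carrier M \<times> carrier N. h (tensor_pure K M N m n) = g m n"
proof -
  interpret H: comm_group H by fact
  let ?S = "carrier M \<times> carrier N"
  have "\<exists>h\<in>hom (free_Abelian_group ?S Mod generate (free_Abelian_group ?S) (tensor_relations K M N)) H.
    \<forall>w\<in>?S. h (generate (free_Abelian_group ?S) (tensor_relations K M N)
      #>\<^bsub>free_Abelian_group ?S\<^esub> frag_of w) = case_prod g w"
  proof (rule presented_universal[OF tensor_relations_closed assms(1)])
    show "case_prod g \<in> ?S \<rightarrow> carrier H"
      using closed by auto
    fix h x
    assume h: "h \<in> hom (free_Abelian_group ?S) H" "\<And>w. w \<in> ?S \<Longrightarrow> h (frag_of w) = case_prod g w"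
      and "x \<in> tensor_relations K M N"
    have g: "h (frag_of (m, n)) = g m n" if "m \<in> carrier M" "n \<in> carrier N" for m n
      using h(2) that by simp
    have sum: "y \<otimes>\<^bsub>H\<^esub> z \<otimes>\<^bsub>H\<^esub> inv\<^bsub>H\<^esub> y \<otimes>\<^bsub>H\<^esub> inv\<^bsub>H\<^esub> z = \<one>\<^bsub>H\<^esub>" if "y \<in> carrier H" "z \<in> carrier H" for y z
    proof -
      have "y \<otimes>\<^bsub>H\<^esub> z \<otimes>\<^bsub>H\<^esub> inv\<^bsub>H\<^esub> y \<otimes>\<^bsub>H\<^esub> inv\<^bsub>H\<^esub> z = (y \<otimes>\<^bsub>H\<^esub> z) \<otimes>\<^bsub>H\<^esub> inv\<^bsub>H\<^esub> (y \<otimes>\<^bsub>H\<^esub> z)"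
        using that by (simp add: H.inv_mult H.m_assoc)
      then show ?thesis using that by simp
    qed
    consider (left) m m' n where "x = frag_of (m \<oplus>\<^bsub>M\<^esub> m', n) - frag_of (m, n) - frag_of (m', n)"
        "m \<in> carrier M" "m' \<in> carrier M" "n \<in> carrier N"
      | (right) m n n' where "x = frag_of (m, n \<oplus>\<^bsub>N\<^esub> n') - frag_of (m, n) - frag_of (m, n')"
        "m \<in> carrier M" "n \<in> carrier N" "n' \<in> carrier N"
      | (smult) c m n where "x = frag_of (c \<odot>\<^bsub>M\<^esub> m, n) - frag_of (m, c \<odot>\<^bsub>N\<^esub> n)"
        "c \<in> carrier K" "m \<in> carrier M" "n \<in> carrier N"
      using \<open>x \<in> tensor_relations K M N\<close> unfolding tensor_relations_def by blast
    then show "h x = \<one>\<^bsub>H\<^esub>"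
    proof cases
      case left
      then show ?thesis
        by (simp add: hom_free_diff[OF H.is_group h(1)] keys_diff_subset g add_left sum closed)
    next
      case right
      then show ?thesis
        by (simp add: hom_free_diff[OF H.is_group h(1)] keys_diff_subset g add_right sum closed)
    next
      case smult
      then show ?thesis
        by (simp add: hom_free_diff[OF H.is_group h(1)] g balanced closed)
    qed
  qed
  then show ?thesis
    by (fastforce simp: tensor_group_def tensor_pure_def tensor_kernel_def)
qed

end

section \<open>The direct sum of the tensor powers of A\<close>

context regular_diff_algebra
begin

abbreviation A_words :: "'c list set"
  where "A_words \<equiv> {w. w \<noteq> [] \<and> set w \<subseteq> carrier A}"

abbreviation Sh_component :: "nat \<Rightarrow> ('c list \<Rightarrow>\<^sub>0 int) set monoid"
  where "Sh_component n \<equiv> tensor_power k A (Suc n)"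

lemma component_generated: "generated_comm_group (Sh_component n) (words A (Suc n)) (power_pure k A)"
  by (rule tensor_power_generated)

lemma component_comm_group: "comm_group (Sh_component n)"
  using component_generated by (rule generated_comm_group.axioms)

lemma component_group: "group (Sh_component n)"
  using component_comm_group by (rule comm_group.axioms)

lemma component_monoid [simp]: "monoid (Sh_component n)"
  using component_group by (rule group.is_monoid)

text \<open>Elements of \<open>sum_group\<close> are extensional families of finite support; with
  index set \<open>UNIV\<close> extensionality is no condition, so only finite support
  remains.\<close>

lemma Sh_group_carrier:
  "carrier Sh_group = {x. (\<forall>n. x n \<in> carrier (Sh_component n)) \<and> finite {n. x n \<noteq> \<one>\<^bsub>Sh_component n\<^esub>}}"
  unfolding Sh_group_def by (auto simp: carrier_sum_group component_group PiE_iff)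

lemma Sh_group_mult: "x \<otimes>\<^bsub>Sh_group\<^esub> y = (\<lambda>n. x n \<otimes>\<^bsub>Sh_component n\<^esub> y n)"
  by (simp add: Sh_group_def restrict_def)

lemma Sh_group_one: "\<one>\<^bsub>Sh_group\<^esub> = (\<lambda>n. \<one>\<^bsub>Sh_component n\<^esub>)"
  by (simp add: Sh_group_def restrict_def)

lemma Sh_group_comm_group: "comm_group Sh_group"
proof -
  interpret group Sh_group
    unfolding Sh_group_def by (simp add: component_group)
  show ?thesis
    by (rule group_comm_groupI)
      (auto simp: Sh_group_carrier Sh_group_mult fun_eq_iff intro!: comm_groupE(4)[OF component_comm_group])
qed

lemma tens_closed:
  assumes "w \<in> A_words"
  shows "tens w \<in> carrier Sh_group"
proof -
  have "power_pure k A w \<in> carrier (Sh_component n)" if "Suc n = length w" for n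
    using generated_comm_group.p_closed[OF component_generated, of w n] that assms by (simp add: words_def)
  then have "\<forall>n. tens w n \<in> carrier (Sh_component n)"
    by (simp add: tens_def component_monoid[THEN monoid.one_closed])
  moreover have "finite {n. tens w n \<noteq> \<one>\<^bsub>Sh_component n\<^esub>}"
    by (rule finite_subset[of _ "{length w - 1}"]) (auto simp: tens_def)
  ultimately show ?thesis
    by (simp add: Sh_group_carrier)
qed

definition Sh_single :: "nat \<Rightarrow> ('c list \<Rightarrow>\<^sub>0 int) set \<Rightarrow> nat \<Rightarrow> ('c list \<Rightarrow>\<^sub>0 int) set"
  where "Sh_single n z = (\<lambda>m. if m = n then z else \<one>\<^bsub>Sh_component m\<^esub>)"

lemma Sh_single_hom: "Sh_single n \<in> hom (Sh_component n) Sh_group"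
proof (rule homI)
  fix z assume "z \<in> carrier (Sh_component n)"
  moreover have "{m. Sh_single n z m \<noteq> \<one>\<^bsub>Sh_component m\<^esub>} \<subseteq> {n}"
    by (auto simp: Sh_single_def)
  ultimately show "Sh_single n z \<in> carrier Sh_group"
    by (auto simp: Sh_group_carrier Sh_single_def component_monoid[THEN monoid.one_closed] intro: finite_subset)
qed (auto simp: Sh_group_mult Sh_single_def fun_eq_iff monoid.l_one monoid.one_closed)

text \<open>A family of finite support is a finite product of families concentrated in one degree,
  and each tensor power is generated by its pure tensors. The truncations of \<open>x\<close> to
  finite index sets are built up one index at a time.\<close>

lemma Sh_group_generated: "carrier Sh_group \<subseteq> generate Sh_group (tens ` A_words)"
proof
  interpret comm_group Sh_group by (rule Sh_group_comm_group)
  have sub: "subgroup (generate Sh_group (tens ` A_words)) Sh_group"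
    by (rule generate_is_subgroup) (use tens_closed in auto)
  have single: "Sh_single n z \<in> generate Sh_group (tens ` A_words)"
    if z: "z \<in> carrier (Sh_component n)" for n z
    using generated_comm_group.generators_induct[OF component_generated z,
        of "\<lambda>z. Sh_single n z \<in> generate Sh_group (tens ` A_words)"]
  proof this
    interpret single: group_hom "Sh_component n" Sh_group "Sh_single n"
      using Sh_single_hom by (simp add: group_hom_def group_hom_axioms_def component_group)
    {
      fix w assume "w \<in> words A (Suc n)"
      then have "Sh_single n (power_pure k A w) = tens w" "w \<in> A_words"
        by (auto simp: Sh_single_def tens_def words_def fun_eq_iff)
      then show "Sh_single n (power_pure k A w) \<in> generate Sh_group (tens ` A_words)"
        by (simp add: generate.incl)
    next
      show "Sh_single n \<one>\<^bsub>Sh_component n\<^esub> \<in> generate Sh_group (tens ` A_words)"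
        using subgroup.one_closed[OF sub] by simp
    next
      fix x y assume "x \<in> carrier (Sh_component n)" "y \<in> carrier (Sh_component n)"
        "Sh_single n x \<in> generate Sh_group (tens ` A_words)" "Sh_single n y \<in> generate Sh_group (tens ` A_words)"
      then show "Sh_single n (x \<otimes>\<^bsub>Sh_component n\<^esub> y) \<in> generate Sh_group (tens ` A_words)"
        using subgroup.m_closed[OF sub] by simp
    next
      fix x assume "x \<in> carrier (Sh_component n)" "Sh_single n x \<in> generate Sh_group (tens ` A_words)"
      then show "Sh_single n (inv\<^bsub>Sh_component n\<^esub> x) \<in> generate Sh_group (tens ` A_words)"
        using subgroup.m_inv_closed[OF sub] by simp
    }
  qed
  fix x assume "x \<in> carrier Sh_group"
  then have x: "\<forall>n. x n \<in> carrier (Sh_component n)" "finite {n. x n \<noteq> \<one>\<^bsub>Sh_component n\<^esub>}"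
    by (auto simp: Sh_group_carrier)
  define F where "F = {n. x n \<noteq> \<one>\<^bsub>Sh_component n\<^esub>}"
  have "(\<lambda>n. if n \<in> I then x n else \<one>\<^bsub>Sh_component n\<^esub>) \<in> generate Sh_group (tens ` A_words)"
    if "finite I" for I
    using that
  proof (induction I rule: finite_induct)
    case empty
    then show ?case
      using subgroup.one_closed[OF sub] by (simp add: Sh_group_one)
  next
    case (insert i I)
    have "(\<lambda>n. if n \<in> insert i I then x n else \<one>\<^bsub>Sh_component n\<^esub>) =
        Sh_single i (x i) \<otimes>\<^bsub>Sh_group\<^esub> (\<lambda>n. if n \<in> I then x n else \<one>\<^bsub>Sh_component n\<^esub>)"
      using insert(2) x(1) by (auto simp: Sh_group_mult Sh_single_def fun_eq_iff monoid.l_one monoid.r_one monoid.one_closed)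
    then show ?case
      using subgroup.m_closed[OF sub single insert(3)] x(1) by simp
  qed
  from this[of F] show "x \<in> generate Sh_group (tens ` A_words)"
  proof -
    have "(\<lambda>n. if n \<in> F then x n else \<one>\<^bsub>Sh_component n\<^esub>) = x"
      by (auto simp: F_def fun_eq_iff)
    then show ?thesis
      using \<open>finite F \<Longrightarrow> _\<close> x(2) by (simp add: F_def)
  qed
qed

sublocale Sh_group: generated_comm_group Sh_group A_words tens
proof -
  interpret comm_group Sh_group by (rule Sh_group_comm_group)
  show "generated_comm_group Sh_group A_words tens"
    by unfold_locales (use tens_closed Sh_group_generated in auto)
qed

lemma tens_add:
  assumes "u @ a # v \<in> A_words" "b \<in> carrier A"
  shows "tens (u @ (a \<oplus>\<^bsub>A\<^esub> b) # v) = tens (u @ a # v) \<otimes>\<^bsub>Sh_group\<^esub> tens (u @ b # v)"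
proof -
  have "u @ a # v \<in> words A (Suc (length (u @ v)))"
    using assms by (simp add: words_def)
  from power_pure_add[OF this assms(2)] show ?thesis
    by (auto simp: tens_def fun_eq_iff Sh_group_mult monoid.l_one monoid.one_closed)
qed

lemma tens_balanced:
  assumes "u @ a # v @ b # w \<in> A_words" "r \<in> carrier k"
  shows "tens (u @ (r \<odot>\<^bsub>A\<^esub> a) # v @ b # w) = tens (u @ a # v @ (r \<odot>\<^bsub>A\<^esub> b) # w)"
proof -
  have "u @ a # v @ b # w \<in> words A (length (u @ a # v @ b # w))"
    using assms by (simp add: words_def)
  from power_pure_balanced[OF this assms(2)] show ?thesis
    by (auto simp: tens_def fun_eq_iff)
qed

text \<open>The universal property of the tensor power is applied degree by degree; the resulting
  homomorphisms are assembled by \<open>gfinprod\<close>, which makes sense because elements have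
  finite support.\<close>

lemma Sh_group_universal:
  assumes "comm_group H" "balanced_multiadditive k A A_words H g"
  shows "\<exists>h\<in>hom Sh_group H. \<forall>w\<in>A_words. h (tens w) = g w"
proof -
  interpret H: comm_group H by fact
  have "balanced_multiadditive k A (words A (Suc n)) H g" for n
    using assms(2) unfolding balanced_multiadditive_def words_def Pi_iff
    by (auto simp flip: length_greater_0_conv)
  then have "\<exists>h\<in>hom (Sh_component n) H. \<forall>w\<in>words A (Suc n). h (power_pure k A w) = g w" for n
    by (rule tensor_power_universal[OF assms(1)])
  then obtain h where h: "\<And>n. h n \<in> hom (Sh_component n) H"
      "\<And>n w. w \<in> words A (Suc n) \<Longrightarrow> h n (power_pure k A w) = g w"
    by metis
  have "gfinprod H (\<lambda>n. h n (tens w n)) UNIV = g w" if w: "w \<in> A_words" for w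
  proof -
    have one: "h n \<one>\<^bsub>Sh_component n\<^esub> = \<one>\<^bsub>H\<^esub>" for n
      using hom_one[OF h(1) component_group H.is_group] .
    obtain n where n: "length w = Suc n"
      using w by (cases w) auto
    have gw: "g w \<in> carrier H"
      using w assms(2) by (auto simp: balanced_multiadditive_def)
    have eq: "(\<lambda>m. h m (tens w m)) = (\<lambda>m. if m = n then g w else \<one>\<^bsub>H\<^esub>)"
      using n w h(2)[of w n] one by (auto simp: tens_def words_def fun_eq_iff)
    show ?thesis
    \<comment> \<open>\<open>gfinprod\<close> multiplies over the indices with nontrivial value.
      This set is the singleton of \<open>n\<close> unless \<open>g w\<close> is trivial, when it is
      empty.\<close>
    proof (cases "g w = \<one>\<^bsub>H\<^esub>")
      case False
      then have "{m. (if m = n then g w else \<one>\<^bsub>H\<^esub>) \<noteq> \<one>\<^bsub>H\<^esub>} = {n}"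
        by auto
      then show ?thesis
        unfolding eq gfinprod_def using gw by simp
    qed (simp add: eq gfinprod_def)
  qed
  then show ?thesis
    using H.hom_group_sum[of UNIV h Sh_component] h(1) component_group
    by (intro bexI[of _ "\<lambda>x. gfinprod H (\<lambda>n. h n (x n)) UNIV"]) (auto simp: Sh_group_def)
qed

end

section \<open>The commutative algebra \<open>Sh(A)\<close>\<close>

text \<open>The counterpart of \<open>balanced_multiadditive\<close> for a target that is a module:
  a scalar can be pulled out of any position, which entails that it can be moved. The parameter
  \<open>S\<close> lets one predicate serve words of a fixed length and all nonempty words.\<close>

definition multilinear where
  "multilinear k M S N g \<longleftrightarrow> g \<in> S \<rightarrow> carrier N \<and>
    (\<forall>u v a b. u @ a # v \<in> S \<longrightarrow> b \<in> carrier M \<longrightarrow>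
      g (u @ (a \<oplus>\<^bsub>M\<^esub> b) # v) = g (u @ a # v) \<oplus>\<^bsub>N\<^esub> g (u @ b # v)) \<and>
    (\<forall>u v r a. u @ a # v \<in> S \<longrightarrow> r \<in> carrier k \<longrightarrow>
      g (u @ (r \<odot>\<^bsub>M\<^esub> a) # v) = r \<odot>\<^bsub>N\<^esub> g (u @ a # v))"

lemma multilinear_closed: "\<lbrakk>multilinear k M S N g; w \<in> S\<rbrakk> \<Longrightarrow> g w \<in> carrier N"
  by (auto simp: multilinear_def)

lemma multilinear_add:
  "\<lbrakk>multilinear k M S N g; u @ a # v \<in> S; b \<in> carrier M\<rbrakk> \<Longrightarrow>
    g (u @ (a \<oplus>\<^bsub>M\<^esub> b) # v) = g (u @ a # v) \<oplus>\<^bsub>N\<^esub> g (u @ b # v)"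
  by (auto simp: multilinear_def)

lemma multilinear_smult:
  "\<lbrakk>multilinear k M S N g; u @ a # v \<in> S; r \<in> carrier k\<rbrakk> \<Longrightarrow>
    g (u @ (r \<odot>\<^bsub>M\<^esub> a) # v) = r \<odot>\<^bsub>N\<^esub> g (u @ a # v)"
  by (auto simp: multilinear_def)

lemma linear_map_closed: "\<lbrakk>L \<in> linear_map k M N; x \<in> carrier M\<rbrakk> \<Longrightarrow> L x \<in> carrier N"
  and linear_map_add: "\<lbrakk>L \<in> linear_map k M N; x \<in> carrier M; y \<in> carrier M\<rbrakk> \<Longrightarrow>
    L (x \<oplus>\<^bsub>M\<^esub> y) = L x \<oplus>\<^bsub>N\<^esub> L y"
  and linear_map_smult: "\<lbrakk>L \<in> linear_map k M N; r \<in> carrier k; x \<in> carrier M\<rbrakk> \<Longrightarrow>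
    L (r \<odot>\<^bsub>M\<^esub> x) = r \<odot>\<^bsub>N\<^esub> L x"
  by (auto simp: linear_map_def)

lemma linear_map_hom: "L \<in> linear_map k M N \<Longrightarrow> L \<in> hom (add_monoid M) (add_monoid N)"
  by (auto simp: linear_map_def hom_def)

lemma additive_zero:
  assumes "abelian_group M" "abelian_group N" "L \<in> hom (add_monoid M) (add_monoid N)"
  shows "L \<zero>\<^bsub>M\<^esub> = \<zero>\<^bsub>N\<^esub>"
  using hom_one[OF assms(3) abelian_group.a_group[OF assms(1)] abelian_group.a_group[OF assms(2)]] by simp

lemma additive_uminus:
  assumes "abelian_group M" "abelian_group N" "L \<in> hom (add_monoid M) (add_monoid N)" "x \<in> carrier M"
  shows "L (\<ominus>\<^bsub>M\<^esub> x) = \<ominus>\<^bsub>N\<^esub> L x"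
proof -
  interpret group_hom "add_monoid M" "add_monoid N" L
    using assms(3) abelian_group.a_group[OF assms(1)] abelian_group.a_group[OF assms(2)]
    by (simp add: group_hom_def group_hom_axioms_def)
  show ?thesis
    using hom_inv[of x] assms(4) by (simp add: a_inv_def)
qed

lemma additive_minus:
  assumes "abelian_group M" "abelian_group N" "L \<in> hom (add_monoid M) (add_monoid N)"
    "x \<in> carrier M" "y \<in> carrier M"
  shows "L (x \<ominus>\<^bsub>M\<^esub> y) = L x \<ominus>\<^bsub>N\<^esub> L y"
  using additive_uminus[OF assms(1,2,3,5)] assms(3-) abelian_group.a_inv_closed[OF assms(1,5)]
  by (simp add: a_minus_def hom_def)

lemma linear_map_zero:
  "\<lbrakk>module k M; module k N; L \<in> linear_map k M N\<rbrakk> \<Longrightarrow> L \<zero>\<^bsub>M\<^esub> = \<zero>\<^bsub>N\<^esub>"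
  by (simp add: additive_zero linear_map_hom module.axioms(2))

lemma linear_map_minus:
  "\<lbrakk>module k M; module k N; L \<in> linear_map k M N; x \<in> carrier M; y \<in> carrier M\<rbrakk> \<Longrightarrow>
    L (x \<ominus>\<^bsub>M\<^esub> y) = L x \<ominus>\<^bsub>N\<^esub> L y"
  by (simp add: additive_minus linear_map_hom module.axioms(2))

text \<open>Transfers the group structure between records that agree in carrier, product and unit
  but are different objects, such as \<open>Sh_group\<close> and
  \<open>add_monoid Sh\<close>.\<close>

lemma comm_group_cong:
  assumes "comm_group G" "carrier H = carrier G" "monoid.mult H = monoid.mult G" "\<one>\<^bsub>H\<^esub> = \<one>\<^bsub>G\<^esub>"
  shows "comm_group H"
proof -
  interpret G: comm_group G by fact
  show ?thesis
    by (rule comm_groupI) (use assms(2-) G.l_inv_ex in \<open>auto simp: G.m_assoc intro: G.m_comm\<close>)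
qed

lemma abelian_group_iff_comm_group: "abelian_group M \<longleftrightarrow> comm_group (add_monoid M)"
  by (auto simp: abelian_group_def abelian_group_axioms_def abelian_monoid_def comm_group_def)

lemma linear_map_id: "(\<lambda>x. x) \<in> linear_map k M M"
  by (simp add: linear_map_def)

text \<open>Additivity of \<open>L\<close> is applied also to the value of \<open>g\<close> at
  \<open>u @ b # v\<close>, so this word has to lie in \<open>S\<close>; hence the closure
  premise.\<close>

lemma multilinear_linear_comp:
  assumes "multilinear k M S N g" "L \<in> linear_map k N N'"
    and "\<And>u a v b. \<lbrakk>u @ a # v \<in> S; b \<in> carrier M\<rbrakk> \<Longrightarrow> u @ b # v \<in> S"
  shows "multilinear k M S N' (\<lambda>w. L (g w))"
  using assms unfolding multilinear_def linear_map_def by (auto simp: Pi_iff)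

lemma (in module) multilinear_plus:
  assumes "multilinear R N S M g" "multilinear R N S M g'"
    and "\<And>u a v b. \<lbrakk>u @ a # v \<in> S; b \<in> carrier N\<rbrakk> \<Longrightarrow> u @ b # v \<in> S"
  shows "multilinear R N S M (\<lambda>w. g w \<oplus>\<^bsub>M\<^esub> g' w)"
  unfolding multilinear_def
proof (intro conjI allI impI)
  show "(\<lambda>w. g w \<oplus>\<^bsub>M\<^esub> g' w) \<in> S \<rightarrow> carrier M"
    using assms(1,2) by (auto simp: multilinear_def)
next
  fix u v a b assume w: "u @ a # v \<in> S" "b \<in> carrier N"
  then show "g (u @ (a \<oplus>\<^bsub>N\<^esub> b) # v) \<oplus>\<^bsub>M\<^esub> g' (u @ (a \<oplus>\<^bsub>N\<^esub> b) # v) =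
      (g (u @ a # v) \<oplus>\<^bsub>M\<^esub> g' (u @ a # v)) \<oplus>\<^bsub>M\<^esub> (g (u @ b # v) \<oplus>\<^bsub>M\<^esub> g' (u @ b # v))"
    using assms(1,2) assms(3)[OF w] by (simp add: multilinear_def Pi_iff M.a_ac)
next
  fix u v r a assume "u @ a # v \<in> S" "r \<in> carrier R"
  then show "g (u @ (r \<odot>\<^bsub>N\<^esub> a) # v) \<oplus>\<^bsub>M\<^esub> g' (u @ (r \<odot>\<^bsub>N\<^esub> a) # v) = r \<odot>\<^bsub>M\<^esub> (g (u @ a # v) \<oplus>\<^bsub>M\<^esub> g' (u @ a # v))"
    using assms(1,2) by (simp add: multilinear_def Pi_iff smult_r_distr)
qed

lemma (in module) linear_map_smult_self: "r \<in> carrier R \<Longrightarrow> (\<lambda>x. r \<odot>\<^bsub>M\<^esub> x) \<in> linear_map R M M"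
  unfolding linear_map_def by (auto simp: smult_r_distr R.m_comm simp flip: smult_assoc1)

lemma (in module) linear_map_uminus: "(\<lambda>x. \<ominus>\<^bsub>M\<^esub> x) \<in> linear_map R M M"
  unfolding linear_map_def by (auto simp: M.minus_add smult_r_minus)

lemma linear_map_comp:
  "\<lbrakk>L \<in> linear_map k M N; L' \<in> linear_map k N N'\<rbrakk> \<Longrightarrow> (\<lambda>x. L' (L x)) \<in> linear_map k M N'"
  unfolding linear_map_def by (auto simp: Pi_iff)

lemma (in algebra) linear_map_mult_left: "a \<in> carrier M \<Longrightarrow> (\<lambda>x. a \<otimes>\<^bsub>M\<^esub> x) \<in> linear_map R M M"
  unfolding linear_map_def using smult_assoc2[of _ _ a] by (auto simp: r_distr m_comm[of a])

lemma (in algebra) linear_map_mult_right: "a \<in> carrier M \<Longrightarrow> (\<lambda>x. x \<otimes>\<^bsub>M\<^esub> a) \<in> linear_map R M M"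
  unfolding linear_map_def by (auto simp: l_distr smult_assoc2)

lemma (in algebra) smult_eq_mult: "\<lbrakk>r \<in> carrier R; x \<in> carrier M\<rbrakk> \<Longrightarrow>
    r \<odot>\<^bsub>M\<^esub> x = (r \<odot>\<^bsub>M\<^esub> \<one>\<^bsub>M\<^esub>) \<otimes>\<^bsub>M\<^esub> x"
  by (simp add: smult_assoc2)

lemma (in module) linear_map_plus:
  "\<lbrakk>L \<in> linear_map R N M; L' \<in> linear_map R N M\<rbrakk> \<Longrightarrow> (\<lambda>x. L x \<oplus>\<^bsub>M\<^esub> L' x) \<in> linear_map R N M"
  unfolding linear_map_def by (auto simp: smult_r_distr M.a_ac Pi_iff)

section \<open>Multilinear maps on words\<close>

context regular_diff_algebra
begin

lemma A_word_cases:
  assumes "u \<in> A_words"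
  obtains (single) a where "u = [a]" "a \<in> carrier A"
    | (Cons) a u' where "u = a # u'" "a \<in> carrier A" "u' \<in> A_words"
  using assms by (cases u; cases "tl u") auto

lemma words_replace: "\<lbrakk>u @ a # v \<in> words A n; b \<in> carrier A\<rbrakk> \<Longrightarrow> u @ b # v \<in> words A n"
  by (auto simp: words_def)

text \<open>None of the conditions compares words of different lengths. This reduction to a fixed
  length makes induction on the length possible. The index \<open>n\<close> of a summand is the
  length minus one.\<close>

lemma multilinear_A_words_iff:
  "multilinear k A A_words N g \<longleftrightarrow> (\<forall>n. multilinear k A (words A (Suc n)) N g)"
proof
  assume "multilinear k A A_words N g"
  then show "\<forall>n. multilinear k A (words A (Suc n)) N g"
    unfolding multilinear_def words_def by (auto simp: Pi_iff simp flip: length_greater_0_conv)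
next
  assume *: "\<forall>n. multilinear k A (words A (Suc n)) N g"
  have w: "w \<in> words A (Suc (length w - 1))" if "w \<in> A_words" for w
    using that by (cases w) (auto simp: words_def)
  show "multilinear k A A_words N g"
    unfolding multilinear_def
  proof (intro conjI allI impI)
    show "g \<in> A_words \<rightarrow> carrier N"
      using multilinear_closed[OF *[rule_format] w] by blast
  qed (use multilinear_add[OF *[rule_format] w] multilinear_smult[OF *[rule_format] w] in blast)+
qed

text \<open>A position in a word is either the first one or lies in the tail. The resulting
  criterion fits maps defined by recursion on words: linearity in the first letter is read off the
  recursion, and the tail with a fixed first letter is left to an induction hypothesis.\<close>

lemma multilinear_words_ConsI:
  assumes "\<And>w. w \<in> words A (Suc n) \<Longrightarrow> g w \<in> carrier N"
    and "\<And>a b w. \<lbrakk>a \<in> carrier A; b \<in> carrier A; w \<in> words A n\<rbrakk> \<Longrightarrow>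
      g ((a \<oplus>\<^bsub>A\<^esub> b) # w) = g (a # w) \<oplus>\<^bsub>N\<^esub> g (b # w)"
    and "\<And>r a w. \<lbrakk>r \<in> carrier k; a \<in> carrier A; w \<in> words A n\<rbrakk> \<Longrightarrow>
      g ((r \<odot>\<^bsub>A\<^esub> a) # w) = r \<odot>\<^bsub>N\<^esub> g (a # w)"
    and "\<And>a. a \<in> carrier A \<Longrightarrow> multilinear k A (words A n) N (\<lambda>w. g (a # w))"
  shows "multilinear k A (words A (Suc n)) N g"
  unfolding multilinear_def
proof (intro conjI allI impI)
  show "g \<in> words A (Suc n) \<rightarrow> carrier N"
    using assms(1) by blast
next
  fix u v a b
  assume "u @ a # v \<in> words A (Suc n)" "b \<in> carrier A"
  then show "g (u @ (a \<oplus>\<^bsub>A\<^esub> b) # v) = g (u @ a # v) \<oplus>\<^bsub>N\<^esub> g (u @ b # v)"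
    using assms(2) multilinear_add[OF assms(4), of "hd u" "tl u" a v b] by (cases u) (auto simp: words_def)
next
  fix u v r a
  assume "u @ a # v \<in> words A (Suc n)" "r \<in> carrier k"
  then show "g (u @ (r \<odot>\<^bsub>A\<^esub> a) # v) = r \<odot>\<^bsub>N\<^esub> g (u @ a # v)"
    using assms(3) multilinear_smult[OF assms(4), of "hd u" "tl u" a v r] by (cases u) (auto simp: words_def)
qed

lemma multilinear_tail:
  assumes "multilinear k A (words A (Suc n)) N g" "a \<in> carrier A"
  shows "multilinear k A (words A n) N (\<lambda>w. g (a # w))"
  unfolding multilinear_def
proof (intro conjI allI impI)
  have w: "a # w \<in> words A (Suc n)" if "w \<in> words A n" for w
    using that assms(2) by (simp add: words_def)
  show "(\<lambda>w. g (a # w)) \<in> words A n \<rightarrow> carrier N"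
    using multilinear_closed[OF assms(1) w] by blast
  fix u v r b
  assume "u @ b # v \<in> words A n"
  then have *: "(a # u) @ b # v \<in> words A (Suc n)"
    using w by simp
  show "g (a # u @ (b \<oplus>\<^bsub>A\<^esub> c) # v) = g (a # u @ b # v) \<oplus>\<^bsub>N\<^esub> g (a # u @ c # v)" if "c \<in> carrier A" for c
    using multilinear_add[OF assms(1) * that] by simp
  show "g (a # u @ (r \<odot>\<^bsub>A\<^esub> b) # v) = r \<odot>\<^bsub>N\<^esub> g (a # u @ b # v)" if "r \<in> carrier k"
    using multilinear_smult[OF assms(1) * that] by simp
qed

lemma multilinear_words_0: "g [] \<in> carrier N \<Longrightarrow> multilinear k A (words A 0) N g"
  by (auto simp: multilinear_def words_def)

lemma multilinear_cong:
  assumes "multilinear k A (words A n) N g" "\<And>w. w \<in> words A n \<Longrightarrow> g w = g' w"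
  shows "multilinear k A (words A n) N g'"
  using assms(1) unfolding multilinear_def
  by (auto simp: Pi_iff assms(2)[symmetric] words_def)

text \<open>Covers the recursions in which the first letter is multiplied by a fixed element before
  the rest of the word is processed.\<close>

lemma multilinear_head:
  assumes "multilinear k A (words A n) N g" "phi \<in> linear_map k A A" "n > 0"
  shows "multilinear k A (words A n) N (\<lambda>w. g (phi (hd w) # tl w))"
  unfolding multilinear_def
proof (intro conjI allI impI)
  have "phi (hd w) # tl w \<in> words A n" if "w \<in> words A n" for w
    using that assms(3) linear_map_closed[OF assms(2)] by (cases w) (auto simp: words_def)
  then show "(\<lambda>w. g (phi (hd w) # tl w)) \<in> words A n \<rightarrow> carrier N"
    using multilinear_closed[OF assms(1)] by blast
next
  fix u v a b
  assume "u @ a # v \<in> words A n" "b \<in> carrier A"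
  then show "g (phi (hd (u @ (a \<oplus>\<^bsub>A\<^esub> b) # v)) # tl (u @ (a \<oplus>\<^bsub>A\<^esub> b) # v)) =
      g (phi (hd (u @ a # v)) # tl (u @ a # v)) \<oplus>\<^bsub>N\<^esub> g (phi (hd (u @ b # v)) # tl (u @ b # v))"
    using multilinear_add[OF assms(1), of "[]" "phi a" v "phi b"]
      multilinear_add[OF assms(1), of "phi (hd u) # tl u" a v b] assms(2)
    by (cases u) (auto simp: words_def linear_map_def Pi_iff)
next
  fix u v r a
  assume "u @ a # v \<in> words A n" "r \<in> carrier k"
  then show "g (phi (hd (u @ (r \<odot>\<^bsub>A\<^esub> a) # v)) # tl (u @ (r \<odot>\<^bsub>A\<^esub> a) # v)) =
      r \<odot>\<^bsub>N\<^esub> g (phi (hd (u @ a # v)) # tl (u @ a # v))"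
    using multilinear_smult[OF assms(1), of "[]" "phi a" v r]
      multilinear_smult[OF assms(1), of "phi (hd u) # tl u" a v r] assms(2)
    by (cases u) (auto simp: words_def linear_map_def Pi_iff)
qed

lemma multilinear_map:
  assumes "multilinear k A (words A n) N g" "phi \<in> linear_map k A A"
  shows "multilinear k A (words A n) N (\<lambda>w. g (map phi w))"
proof -
  have w: "map phi w \<in> words A n" if "w \<in> words A n" for w
    using that linear_map_closed[OF assms(2)] by (auto simp: words_def)
  show ?thesis
    unfolding multilinear_def
  proof (intro conjI allI impI)
    show "(\<lambda>w. g (map phi w)) \<in> words A n \<rightarrow> carrier N"
      using multilinear_closed[OF assms(1) w] by blast
  next
    fix u v a b
    assume *: "u @ a # v \<in> words A n" "b \<in> carrier A"
    then show "g (map phi (u @ (a \<oplus>\<^bsub>A\<^esub> b) # v)) = g (map phi (u @ a # v)) \<oplus>\<^bsub>N\<^esub> g (map phi (u @ b # v))"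
      using w[OF *(1)] multilinear_add[OF assms(1), of "map phi u" "phi a" "map phi v" "phi b"] assms(2)
      by (auto simp: linear_map_def Pi_iff words_def)
  next
    fix u v r a
    assume *: "u @ a # v \<in> words A n" "r \<in> carrier k"
    then show "g (map phi (u @ (r \<odot>\<^bsub>A\<^esub> a) # v)) = r \<odot>\<^bsub>N\<^esub> g (map phi (u @ a # v))"
      using w[OF *(1)] multilinear_smult[OF assms(1), of "map phi u" "phi a" "map phi v" r] assms(2)
      by (auto simp: linear_map_def Pi_iff words_def)
  qed
qed

section \<open>The k-module Sh(A)\<close>

lemma Sh_simps [simp]:
  "carrier Sh = carrier Sh_group" "add Sh = monoid.mult Sh_group" "\<zero>\<^bsub>Sh\<^esub> = \<one>\<^bsub>Sh_group\<^esub>"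
  "module.smult Sh = Sh_smult" "\<one>\<^bsub>Sh\<^esub> = tens [\<one>\<^bsub>A\<^esub>]"
  by (simp_all add: Sh_def)

text \<open>The scalar \<open>r\<close> acts on the first letter. When the moved scalar
  \<open>s\<close> also sits there, the two have to be interchanged, which is where commutativity of
  \<open>k\<close> enters.\<close>

lemma Sh_smult_balanced:
  assumes "r \<in> carrier k"
  shows "balanced_multiadditive k A A_words Sh_group (\<lambda>w. tens ((r \<odot>\<^bsub>A\<^esub> hd w) # tl w))"
  unfolding balanced_multiadditive_def
proof (intro conjI allI impI)
  show "(\<lambda>w. tens ((r \<odot>\<^bsub>A\<^esub> hd w) # tl w)) \<in> A_words \<rightarrow> carrier Sh_group"
    using assms by (auto simp: neq_Nil_conv intro!: tens_closed)
next
  fix u v a b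
  assume "u @ a # v \<in> A_words" "b \<in> carrier A"
  then show "tens ((r \<odot>\<^bsub>A\<^esub> hd (u @ (a \<oplus>\<^bsub>A\<^esub> b) # v)) # tl (u @ (a \<oplus>\<^bsub>A\<^esub> b) # v)) =
      tens ((r \<odot>\<^bsub>A\<^esub> hd (u @ a # v)) # tl (u @ a # v)) \<otimes>\<^bsub>Sh_group\<^esub> tens ((r \<odot>\<^bsub>A\<^esub> hd (u @ b # v)) # tl (u @ b # v))"
    using assms tens_add[of "[]" "r \<odot>\<^bsub>A\<^esub> a" v "r \<odot>\<^bsub>A\<^esub> b"] tens_add[of "(r \<odot>\<^bsub>A\<^esub> hd u) # tl u" a v b]
    by (cases u) (auto simp: smult_r_distr)
next
  fix u v w s a b
  assume "u @ a # v @ b # w \<in> A_words" "s \<in> carrier k"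
  then show "tens ((r \<odot>\<^bsub>A\<^esub> hd (u @ (s \<odot>\<^bsub>A\<^esub> a) # v @ b # w)) # tl (u @ (s \<odot>\<^bsub>A\<^esub> a) # v @ b # w)) =
      tens ((r \<odot>\<^bsub>A\<^esub> hd (u @ a # v @ (s \<odot>\<^bsub>A\<^esub> b) # w)) # tl (u @ a # v @ (s \<odot>\<^bsub>A\<^esub> b) # w))"
    using assms tens_balanced[of "[]" "r \<odot>\<^bsub>A\<^esub> a" v b w s] tens_balanced[of "(r \<odot>\<^bsub>A\<^esub> hd u) # tl u" a v b w s]
    by (cases u) (auto simp: R.m_comm simp flip: smult_assoc1)
qed

lemma Sh_smult_hom: "r \<in> carrier k \<Longrightarrow> Sh_smult r \<in> hom Sh_group Sh_group"
  unfolding Sh_smult_def Sh_ext_def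
  by (rule Sh_group.hom_ext_props(1)[OF Sh_group.is_group
    Sh_group_universal[OF Sh_group.comm_group_axioms Sh_smult_balanced]])

lemma Sh_smult_Cons:
  "\<lbrakk>r \<in> carrier k; a \<in> carrier A; set w \<subseteq> carrier A\<rbrakk> \<Longrightarrow> Sh_smult r (tens (a # w)) = tens ((r \<odot>\<^bsub>A\<^esub> a) # w)"
  unfolding Sh_smult_def Sh_ext_def
  by (subst Sh_group.hom_ext_props(2)[OF Sh_group.is_group
    Sh_group_universal[OF Sh_group.comm_group_axioms Sh_smult_balanced]]) auto

text \<open>A scalar on a later letter is carried to the first one by the balance relation, and
  there it is the action of \<open>Sh_smult\<close>.\<close>

lemma tens_smult:
  assumes "u @ a # v \<in> A_words" "r \<in> carrier k"
  shows "tens (u @ (r \<odot>\<^bsub>A\<^esub> a) # v) = Sh_smult r (tens (u @ a # v))"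
  using assms tens_balanced[of "[]" "hd u" "tl u" a v r]
  by (cases u) (auto simp: Sh_smult_Cons)

sublocale Sh: module k Sh
proof (rule moduleI)
  show "cring k" by (rule R_cring)
  show "abelian_group Sh"
    unfolding abelian_group_iff_comm_group
    by (rule comm_group_cong[OF Sh_group.comm_group_axioms]) simp_all
next
  fix r x assume "r \<in> carrier k" "x \<in> carrier Sh"
  then show "r \<odot>\<^bsub>Sh\<^esub> x \<in> carrier Sh"
    using Sh_smult_hom by (auto simp: hom_def)
next
  fix r s x assume rs: "r \<in> carrier k" "s \<in> carrier k" and "x \<in> carrier Sh"
  show "(r \<oplus>\<^bsub>k\<^esub> s) \<odot>\<^bsub>Sh\<^esub> x = r \<odot>\<^bsub>Sh\<^esub> x \<oplus>\<^bsub>Sh\<^esub> s \<odot>\<^bsub>Sh\<^esub> x"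
    unfolding Sh_simps
  proof (rule Sh_group.hom_eqI[OF Sh_group.is_group, of "Sh_smult (r \<oplus>\<^bsub>k\<^esub> s)" "(\<lambda>x. Sh_smult r x \<otimes>\<^bsub>Sh_group\<^esub> Sh_smult s x)"])
    show "Sh_smult (r \<oplus>\<^bsub>k\<^esub> s) \<in> hom Sh_group Sh_group"
      using rs by (simp add: Sh_smult_hom)
    show "(\<lambda>x. Sh_smult r x \<otimes>\<^bsub>Sh_group\<^esub> Sh_smult s x) \<in> hom Sh_group Sh_group"
      by (rule hom_comp_mult[OF Sh_group.comm_group_axioms]) (simp_all add: Sh_smult_hom rs)
    fix w assume "w \<in> A_words"
    then obtain a v where w: "w = a # v" "a \<in> carrier A" "set v \<subseteq> carrier A"
      by (cases w) auto
    then show "Sh_smult (r \<oplus>\<^bsub>k\<^esub> s) (tens w) = Sh_smult r (tens w) \<otimes>\<^bsub>Sh_group\<^esub> Sh_smult s (tens w)"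
      using rs tens_add[of "[]" "r \<odot>\<^bsub>A\<^esub> a" v "s \<odot>\<^bsub>A\<^esub> a"] by (simp add: Sh_smult_Cons smult_l_distr)
  qed (use \<open>x \<in> carrier Sh\<close> in simp)
next
  fix r x y assume "r \<in> carrier k" "x \<in> carrier Sh" "y \<in> carrier Sh"
  then show "r \<odot>\<^bsub>Sh\<^esub> (x \<oplus>\<^bsub>Sh\<^esub> y) = r \<odot>\<^bsub>Sh\<^esub> x \<oplus>\<^bsub>Sh\<^esub> r \<odot>\<^bsub>Sh\<^esub> y"
    using hom_mult[OF Sh_smult_hom] by simp
next
  fix r s x assume rs: "r \<in> carrier k" "s \<in> carrier k" and "x \<in> carrier Sh"
  show "(r \<otimes>\<^bsub>k\<^esub> s) \<odot>\<^bsub>Sh\<^esub> x = r \<odot>\<^bsub>Sh\<^esub> (s \<odot>\<^bsub>Sh\<^esub> x)"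
    unfolding Sh_simps
  proof (rule Sh_group.hom_eqI[OF Sh_group.is_group, of "Sh_smult (r \<otimes>\<^bsub>k\<^esub> s)" "(\<lambda>x. Sh_smult r (Sh_smult s x))"])
    show "Sh_smult (r \<otimes>\<^bsub>k\<^esub> s) \<in> hom Sh_group Sh_group"
      using rs by (simp add: Sh_smult_hom)
    show "(\<lambda>x. Sh_smult r (Sh_smult s x)) \<in> hom Sh_group Sh_group"
      using hom_compose[OF Sh_smult_hom[OF rs(2)] Sh_smult_hom[OF rs(1)]] by (simp add: comp_def)
    fix w assume "w \<in> A_words"
    then show "Sh_smult (r \<otimes>\<^bsub>k\<^esub> s) (tens w) = Sh_smult r (Sh_smult s (tens w))"
      using rs by (cases w) (simp_all add: Sh_smult_Cons smult_assoc1)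
  qed (use \<open>x \<in> carrier Sh\<close> in simp)
next
  fix x assume "x \<in> carrier Sh"
  show "\<one>\<^bsub>k\<^esub> \<odot>\<^bsub>Sh\<^esub> x = x"
    unfolding Sh_simps
  proof (rule Sh_group.hom_eqI[OF Sh_group.is_group Sh_smult_hom[OF R.one_closed], of "(\<lambda>x. x)"])
    show "(\<lambda>x. x) \<in> hom Sh_group Sh_group"
      by (simp add: hom_def)
    fix w assume "w \<in> A_words"
    then show "Sh_smult \<one>\<^bsub>k\<^esub> (tens w) = tens w"
      by (cases w) (simp_all add: Sh_smult_Cons)
  qed (use \<open>x \<in> carrier Sh\<close> in simp)
qed

lemma tens_multilinear: "multilinear k A A_words Sh tens"
  unfolding multilinear_def using tens_closed tens_add tens_smult by auto

text \<open>Multilinearity gives balance because the scalar can be pulled out of either position.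
  The additive map so obtained is linear: scaling before and scaling after are additive maps that
  agree on pure tensors.\<close>

lemma Sh_linear_universal:
  assumes "module k N" "multilinear k A A_words N g"
  shows "\<exists>L\<in>linear_map k Sh N. \<forall>w\<in>A_words. L (tens w) = g w"
proof -
  interpret N: module k N by fact
  have "balanced_multiadditive k A A_words (add_monoid N) g"
    unfolding balanced_multiadditive_def
  proof (intro conjI allI impI)
    fix u v w r a b
    assume *: "u @ a # v @ b # w \<in> A_words" "r \<in> carrier k"
    show "g (u @ (r \<odot>\<^bsub>A\<^esub> a) # v @ b # w) = g (u @ a # v @ (r \<odot>\<^bsub>A\<^esub> b) # w)"
      using multilinear_smult[OF assms(2) *] multilinear_smult[OF assms(2) _ *(2), of "u @ a # v"] * by simp
  qed (use assms(2) in \<open>auto simp: multilinear_def\<close>)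
  from Sh_group_universal[OF N.a_comm_group this]
  obtain L where L: "L \<in> hom Sh_group (add_monoid N)" "\<And>w. w \<in> A_words \<Longrightarrow> L (tens w) = g w"
    by blast
  have "L (r \<odot>\<^bsub>Sh\<^esub> x) = r \<odot>\<^bsub>N\<^esub> L x" if r: "r \<in> carrier k" and x: "x \<in> carrier Sh" for r x
    unfolding Sh_simps
  proof (rule Sh_group.hom_eqI[OF N.a_group, of "(\<lambda>x. L (Sh_smult r x))" "(\<lambda>x. r \<odot>\<^bsub>N\<^esub> L x)"])
    show "(\<lambda>x. L (Sh_smult r x)) \<in> hom Sh_group (add_monoid N)"
      using hom_compose[OF Sh_smult_hom[OF r] L(1)] by (simp add: comp_def)
    show "(\<lambda>x. r \<odot>\<^bsub>N\<^esub> L x) \<in> hom Sh_group (add_monoid N)"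
      using L(1) r by (auto simp: hom_def Pi_iff N.smult_r_distr)
    fix w assume w: "w \<in> A_words"
    then show "L (Sh_smult r (tens w)) = r \<odot>\<^bsub>N\<^esub> L (tens w)"
      using multilinear_smult[OF assms(2), of "[]" "hd w" "tl w" r] r
      by (cases w) (auto simp: Sh_smult_Cons L(2))
  qed (use x in simp)
  then show ?thesis
    using L by (intro bexI[of _ L]) (auto simp: linear_map_def hom_def)
qed

lemma hom_Sh_group_iff: "L \<in> hom Sh_group (add_monoid N) \<longleftrightarrow> L \<in> hom (add_monoid Sh) (add_monoid N)"
  by (simp add: hom_def)

lemma hom_Sh_group_Sh: "hom Sh_group Sh_group = hom (add_monoid Sh) (add_monoid Sh)"
  by (simp add: hom_def)

lemma Sh_additive_eqI:
  assumes "abelian_group N" "L \<in> hom (add_monoid Sh) (add_monoid N)" "L' \<in> hom (add_monoid Sh) (add_monoid N)"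
    and "\<And>w. w \<in> A_words \<Longrightarrow> L (tens w) = L' (tens w)" and "x \<in> carrier Sh"
  shows "L x = L' x"
  using Sh_group.hom_eqI[OF abelian_group.a_group[OF assms(1)], of L L' x] assms(2-)
  by (auto simp: hom_Sh_group_iff)

lemma Sh_ext_linear:
  assumes "multilinear k A A_words Sh g"
  shows "Sh_ext g \<in> linear_map k Sh Sh" "\<And>w. w \<in> A_words \<Longrightarrow> Sh_ext g (tens w) = g w"
proof -
  obtain L where L: "L \<in> linear_map k Sh Sh" "\<And>w. w \<in> A_words \<Longrightarrow> L (tens w) = g w"
    using Sh_linear_universal[OF Sh.module_axioms assms] by blast
  have "L \<in> hom Sh_group Sh_group"
    using L(1) by (auto simp: linear_map_def hom_def)
  then have *: "Sh_ext g = restrict L (carrier Sh)"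
    unfolding Sh_ext_def using Sh_group.hom_ext_eq[OF Sh_group.is_group, of L g] L(2) by simp
  show "Sh_ext g \<in> linear_map k Sh Sh"
    using L(1) Sh.smult_closed Sh.M.a_closed by (auto simp: * linear_map_def)
  show "Sh_ext g (tens w) = g w" if "w \<in> A_words" for w
    using that L(2) tens_closed by (auto simp: *)
qed

lemma Sh_cons_multilinear:
  assumes "c \<in> carrier A"
  shows "multilinear k A A_words Sh (\<lambda>w. tens (c # w))"
  unfolding multilinear_def
proof (intro conjI allI impI)
  show "(\<lambda>w. tens (c # w)) \<in> A_words \<rightarrow> carrier Sh"
    using assms by (auto intro!: tens_closed)
next
  fix u v a b assume "u @ a # v \<in> A_words" "b \<in> carrier A"
  then show "tens (c # u @ (a \<oplus>\<^bsub>A\<^esub> b) # v) = tens (c # u @ a # v) \<oplus>\<^bsub>Sh\<^esub> tens (c # u @ b # v)"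
    using assms tens_add[of "c # u" a v b] by simp
next
  fix u v r a assume "u @ a # v \<in> A_words" "r \<in> carrier k"
  then show "tens (c # u @ (r \<odot>\<^bsub>A\<^esub> a) # v) = r \<odot>\<^bsub>Sh\<^esub> tens (c # u @ a # v)"
    using assms tens_smult[of "c # u" a v r] by simp
qed

lemma Sh_cons_linear: "c \<in> carrier A \<Longrightarrow> Sh_cons c \<in> linear_map k Sh Sh"
  and Sh_cons_tens: "\<lbrakk>c \<in> carrier A; w \<in> A_words\<rbrakk> \<Longrightarrow> Sh_cons c (tens w) = tens (c # w)"
  unfolding Sh_cons_def using Sh_ext_linear[OF Sh_cons_multilinear] by auto

lemma Sh_cons_closed: "\<lbrakk>c \<in> carrier A; x \<in> carrier Sh_group\<rbrakk> \<Longrightarrow> Sh_cons c x \<in> carrier Sh_group"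
  using linear_map_closed[OF Sh_cons_linear] by simp

lemma Sh_cons_add:
  assumes "a \<in> carrier A" "b \<in> carrier A" "x \<in> carrier Sh"
  shows "Sh_cons (a \<oplus>\<^bsub>A\<^esub> b) x = Sh_cons a x \<oplus>\<^bsub>Sh\<^esub> Sh_cons b x"
proof (rule Sh_additive_eqI[of Sh "Sh_cons (a \<oplus>\<^bsub>A\<^esub> b)" "\<lambda>x. Sh_cons a x \<oplus>\<^bsub>Sh\<^esub> Sh_cons b x"])
  show "(\<lambda>x. Sh_cons a x \<oplus>\<^bsub>Sh\<^esub> Sh_cons b x) \<in> hom (add_monoid Sh) (add_monoid Sh)"
    using hom_comp_mult[OF Sh.M.a_comm_group linear_map_hom linear_map_hom, OF Sh_cons_linear Sh_cons_linear]
      assms by simp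
  fix w assume "w \<in> A_words"
  then show "Sh_cons (a \<oplus>\<^bsub>A\<^esub> b) (tens w) = Sh_cons a (tens w) \<oplus>\<^bsub>Sh\<^esub> Sh_cons b (tens w)"
    using assms tens_add[of "[]" a w b] by (simp add: Sh_cons_tens)
qed (use assms linear_map_hom[OF Sh_cons_linear] Sh.M.abelian_group_axioms in auto)

lemma Sh_cons_smult:
  assumes "r \<in> carrier k" "a \<in> carrier A" "x \<in> carrier Sh"
  shows "Sh_cons (r \<odot>\<^bsub>A\<^esub> a) x = r \<odot>\<^bsub>Sh\<^esub> Sh_cons a x"
proof (rule Sh_additive_eqI[of Sh "Sh_cons (r \<odot>\<^bsub>A\<^esub> a)" "\<lambda>x. r \<odot>\<^bsub>Sh\<^esub> Sh_cons a x"])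
  show "(\<lambda>x. r \<odot>\<^bsub>Sh\<^esub> Sh_cons a x) \<in> hom (add_monoid Sh) (add_monoid Sh)"
    using assms Sh_cons_linear[OF assms(2)] Sh.smult_closed Sh.smult_r_distr[of r]
    by (auto simp: linear_map_def hom_def simp del: Sh_simps)
  fix w assume "w \<in> A_words"
  then show "Sh_cons (r \<odot>\<^bsub>A\<^esub> a) (tens w) = r \<odot>\<^bsub>Sh\<^esub> Sh_cons a (tens w)"
    using assms tens_smult[of "[]" a w r] by (simp add: Sh_cons_tens)
qed (use assms linear_map_hom[OF Sh_cons_linear] Sh.M.abelian_group_axioms in auto)

section \<open>The mixable shuffle product\<close>

lemma shuffle_Cons:
  assumes "u \<in> A_words" "v \<in> A_words"
  shows "shuffle (a # u) (b # v) = Sh_cons (a \<otimes>\<^bsub>A\<^esub> b)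
    (shuffle u (\<one>\<^bsub>A\<^esub> # v) \<oplus>\<^bsub>Sh\<^esub> shuffle (\<one>\<^bsub>A\<^esub> # u) v \<oplus>\<^bsub>Sh\<^esub> lam \<odot>\<^bsub>Sh\<^esub> shuffle u v)"
  using assms by (cases u; cases v) auto

lemma shuffle_single_right: "shuffle (a # u) [b] = tens ((a \<otimes>\<^bsub>A\<^esub> b) # u)"
  by (cases u) auto

text \<open>Replacing a first letter by the unit does not change the length, so in each of the three
  recursive calls the total length drops: by one in the first two, by two in the third. This measure
  also carries the later inductions on \<open>shuffle\<close>.\<close>

lemma shuffle_closed: "\<lbrakk>u \<in> A_words; v \<in> A_words\<rbrakk> \<Longrightarrow> shuffle u v \<in> carrier Sh"
proof (induction "length u + length v" arbitrary: u v rule: less_induct)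
  case less
  from less(2) show ?case
  proof (cases rule: A_word_cases)
    case (single a)
    then show ?thesis
      using less(3) tens_closed by (cases v) auto
  next
    case u: (Cons a u')
    from less(3) show ?thesis
    proof (cases rule: A_word_cases)
      case (single b)
      then show ?thesis
        using u by (auto simp: shuffle_single_right intro!: tens_closed)
    next
      case v: (Cons b v')
      have "shuffle u' (\<one>\<^bsub>A\<^esub> # v') \<in> carrier Sh" "shuffle (\<one>\<^bsub>A\<^esub> # u') v' \<in> carrier Sh" "shuffle u' v' \<in> carrier Sh"
        using u v by (auto intro!: less(1) simp del: Sh_simps)
      then have "shuffle u' (\<one>\<^bsub>A\<^esub> # v') \<oplus>\<^bsub>Sh\<^esub> shuffle (\<one>\<^bsub>A\<^esub> # u') v' \<oplus>\<^bsub>Sh\<^esub> lam \<odot>\<^bsub>Sh\<^esub> shuffle u' v' \<in> carrier Sh"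
        using lam_closed by (intro Sh.M.a_closed Sh.smult_closed)
      then show ?thesis
        using linear_map_closed[OF Sh_cons_linear] u v by (simp only: shuffle_Cons m_closed)
    qed
  qed
qed

text \<open>Interchanging the words interchanges the first two summands of the recursion and fixes
  the weighted one.\<close>

lemma shuffle_commute: "\<lbrakk>u \<in> A_words; v \<in> A_words\<rbrakk> \<Longrightarrow> shuffle u v = shuffle v u"
proof (induction "length u + length v" arbitrary: u v rule: less_induct)
  case less
  from less(2) show ?case
  proof (cases rule: A_word_cases)
    case (single a)
    then show ?thesis
      using less(3) by (cases v) (auto simp: shuffle_single_right m_comm)
  next
    case u: (Cons a u')
    from less(3) show ?thesis
    proof (cases rule: A_word_cases)
      case (single b)
      then show ?thesis
        using u by (auto simp: shuffle_single_right m_comm)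
    next
      case v: (Cons b v')
      have "shuffle u' (\<one>\<^bsub>A\<^esub> # v') = shuffle (\<one>\<^bsub>A\<^esub> # v') u'" "shuffle (\<one>\<^bsub>A\<^esub> # u') v' = shuffle v' (\<one>\<^bsub>A\<^esub> # u')"
        "shuffle u' v' = shuffle v' u'"
        using u v by (auto intro!: less(1))
      moreover have "shuffle (\<one>\<^bsub>A\<^esub> # v') u' \<in> carrier Sh" "shuffle v' (\<one>\<^bsub>A\<^esub> # u') \<in> carrier Sh"
        using u v by (auto intro!: shuffle_closed simp del: Sh_simps)
      ultimately show ?thesis
        using u v by (simp only: shuffle_Cons m_comm[of a b] Sh.M.a_comm)
    qed
  qed
qed

text \<open>By the recursion, a fixed first letter leaves a linear map applied to the sum of three
  shuffles, each with smaller measure. The measure is taken with \<open>n\<close> because the left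
  word has length \<open>Suc n\<close>.\<close>

lemma shuffle_multilinear_words:
  "v \<in> A_words \<Longrightarrow> multilinear k A (words A (Suc n)) Sh (\<lambda>u. shuffle u v)"
proof (induction "n + length v" arbitrary: n v rule: less_induct)
  case less
  have tens: "multilinear k A (words A (Suc m)) Sh tens" for m
    using tens_multilinear by (simp add: multilinear_A_words_iff)
  from less(2) show ?case
  proof (cases rule: A_word_cases)
    case (single c)
    have "multilinear k A (words A (Suc n)) Sh (\<lambda>u. tens ((hd u \<otimes>\<^bsub>A\<^esub> c) # tl u))"
      by (rule multilinear_head[OF tens linear_map_mult_right[OF single(2)]]) simp
    then show ?thesis
      by (rule multilinear_cong) (auto simp: words_def single(1) shuffle_single_right length_Suc_conv)
  next
    case v: (Cons c v')
    let ?s = "\<lambda>u. shuffle u (\<one>\<^bsub>A\<^esub> # v') \<oplus>\<^bsub>Sh\<^esub> shuffle (\<one>\<^bsub>A\<^esub> # u) v' \<oplus>\<^bsub>Sh\<^esub> lam \<odot>\<^bsub>Sh\<^esub> shuffle u v'"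
    have s_closed: "?s u \<in> carrier Sh" if "u \<in> A_words" for u
      using that v lam_closed by (intro Sh.M.a_closed Sh.smult_closed shuffle_closed) auto
    have tail: "w = [] \<or> w \<in> A_words" if "w \<in> words A n" for w
      using that by (auto simp: words_def)
    show ?thesis
    proof (rule multilinear_words_ConsI)
      show "shuffle w v \<in> carrier Sh" if "w \<in> words A (Suc n)" for w
        using that less(2) by (intro shuffle_closed) (auto simp: words_def)
    next
      fix a b w assume "a \<in> carrier A" "b \<in> carrier A" "w \<in> words A n"
      then show "shuffle ((a \<oplus>\<^bsub>A\<^esub> b) # w) v = shuffle (a # w) v \<oplus>\<^bsub>Sh\<^esub> shuffle (b # w) v"
        using tail[of w] v s_closed[of w] tens_add[of "[]" "a \<otimes>\<^bsub>A\<^esub> c" v' "b \<otimes>\<^bsub>A\<^esub> c"]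
          Sh_cons_add[of "a \<otimes>\<^bsub>A\<^esub> c" "b \<otimes>\<^bsub>A\<^esub> c" "?s w"]
        by (auto simp: shuffle_Cons l_distr)
    next
      fix r a w assume "r \<in> carrier k" "a \<in> carrier A" "w \<in> words A n"
      then show "shuffle ((r \<odot>\<^bsub>A\<^esub> a) # w) v = r \<odot>\<^bsub>Sh\<^esub> shuffle (a # w) v"
        using tail[of w] v s_closed[of w] tens_smult[of "[]" "a \<otimes>\<^bsub>A\<^esub> c" v' r]
          Sh_cons_smult[of r "a \<otimes>\<^bsub>A\<^esub> c" "?s w"]
        by (auto simp: shuffle_Cons smult_assoc2)
    next
      fix a assume a: "a \<in> carrier A"
      then have ac: "a \<otimes>\<^bsub>A\<^esub> c \<in> carrier A"
        using v by simp
      show "multilinear k A (words A n) Sh (\<lambda>u. shuffle (a # u) v)"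
      proof (cases n)
        case 0
        then show ?thesis
          using a less(2) shuffle_closed[of "[a]" v] multilinear_words_0[of "\<lambda>u. shuffle (a # u) v" Sh] by simp
      next
        case (Suc m)
        have 1: "multilinear k A (words A n) Sh (\<lambda>u. shuffle u (\<one>\<^bsub>A\<^esub> # v'))"
          unfolding Suc by (rule less(1)) (use v Suc in auto)
        \<comment> \<open>Here the left word keeps its length while the right one has lost a letter.
          The induction hypothesis concerns words of length \<open>Suc n\<close>, and fixing their
          first letter to be the unit leaves a map on words of length \<open>n\<close>.\<close>
        have 2: "multilinear k A (words A n) Sh (\<lambda>u. shuffle (\<one>\<^bsub>A\<^esub> # u) v')"
          by (rule multilinear_tail[OF less(1)]) (use v in auto)
        have 3: "multilinear k A (words A n) Sh (\<lambda>u. lam \<odot>\<^bsub>Sh\<^esub> shuffle u v')"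
          unfolding Suc
          by (rule multilinear_linear_comp[OF less(1) Sh.linear_map_smult_self[OF lam_closed] words_replace])
            (use v Suc in auto)
        have "multilinear k A (words A n) Sh (\<lambda>u. Sh_cons (a \<otimes>\<^bsub>A\<^esub> c) (?s u))"
          by (rule multilinear_linear_comp[OF Sh.multilinear_plus[OF Sh.multilinear_plus[OF 1 2 words_replace] 3 words_replace]
            Sh_cons_linear[OF ac] words_replace])
        then show ?thesis
          by (rule multilinear_cong) (use v Suc in \<open>auto simp: words_def shuffle_Cons simp flip: length_greater_0_conv\<close>)
      qed
    qed
  qed
qed

lemma shuffle_multilinear_left:
  "v \<in> A_words \<Longrightarrow> multilinear k A A_words Sh (\<lambda>u. shuffle u v)"
  by (simp add: multilinear_A_words_iff shuffle_multilinear_words)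

lemma shuffle_hom_left:
  assumes "v \<in> A_words"
  shows "\<exists>h\<in>hom Sh_group Sh_group. \<forall>u\<in>A_words. h (tens u) = shuffle u v"
proof -
  obtain L where L: "L \<in> linear_map k Sh Sh" "\<forall>u\<in>A_words. L (tens u) = shuffle u v"
    using Sh_linear_universal[OF Sh.module_axioms shuffle_multilinear_left[OF assms]] by blast
  show ?thesis
    using L(2) linear_map_hom[OF L(1)] unfolding hom_Sh_group_Sh[symmetric] by (intro bexI[of _ L])
qed

text \<open>Commutativity reduces the second argument to the first, so linearity in it requires no
  second induction.\<close>

lemma shuffle_hom_right:
  assumes "u \<in> A_words"
  shows "\<exists>h\<in>hom Sh_group Sh_group. \<forall>v\<in>A_words. h (tens v) = shuffle u v"
proof -
  obtain h where "h \<in> hom Sh_group Sh_group" "\<forall>v\<in>A_words. h (tens v) = shuffle v u"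
    using shuffle_hom_left[OF assms] by blast
  then show ?thesis
    using shuffle_commute[OF assms] by (intro bexI[of _ h]) auto
qed

lemma Sh_mult_eq: "monoid.mult Sh = biadd_ext Sh_group A_words tens shuffle"
  by (simp add: Sh_def)

lemma Sh_mult_hom_left: "y \<in> carrier Sh \<Longrightarrow> (\<lambda>x. x \<otimes>\<^bsub>Sh\<^esub> y) \<in> hom (add_monoid Sh) (add_monoid Sh)"
  using Sh_group.biadd_ext_hom_left[where g = shuffle, OF shuffle_hom_left shuffle_hom_right]
  by (simp add: Sh_mult_eq hom_Sh_group_Sh)

lemma Sh_mult_hom_right: "x \<in> carrier Sh \<Longrightarrow> (\<lambda>y. x \<otimes>\<^bsub>Sh\<^esub> y) \<in> hom (add_monoid Sh) (add_monoid Sh)"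
  using Sh_group.biadd_ext_hom_right[where g = shuffle, OF shuffle_hom_left shuffle_hom_right]
  by (simp add: Sh_mult_eq hom_Sh_group_Sh)

lemma Sh_mult_tens: "\<lbrakk>u \<in> A_words; v \<in> A_words\<rbrakk> \<Longrightarrow> tens u \<otimes>\<^bsub>Sh\<^esub> tens v = shuffle u v"
  using Sh_group.biadd_ext_generators[where g = shuffle, OF shuffle_hom_left shuffle_hom_right]
  by (simp add: Sh_mult_eq)

lemma Sh_mult_closed: "\<lbrakk>x \<in> carrier Sh; y \<in> carrier Sh\<rbrakk> \<Longrightarrow> x \<otimes>\<^bsub>Sh\<^esub> y \<in> carrier Sh"
  using Sh_mult_hom_left by (fastforce simp: hom_def)

lemma Sh_mult_add_left: "\<lbrakk>x \<in> carrier Sh; y \<in> carrier Sh; z \<in> carrier Sh\<rbrakk> \<Longrightarrow>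
    (x \<oplus>\<^bsub>Sh\<^esub> y) \<otimes>\<^bsub>Sh\<^esub> z = x \<otimes>\<^bsub>Sh\<^esub> z \<oplus>\<^bsub>Sh\<^esub> y \<otimes>\<^bsub>Sh\<^esub> z"
  using Sh_mult_hom_left[of z] by (simp add: hom_def)

lemma Sh_mult_add_right: "\<lbrakk>x \<in> carrier Sh; y \<in> carrier Sh; z \<in> carrier Sh\<rbrakk> \<Longrightarrow>
    x \<otimes>\<^bsub>Sh\<^esub> (y \<oplus>\<^bsub>Sh\<^esub> z) = x \<otimes>\<^bsub>Sh\<^esub> y \<oplus>\<^bsub>Sh\<^esub> x \<otimes>\<^bsub>Sh\<^esub> z"
  using Sh_mult_hom_right[of x] by (simp add: hom_def)

lemma Sh_biadditive_eqI:
  assumes "abelian_group N"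
    and "\<And>y. y \<in> carrier Sh \<Longrightarrow> (\<lambda>x. F x y) \<in> hom (add_monoid Sh) (add_monoid N)"
    and "\<And>y. y \<in> carrier Sh \<Longrightarrow> (\<lambda>x. G x y) \<in> hom (add_monoid Sh) (add_monoid N)"
    and "\<And>x. x \<in> carrier Sh \<Longrightarrow> F x \<in> hom (add_monoid Sh) (add_monoid N)"
    and "\<And>x. x \<in> carrier Sh \<Longrightarrow> G x \<in> hom (add_monoid Sh) (add_monoid N)"
    and "\<And>u v. \<lbrakk>u \<in> A_words; v \<in> A_words\<rbrakk> \<Longrightarrow> F (tens u) (tens v) = G (tens u) (tens v)"
    and "x \<in> carrier Sh" "y \<in> carrier Sh"
  shows "F x y = G x y"
proof (rule Sh_additive_eqI[OF assms(1) assms(2)[OF assms(8)] assms(3)[OF assms(8)] _ assms(7)])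
  fix u assume u: "u \<in> A_words"
  then have tu: "tens u \<in> carrier Sh"
    using tens_closed by simp
  show "F (tens u) y = G (tens u) y"
    by (rule Sh_additive_eqI[OF assms(1) assms(4)[OF tu] assms(5)[OF tu] assms(6)[OF u] assms(8)])
qed

lemma hom_add: "\<lbrakk>f \<in> hom (add_monoid Sh) (add_monoid Sh); g \<in> hom (add_monoid Sh) (add_monoid Sh)\<rbrakk> \<Longrightarrow>
    (\<lambda>x. f x \<oplus>\<^bsub>Sh\<^esub> g x) \<in> hom (add_monoid Sh) (add_monoid Sh)"
  using hom_comp_mult[OF Sh.M.a_comm_group, of f _ g] by simp

lemma hom_smult: "\<lbrakk>r \<in> carrier k; f \<in> hom G (add_monoid Sh)\<rbrakk> \<Longrightarrow>
    (\<lambda>x. r \<odot>\<^bsub>Sh\<^esub> f x) \<in> hom G (add_monoid Sh)"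
  using Sh.smult_closed Sh.smult_r_distr by (auto simp: hom_def Pi_iff simp del: Sh_simps)

lemma Sh_mult_smult_left:
  assumes "r \<in> carrier k" "x \<in> carrier Sh" "y \<in> carrier Sh"
  shows "(r \<odot>\<^bsub>Sh\<^esub> x) \<otimes>\<^bsub>Sh\<^esub> y = r \<odot>\<^bsub>Sh\<^esub> (x \<otimes>\<^bsub>Sh\<^esub> y)"
proof (rule Sh_biadditive_eqI[of Sh "\<lambda>x y. (r \<odot>\<^bsub>Sh\<^esub> x) \<otimes>\<^bsub>Sh\<^esub> y" "\<lambda>x y. r \<odot>\<^bsub>Sh\<^esub> (x \<otimes>\<^bsub>Sh\<^esub> y)"])
  fix u v assume uv: "u \<in> A_words" "v \<in> A_words"
  then obtain a u' where u: "u = a # u'" "a \<in> carrier A" "set u' \<subseteq> carrier A"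
    by (cases u) auto
  have "(r \<odot>\<^bsub>Sh\<^esub> tens u) \<otimes>\<^bsub>Sh\<^esub> tens v = shuffle ((r \<odot>\<^bsub>A\<^esub> a) # u') v"
    using u uv assms(1) Sh_mult_tens[of "(r \<odot>\<^bsub>A\<^esub> a) # u'" v] by (simp add: Sh_smult_Cons)
  also have "\<dots> = r \<odot>\<^bsub>Sh\<^esub> shuffle u v"
    using multilinear_smult[OF shuffle_multilinear_left[OF uv(2)], of "[]" a u' r] u assms(1) by simp
  finally show "(r \<odot>\<^bsub>Sh\<^esub> tens u) \<otimes>\<^bsub>Sh\<^esub> tens v = r \<odot>\<^bsub>Sh\<^esub> (tens u \<otimes>\<^bsub>Sh\<^esub> tens v)"
    using uv Sh_mult_tens by simp
next
  fix y assume "y \<in> carrier Sh"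
  from hom_compose'[OF hom_smult[OF assms(1) hom_id] Sh_mult_hom_left[OF this]]
  show "(\<lambda>x. (r \<odot>\<^bsub>Sh\<^esub> x) \<otimes>\<^bsub>Sh\<^esub> y) \<in> hom (add_monoid Sh) (add_monoid Sh)" .
qed (use assms Sh.M.abelian_group_axioms Sh.smult_closed in
  \<open>auto intro!: hom_smult Sh_mult_hom_left Sh_mult_hom_right simp del: Sh_simps\<close>)

lemma Sh_mult_commute:
  assumes "x \<in> carrier Sh" "y \<in> carrier Sh"
  shows "x \<otimes>\<^bsub>Sh\<^esub> y = y \<otimes>\<^bsub>Sh\<^esub> x"
  by (rule Sh_biadditive_eqI[of Sh "\<lambda>x y. x \<otimes>\<^bsub>Sh\<^esub> y" "\<lambda>x y. y \<otimes>\<^bsub>Sh\<^esub> x"])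
    (use assms Sh.M.abelian_group_axioms in
      \<open>auto intro!: Sh_mult_hom_left Sh_mult_hom_right simp: Sh_mult_tens shuffle_commute simp del: Sh_simps\<close>)

lemma Sh_single_mult:
  assumes "a \<in> carrier A" "b \<in> carrier A" "set w \<subseteq> carrier A"
  shows "tens [a] \<otimes>\<^bsub>Sh\<^esub> tens (b # w) = tens ((a \<otimes>\<^bsub>A\<^esub> b) # w)"
  using assms Sh_mult_tens[of "[a]" "b # w"] by simp

lemma Sh_single_mult_cons:
  assumes "a \<in> carrier A" "b \<in> carrier A" "x \<in> carrier Sh"
  shows "tens [a] \<otimes>\<^bsub>Sh\<^esub> Sh_cons b x = Sh_cons (a \<otimes>\<^bsub>A\<^esub> b) x"
proof (rule Sh_additive_eqI[of Sh "\<lambda>x. tens [a] \<otimes>\<^bsub>Sh\<^esub> Sh_cons b x" "Sh_cons (a \<otimes>\<^bsub>A\<^esub> b)"])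
  show "(\<lambda>x. tens [a] \<otimes>\<^bsub>Sh\<^esub> Sh_cons b x) \<in> hom (add_monoid Sh) (add_monoid Sh)"
    using assms tens_closed[of "[a]"]
    by (intro hom_compose'[OF linear_map_hom[OF Sh_cons_linear] Sh_mult_hom_right]) auto
qed (use assms linear_map_hom[OF Sh_cons_linear] Sh.M.abelian_group_axioms in
  \<open>auto simp: Sh_cons_tens Sh_single_mult\<close>)

lemma Sh_one_mult:
  assumes "x \<in> carrier Sh"
  shows "tens [\<one>\<^bsub>A\<^esub>] \<otimes>\<^bsub>Sh\<^esub> x = x"
proof (rule Sh_additive_eqI[of Sh "\<lambda>x. tens [\<one>\<^bsub>A\<^esub>] \<otimes>\<^bsub>Sh\<^esub> x" "\<lambda>x. x"])
  fix w assume "w \<in> A_words"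
  then show "tens [\<one>\<^bsub>A\<^esub>] \<otimes>\<^bsub>Sh\<^esub> tens w = tens w"
    by (cases w) (simp_all add: Sh_single_mult)
qed (use assms tens_closed[of "[\<one>\<^bsub>A\<^esub>]"] Sh_mult_hom_right Sh.M.abelian_group_axioms in \<open>auto simp: hom_id\<close>)

text \<open>The recursion puts the product of the two first letters in front and leaves them out of
  the tail, so an extra factor from \<open>A\<close> changes this front letter only. Through this
  lemma, first letters can be stripped off in the proof of associativity.\<close>

lemma Sh_single_mult_assoc:
  assumes "a \<in> carrier A" "x \<in> carrier Sh" "y \<in> carrier Sh"
  shows "(tens [a] \<otimes>\<^bsub>Sh\<^esub> x) \<otimes>\<^bsub>Sh\<^esub> y = tens [a] \<otimes>\<^bsub>Sh\<^esub> (x \<otimes>\<^bsub>Sh\<^esub> y)"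
proof (rule Sh_biadditive_eqI[of Sh "\<lambda>x y. (tens [a] \<otimes>\<^bsub>Sh\<^esub> x) \<otimes>\<^bsub>Sh\<^esub> y" "\<lambda>x y. tens [a] \<otimes>\<^bsub>Sh\<^esub> (x \<otimes>\<^bsub>Sh\<^esub> y)"])
  have a: "tens [a] \<in> carrier Sh"
    using assms(1) tens_closed[of "[a]"] by simp
  fix y assume y: "y \<in> carrier Sh"
  show "(\<lambda>x. (tens [a] \<otimes>\<^bsub>Sh\<^esub> x) \<otimes>\<^bsub>Sh\<^esub> y) \<in> hom (add_monoid Sh) (add_monoid Sh)"
    by (rule hom_compose'[OF Sh_mult_hom_right[OF a] Sh_mult_hom_left[OF y]])
  show "(\<lambda>x. tens [a] \<otimes>\<^bsub>Sh\<^esub> (x \<otimes>\<^bsub>Sh\<^esub> y)) \<in> hom (add_monoid Sh) (add_monoid Sh)"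
    by (rule hom_compose'[OF Sh_mult_hom_left[OF y] Sh_mult_hom_right[OF a]])
  show "(\<lambda>x. (tens [a] \<otimes>\<^bsub>Sh\<^esub> y) \<otimes>\<^bsub>Sh\<^esub> x) \<in> hom (add_monoid Sh) (add_monoid Sh)"
    by (rule Sh_mult_hom_right[OF Sh_mult_closed[OF a y]])
  show "(\<lambda>x. tens [a] \<otimes>\<^bsub>Sh\<^esub> (y \<otimes>\<^bsub>Sh\<^esub> x)) \<in> hom (add_monoid Sh) (add_monoid Sh)"
    by (rule hom_compose'[OF Sh_mult_hom_right[OF y] Sh_mult_hom_right[OF a]])
next
  fix u v assume uv: "u \<in> A_words" "v \<in> A_words"
  obtain b u' where u: "u = b # u'" "b \<in> carrier A" "set u' \<subseteq> carrier A"
    using uv by (cases u) auto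
  obtain c v' where v: "v = c # v'" "c \<in> carrier A" "set v' \<subseteq> carrier A"
    using uv by (cases v) auto
  have "shuffle ((a \<otimes>\<^bsub>A\<^esub> b) # u') v = tens [a] \<otimes>\<^bsub>Sh\<^esub> shuffle (b # u') v"
  proof (cases "u' = [] \<or> v' = []")
    case True
    then show ?thesis
      using u v assms(1) by (auto simp: shuffle_single_right Sh_single_mult m_assoc)
  next
    case False
    then have uv': "u' \<in> A_words" "v' \<in> A_words"
      using u v by auto
    let ?x = "shuffle u' (\<one>\<^bsub>A\<^esub> # v') \<oplus>\<^bsub>Sh\<^esub> shuffle (\<one>\<^bsub>A\<^esub> # u') v' \<oplus>\<^bsub>Sh\<^esub> lam \<odot>\<^bsub>Sh\<^esub> shuffle u' v'"
    have "?x \<in> carrier Sh"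
      using uv' lam_closed by (intro Sh.M.a_closed Sh.smult_closed shuffle_closed) auto
    then show ?thesis
      using uv' u v assms(1) by (simp add: shuffle_Cons m_assoc Sh_single_mult_cons del: Sh_simps)
  qed
  then show "(tens [a] \<otimes>\<^bsub>Sh\<^esub> tens u) \<otimes>\<^bsub>Sh\<^esub> tens v = tens [a] \<otimes>\<^bsub>Sh\<^esub> (tens u \<otimes>\<^bsub>Sh\<^esub> tens v)"
    using u v assms(1) Sh_mult_tens[of "(a \<otimes>\<^bsub>A\<^esub> b) # u'" v] Sh_mult_tens[of "b # u'" v]
    by (simp add: Sh_single_mult)
qed (use assms Sh.M.abelian_group_axioms in auto)

section \<open>The Rota-Baxter identity and associativity\<close>

text \<open>On pure tensors this is the shuffle recursion for two words that both begin with the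
  unit. Both sides are biadditive, so it holds throughout.\<close>

lemma Sh_cons_Rota_Baxter:
  assumes "x \<in> carrier Sh" "y \<in> carrier Sh"
  shows "Sh_cons \<one>\<^bsub>A\<^esub> x \<otimes>\<^bsub>Sh\<^esub> Sh_cons \<one>\<^bsub>A\<^esub> y =
    Sh_cons \<one>\<^bsub>A\<^esub> (x \<otimes>\<^bsub>Sh\<^esub> Sh_cons \<one>\<^bsub>A\<^esub> y \<oplus>\<^bsub>Sh\<^esub> Sh_cons \<one>\<^bsub>A\<^esub> x \<otimes>\<^bsub>Sh\<^esub> y \<oplus>\<^bsub>Sh\<^esub> lam \<odot>\<^bsub>Sh\<^esub> (x \<otimes>\<^bsub>Sh\<^esub> y))"
proof (rule Sh_biadditive_eqI[of Sh "\<lambda>x y. Sh_cons \<one>\<^bsub>A\<^esub> x \<otimes>\<^bsub>Sh\<^esub> Sh_cons \<one>\<^bsub>A\<^esub> y"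
    "\<lambda>x y. Sh_cons \<one>\<^bsub>A\<^esub> (x \<otimes>\<^bsub>Sh\<^esub> Sh_cons \<one>\<^bsub>A\<^esub> y \<oplus>\<^bsub>Sh\<^esub> Sh_cons \<one>\<^bsub>A\<^esub> x \<otimes>\<^bsub>Sh\<^esub> y \<oplus>\<^bsub>Sh\<^esub> lam \<odot>\<^bsub>Sh\<^esub> (x \<otimes>\<^bsub>Sh\<^esub> y))"])
  note P = linear_map_hom[OF Sh_cons_linear[OF one_closed]]
  have Pc: "Sh_cons \<one>\<^bsub>A\<^esub> x \<in> carrier Sh" if "x \<in> carrier Sh" for x
    using Sh_cons_closed that by simp
  fix y assume y: "y \<in> carrier Sh"
  show "(\<lambda>x. Sh_cons \<one>\<^bsub>A\<^esub> x \<otimes>\<^bsub>Sh\<^esub> Sh_cons \<one>\<^bsub>A\<^esub> y) \<in> hom (add_monoid Sh) (add_monoid Sh)"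
    by (rule hom_compose'[OF P Sh_mult_hom_left[OF Pc[OF y]]])
  show "(\<lambda>x. Sh_cons \<one>\<^bsub>A\<^esub> y \<otimes>\<^bsub>Sh\<^esub> Sh_cons \<one>\<^bsub>A\<^esub> x) \<in> hom (add_monoid Sh) (add_monoid Sh)"
    by (rule hom_compose'[OF P Sh_mult_hom_right[OF Pc[OF y]]])
  show "(\<lambda>x. Sh_cons \<one>\<^bsub>A\<^esub> (x \<otimes>\<^bsub>Sh\<^esub> Sh_cons \<one>\<^bsub>A\<^esub> y \<oplus>\<^bsub>Sh\<^esub> Sh_cons \<one>\<^bsub>A\<^esub> x \<otimes>\<^bsub>Sh\<^esub> y \<oplus>\<^bsub>Sh\<^esub> lam \<odot>\<^bsub>Sh\<^esub> (x \<otimes>\<^bsub>Sh\<^esub> y)))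
      \<in> hom (add_monoid Sh) (add_monoid Sh)"
    by (rule hom_compose'[OF _ P], intro hom_add hom_smult lam_closed Sh_mult_hom_left y Pc
      hom_compose'[OF P Sh_mult_hom_left])
  show "(\<lambda>x. Sh_cons \<one>\<^bsub>A\<^esub> (y \<otimes>\<^bsub>Sh\<^esub> Sh_cons \<one>\<^bsub>A\<^esub> x \<oplus>\<^bsub>Sh\<^esub> Sh_cons \<one>\<^bsub>A\<^esub> y \<otimes>\<^bsub>Sh\<^esub> x \<oplus>\<^bsub>Sh\<^esub> lam \<odot>\<^bsub>Sh\<^esub> (y \<otimes>\<^bsub>Sh\<^esub> x)))
      \<in> hom (add_monoid Sh) (add_monoid Sh)"
    by (rule hom_compose'[OF _ P], intro hom_add hom_smult lam_closed Sh_mult_hom_right y Pc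
      hom_compose'[OF P Sh_mult_hom_right])
next
  fix u v assume uv: "u \<in> A_words" "v \<in> A_words"
  then show "Sh_cons \<one>\<^bsub>A\<^esub> (tens u) \<otimes>\<^bsub>Sh\<^esub> Sh_cons \<one>\<^bsub>A\<^esub> (tens v) =
    Sh_cons \<one>\<^bsub>A\<^esub> (tens u \<otimes>\<^bsub>Sh\<^esub> Sh_cons \<one>\<^bsub>A\<^esub> (tens v) \<oplus>\<^bsub>Sh\<^esub> Sh_cons \<one>\<^bsub>A\<^esub> (tens u) \<otimes>\<^bsub>Sh\<^esub> tens v
      \<oplus>\<^bsub>Sh\<^esub> lam \<odot>\<^bsub>Sh\<^esub> (tens u \<otimes>\<^bsub>Sh\<^esub> tens v))"
    using shuffle_Cons[OF uv, of "\<one>\<^bsub>A\<^esub>" "\<one>\<^bsub>A\<^esub>"] by (simp add: Sh_cons_tens Sh_mult_tens del: Sh_simps)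
qed (use assms Sh.M.abelian_group_axioms in auto)

text \<open>Applying the Rota-Baxter identity twice on each side reduces the claim to products in
  which \<open>P\<close> is missing from at least one of the three factors. The seven associativity
  premises are exactly these cases, one for each nonempty set of missing occurrences.\<close>

lemma Sh_Rota_Baxter_assoc_step:
  fixes x y z
  defines "P \<equiv> Sh_cons \<one>\<^bsub>A\<^esub>"
  assumes carr: "x \<in> carrier Sh" "y \<in> carrier Sh" "z \<in> carrier Sh"
    and "(x \<otimes>\<^bsub>Sh\<^esub> P y) \<otimes>\<^bsub>Sh\<^esub> P z = x \<otimes>\<^bsub>Sh\<^esub> (P y \<otimes>\<^bsub>Sh\<^esub> P z)"
    and "(P x \<otimes>\<^bsub>Sh\<^esub> y) \<otimes>\<^bsub>Sh\<^esub> P z = P x \<otimes>\<^bsub>Sh\<^esub> (y \<otimes>\<^bsub>Sh\<^esub> P z)"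
    and "(P x \<otimes>\<^bsub>Sh\<^esub> P y) \<otimes>\<^bsub>Sh\<^esub> z = P x \<otimes>\<^bsub>Sh\<^esub> (P y \<otimes>\<^bsub>Sh\<^esub> z)"
    and "(x \<otimes>\<^bsub>Sh\<^esub> y) \<otimes>\<^bsub>Sh\<^esub> P z = x \<otimes>\<^bsub>Sh\<^esub> (y \<otimes>\<^bsub>Sh\<^esub> P z)"
    and "(x \<otimes>\<^bsub>Sh\<^esub> P y) \<otimes>\<^bsub>Sh\<^esub> z = x \<otimes>\<^bsub>Sh\<^esub> (P y \<otimes>\<^bsub>Sh\<^esub> z)"
    and "(P x \<otimes>\<^bsub>Sh\<^esub> y) \<otimes>\<^bsub>Sh\<^esub> z = P x \<otimes>\<^bsub>Sh\<^esub> (y \<otimes>\<^bsub>Sh\<^esub> z)"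
    and "(x \<otimes>\<^bsub>Sh\<^esub> y) \<otimes>\<^bsub>Sh\<^esub> z = x \<otimes>\<^bsub>Sh\<^esub> (y \<otimes>\<^bsub>Sh\<^esub> z)"
  shows "(P x \<otimes>\<^bsub>Sh\<^esub> P y) \<otimes>\<^bsub>Sh\<^esub> P z = P x \<otimes>\<^bsub>Sh\<^esub> (P y \<otimes>\<^bsub>Sh\<^esub> P z)"
proof -
  have P: "P x \<in> carrier Sh" "P y \<in> carrier Sh" "P z \<in> carrier Sh"
    using Sh_cons_closed carr by (simp_all add: P_def)
  note closed = carr P Sh_mult_closed Sh.smult_closed[OF lam_closed] Sh.M.a_closed lam_closed
  note RB = Sh_cons_Rota_Baxter[folded P_def]
  have right: "u \<otimes>\<^bsub>Sh\<^esub> (lam \<odot>\<^bsub>Sh\<^esub> v) = lam \<odot>\<^bsub>Sh\<^esub> (u \<otimes>\<^bsub>Sh\<^esub> v)" if "u \<in> carrier Sh" "v \<in> carrier Sh" for u v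
    using Sh_mult_smult_left[OF lam_closed that(2,1)] that Sh.smult_closed[OF lam_closed that(2)]
      Sh_mult_commute by metis
  let ?s = "x \<otimes>\<^bsub>Sh\<^esub> P y \<oplus>\<^bsub>Sh\<^esub> P x \<otimes>\<^bsub>Sh\<^esub> y \<oplus>\<^bsub>Sh\<^esub> lam \<odot>\<^bsub>Sh\<^esub> (x \<otimes>\<^bsub>Sh\<^esub> y)"
  let ?t = "y \<otimes>\<^bsub>Sh\<^esub> P z \<oplus>\<^bsub>Sh\<^esub> P y \<otimes>\<^bsub>Sh\<^esub> z \<oplus>\<^bsub>Sh\<^esub> lam \<odot>\<^bsub>Sh\<^esub> (y \<otimes>\<^bsub>Sh\<^esub> z)"
  have s: "?s \<in> carrier Sh" "?t \<in> carrier Sh"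
    by (intro closed)+
  have "(P x \<otimes>\<^bsub>Sh\<^esub> P y) \<otimes>\<^bsub>Sh\<^esub> P z = P (?s \<otimes>\<^bsub>Sh\<^esub> P z \<oplus>\<^bsub>Sh\<^esub> (P x \<otimes>\<^bsub>Sh\<^esub> P y) \<otimes>\<^bsub>Sh\<^esub> z \<oplus>\<^bsub>Sh\<^esub> lam \<odot>\<^bsub>Sh\<^esub> (?s \<otimes>\<^bsub>Sh\<^esub> z))"
    using RB[OF s(1) carr(3)] RB[OF carr(1,2)] by simp
  also have "?s \<otimes>\<^bsub>Sh\<^esub> P z \<oplus>\<^bsub>Sh\<^esub> (P x \<otimes>\<^bsub>Sh\<^esub> P y) \<otimes>\<^bsub>Sh\<^esub> z \<oplus>\<^bsub>Sh\<^esub> lam \<odot>\<^bsub>Sh\<^esub> (?s \<otimes>\<^bsub>Sh\<^esub> z) =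
      x \<otimes>\<^bsub>Sh\<^esub> (P y \<otimes>\<^bsub>Sh\<^esub> P z) \<oplus>\<^bsub>Sh\<^esub> P x \<otimes>\<^bsub>Sh\<^esub> ?t \<oplus>\<^bsub>Sh\<^esub> lam \<odot>\<^bsub>Sh\<^esub> (x \<otimes>\<^bsub>Sh\<^esub> ?t)"
    by (simp add: closed Sh_mult_add_left Sh_mult_add_right Sh_mult_smult_left right assms(5-)
      Sh.smult_r_distr Sh.M.a_ac del: Sh_simps)
  also have "P \<dots> = P x \<otimes>\<^bsub>Sh\<^esub> (P y \<otimes>\<^bsub>Sh\<^esub> P z)"
    using RB[OF carr(1) s(2)] RB[OF carr(2,3)] by simp
  finally show ?thesis .
qed

text \<open>Each pure tensor is a letter times either the unit or the value of \<open>?P\<close> at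
  a tensor one letter shorter. The letters are moved to the front on both sides, which leaves the
  associativity of the second factors. That is trivial if one of them is the unit and follows from
  the Rota-Baxter identity otherwise.\<close>

lemma Sh_mult_assoc_tens:
  "\<lbrakk>u \<in> A_words; v \<in> A_words; w \<in> A_words\<rbrakk> \<Longrightarrow>
    (tens u \<otimes>\<^bsub>Sh\<^esub> tens v) \<otimes>\<^bsub>Sh\<^esub> tens w = tens u \<otimes>\<^bsub>Sh\<^esub> (tens v \<otimes>\<^bsub>Sh\<^esub> tens w)"
proof (induction "length u + length v + length w" arbitrary: u v w rule: less_induct)
  case less
  let ?P = "Sh_cons \<one>\<^bsub>A\<^esub>"
  have head: "\<exists>a x. a \<in> carrier A \<and> x \<in> carrier Sh \<and> tens u = tens [a] \<otimes>\<^bsub>Sh\<^esub> x \<and>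
      (x = tens [\<one>\<^bsub>A\<^esub>] \<or> (\<exists>u'\<in>A_words. length u = Suc (length u') \<and> x = ?P (tens u')))"
    if "u \<in> A_words" for u
    using that
  proof (cases rule: A_word_cases)
    case (single a)
    then show ?thesis
      using tens_closed[of "[\<one>\<^bsub>A\<^esub>]"] Sh_single_mult[of a "\<one>\<^bsub>A\<^esub>" "[]"] by auto
  next
    case (Cons a u')
    then have "?P (tens u') = tens (\<one>\<^bsub>A\<^esub> # u')" "tens (\<one>\<^bsub>A\<^esub> # u') \<in> carrier Sh"
      using tens_closed[of "\<one>\<^bsub>A\<^esub> # u'"] by (simp_all add: Sh_cons_tens)
    then show ?thesis
      using Cons Sh_single_mult[of a "\<one>\<^bsub>A\<^esub>" u']
      by (intro exI[of _ a] exI[of _ "tens (\<one>\<^bsub>A\<^esub> # u')"] conjI disjI2 bexI[of _ u']) simp_all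
  qed
  obtain a x where x: "a \<in> carrier A" "x \<in> carrier Sh" "tens u = tens [a] \<otimes>\<^bsub>Sh\<^esub> x"
    "x = tens [\<one>\<^bsub>A\<^esub>] \<or> (\<exists>u'\<in>A_words. length u = Suc (length u') \<and> x = ?P (tens u'))"
    using head[OF less(2)] by blast
  obtain b y where y: "b \<in> carrier A" "y \<in> carrier Sh" "tens v = tens [b] \<otimes>\<^bsub>Sh\<^esub> y"
    "y = tens [\<one>\<^bsub>A\<^esub>] \<or> (\<exists>v'\<in>A_words. length v = Suc (length v') \<and> y = ?P (tens v'))"
    using head[OF less(3)] by blast
  obtain c z where z: "c \<in> carrier A" "z \<in> carrier Sh" "tens w = tens [c] \<otimes>\<^bsub>Sh\<^esub> z"
    "z = tens [\<one>\<^bsub>A\<^esub>] \<or> (\<exists>w'\<in>A_words. length w = Suc (length w') \<and> z = ?P (tens w'))"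
    using head[OF less(4)] by blast
  have xyz: "(x \<otimes>\<^bsub>Sh\<^esub> y) \<otimes>\<^bsub>Sh\<^esub> z = x \<otimes>\<^bsub>Sh\<^esub> (y \<otimes>\<^bsub>Sh\<^esub> z)"
  proof (cases "x = tens [\<one>\<^bsub>A\<^esub>] \<or> y = tens [\<one>\<^bsub>A\<^esub>] \<or> z = tens [\<one>\<^bsub>A\<^esub>]")
    case True
    have "x' \<otimes>\<^bsub>Sh\<^esub> tens [\<one>\<^bsub>A\<^esub>] = x'" if "x' \<in> carrier Sh" for x'
      using Sh_one_mult[OF that] Sh_mult_commute[OF that, of "tens [\<one>\<^bsub>A\<^esub>]"] tens_closed[of "[\<one>\<^bsub>A\<^esub>]"] by simp
    then show ?thesis
      using True x(2) y(2) z(2) by (auto simp: Sh_one_mult Sh_mult_closed simp del: Sh_simps)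
  next
    case False
    then obtain u' v' w' where
      u': "u' \<in> A_words" "length u = Suc (length u')" "x = ?P (tens u')" and
      v': "v' \<in> A_words" "length v = Suc (length v')" "y = ?P (tens v')" and
      w': "w' \<in> A_words" "length w = Suc (length w')" "z = ?P (tens w')"
      using x(4) y(4) z(4) by blast
    have one: "\<one>\<^bsub>A\<^esub> # u' \<in> A_words" "\<one>\<^bsub>A\<^esub> # v' \<in> A_words" "\<one>\<^bsub>A\<^esub> # w' \<in> A_words"
      using u' v' w' by auto
    have P: "?P (tens u') = tens (\<one>\<^bsub>A\<^esub> # u')" "?P (tens v') = tens (\<one>\<^bsub>A\<^esub> # v')" "?P (tens w') = tens (\<one>\<^bsub>A\<^esub> # w')"
      using u' v' w' by (auto simp: Sh_cons_tens)
    \<comment> \<open>Since \<open>?P\<close> only prefixes the unit, each of the seven premises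
      concerns three pure tensors. At least one of them has lost its leading unit, so the total
      length is smaller and the induction hypothesis applies.\<close>
    have "(?P (tens u') \<otimes>\<^bsub>Sh\<^esub> ?P (tens v')) \<otimes>\<^bsub>Sh\<^esub> ?P (tens w') = ?P (tens u') \<otimes>\<^bsub>Sh\<^esub> (?P (tens v') \<otimes>\<^bsub>Sh\<^esub> ?P (tens w'))"
      by (rule Sh_Rota_Baxter_assoc_step; (unfold P)?)
        (use u' v' w' one tens_closed in \<open>auto intro!: less(1)\<close>)
    then show ?thesis
      using u' v' w' by simp
  qed
  have single: "tens [a] \<in> carrier Sh" "tens [b] \<in> carrier Sh" "tens [c] \<in> carrier Sh"
    using x y z tens_closed by auto
  have swap: "p \<otimes>\<^bsub>Sh\<^esub> (tens [e] \<otimes>\<^bsub>Sh\<^esub> q) = tens [e] \<otimes>\<^bsub>Sh\<^esub> (p \<otimes>\<^bsub>Sh\<^esub> q)"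
    if "p \<in> carrier Sh" "q \<in> carrier Sh" "e \<in> carrier A" for p q e
  proof -
    have "tens [e] \<in> carrier Sh"
      using that(3) tens_closed by auto
    then have "p \<otimes>\<^bsub>Sh\<^esub> (tens [e] \<otimes>\<^bsub>Sh\<^esub> q) = (tens [e] \<otimes>\<^bsub>Sh\<^esub> q) \<otimes>\<^bsub>Sh\<^esub> p"
      using that by (intro Sh_mult_commute Sh_mult_closed)
    also have "\<dots> = tens [e] \<otimes>\<^bsub>Sh\<^esub> (p \<otimes>\<^bsub>Sh\<^esub> q)"
      using that by (simp only: Sh_single_mult_assoc Sh_mult_commute[of q p])
    finally show ?thesis .
  qed
  have pair: "(tens [e] \<otimes>\<^bsub>Sh\<^esub> p) \<otimes>\<^bsub>Sh\<^esub> (tens [e'] \<otimes>\<^bsub>Sh\<^esub> q) = tens [e] \<otimes>\<^bsub>Sh\<^esub> (tens [e'] \<otimes>\<^bsub>Sh\<^esub> (p \<otimes>\<^bsub>Sh\<^esub> q))"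
    if "p \<in> carrier Sh" "q \<in> carrier Sh" "e \<in> carrier A" "e' \<in> carrier A" for p q e e'
  proof -
    have "tens [e'] \<otimes>\<^bsub>Sh\<^esub> q \<in> carrier Sh"
      using that tens_closed[of "[e']"] by (intro Sh_mult_closed) auto
    then show ?thesis
      using that Sh_single_mult_assoc swap by metis
  qed
  have yz: "tens [c] \<otimes>\<^bsub>Sh\<^esub> (y \<otimes>\<^bsub>Sh\<^esub> z) \<in> carrier Sh" and xy: "x \<otimes>\<^bsub>Sh\<^esub> y \<in> carrier Sh"
    by (intro Sh_mult_closed single x(2) y(2) z(2))+
  have yz': "y \<otimes>\<^bsub>Sh\<^esub> z \<in> carrier Sh"
    by (intro Sh_mult_closed y(2) z(2))
  have bxy: "tens [b] \<otimes>\<^bsub>Sh\<^esub> (x \<otimes>\<^bsub>Sh\<^esub> y) \<in> carrier Sh"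
    by (intro Sh_mult_closed single xy)
  have "(tens u \<otimes>\<^bsub>Sh\<^esub> tens v) \<otimes>\<^bsub>Sh\<^esub> tens w = (tens [a] \<otimes>\<^bsub>Sh\<^esub> (tens [b] \<otimes>\<^bsub>Sh\<^esub> (x \<otimes>\<^bsub>Sh\<^esub> y))) \<otimes>\<^bsub>Sh\<^esub> (tens [c] \<otimes>\<^bsub>Sh\<^esub> z)"
    unfolding x(3) y(3) z(3) using pair[OF x(2) y(2) x(1) y(1)] by simp
  also have "\<dots> = tens [a] \<otimes>\<^bsub>Sh\<^esub> (tens [c] \<otimes>\<^bsub>Sh\<^esub> ((tens [b] \<otimes>\<^bsub>Sh\<^esub> (x \<otimes>\<^bsub>Sh\<^esub> y)) \<otimes>\<^bsub>Sh\<^esub> z))"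
    by (rule pair[OF bxy z(2) x(1) z(1)])
  also have "\<dots> = tens [a] \<otimes>\<^bsub>Sh\<^esub> (tens [c] \<otimes>\<^bsub>Sh\<^esub> (tens [b] \<otimes>\<^bsub>Sh\<^esub> (x \<otimes>\<^bsub>Sh\<^esub> (y \<otimes>\<^bsub>Sh\<^esub> z))))"
    using Sh_single_mult_assoc[OF y(1) xy z(2)] xyz by simp
  also have "\<dots> = tens [a] \<otimes>\<^bsub>Sh\<^esub> (tens [b] \<otimes>\<^bsub>Sh\<^esub> (x \<otimes>\<^bsub>Sh\<^esub> (tens [c] \<otimes>\<^bsub>Sh\<^esub> (y \<otimes>\<^bsub>Sh\<^esub> z))))"
    using swap[OF x(2) yz' z(1)] swap[OF single(2) Sh_mult_closed[OF x(2) yz'] z(1)] by simp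
  also have "\<dots> = tens u \<otimes>\<^bsub>Sh\<^esub> (tens v \<otimes>\<^bsub>Sh\<^esub> tens w)"
    unfolding x(3) y(3) z(3) using pair[OF x(2) yz x(1) y(1)] pair[OF y(2) z(2) y(1) z(1)] by simp
  finally show ?case .
qed

lemma Sh_mult_assoc:
  assumes "x \<in> carrier Sh" "y \<in> carrier Sh" "z \<in> carrier Sh"
  shows "(x \<otimes>\<^bsub>Sh\<^esub> y) \<otimes>\<^bsub>Sh\<^esub> z = x \<otimes>\<^bsub>Sh\<^esub> (y \<otimes>\<^bsub>Sh\<^esub> z)"
proof (rule Sh_additive_eqI[of Sh "\<lambda>z. (x \<otimes>\<^bsub>Sh\<^esub> y) \<otimes>\<^bsub>Sh\<^esub> z" "\<lambda>z. x \<otimes>\<^bsub>Sh\<^esub> (y \<otimes>\<^bsub>Sh\<^esub> z)"])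
  show "(\<lambda>z. x \<otimes>\<^bsub>Sh\<^esub> (y \<otimes>\<^bsub>Sh\<^esub> z)) \<in> hom (add_monoid Sh) (add_monoid Sh)"
    using assms by (intro hom_compose'[OF Sh_mult_hom_right Sh_mult_hom_right])
  fix w assume w: "w \<in> A_words"
  have wc: "tens w \<in> carrier Sh"
    using w tens_closed by simp
  show "(x \<otimes>\<^bsub>Sh\<^esub> y) \<otimes>\<^bsub>Sh\<^esub> tens w = x \<otimes>\<^bsub>Sh\<^esub> (y \<otimes>\<^bsub>Sh\<^esub> tens w)"
  proof (rule Sh_biadditive_eqI[of Sh "\<lambda>x y. (x \<otimes>\<^bsub>Sh\<^esub> y) \<otimes>\<^bsub>Sh\<^esub> tens w" "\<lambda>x y. x \<otimes>\<^bsub>Sh\<^esub> (y \<otimes>\<^bsub>Sh\<^esub> tens w)"])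
    fix y assume y: "y \<in> carrier Sh"
    show "(\<lambda>x. (x \<otimes>\<^bsub>Sh\<^esub> y) \<otimes>\<^bsub>Sh\<^esub> tens w) \<in> hom (add_monoid Sh) (add_monoid Sh)"
      by (rule hom_compose'[OF Sh_mult_hom_left[OF y] Sh_mult_hom_left[OF wc]])
    show "(\<lambda>x. x \<otimes>\<^bsub>Sh\<^esub> (y \<otimes>\<^bsub>Sh\<^esub> tens w)) \<in> hom (add_monoid Sh) (add_monoid Sh)"
      by (rule Sh_mult_hom_left[OF Sh_mult_closed[OF y wc]])
    show "(\<lambda>x. (y \<otimes>\<^bsub>Sh\<^esub> x) \<otimes>\<^bsub>Sh\<^esub> tens w) \<in> hom (add_monoid Sh) (add_monoid Sh)"
      by (rule hom_compose'[OF Sh_mult_hom_right[OF y] Sh_mult_hom_left[OF wc]])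
    show "(\<lambda>x. y \<otimes>\<^bsub>Sh\<^esub> (x \<otimes>\<^bsub>Sh\<^esub> tens w)) \<in> hom (add_monoid Sh) (add_monoid Sh)"
      by (rule hom_compose'[OF Sh_mult_hom_left[OF wc] Sh_mult_hom_right[OF y]])
  qed (use assms w Sh_mult_assoc_tens Sh.M.abelian_group_axioms in auto)
qed (use assms Sh_mult_hom_right Sh_mult_closed Sh.M.abelian_group_axioms in \<open>auto simp del: Sh_simps\<close>)

sublocale Sh: algebra k Sh
proof (rule algebraI)
  have one: "\<one>\<^bsub>Sh\<^esub> \<in> carrier Sh"
    using tens_closed by simp
  show "cring Sh"
  proof (rule cringI)
    show "comm_monoid Sh"
    proof (rule comm_monoidI)
      fix x assume "x \<in> carrier Sh"
      then show "\<one>\<^bsub>Sh\<^esub> \<otimes>\<^bsub>Sh\<^esub> x = x"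
        using Sh_one_mult by simp
    qed (fact Sh_mult_closed one Sh_mult_assoc Sh_mult_commute)+
  qed (fact Sh.M.abelian_group_axioms Sh_mult_add_left)+
qed (fact R_cring Sh.smult_closed Sh.smult_l_distr Sh.smult_r_distr Sh.smult_assoc1 Sh.smult_one Sh_mult_smult_left)+

section \<open>The derivation of Sh(A)\<close>

lemma multilinear_linear_tens:
  "L \<in> linear_map k Sh N \<Longrightarrow> multilinear k A A_words N (\<lambda>w. L (tens w))"
  by (rule multilinear_linear_comp[OF tens_multilinear]) auto

lemma d_closed: "a \<in> carrier A \<Longrightarrow> d a \<in> carrier A"
  and d_add: "\<lbrakk>a \<in> carrier A; b \<in> carrier A\<rbrakk> \<Longrightarrow> d (a \<oplus>\<^bsub>A\<^esub> b) = d a \<oplus>\<^bsub>A\<^esub> d b"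
  and d_smult: "\<lbrakk>r \<in> carrier k; a \<in> carrier A\<rbrakk> \<Longrightarrow> d (r \<odot>\<^bsub>A\<^esub> a) = r \<odot>\<^bsub>A\<^esub> d a"
  using d_linear by (auto simp: linear_map_def)

lemma tens_closed': "\<lbrakk>w \<noteq> []; set w \<subseteq> carrier A\<rbrakk> \<Longrightarrow> tens w \<in> carrier Sh"
  using tens_closed by simp

lemma tens_single_closed: "a \<in> carrier A \<Longrightarrow> tens [a] \<in> carrier Sh"
  by (rule tens_closed') auto

lemma tens_head_add: "\<lbrakk>a \<in> carrier A; b \<in> carrier A; set w \<subseteq> carrier A\<rbrakk> \<Longrightarrow>
    tens ((a \<oplus>\<^bsub>A\<^esub> b) # w) = tens (a # w) \<oplus>\<^bsub>Sh\<^esub> tens (b # w)"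
  using tens_add[of "[]" a w b] by simp

lemma tens_head_smult: "\<lbrakk>r \<in> carrier k; a \<in> carrier A; set w \<subseteq> carrier A\<rbrakk> \<Longrightarrow>
    tens ((r \<odot>\<^bsub>A\<^esub> a) # w) = r \<odot>\<^bsub>Sh\<^esub> tens (a # w)"
  using tens_smult[of "[]" a w r] by simp

lemma tens_head_zero:
  assumes "set w \<subseteq> carrier A"
  shows "tens (\<zero>\<^bsub>A\<^esub> # w) = \<zero>\<^bsub>Sh\<^esub>"
proof -
  have "tens (\<zero>\<^bsub>A\<^esub> # w) = \<zero>\<^bsub>k\<^esub> \<odot>\<^bsub>Sh\<^esub> tens (\<zero>\<^bsub>A\<^esub> # w)"
    using tens_head_smult[of "\<zero>\<^bsub>k\<^esub>" "\<zero>\<^bsub>A\<^esub>" w] assms by simp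
  also have "\<dots> = \<zero>\<^bsub>Sh\<^esub>"
    using assms by (intro Sh.smult_l_null tens_closed') auto
  finally show ?thesis .
qed

lemma tens_Cons: "\<lbrakk>a \<in> carrier A; w \<in> A_words\<rbrakk> \<Longrightarrow>
    tens (a # w) = tens [a] \<otimes>\<^bsub>Sh\<^esub> Sh_cons \<one>\<^bsub>A\<^esub> (tens w)"
  using Sh_single_mult[of a "\<one>\<^bsub>A\<^esub>" w] by (simp add: Sh_cons_tens)

text \<open>The value of the derivation on \<open>a\<close> prefixed to \<open>x\<close>, written as
  a linear function of the tail. Merging \<open>a\<close> with the next letter is multiplication of
  the tail by the one-letter tensor of \<open>a\<close>, so the second letter need not be
  named.\<close>

definition d_tail where
  "d_tail a x = Sh_cons (d a) x \<oplus>\<^bsub>Sh\<^esub> tens [a] \<otimes>\<^bsub>Sh\<^esub> x \<oplus>\<^bsub>Sh\<^esub> lam \<odot>\<^bsub>Sh\<^esub> (tens [d a] \<otimes>\<^bsub>Sh\<^esub> x)"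

lemma d_word_Cons: "\<lbrakk>a \<in> carrier A; w \<in> A_words\<rbrakk> \<Longrightarrow> d_word (a # w) = d_tail a (tens w)"
  by (cases w) (simp_all add: d_tail_def Sh_cons_tens Sh_single_mult d_closed del: Sh_simps)

lemma d_tail_linear: "a \<in> carrier A \<Longrightarrow> d_tail a \<in> linear_map k Sh Sh"
  unfolding d_tail_def
  by (intro Sh.linear_map_plus Sh_cons_linear Sh.linear_map_mult_left tens_single_closed d_closed
    linear_map_comp[OF Sh.linear_map_mult_left Sh.linear_map_smult_self] lam_closed)

lemma d_tail_add:
  assumes "a \<in> carrier A" "b \<in> carrier A" "x \<in> carrier Sh"
  shows "d_tail (a \<oplus>\<^bsub>A\<^esub> b) x = d_tail a x \<oplus>\<^bsub>Sh\<^esub> d_tail b x"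
proof -
  have "Sh_cons c x \<in> carrier Sh" if "c \<in> carrier A" for c
    using that assms(3) Sh_cons_closed by simp
  then show ?thesis
    using assms tens_single_closed lam_closed
    by (simp add: d_tail_def d_add d_closed Sh_cons_add tens_head_add Sh.l_distr Sh.smult_r_distr
      Sh.M.a_ac del: Sh_simps)
qed

lemma d_tail_smult:
  assumes "r \<in> carrier k" "a \<in> carrier A" "x \<in> carrier Sh"
  shows "d_tail (r \<odot>\<^bsub>A\<^esub> a) x = r \<odot>\<^bsub>Sh\<^esub> d_tail a x"
proof -
  have "Sh_cons c x \<in> carrier Sh" if "c \<in> carrier A" for c
    using that assms(3) Sh_cons_closed by simp
  then show ?thesis
    using assms tens_single_closed lam_closed
    by (simp add: d_tail_def d_smult d_closed Sh_cons_smult tens_head_smult Sh.smult_assoc2 Sh.smult_r_distr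
      R.m_comm del: Sh_simps flip: Sh.smult_assoc1)
qed

lemma d_word_multilinear: "multilinear k A A_words Sh d_word"
  unfolding multilinear_A_words_iff
proof
  fix n show "multilinear k A (words A (Suc n)) Sh d_word"
  proof (rule multilinear_words_ConsI)
    have w: "w = [] \<or> w \<in> A_words" if "w \<in> words A m" for w m
      using that by (auto simp: words_def)
    show "d_word w \<in> carrier Sh" if word: "w \<in> words A (Suc n)" for w
    proof -
      obtain a v where w': "w = a # v" "a \<in> carrier A" "v \<in> words A n"
        using word by (cases w) (auto simp: words_def)
      show ?thesis
      proof (cases "v = []")
        case False
        then have v: "v \<in> A_words"
          using w[OF w'(3)] by blast
        then have "tens v \<in> carrier Sh"
          by (intro tens_closed') auto
        then show ?thesis
          using linear_map_closed[OF d_tail_linear[OF w'(2)]] by (simp only: w'(1) d_word_Cons[OF w'(2) v])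
      qed (simp only: w'(1) d_word.simps tens_single_closed d_closed w'(2))
    qed
    show "d_word ((a \<oplus>\<^bsub>A\<^esub> b) # v) = d_word (a # v) \<oplus>\<^bsub>Sh\<^esub> d_word (b # v)"
      if "a \<in> carrier A" "b \<in> carrier A" "v \<in> words A n" for a b v
      using w[OF that(3)] that
      by (auto simp: d_word_Cons d_tail_add tens_closed' d_add tens_head_add d_closed simp del: Sh_simps)
    show "d_word ((r \<odot>\<^bsub>A\<^esub> a) # v) = r \<odot>\<^bsub>Sh\<^esub> d_word (a # v)"
      if "r \<in> carrier k" "a \<in> carrier A" "v \<in> words A n" for r a v
      using w[OF that(3)] that
      by (auto simp: d_word_Cons d_tail_smult tens_closed' d_smult tens_head_smult d_closed simp del: Sh_simps)
    show "multilinear k A (words A n) Sh (\<lambda>w. d_word (a # w))" if a: "a \<in> carrier A" for a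
    proof (cases n)
      case 0
      then show ?thesis
        using a by (auto intro!: multilinear_words_0 tens_single_closed d_closed simp del: Sh_simps)
    next
      case (Suc m)
      have "multilinear k A (words A n) Sh (\<lambda>w. d_tail a (tens w))"
        using multilinear_linear_tens[OF d_tail_linear[OF a]] by (simp add: multilinear_A_words_iff Suc)
      then show ?thesis
        by (rule multilinear_cong) (auto simp: Suc words_def d_word_Cons a simp flip: length_greater_0_conv)
    qed
  qed
qed

lemma d_Sh_linear: "d_Sh \<in> linear_map k Sh Sh"
  and d_Sh_tens: "w \<in> A_words \<Longrightarrow> d_Sh (tens w) = d_word w"
  unfolding d_Sh_def using Sh_ext_linear[OF d_word_multilinear] by auto

lemma d_Sh_closed: "x \<in> carrier Sh \<Longrightarrow> d_Sh x \<in> carrier Sh"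
  and d_Sh_add: "\<lbrakk>x \<in> carrier Sh; y \<in> carrier Sh\<rbrakk> \<Longrightarrow> d_Sh (x \<oplus>\<^bsub>Sh\<^esub> y) = d_Sh x \<oplus>\<^bsub>Sh\<^esub> d_Sh y"
  using d_Sh_linear by (auto simp: linear_map_def simp del: Sh_simps)

lemma d_Sh_single: "a \<in> carrier A \<Longrightarrow> d_Sh (tens [a]) = tens [d a]"
  by (simp add: d_Sh_tens)

text \<open>As \<open>d\<close> kills the unit, the first and the weighted term of
  \<open>d_tail\<close> vanish, and the middle one multiplies the tail by the unit of
  \<open>Sh\<close>.\<close>

lemma d_Sh_cons_one:
  assumes "x \<in> carrier Sh"
  shows "d_Sh (Sh_cons \<one>\<^bsub>A\<^esub> x) = x"
proof (rule Sh_additive_eqI[OF _ _ hom_id _ assms, where L = "\<lambda>x. d_Sh (Sh_cons \<one>\<^bsub>A\<^esub> x)"])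
  show "(\<lambda>x. d_Sh (Sh_cons \<one>\<^bsub>A\<^esub> x)) \<in> hom (add_monoid Sh) (add_monoid Sh)"
    by (rule hom_compose'[OF linear_map_hom[OF Sh_cons_linear] linear_map_hom[OF d_Sh_linear]]) simp
  fix w assume w: "w \<in> A_words"
  then have "tens w \<in> carrier Sh"
    by (intro tens_closed') auto
  moreover have "tens (\<zero>\<^bsub>A\<^esub> # w) = \<zero>\<^bsub>Sh\<^esub>" "tens [\<zero>\<^bsub>A\<^esub>] = \<zero>\<^bsub>Sh\<^esub>"
    using w by (auto intro!: tens_head_zero simp del: Sh_simps)
  moreover have "tens [\<one>\<^bsub>A\<^esub>] \<otimes>\<^bsub>Sh\<^esub> tens w = tens w"
    using \<open>tens w \<in> carrier Sh\<close> by (rule Sh_one_mult)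
  ultimately show "d_Sh (Sh_cons \<one>\<^bsub>A\<^esub> (tens w)) = tens w"
    using w lam_closed by (simp add: Sh_cons_tens d_Sh_tens d_word_Cons d_tail_def d_one del: Sh_simps)
qed (rule Sh.M.abelian_group_axioms)

end

section \<open>The weighted Leibniz rule\<close>

text \<open>Both sides expand to the same seven terms: one for each nonempty set of factors to be
  primed, with \<open>l\<close> to the power of its size minus one.\<close>

lemma (in cring) weighted_Leibniz_assoc:
  assumes "x \<in> carrier R" "y \<in> carrier R" "z \<in> carrier R" "l \<in> carrier R"
    and "x' \<in> carrier R" "y' \<in> carrier R" "z' \<in> carrier R"
  shows "(x' \<otimes> y \<oplus> x \<otimes> y' \<oplus> l \<otimes> (x' \<otimes> y')) \<otimes> z \<oplus> (x \<otimes> y) \<otimes> z'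
      \<oplus> l \<otimes> ((x' \<otimes> y \<oplus> x \<otimes> y' \<oplus> l \<otimes> (x' \<otimes> y')) \<otimes> z')
    = x' \<otimes> (y \<otimes> z) \<oplus> x \<otimes> (y' \<otimes> z \<oplus> y \<otimes> z' \<oplus> l \<otimes> (y' \<otimes> z'))
      \<oplus> l \<otimes> (x' \<otimes> (y' \<otimes> z \<oplus> y \<otimes> z' \<oplus> l \<otimes> (y' \<otimes> z')))"
  using assms by (simp add: l_distr r_distr m_ac a_ac)

context regular_diff_algebra
begin

text \<open>Expresses the weight as an element of the ring, so that the purely ring-theoretic
  identity \<open>weighted_Leibniz_assoc\<close> applies in \<open>Sh\<close>.\<close>

definition lam_Sh where
  "lam_Sh = lam \<odot>\<^bsub>Sh\<^esub> \<one>\<^bsub>Sh\<^esub>"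

lemma lam_Sh_closed: "lam_Sh \<in> carrier Sh"
  unfolding lam_Sh_def using lam_closed by (intro Sh.smult_closed Sh.one_closed)

lemma lam_smult_eq: "x \<in> carrier Sh \<Longrightarrow> lam \<odot>\<^bsub>Sh\<^esub> x = lam_Sh \<otimes>\<^bsub>Sh\<^esub> x"
  unfolding lam_Sh_def by (rule Sh.smult_eq_mult[OF lam_closed])

definition Leibniz where
  "Leibniz x y \<longleftrightarrow> d_Sh (x \<otimes>\<^bsub>Sh\<^esub> y) = d_Sh x \<otimes>\<^bsub>Sh\<^esub> y \<oplus>\<^bsub>Sh\<^esub> x \<otimes>\<^bsub>Sh\<^esub> d_Sh y
    \<oplus>\<^bsub>Sh\<^esub> lam_Sh \<otimes>\<^bsub>Sh\<^esub> (d_Sh x \<otimes>\<^bsub>Sh\<^esub> d_Sh y)"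

text \<open>Both Leibniz rules in the equivalence compute \<open>d_Sh\<close> of the product of \<open>x\<close>, \<open>y\<close> and \<open>z\<close>.\<close>

lemma Leibniz_assoc:
  assumes "Leibniz x y" "Leibniz y z"
    and carr: "x \<in> carrier Sh" "y \<in> carrier Sh" "z \<in> carrier Sh"
  shows "Leibniz (x \<otimes>\<^bsub>Sh\<^esub> y) z \<longleftrightarrow> Leibniz x (y \<otimes>\<^bsub>Sh\<^esub> z)"
  using assms(1,2) Sh.weighted_Leibniz_assoc[OF carr lam_Sh_closed carr[THEN d_Sh_closed]]
  unfolding Leibniz_def by (simp only: Sh.m_assoc[OF carr])

lemma Leibniz_sym:
  assumes "Leibniz x y" "x \<in> carrier Sh" "y \<in> carrier Sh"
  shows "Leibniz y x"
  using assms d_Sh_closed lam_Sh_closed unfolding Leibniz_def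
  by (simp add: Sh.m_comm[of y] Sh.m_comm[of "d_Sh y"] Sh.M.a_ac del: Sh_simps)

lemma Leibniz_single_single:
  assumes "a \<in> carrier A" "b \<in> carrier A"
  shows "Leibniz (tens [a]) (tens [b])"
  using assms lam_closed
  by (simp add: Leibniz_def Sh_single_mult d_Sh_single d_mult tens_head_add tens_head_smult
    tens_single_closed d_closed flip: lam_smult_eq del: Sh_simps)

text \<open>The formula prescribed for the derivation on \<open>a # w\<close> is the Leibniz rule
  for this very product.\<close>

lemma Leibniz_single_cons:
  assumes "a \<in> carrier A" "w \<in> A_words"
  shows "Leibniz (tens [a]) (Sh_cons \<one>\<^bsub>A\<^esub> (tens w))"
proof -
  have w: "tens w \<in> carrier Sh"
    using assms by (intro tens_closed') auto
  have "tens [d a] \<otimes>\<^bsub>Sh\<^esub> Sh_cons \<one>\<^bsub>A\<^esub> (tens w) = Sh_cons (d a) (tens w)"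
    using Sh_single_mult_cons[of "d a" "\<one>\<^bsub>A\<^esub>"] assms d_closed w by simp
  then show ?thesis
    using assms w d_closed
    by (simp add: Leibniz_def d_Sh_single d_Sh_cons_one d_Sh_tens d_word_Cons d_tail_def
      tens_single_closed flip: lam_smult_eq tens_Cons del: Sh_simps)
qed

text \<open>The derivation strips the outer operator from the right side of the Rota-Baxter
  identity; what remains is the Leibniz expression, because the derivation also undoes the operator
  on each factor.\<close>

lemma Leibniz_cons_cons:
  assumes "x \<in> carrier Sh" "y \<in> carrier Sh"
  shows "Leibniz (Sh_cons \<one>\<^bsub>A\<^esub> x) (Sh_cons \<one>\<^bsub>A\<^esub> y)"
proof -
  have P: "Sh_cons \<one>\<^bsub>A\<^esub> x \<in> carrier Sh" "Sh_cons \<one>\<^bsub>A\<^esub> y \<in> carrier Sh"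
    using assms Sh_cons_closed by simp_all
  have s: "x \<otimes>\<^bsub>Sh\<^esub> Sh_cons \<one>\<^bsub>A\<^esub> y \<oplus>\<^bsub>Sh\<^esub> Sh_cons \<one>\<^bsub>A\<^esub> x \<otimes>\<^bsub>Sh\<^esub> y
      \<oplus>\<^bsub>Sh\<^esub> lam \<odot>\<^bsub>Sh\<^esub> (x \<otimes>\<^bsub>Sh\<^esub> y) \<in> carrier Sh"
    using assms P lam_closed by (intro Sh.M.a_closed Sh.m_closed Sh.smult_closed)
  show ?thesis
    unfolding Leibniz_def Sh_cons_Rota_Baxter[OF assms] d_Sh_cons_one[OF s]
      d_Sh_cons_one[OF assms(1)] d_Sh_cons_one[OF assms(2)] lam_smult_eq[OF Sh.m_closed[OF assms], symmetric] ..
qed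

lemma Leibniz_one:
  assumes "x \<in> carrier Sh"
  shows "Leibniz \<one>\<^bsub>Sh\<^esub> x" "Leibniz x \<one>\<^bsub>Sh\<^esub>"
proof -
  have "d_Sh \<one>\<^bsub>Sh\<^esub> = \<zero>\<^bsub>Sh\<^esub>"
    using d_Sh_single[of "\<one>\<^bsub>A\<^esub>"] tens_head_zero[of "[]"] d_one by simp
  then show "Leibniz \<one>\<^bsub>Sh\<^esub> x" "Leibniz x \<one>\<^bsub>Sh\<^esub>"
    using assms d_Sh_closed[OF assms] lam_Sh_closed by (simp_all add: Leibniz_def del: Sh_simps)
qed

lemma A_word_factor:
  assumes "u \<in> A_words"
  obtains a x where "a \<in> carrier A" "x \<in> carrier Sh" "tens u = tens [a] \<otimes>\<^bsub>Sh\<^esub> x"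
    "x = \<one>\<^bsub>Sh\<^esub> \<or> (\<exists>w\<in>A_words. x = Sh_cons \<one>\<^bsub>A\<^esub> (tens w))"
  using assms
proof (cases rule: A_word_cases)
  case (single a)
  then show ?thesis
    using that[of a "\<one>\<^bsub>Sh\<^esub>"] Sh.r_one[OF tens_single_closed] Sh.one_closed by simp
next
  case (Cons a w)
  then show ?thesis
    using that[of a "Sh_cons \<one>\<^bsub>A\<^esub> (tens w)"] tens_Cons[of a w] Sh_cons_closed[of "\<one>\<^bsub>A\<^esub>" "tens w"] tens_closed[of w]
    by auto
qed

text \<open>The rule is known for two letters, for a letter against an operator value and for two
  operator values. Writing the tensors as \<open>a x\<close> and \<open>b y\<close>, these cases are
  combined by regrouping: whenever two adjacent pairs satisfy the rule, it may be tested for either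
  bracketing of the triple product.\<close>

lemma Leibniz_tens:
  assumes "u \<in> A_words" "v \<in> A_words"
  shows "Leibniz (tens u) (tens v)"
proof -
  have single: "Leibniz (tens [a]) x" if "a \<in> carrier A" "x \<in> carrier Sh"
      "x = \<one>\<^bsub>Sh\<^esub> \<or> (\<exists>w\<in>A_words. x = Sh_cons \<one>\<^bsub>A\<^esub> (tens w))" for a x
    using that Leibniz_one(2)[OF tens_single_closed] Leibniz_single_cons by blast
  have tw: "tens w \<in> carrier Sh" if "w \<in> A_words" for w
    using that tens_closed by simp
  obtain a x where x: "a \<in> carrier A" "x \<in> carrier Sh" "tens u = tens [a] \<otimes>\<^bsub>Sh\<^esub> x"
    "x = \<one>\<^bsub>Sh\<^esub> \<or> (\<exists>w\<in>A_words. x = Sh_cons \<one>\<^bsub>A\<^esub> (tens w))"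
    using A_word_factor[OF assms(1)] by blast
  obtain b y where y: "b \<in> carrier A" "y \<in> carrier Sh" "tens v = tens [b] \<otimes>\<^bsub>Sh\<^esub> y"
    "y = \<one>\<^bsub>Sh\<^esub> \<or> (\<exists>w\<in>A_words. y = Sh_cons \<one>\<^bsub>A\<^esub> (tens w))"
    using A_word_factor[OF assms(2)] by blast
  have xy: "Leibniz x y"
    using x(2,4) y(2,4) Leibniz_one Leibniz_cons_cons tw by blast
  have base: "Leibniz (tens [c]) (tens w)" if c: "c \<in> carrier A" and w: "w \<in> A_words" for c w
  proof -
    obtain b y where y: "b \<in> carrier A" "y \<in> carrier Sh" "tens w = tens [b] \<otimes>\<^bsub>Sh\<^esub> y"
      "y = \<one>\<^bsub>Sh\<^esub> \<or> (\<exists>w\<in>A_words. y = Sh_cons \<one>\<^bsub>A\<^esub> (tens w))"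
      using A_word_factor[OF w] by blast
    have "Leibniz (tens [c] \<otimes>\<^bsub>Sh\<^esub> tens [b]) y"
      using c y single[of "c \<otimes>\<^bsub>A\<^esub> b" y] Sh_single_mult[of c b "[]"] by simp
    then show ?thesis
      unfolding y(3) using c y single[OF y(1,2,4)] Leibniz_single_single
      by (subst Leibniz_assoc[symmetric]) (auto intro: tens_single_closed simp del: Sh_simps)
  qed
  \<comment> \<open>Arbitrary \<open>z\<close> is required since the products to which this is
    applied, such as \<open>y\<close> times \<open>x\<close>, need not be pure tensors.\<close>
  have base': "Leibniz (tens [c]) z" if "c \<in> carrier A" "z \<in> carrier Sh" for c z
  proof -
    note c = tens_single_closed[OF that(1)] tens_single_closed[OF d_closed[OF that(1)]]
    have 1: "(\<lambda>z. d_Sh (tens [c] \<otimes>\<^bsub>Sh\<^esub> z)) \<in> hom (add_monoid Sh) (add_monoid Sh)"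
      using linear_map_hom[OF linear_map_comp[OF Sh.linear_map_mult_left[OF c(1)] d_Sh_linear]] .
    have 2: "(\<lambda>z. d_Sh (tens [c]) \<otimes>\<^bsub>Sh\<^esub> z \<oplus>\<^bsub>Sh\<^esub> tens [c] \<otimes>\<^bsub>Sh\<^esub> d_Sh z
        \<oplus>\<^bsub>Sh\<^esub> lam_Sh \<otimes>\<^bsub>Sh\<^esub> (d_Sh (tens [c]) \<otimes>\<^bsub>Sh\<^esub> d_Sh z)) \<in> hom (add_monoid Sh) (add_monoid Sh)"
      unfolding d_Sh_single[OF that(1)]
      by (rule linear_map_hom[where k = k], intro Sh.linear_map_plus Sh.linear_map_mult_left c
        linear_map_comp[OF d_Sh_linear Sh.linear_map_mult_left]
        linear_map_comp[OF linear_map_comp[OF d_Sh_linear Sh.linear_map_mult_left] Sh.linear_map_mult_left]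
        lam_Sh_closed)
    show ?thesis
      unfolding Leibniz_def
      by (rule Sh_additive_eqI[OF Sh.M.abelian_group_axioms 1 2 _ that(2)])
        (rule base[unfolded Leibniz_def, OF that(1)])
  qed
  note closed = tens_single_closed[OF x(1)] tens_single_closed[OF y(1)] x(2) y(2)
  \<comment> \<open>Regrouping of \<open>b (y x)\<close>. The symmetric form of the outcome is then
    the premise that allows \<open>a (x (b y))\<close> to be regrouped.\<close>
  have "Leibniz (tens [b] \<otimes>\<^bsub>Sh\<^esub> y) x"
    using base'[OF y(1) Sh.m_closed[OF y(2) x(2)]]
    by (simp only: Leibniz_assoc[OF base'[OF y(1,2)] Leibniz_sym[OF xy x(2) y(2)] closed(2) y(2) x(2)])
  then have "Leibniz x (tens [b] \<otimes>\<^bsub>Sh\<^esub> y)"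
    by (rule Leibniz_sym) (intro Sh.m_closed closed)+
  then have "Leibniz (tens [a] \<otimes>\<^bsub>Sh\<^esub> x) (tens [b] \<otimes>\<^bsub>Sh\<^esub> y)"
    using base'[OF x(1) Sh.m_closed[OF x(2) Sh.m_closed[OF closed(2) y(2)]]]
      Leibniz_assoc[OF base'[OF x(1,2)] _ closed(1) x(2) Sh.m_closed[OF closed(2) y(2)]] by simp
  then show ?thesis
    unfolding x(3) y(3) .
qed

lemma d_Sh_mult:
  assumes "x \<in> carrier Sh" "y \<in> carrier Sh"
  shows "d_Sh (x \<otimes>\<^bsub>Sh\<^esub> y) = d_Sh x \<otimes>\<^bsub>Sh\<^esub> y \<oplus>\<^bsub>Sh\<^esub> x \<otimes>\<^bsub>Sh\<^esub> d_Sh y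
    \<oplus>\<^bsub>Sh\<^esub> lam_Sh \<otimes>\<^bsub>Sh\<^esub> (d_Sh x \<otimes>\<^bsub>Sh\<^esub> d_Sh y)"
proof (rule Sh_biadditive_eqI[OF Sh.M.abelian_group_axioms _ _ _ _ _ assms,
    where F = "\<lambda>x y. d_Sh (x \<otimes>\<^bsub>Sh\<^esub> y)" and G = "\<lambda>x y. d_Sh x \<otimes>\<^bsub>Sh\<^esub> y \<oplus>\<^bsub>Sh\<^esub> x \<otimes>\<^bsub>Sh\<^esub> d_Sh y
    \<oplus>\<^bsub>Sh\<^esub> lam_Sh \<otimes>\<^bsub>Sh\<^esub> (d_Sh x \<otimes>\<^bsub>Sh\<^esub> d_Sh y)"])
  fix y assume y: "y \<in> carrier Sh"
  note c = y d_Sh_closed[OF y]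
  show "(\<lambda>x. d_Sh (x \<otimes>\<^bsub>Sh\<^esub> y)) \<in> hom (add_monoid Sh) (add_monoid Sh)"
    by (rule linear_map_hom[OF linear_map_comp[OF Sh.linear_map_mult_right[OF y] d_Sh_linear]])
  show "(\<lambda>x. d_Sh (y \<otimes>\<^bsub>Sh\<^esub> x)) \<in> hom (add_monoid Sh) (add_monoid Sh)"
    by (rule linear_map_hom[OF linear_map_comp[OF Sh.linear_map_mult_left[OF y] d_Sh_linear]])
  show "(\<lambda>x. d_Sh x \<otimes>\<^bsub>Sh\<^esub> y \<oplus>\<^bsub>Sh\<^esub> x \<otimes>\<^bsub>Sh\<^esub> d_Sh y
      \<oplus>\<^bsub>Sh\<^esub> lam_Sh \<otimes>\<^bsub>Sh\<^esub> (d_Sh x \<otimes>\<^bsub>Sh\<^esub> d_Sh y)) \<in> hom (add_monoid Sh) (add_monoid Sh)"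
    by (rule linear_map_hom[where k = k], intro Sh.linear_map_plus Sh.linear_map_mult_right c lam_Sh_closed
      linear_map_comp[OF d_Sh_linear Sh.linear_map_mult_right]
      linear_map_comp[OF linear_map_comp[OF d_Sh_linear Sh.linear_map_mult_right] Sh.linear_map_mult_left])
  show "(\<lambda>x. d_Sh y \<otimes>\<^bsub>Sh\<^esub> x \<oplus>\<^bsub>Sh\<^esub> y \<otimes>\<^bsub>Sh\<^esub> d_Sh x
      \<oplus>\<^bsub>Sh\<^esub> lam_Sh \<otimes>\<^bsub>Sh\<^esub> (d_Sh y \<otimes>\<^bsub>Sh\<^esub> d_Sh x)) \<in> hom (add_monoid Sh) (add_monoid Sh)"
    by (rule linear_map_hom[where k = k], intro Sh.linear_map_plus Sh.linear_map_mult_left c lam_Sh_closed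
      linear_map_comp[OF d_Sh_linear Sh.linear_map_mult_left]
      linear_map_comp[OF linear_map_comp[OF d_Sh_linear Sh.linear_map_mult_left] Sh.linear_map_mult_left])
qed (rule Leibniz_tens[unfolded Leibniz_def])

end

section \<open>The \<open>K\<close>-algebras \<open>Sh\<^sub>T(A)\<close> and \<open>A\<^sub>\<epsilon>\<close>\<close>

context regular_diff_algebra
begin

declare Sh_simps [simp del]

section \<open>The quasi-antiderivative, its kernel and the projector T\<close>

lemma Q_linear: "Q \<in> linear_map k A A"
  and d_Q_d: "a \<in> carrier A \<Longrightarrow> d (Q (d a)) = d a"
  and Q_d_Q: "a \<in> carrier A \<Longrightarrow> Q (d (Q a)) = Q a"
  using Q_quasi_inverse by (auto simp: quasi_inverse_def)

lemma Q_closed [simp]: "a \<in> carrier A \<Longrightarrow> Q a \<in> carrier A"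
  and Q_add: "\<lbrakk>a \<in> carrier A; b \<in> carrier A\<rbrakk> \<Longrightarrow> Q (a \<oplus>\<^bsub>A\<^esub> b) = Q a \<oplus>\<^bsub>A\<^esub> Q b"
  and Q_smult: "\<lbrakk>r \<in> carrier k; a \<in> carrier A\<rbrakk> \<Longrightarrow> Q (r \<odot>\<^bsub>A\<^esub> a) = r \<odot>\<^bsub>A\<^esub> Q a"
  using Q_linear by (auto simp: linear_map_def)

declare d_closed [simp]

lemma A_module: "module k A"
  by (rule module_axioms)

lemma d_zero [simp]: "d \<zero>\<^bsub>A\<^esub> = \<zero>\<^bsub>A\<^esub>"
  by (rule linear_map_zero[OF A_module A_module d_linear])

lemma d_minus: "\<lbrakk>a \<in> carrier A; b \<in> carrier A\<rbrakk> \<Longrightarrow> d (a \<ominus>\<^bsub>A\<^esub> b) = d a \<ominus>\<^bsub>A\<^esub> d b"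
  by (rule linear_map_minus[OF A_module A_module d_linear])

lemma Q_minus: "\<lbrakk>a \<in> carrier A; b \<in> carrier A\<rbrakk> \<Longrightarrow> Q (a \<ominus>\<^bsub>A\<^esub> b) = Q a \<ominus>\<^bsub>A\<^esub> Q b"
  by (rule linear_map_minus[OF A_module A_module Q_linear])

lemma (in module) linear_map_diff:
  "\<lbrakk>L \<in> linear_map R N M; L' \<in> linear_map R N M\<rbrakk> \<Longrightarrow> (\<lambda>x. L x \<ominus>\<^bsub>M\<^esub> L' x) \<in> linear_map R N M"
  unfolding a_minus_def by (intro linear_map_plus linear_map_comp[OF _ linear_map_uminus])

lemma T_linear: "T \<in> linear_map k A A"
proof -
  have "(\<lambda>a. a \<ominus>\<^bsub>A\<^esub> d (Q a)) \<in> linear_map k A A"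
    by (intro linear_map_diff linear_map_id linear_map_comp[OF Q_linear d_linear])
  then show ?thesis
    by (simp add: T_def[abs_def])
qed

lemma T_closed [simp]: "a \<in> carrier A \<Longrightarrow> T a \<in> carrier A"
  using linear_map_closed[OF T_linear] .

lemma A_T_closed: "a \<in> A_T \<Longrightarrow> a \<in> carrier A"
  and A_T_subset: "A_T \<subseteq> carrier A"
  by (auto simp: A_T_def)

lemma T_in_A_T: "a \<in> carrier A \<Longrightarrow> T a \<in> A_T"
  by (simp add: A_T_def T_def Q_minus Q_d_Q)

lemma T_A_T: "a \<in> A_T \<Longrightarrow> T a = a"
  by (auto simp: A_T_def T_def M.minus_eq)

lemma A_T_smult: "\<lbrakk>r \<in> carrier k; a \<in> A_T\<rbrakk> \<Longrightarrow> r \<odot>\<^bsub>A\<^esub> a \<in> A_T"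
  by (simp add: A_T_def Q_smult)

lemma A_T_mult: "\<lbrakk>lam \<noteq> \<zero>\<^bsub>k\<^esub>; a \<in> A_T; b \<in> A_T\<rbrakk> \<Longrightarrow> a \<otimes>\<^bsub>A\<^esub> b \<in> A_T"
  using ker_Q_subalgebra by (auto simp: A_T_def nonunital_subalgebra_def)

section \<open>Additive spans of pure tensors\<close>

text \<open>The carrier of \<open>Sh_T\<close> is the span of \<open>T_words\<close>. Spans of
  smaller families of words keep track of where the head and the tail of a product lie.\<close>

definition word_span :: "'c list set \<Rightarrow> (nat \<Rightarrow> ('c list \<Rightarrow>\<^sub>0 int) set) set"
  where "word_span W = generate Sh_group (tens ` W)"

context
  fixes W assumes W: "W \<subseteq> A_words"
begin

lemma word_span_subgroup: "subgroup (word_span W) Sh_group"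
  unfolding word_span_def by (rule Sh_group.generate_is_subgroup) (use W in auto)

lemma word_span_closed: "x \<in> word_span W \<Longrightarrow> x \<in> carrier Sh"
  using subgroup.mem_carrier[OF word_span_subgroup] by (simp add: Sh_simps)

lemma word_span_zero: "\<zero>\<^bsub>Sh\<^esub> \<in> word_span W"
  using subgroup.one_closed[OF word_span_subgroup] by (simp add: Sh_simps)

lemma word_span_add: "\<lbrakk>x \<in> word_span W; y \<in> word_span W\<rbrakk> \<Longrightarrow> x \<oplus>\<^bsub>Sh\<^esub> y \<in> word_span W"
  using subgroup.m_closed[OF word_span_subgroup] by (simp add: Sh_simps)

lemma Sh_uminus: "x \<in> carrier Sh \<Longrightarrow> inv\<^bsub>Sh_group\<^esub> x = \<ominus>\<^bsub>Sh\<^esub> x"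
  using Sh.M.l_neg[of x] Sh.M.a_inv_closed[of x]
  by (intro Sh_group.inv_equality) (simp_all add: Sh_simps)

lemma word_span_uminus: "x \<in> word_span W \<Longrightarrow> \<ominus>\<^bsub>Sh\<^esub> x \<in> word_span W"
  using subgroup.m_inv_closed[OF word_span_subgroup, of x] Sh_uminus[OF word_span_closed] by simp

lemma word_span_tens: "w \<in> W \<Longrightarrow> tens w \<in> word_span W"
  unfolding word_span_def by (auto intro: generate.incl)

lemma word_span_induct [consumes 1, case_names tens zero add uminus]:
  assumes "x \<in> word_span W" "\<And>w. w \<in> W \<Longrightarrow> P (tens w)" "P \<zero>\<^bsub>Sh\<^esub>"
    "\<And>x y. \<lbrakk>x \<in> word_span W; y \<in> word_span W; P x; P y\<rbrakk> \<Longrightarrow> P (x \<oplus>\<^bsub>Sh\<^esub> y)"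
    "\<And>x. \<lbrakk>x \<in> word_span W; P x\<rbrakk> \<Longrightarrow> P (\<ominus>\<^bsub>Sh\<^esub> x)"
  shows "P x"
  using assms(1) unfolding word_span_def
proof (induction rule: generate.induct)
  case one
  then show ?case using assms(3) by (simp add: Sh_simps)
next
  case (inv h)
  then have "h \<in> word_span W"
    using word_span_tens by auto
  then show ?case
    using assms(2,5) inv Sh_uminus word_span_closed by fastforce
next
  case (eng x y)
  then show ?case
    using assms(4)[of x y] by (simp add: Sh_simps word_span_def)
qed (use assms(2) in auto)

end

lemma word_span_linear:
  assumes "W \<subseteq> A_words" "W' \<subseteq> A_words" "L \<in> linear_map k Sh Sh" "\<And>w. w \<in> W \<Longrightarrow> L (tens w) \<in> word_span W'"
    and "x \<in> word_span W"
  shows "L x \<in> word_span W'"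
  using assms(5)
proof (induction rule: word_span_induct[OF assms(1), consumes 1, case_names tens zero add uminus])
  case (add x y)
  then show ?case
    using word_span_add[OF assms(2)] linear_map_add[OF assms(3)] word_span_closed[OF assms(1)] by simp
next
  case (uminus x)
  then show ?case
    using word_span_uminus[OF assms(2)] word_span_closed[OF assms(1)]
      additive_uminus[OF Sh.M.abelian_group_axioms Sh.M.abelian_group_axioms linear_map_hom[OF assms(3)]] by simp
qed (use assms(4) word_span_zero[OF assms(2)] linear_map_zero[OF Sh.module_axioms Sh.module_axioms assms(3)] in simp_all)

lemma Sh_T_simps [simp]:
  "monoid.mult Sh_T = monoid.mult Sh" "\<one>\<^bsub>Sh_T\<^esub> = \<one>\<^bsub>Sh\<^esub>" "\<zero>\<^bsub>Sh_T\<^esub> = \<zero>\<^bsub>Sh\<^esub>" "add Sh_T = add Sh"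
  "c \<odot>\<^bsub>Sh_T\<^esub> x = tens [c] \<otimes>\<^bsub>Sh\<^esub> x"
  by (simp_all add: Sh_T_def)

lemma Sh_T_carrier: "carrier Sh_T = word_span T_words"
  by (simp add: Sh_T_def word_span_def)

lemma T_words_subset: "T_words \<subseteq> A_words"
  using A_T_subset by (auto simp: T_words_def)

definition head_words where
  "head_words c = {c # w | w. set w \<subseteq> A_T}"

lemma head_words_subset: "c \<in> carrier A \<Longrightarrow> head_words c \<subseteq> A_words"
  using A_T_subset by (auto simp: head_words_def)

text \<open>Their span is the part of positive degree of the mixable shuffle algebra on
  \<open>A_T\<close>, viewed inside \<open>Sh\<close>; it supplies what may stand behind the first
  letter of an element of \<open>Sh_T\<close>.\<close>

definition tail_words where
  "tail_words = {w. w \<noteq> [] \<and> set w \<subseteq> A_T}"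

lemma tail_words_subset: "tail_words \<subseteq> A_words"
  using A_T_subset by (auto simp: tail_words_def)

lemma word_span_mono: "W \<subseteq> W' \<Longrightarrow> word_span W \<subseteq> word_span W'"
  unfolding word_span_def by (intro Sh_group.mono_generate image_mono)

lemma Sh_cons_tail:
  assumes "c \<in> carrier A" "x \<in> word_span tail_words"
  shows "Sh_cons c x \<in> word_span (head_words c)"
proof (rule word_span_linear[OF tail_words_subset head_words_subset[OF assms(1)] Sh_cons_linear[OF assms(1)] _ assms(2)])
  fix w assume w: "w \<in> tail_words"
  then have "c # w \<in> head_words c"
    by (auto simp: head_words_def tail_words_def)
  then show "Sh_cons c (tens w) \<in> word_span (head_words c)"
    using w tail_words_subset assms(1) word_span_tens[OF head_words_subset[OF assms(1)]]
    by (subst Sh_cons_tens) auto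
qed

lemma word_span_tail_smult:
  assumes "r \<in> carrier k" "x \<in> word_span tail_words"
  shows "r \<odot>\<^bsub>Sh\<^esub> x \<in> word_span tail_words"
proof (rule word_span_linear[OF tail_words_subset tail_words_subset Sh.linear_map_smult_self[OF assms(1)] _ assms(2)])
  fix w assume w: "w \<in> tail_words"
  then obtain a v where v: "w = a # v" "a \<in> A_T" "set v \<subseteq> A_T"
    by (cases w) (auto simp: tail_words_def)
  then have "r \<odot>\<^bsub>Sh\<^esub> tens w = tens ((r \<odot>\<^bsub>A\<^esub> a) # v)"
    using assms(1) A_T_subset by (subst tens_head_smult) auto
  moreover have "(r \<odot>\<^bsub>A\<^esub> a) # v \<in> tail_words"
    using v assms(1) A_T_smult by (auto simp: tail_words_def)
  ultimately show "r \<odot>\<^bsub>Sh\<^esub> tens w \<in> word_span tail_words"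
    using word_span_tens[OF tail_words_subset] by simp
qed

section \<open>Products of words over A_T\<close>

text \<open>The mixable shuffle product of the words \<open>u\<close> and \<open>v\<close>
  themselves, without the extra first letter from \<open>A\<close> that the product of
  \<open>Sh\<close> carries.\<close>

definition shuffle_sum where
  "shuffle_sum u v = shuffle u (\<one>\<^bsub>A\<^esub> # v) \<oplus>\<^bsub>Sh\<^esub> shuffle (\<one>\<^bsub>A\<^esub> # u) v \<oplus>\<^bsub>Sh\<^esub> lam \<odot>\<^bsub>Sh\<^esub> shuffle u v"

lemma shuffle_eq_Sh_cons:
  "\<lbrakk>u \<in> A_words; v \<in> A_words\<rbrakk> \<Longrightarrow> shuffle (a # u) (b # v) = Sh_cons (a \<otimes>\<^bsub>A\<^esub> b) (shuffle_sum u v)"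
  by (simp add: shuffle_Cons shuffle_sum_def)

text \<open>The last premise is the assertion of \<open>shuffle_sum_tail\<close>; as a premise it
  lets this lemma be used inside the induction that proves that assertion.\<close>

lemma shuffle_head_span_aux:
  assumes "a \<in> carrier A" "b \<in> carrier A" "set u \<subseteq> A_T" "set v \<subseteq> A_T"
    and "\<lbrakk>u \<in> tail_words; v \<in> tail_words\<rbrakk> \<Longrightarrow> shuffle_sum u v \<in> word_span tail_words"
  shows "shuffle (a # u) (b # v) \<in> word_span (head_words (a \<otimes>\<^bsub>A\<^esub> b))"
proof (cases "u = [] \<or> v = []")
  case True
  then have "shuffle (a # u) (b # v) = tens ((a \<otimes>\<^bsub>A\<^esub> b) # u @ v)"
    by (auto simp: shuffle_single_right)
  then show ?thesis
    using assms(1-4) word_span_tens[OF head_words_subset[of "a \<otimes>\<^bsub>A\<^esub> b"], of "(a \<otimes>\<^bsub>A\<^esub> b) # u @ v"]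
    by (auto simp: head_words_def)
next
  case False
  then have tail: "u \<in> tail_words" "v \<in> tail_words"
    using assms(3,4) by (auto simp: tail_words_def)
  then have "u \<in> A_words" "v \<in> A_words"
    using tail_words_subset by auto
  then show ?thesis
    using assms(1,2,5) tail by (simp add: shuffle_eq_Sh_cons Sh_cons_tail)
qed

text \<open>With first letters \<open>a\<close> of \<open>u\<close> and \<open>b\<close> of
  \<open>v\<close>, the three summands begin with \<open>a\<close>, \<open>b\<close> and the product
  of both. The first two letters lie in \<open>A_T\<close>. The third summand carries the factor
  \<open>lam\<close>: it vanishes for weight zero, and for nonzero weight the product lies in
  \<open>A_T\<close> since the kernel of \<open>Q\<close> is closed under multiplication.\<close>

lemma shuffle_sum_tail:
  "\<lbrakk>u \<in> tail_words; v \<in> tail_words\<rbrakk> \<Longrightarrow> shuffle_sum u v \<in> word_span tail_words"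
proof (induction "length u + length v" arbitrary: u v rule: less_induct)
  case less
  have "u \<noteq> []" "v \<noteq> []"
    using less(2,3) by (simp_all add: tail_words_def)
  then obtain a u' b v' where uv: "u = a # u'" "v = b # v'"
    by (meson neq_Nil_conv)
  have carr: "a \<in> A_T" "b \<in> A_T" "set u' \<subseteq> A_T" "set v' \<subseteq> A_T" "set u \<subseteq> A_T" "set v \<subseteq> A_T"
    using uv less(2,3) by (auto simp: tail_words_def)
  note AT = carr(1,2)[THEN A_T_closed]
  have A: "u \<in> A_words" "v \<in> A_words"
    using less(2,3) tail_words_subset by auto
  have tail: "word_span (head_words c) \<subseteq> word_span tail_words" if "c \<in> A_T" for c
    using that by (intro word_span_mono) (auto simp: head_words_def tail_words_def)
  have "shuffle u (\<one>\<^bsub>A\<^esub> # v) \<in> word_span (head_words (a \<otimes>\<^bsub>A\<^esub> \<one>\<^bsub>A\<^esub>))"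
    unfolding uv(1) by (rule shuffle_head_span_aux) (use carr AT less(1) uv in auto)
  then have 1: "shuffle u (\<one>\<^bsub>A\<^esub> # v) \<in> word_span tail_words"
    using tail[OF carr(1)] AT by auto
  have "shuffle (\<one>\<^bsub>A\<^esub> # u) v \<in> word_span (head_words (\<one>\<^bsub>A\<^esub> \<otimes>\<^bsub>A\<^esub> b))"
    unfolding uv(2) by (rule shuffle_head_span_aux) (use carr AT less(1) uv in auto)
  then have 2: "shuffle (\<one>\<^bsub>A\<^esub> # u) v \<in> word_span tail_words"
    using tail[OF carr(2)] AT by auto
  have 3: "lam \<odot>\<^bsub>Sh\<^esub> shuffle u v \<in> word_span tail_words"
  proof (cases "lam = \<zero>\<^bsub>k\<^esub>")
    case True
    then show ?thesis
      using word_span_zero[OF tail_words_subset] Sh.smult_l_null[OF shuffle_closed[OF A]] by simp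
  next
    case False
    have "shuffle u v \<in> word_span (head_words (a \<otimes>\<^bsub>A\<^esub> b))"
      unfolding uv by (rule shuffle_head_span_aux) (use carr AT less(1) uv in auto)
    then have "shuffle u v \<in> word_span tail_words"
      using tail[OF A_T_mult[OF False carr(1,2)]] by auto
    then show ?thesis
      by (rule word_span_tail_smult[OF lam_closed])
  qed
  show ?case
    unfolding shuffle_sum_def using 1 2 3 by (intro word_span_add[OF tail_words_subset])
qed

lemma shuffle_head_span:
  "\<lbrakk>a \<in> carrier A; b \<in> carrier A; set u \<subseteq> A_T; set v \<subseteq> A_T\<rbrakk> \<Longrightarrow>
    shuffle (a # u) (b # v) \<in> word_span (head_words (a \<otimes>\<^bsub>A\<^esub> b))"
  by (rule shuffle_head_span_aux) (auto intro: shuffle_sum_tail)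

lemma head_words_T_words: "c \<in> carrier A \<Longrightarrow> head_words c \<subseteq> T_words"
  by (auto simp: head_words_def T_words_def)

lemma Sh_T_mult:
  assumes "x \<in> word_span T_words" "y \<in> word_span T_words"
  shows "x \<otimes>\<^bsub>Sh\<^esub> y \<in> word_span T_words"
proof (rule word_span_linear[OF T_words_subset T_words_subset Sh.linear_map_mult_right _ assms(1)])
  show "y \<in> carrier Sh"
    using word_span_closed[OF T_words_subset assms(2)] .
  fix u assume u: "u \<in> T_words"
  then have uc: "tens u \<in> carrier Sh"
    using T_words_subset by (intro tens_closed') auto
  show "tens u \<otimes>\<^bsub>Sh\<^esub> y \<in> word_span T_words"
  proof (rule word_span_linear[OF T_words_subset T_words_subset Sh.linear_map_mult_left[OF uc] _ assms(2)])
    fix v assume v: "v \<in> T_words"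
    obtain a u' b v' where w: "u = a # u'" "v = b # v'" "a \<in> carrier A" "b \<in> carrier A" "set u' \<subseteq> A_T" "set v' \<subseteq> A_T"
      using u v by (auto simp: T_words_def)
    have "shuffle u v \<in> word_span (head_words (a \<otimes>\<^bsub>A\<^esub> b))"
      unfolding w(1,2) by (rule shuffle_head_span[OF w(3-6)])
    then have "shuffle u v \<in> word_span T_words"
      using word_span_mono[OF head_words_T_words] w(3,4) m_closed by blast
    then show "tens u \<otimes>\<^bsub>Sh\<^esub> tens v \<in> word_span T_words"
      using u v T_words_subset by (subst Sh_mult_tens) auto
  qed
qed

lemma Sh_T_single: "a \<in> carrier A \<Longrightarrow> tens [a] \<in> word_span T_words"
  by (rule word_span_tens[OF T_words_subset]) (auto simp: T_words_def)

lemma Sh_T_closed: "x \<in> carrier Sh_T \<Longrightarrow> x \<in> carrier Sh"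
  using word_span_closed[OF T_words_subset] by (simp add: Sh_T_carrier)

lemma Sh_T_one: "\<one>\<^bsub>Sh\<^esub> \<in> carrier Sh_T"
  using Sh_T_single[of "\<one>\<^bsub>A\<^esub>"] by (simp add: Sh_T_carrier Sh_simps)

lemma Sh_T_cring: "cring Sh_T"
proof (rule cringI)
  show "abelian_group Sh_T"
  proof (rule abelian_groupI)
    fix x assume x: "x \<in> carrier Sh_T"
    then have "\<ominus>\<^bsub>Sh\<^esub> x \<in> carrier Sh_T"
      using word_span_uminus[OF T_words_subset] by (simp add: Sh_T_carrier)
    then show "\<exists>y\<in>carrier Sh_T. y \<oplus>\<^bsub>Sh_T\<^esub> x = \<zero>\<^bsub>Sh_T\<^esub>"
      using Sh.M.l_neg[OF Sh_T_closed[OF x]] by auto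
  qed (simp_all add: Sh.M.a_ac Sh_T_carrier word_span_closed[OF T_words_subset]
    word_span_add[OF T_words_subset] word_span_zero[OF T_words_subset])
  show "comm_monoid Sh_T"
    by (rule comm_monoidI) (auto simp: Sh_T_one[unfolded Sh_T_carrier] Sh_T_closed Sh_T_carrier
      intro: Sh_T_mult Sh.m_assoc Sh.m_comm word_span_closed[OF T_words_subset])
  show "\<And>x y z. \<lbrakk>x \<in> carrier Sh_T; y \<in> carrier Sh_T; z \<in> carrier Sh_T\<rbrakk> \<Longrightarrow>
      (x \<oplus>\<^bsub>Sh_T\<^esub> y) \<otimes>\<^bsub>Sh_T\<^esub> z = x \<otimes>\<^bsub>Sh_T\<^esub> z \<oplus>\<^bsub>Sh_T\<^esub> y \<otimes>\<^bsub>Sh_T\<^esub> z"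
    by (simp add: Sh_T_closed Sh.l_distr)
qed

section \<open>The ring of constants, the replica and the K-algebra Sh_T(A)\<close>

lemma K_simps [simp]:
  "carrier K = {a \<in> carrier A. d a = \<zero>\<^bsub>A\<^esub>}" "monoid.mult K = monoid.mult A" "\<one>\<^bsub>K\<^esub> = \<one>\<^bsub>A\<^esub>" "\<zero>\<^bsub>K\<^esub> = \<zero>\<^bsub>A\<^esub>"
  "add K = add A"
  by (simp_all add: K_def)

lemma K_cring: "cring K"
proof (rule cringI)
  show "abelian_group K"
  proof (rule abelian_groupI)
    fix x assume "x \<in> carrier K"
    then show "\<exists>y\<in>carrier K. y \<oplus>\<^bsub>K\<^esub> x = \<zero>\<^bsub>K\<^esub>"
      using additive_uminus[OF M.abelian_group_axioms M.abelian_group_axioms linear_map_hom[OF d_linear], of x]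
      by (intro bexI[of _ "\<ominus>\<^bsub>A\<^esub> x"]) (simp_all add: M.l_neg)
  qed (auto simp: d_add M.a_ac)
  show "comm_monoid K"
    by (rule comm_monoidI) (auto simp: d_mult d_one lam_closed m_ac)
qed (simp add: l_distr)

lemma A_eps_simps [simp]:
  "carrier A_eps = Eps ` carrier A" "Eps a \<otimes>\<^bsub>A_eps\<^esub> Eps b = Eps (a \<otimes>\<^bsub>A\<^esub> b)" "\<one>\<^bsub>A_eps\<^esub> = Eps \<one>\<^bsub>A\<^esub>"
  "\<zero>\<^bsub>A_eps\<^esub> = Eps \<zero>\<^bsub>A\<^esub>" "Eps a \<oplus>\<^bsub>A_eps\<^esub> Eps b = Eps (a \<oplus>\<^bsub>A\<^esub> b)" "c \<odot>\<^bsub>A_eps\<^esub> Eps a = Eps (c \<otimes>\<^bsub>A\<^esub> a)"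
  by (simp_all add: A_eps_def)

lemma A_eps_algebra: "algebra K A_eps"
proof (rule algebraI[OF K_cring])
  show "cring A_eps"
  proof (rule cringI)
    show "abelian_group A_eps"
    proof (rule abelian_groupI)
      fix x assume "x \<in> carrier A_eps"
      then obtain a where "x = Eps a" "a \<in> carrier A"
        by auto
      then show "\<exists>y\<in>carrier A_eps. y \<oplus>\<^bsub>A_eps\<^esub> x = \<zero>\<^bsub>A_eps\<^esub>"
        by (intro bexI[of _ "Eps (\<ominus>\<^bsub>A\<^esub> a)"]) (simp_all add: M.l_neg)
    qed (auto simp: M.a_ac)
    show "comm_monoid A_eps"
      by (rule comm_monoidI) (auto simp: m_ac)
  qed (auto simp: l_distr)
qed (auto simp: l_distr r_distr m_assoc)

lemma tens_single_mult: "\<lbrakk>a \<in> carrier A; b \<in> carrier A\<rbrakk> \<Longrightarrow> tens [a \<otimes>\<^bsub>A\<^esub> b] = tens [a] \<otimes>\<^bsub>Sh\<^esub> tens [b]"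
  using Sh_single_mult[of a b "[]"] by simp

lemma tens_single_add: "\<lbrakk>a \<in> carrier A; b \<in> carrier A\<rbrakk> \<Longrightarrow> tens [a \<oplus>\<^bsub>A\<^esub> b] = tens [a] \<oplus>\<^bsub>Sh\<^esub> tens [b]"
  using tens_head_add[of a b "[]"] by simp

lemma tens_single_one: "tens [\<one>\<^bsub>A\<^esub>] = \<one>\<^bsub>Sh\<^esub>"
  by (simp add: Sh_simps)

lemma Sh_T_algebra: "algebra K Sh_T"
  by (rule algebraI[OF K_cring Sh_T_cring])
    (auto simp: Sh_T_closed tens_single_closed tens_single_add tens_single_mult tens_single_one
      Sh.l_distr Sh.r_distr Sh.m_assoc Sh_T_carrier word_span_closed[OF T_words_subset] intro!: Sh_T_mult Sh_T_single)

text \<open>The derivation merges the first two letters only, and the first letter of a word in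
  \<open>T_words\<close> may be any element of \<open>A\<close>.\<close>

lemma d_Sh_T: "x \<in> carrier Sh_T \<Longrightarrow> d_Sh x \<in> carrier Sh_T"
  unfolding Sh_T_carrier
proof (rule word_span_linear[OF T_words_subset T_words_subset d_Sh_linear])
  fix w assume w: "w \<in> T_words"
  then obtain a v where v: "w = a # v" "a \<in> carrier A" "set v \<subseteq> A_T"
    by (auto simp: T_words_def)
  note lin = word_span_tens[OF T_words_subset]
  have mem: "c # u \<in> T_words" if "c \<in> carrier A" "set u \<subseteq> A_T" for c u
    using that by (auto simp: T_words_def)
  have smult: "r \<odot>\<^bsub>Sh\<^esub> tens (c # u) \<in> word_span T_words" if "r \<in> carrier k" "c \<in> carrier A" "set u \<subseteq> A_T" for r c u
    using that A_T_subset lin[of "(r \<odot>\<^bsub>A\<^esub> c) # u"] by (subst tens_head_smult[symmetric]) (auto simp: T_words_def)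
  have "d_word w \<in> word_span T_words"
  proof (cases v)
    case Nil
    then show ?thesis
      using v Sh_T_single by simp
  next
    case (Cons b u)
    then have "b \<in> carrier A" "set u \<subseteq> A_T" "b \<in> A_T"
      using v A_T_subset by auto
    then show ?thesis
      using v Cons lam_closed
      by (auto intro!: word_span_add[OF T_words_subset] lin mem smult)
  qed
  then show "d_Sh (tens w) \<in> word_span T_words"
    using w T_words_subset by (subst d_Sh_tens) auto
qed

text \<open>By the Leibniz rule, all terms containing the derivative of the constant drop out.
  Linearity over \<open>K\<close> is what lets the derivation act on the second factor of a tensor
  product over \<open>K\<close>.\<close>

lemma d_Sh_K_linear:
  assumes "c \<in> carrier K" "x \<in> carrier Sh"
  shows "d_Sh (tens [c] \<otimes>\<^bsub>Sh\<^esub> x) = tens [c] \<otimes>\<^bsub>Sh\<^esub> d_Sh x"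
proof -
  have c: "c \<in> carrier A" "d_Sh (tens [c]) = \<zero>\<^bsub>Sh\<^esub>" "tens [c] \<in> carrier Sh"
    using assms(1) tens_head_zero[of "[]"] tens_single_closed by (auto simp: d_Sh_single)
  show ?thesis
    using d_Sh_mult[OF c(3) assms(2)] c assms(2) d_Sh_closed[OF assms(2)] lam_Sh_closed by simp
qed

end

section \<open>The tensor product of two commutative algebras\<close>

locale tensor_algebras = M: algebra K M + N: algebra K N for K (structure) and M (structure) and N (structure)
begin

sublocale tensor_modules K M N ..

abbreviation TA where "TA \<equiv> tensor_algebra K M N"
abbreviation pure where "pure \<equiv> tensor_pure K M N"

lemma TA_simps:
  "carrier TA = carrier (tensor_group K M N)" "add TA = monoid.mult (tensor_group K M N)"
  "\<zero>\<^bsub>TA\<^esub> = \<one>\<^bsub>tensor_group K M N\<^esub>" "\<one>\<^bsub>TA\<^esub> = pure \<one>\<^bsub>M\<^esub> \<one>\<^bsub>N\<^esub>"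
  by (simp_all add: tensor_algebra_def)

lemma TA_smult: "c \<odot>\<^bsub>TA\<^esub> x = tensor_ext K M N (\<lambda>m n. pure (c \<odot>\<^bsub>M\<^esub> m) n) x"
  by (simp add: tensor_algebra_def)

lemma TA_abelian_group: "abelian_group TA"
  unfolding abelian_group_iff_comm_group
  by (rule comm_group_cong[OF tensor.comm_group_axioms]) (simp_all add: TA_simps)

interpretation TA: abelian_group TA by (rule TA_abelian_group)

lemma hom_TA: "hom (tensor_group K M N) H = hom (add_monoid TA) H"
  "hom H' (tensor_group K M N) = hom H' (add_monoid TA)"
  by (simp_all add: hom_def TA_simps)

lemma pure_closed [simp]: "\<lbrakk>m \<in> carrier M; n \<in> carrier N\<rbrakk> \<Longrightarrow> pure m n \<in> carrier TA"
  by (simp add: TA_simps)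

lemma pure_add_left: "\<lbrakk>m \<in> carrier M; m' \<in> carrier M; n \<in> carrier N\<rbrakk> \<Longrightarrow>
    pure (m \<oplus>\<^bsub>M\<^esub> m') n = pure m n \<oplus>\<^bsub>TA\<^esub> pure m' n"
  by (simp add: tensor_pure_add_left TA_simps)

lemma pure_add_right: "\<lbrakk>m \<in> carrier M; n \<in> carrier N; n' \<in> carrier N\<rbrakk> \<Longrightarrow>
    pure m (n \<oplus>\<^bsub>N\<^esub> n') = pure m n \<oplus>\<^bsub>TA\<^esub> pure m n'"
  by (simp add: tensor_pure_add_right TA_simps)

lemma pure_hom_left: "n \<in> carrier N \<Longrightarrow> (\<lambda>m. pure m n) \<in> hom (add_monoid M) (add_monoid TA)"
  by (auto simp: hom_def pure_add_left)

lemma TA_additive_eqI: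
  assumes "abelian_group H" "L \<in> hom (add_monoid TA) (add_monoid H)" "L' \<in> hom (add_monoid TA) (add_monoid H)"
    and "\<And>m n. \<lbrakk>m \<in> carrier M; n \<in> carrier N\<rbrakk> \<Longrightarrow> L (pure m n) = L' (pure m n)"
    and "x \<in> carrier TA"
  shows "L x = L' x"
  by (rule tensor.hom_eqI[OF abelian_group.a_group[OF assms(1)] assms(2,3)[folded hom_TA]])
    (use assms(4,5) in \<open>auto simp: TA_simps\<close>)

lemma TA_biadditive_eqI:
  assumes "abelian_group H"
    and "\<And>y. y \<in> carrier TA \<Longrightarrow> (\<lambda>x. F x y) \<in> hom (add_monoid TA) (add_monoid H)"
    and "\<And>y. y \<in> carrier TA \<Longrightarrow> (\<lambda>x. G x y) \<in> hom (add_monoid TA) (add_monoid H)"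
    and "\<And>x. x \<in> carrier TA \<Longrightarrow> F x \<in> hom (add_monoid TA) (add_monoid H)"
    and "\<And>x. x \<in> carrier TA \<Longrightarrow> G x \<in> hom (add_monoid TA) (add_monoid H)"
    and "\<And>m n m' n'. \<lbrakk>m \<in> carrier M; n \<in> carrier N; m' \<in> carrier M; n' \<in> carrier N\<rbrakk> \<Longrightarrow>
      F (pure m n) (pure m' n') = G (pure m n) (pure m' n')"
    and "x \<in> carrier TA" "y \<in> carrier TA"
  shows "F x y = G x y"
proof (rule TA_additive_eqI[OF assms(1) assms(2)[OF assms(8)] assms(3)[OF assms(8)] _ assms(7)])
  fix m n assume "m \<in> carrier M" "n \<in> carrier N"
  then show "F (pure m n) y = G (pure m n) y"
    by (intro TA_additive_eqI[OF assms(1) assms(4)[OF pure_closed] assms(5)[OF pure_closed] assms(6) assms(8)])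
qed

lemma TA_universal:
  assumes "abelian_group H"
    and "\<And>m n. \<lbrakk>m \<in> carrier M; n \<in> carrier N\<rbrakk> \<Longrightarrow> g m n \<in> carrier H"
    and "\<And>m m' n. \<lbrakk>m \<in> carrier M; m' \<in> carrier M; n \<in> carrier N\<rbrakk> \<Longrightarrow> g (m \<oplus>\<^bsub>M\<^esub> m') n = g m n \<oplus>\<^bsub>H\<^esub> g m' n"
    and "\<And>m n n'. \<lbrakk>m \<in> carrier M; n \<in> carrier N; n' \<in> carrier N\<rbrakk> \<Longrightarrow> g m (n \<oplus>\<^bsub>N\<^esub> n') = g m n \<oplus>\<^bsub>H\<^esub> g m n'"
    and "\<And>c m n. \<lbrakk>c \<in> carrier K; m \<in> carrier M; n \<in> carrier N\<rbrakk> \<Longrightarrow> g (c \<odot>\<^bsub>M\<^esub> m) n = g m (c \<odot>\<^bsub>N\<^esub> n)"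
  obtains L where "L \<in> hom (add_monoid TA) (add_monoid H)"
    "\<And>m n. \<lbrakk>m \<in> carrier M; n \<in> carrier N\<rbrakk> \<Longrightarrow> L (pure m n) = g m n"
proof -
  have "\<exists>h\<in>hom (tensor_group K M N) (add_monoid H). \<forall>(m, n)\<in>carrier M \<times> carrier N. h (pure m n) = g m n"
    by (rule tensor_universal) (use assms in \<open>simp_all add: abelian_group_iff_comm_group\<close>)
  then show ?thesis
    using that by (auto simp: hom_TA)
qed

lemma tensor_ext_eq:
  assumes "L \<in> hom (add_monoid TA) (add_monoid TA)"
    "\<And>m n. \<lbrakk>m \<in> carrier M; n \<in> carrier N\<rbrakk> \<Longrightarrow> L (pure m n) = g m n" and "x \<in> carrier TA"
  shows "tensor_ext K M N g x = L x"
proof -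
  have "L \<in> hom (tensor_group K M N) (tensor_group K M N)"
    using assms(1) by (simp add: hom_TA)
  then show ?thesis
    unfolding tensor_ext_def using tensor.hom_ext_eq[OF tensor.is_group, of L "case_prod g"] assms(2,3)
    by (auto simp: TA_simps)
qed

lemma TA_ext_exists:
  assumes "f \<in> linear_map K M M" "h \<in> linear_map K N N"
  obtains L where "L \<in> hom (add_monoid TA) (add_monoid TA)"
    "\<And>m n. \<lbrakk>m \<in> carrier M; n \<in> carrier N\<rbrakk> \<Longrightarrow> L (pure m n) = pure (f m) (h n)"
  using TA_universal[OF TA_abelian_group, of "\<lambda>m n. pure (f m) (h n)"] assms
  by (auto simp: linear_map_def Pi_iff pure_add_left pure_add_right tensor_pure_balanced)

lemma TA_mult_left_exists:
  assumes "m' \<in> carrier M" "n' \<in> carrier N"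
  shows "\<exists>h\<in>hom (tensor_group K M N) (tensor_group K M N). \<forall>s\<in>carrier M \<times> carrier N.
    h (case_prod pure s) = (\<lambda>(m, n) (m', n'). pure (m \<otimes>\<^bsub>M\<^esub> m') (n \<otimes>\<^bsub>N\<^esub> n')) s (m', n')"
proof -
  obtain L where "L \<in> hom (add_monoid TA) (add_monoid TA)"
    "\<And>m n. \<lbrakk>m \<in> carrier M; n \<in> carrier N\<rbrakk> \<Longrightarrow> L (pure m n) = pure (m \<otimes>\<^bsub>M\<^esub> m') (n \<otimes>\<^bsub>N\<^esub> n')"
    using TA_ext_exists[OF M.linear_map_mult_right[OF assms(1)] N.linear_map_mult_right[OF assms(2)]] by blast
  then show ?thesis
    by (intro bexI[of _ L]) (auto simp: hom_TA)
qed

lemma TA_mult_right_exists: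
  assumes "m \<in> carrier M" "n \<in> carrier N"
  shows "\<exists>h\<in>hom (tensor_group K M N) (tensor_group K M N). \<forall>t\<in>carrier M \<times> carrier N.
    h (case_prod pure t) = (\<lambda>(m, n) (m', n'). pure (m \<otimes>\<^bsub>M\<^esub> m') (n \<otimes>\<^bsub>N\<^esub> n')) (m, n) t"
proof -
  obtain L where "L \<in> hom (add_monoid TA) (add_monoid TA)"
    "\<And>m' n'. \<lbrakk>m' \<in> carrier M; n' \<in> carrier N\<rbrakk> \<Longrightarrow> L (pure m' n') = pure (m \<otimes>\<^bsub>M\<^esub> m') (n \<otimes>\<^bsub>N\<^esub> n')"
    using TA_ext_exists[OF M.linear_map_mult_left[OF assms(1)] N.linear_map_mult_left[OF assms(2)]] by blast
  then show ?thesis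
    by (intro bexI[of _ L]) (auto simp: hom_TA)
qed

lemma TA_mult_eq: "monoid.mult TA = biadd_ext (tensor_group K M N) (carrier M \<times> carrier N) (case_prod pure)
    (\<lambda>(m, n) (m', n'). pure (m \<otimes>\<^bsub>M\<^esub> m') (n \<otimes>\<^bsub>N\<^esub> n'))"
  by (simp add: tensor_algebra_def)

lemma TA_mult_hom_left: "y \<in> carrier TA \<Longrightarrow> (\<lambda>x. x \<otimes>\<^bsub>TA\<^esub> y) \<in> hom (add_monoid TA) (add_monoid TA)"
  unfolding TA_mult_eq hom_TA(1)[symmetric] hom_TA(2)[symmetric]
  by (rule tensor.biadd_ext_hom_left) (use TA_mult_left_exists TA_mult_right_exists in \<open>auto simp: TA_simps(1)\<close>)

lemma TA_mult_hom_right: "x \<in> carrier TA \<Longrightarrow> (\<lambda>y. x \<otimes>\<^bsub>TA\<^esub> y) \<in> hom (add_monoid TA) (add_monoid TA)"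
  unfolding TA_mult_eq hom_TA(1)[symmetric] hom_TA(2)[symmetric]
  by (rule tensor.biadd_ext_hom_right) (use TA_mult_left_exists TA_mult_right_exists in \<open>auto simp: TA_simps(1)\<close>)

lemma pure_mult: "\<lbrakk>m \<in> carrier M; n \<in> carrier N; m' \<in> carrier M; n' \<in> carrier N\<rbrakk> \<Longrightarrow>
    pure m n \<otimes>\<^bsub>TA\<^esub> pure m' n' = pure (m \<otimes>\<^bsub>M\<^esub> m') (n \<otimes>\<^bsub>N\<^esub> n')"
  unfolding TA_mult_eq
  using tensor.biadd_ext_generators[of "\<lambda>(m, n) (m', n'). pure (m \<otimes>\<^bsub>M\<^esub> m') (n \<otimes>\<^bsub>N\<^esub> n')" "(m, n)" "(m', n')"]
    TA_mult_left_exists TA_mult_right_exists by auto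

lemma TA_mult_closed: "\<lbrakk>x \<in> carrier TA; y \<in> carrier TA\<rbrakk> \<Longrightarrow> x \<otimes>\<^bsub>TA\<^esub> y \<in> carrier TA"
  using TA_mult_hom_left by (fastforce simp: hom_def)

lemma TA_mult_commute:
  assumes "x \<in> carrier TA" "y \<in> carrier TA"
  shows "x \<otimes>\<^bsub>TA\<^esub> y = y \<otimes>\<^bsub>TA\<^esub> x"
proof (rule TA_biadditive_eqI[where F = "\<lambda>x y. x \<otimes>\<^bsub>TA\<^esub> y" and G = "\<lambda>x y. y \<otimes>\<^bsub>TA\<^esub> x",
      OF TA_abelian_group TA_mult_hom_left TA_mult_hom_right TA_mult_hom_right TA_mult_hom_left _ assms])
  fix m n m' n' assume "m \<in> carrier M" "n \<in> carrier N" "m' \<in> carrier M" "n' \<in> carrier N"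
  then show "pure m n \<otimes>\<^bsub>TA\<^esub> pure m' n' = pure m' n' \<otimes>\<^bsub>TA\<^esub> pure m n"
    using M.m_comm[of m m'] N.m_comm[of n n'] by (simp only: pure_mult)
qed

lemma TA_mult_assoc:
  assumes "x \<in> carrier TA" "y \<in> carrier TA" "z \<in> carrier TA"
  shows "(x \<otimes>\<^bsub>TA\<^esub> y) \<otimes>\<^bsub>TA\<^esub> z = x \<otimes>\<^bsub>TA\<^esub> (y \<otimes>\<^bsub>TA\<^esub> z)"
proof (rule TA_additive_eqI[where L = "\<lambda>z. (x \<otimes>\<^bsub>TA\<^esub> y) \<otimes>\<^bsub>TA\<^esub> z" and L' = "\<lambda>z. x \<otimes>\<^bsub>TA\<^esub> (y \<otimes>\<^bsub>TA\<^esub> z)",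
    OF TA_abelian_group TA_mult_hom_right[OF TA_mult_closed[OF assms(1,2)]]
      hom_compose'[OF TA_mult_hom_right[OF assms(2)] TA_mult_hom_right[OF assms(1)]] _ assms(3)])
  fix m n assume mn: "m \<in> carrier M" "n \<in> carrier N"
  note p = pure_closed[OF mn]
  show "(x \<otimes>\<^bsub>TA\<^esub> y) \<otimes>\<^bsub>TA\<^esub> pure m n = x \<otimes>\<^bsub>TA\<^esub> (y \<otimes>\<^bsub>TA\<^esub> pure m n)"
    by (rule TA_biadditive_eqI[where F = "\<lambda>x y. (x \<otimes>\<^bsub>TA\<^esub> y) \<otimes>\<^bsub>TA\<^esub> pure m n"
          and G = "\<lambda>x y. x \<otimes>\<^bsub>TA\<^esub> (y \<otimes>\<^bsub>TA\<^esub> pure m n)", OF TA_abelian_group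
        hom_compose'[OF TA_mult_hom_left TA_mult_hom_left[OF p]] TA_mult_hom_left[OF TA_mult_closed[OF _ p]]
        hom_compose'[OF TA_mult_hom_right TA_mult_hom_left[OF p]]
        hom_compose'[OF TA_mult_hom_left[OF p] TA_mult_hom_right] _ assms(1,2)])
      (use mn in \<open>auto simp: pure_mult M.m_assoc N.m_assoc\<close>)
qed

lemma TA_smult_props:
  assumes "c \<in> carrier K"
  shows TA_smult_hom: "(\<lambda>x. c \<odot>\<^bsub>TA\<^esub> x) \<in> hom (add_monoid TA) (add_monoid TA)"
    and TA_smult_pure: "\<And>m n. \<lbrakk>m \<in> carrier M; n \<in> carrier N\<rbrakk> \<Longrightarrow> c \<odot>\<^bsub>TA\<^esub> pure m n = pure (c \<odot>\<^bsub>M\<^esub> m) n"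
proof -
  obtain L where L: "L \<in> hom (add_monoid TA) (add_monoid TA)"
    "\<And>m n. \<lbrakk>m \<in> carrier M; n \<in> carrier N\<rbrakk> \<Longrightarrow> L (pure m n) = pure (c \<odot>\<^bsub>M\<^esub> m) n"
    using TA_ext_exists[OF M.linear_map_smult_self[OF assms] linear_map_id] by blast
  have *: "c \<odot>\<^bsub>TA\<^esub> x = L x" if "x \<in> carrier TA" for x
    unfolding TA_smult by (rule tensor_ext_eq[OF L that])
  show "(\<lambda>x. c \<odot>\<^bsub>TA\<^esub> x) \<in> hom (add_monoid TA) (add_monoid TA)"
    using L(1) TA.a_closed by (simp add: hom_def Pi_iff *)
  show "\<And>m n. \<lbrakk>m \<in> carrier M; n \<in> carrier N\<rbrakk> \<Longrightarrow> c \<odot>\<^bsub>TA\<^esub> pure m n = pure (c \<odot>\<^bsub>M\<^esub> m) n"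
    using L(2) * by simp
qed

lemma TA_hom_add: "\<lbrakk>f \<in> hom G (add_monoid TA); g \<in> hom G (add_monoid TA)\<rbrakk> \<Longrightarrow>
    (\<lambda>x. f x \<oplus>\<^bsub>TA\<^esub> g x) \<in> hom G (add_monoid TA)"
  using hom_comp_mult[OF TA.a_comm_group, of f G g] by simp

lemma tensor_algebra_algebra: "algebra K TA"
proof (rule algebraI)
  show "cring K" by (rule M.R_cring)
  show "cring TA"
  proof (rule cringI[OF TA_abelian_group])
    show "comm_monoid TA"
    proof (rule comm_monoidI)
      show one: "\<one>\<^bsub>TA\<^esub> \<in> carrier TA"
        by (simp add: TA_simps(4))
      fix x assume x: "x \<in> carrier TA"
      show "\<one>\<^bsub>TA\<^esub> \<otimes>\<^bsub>TA\<^esub> x = x"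
        by (rule TA_additive_eqI[OF TA_abelian_group TA_mult_hom_right[OF one] hom_id _ x])
          (simp add: TA_simps(4) pure_mult)
    qed (fact TA_mult_closed TA_mult_assoc TA_mult_commute)+
    show "(x \<oplus>\<^bsub>TA\<^esub> y) \<otimes>\<^bsub>TA\<^esub> z = x \<otimes>\<^bsub>TA\<^esub> z \<oplus>\<^bsub>TA\<^esub> y \<otimes>\<^bsub>TA\<^esub> z"
      if "x \<in> carrier TA" "y \<in> carrier TA" "z \<in> carrier TA" for x y z
      using TA_mult_hom_left[OF that(3)] that by (simp add: hom_def)
  qed
next
  fix c x assume "c \<in> carrier K" "x \<in> carrier TA"
  then show "c \<odot>\<^bsub>TA\<^esub> x \<in> carrier TA"
    using TA_smult_hom by (fastforce simp: hom_def)
next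
  fix c x y assume "c \<in> carrier K" "x \<in> carrier TA" "y \<in> carrier TA"
  then show "c \<odot>\<^bsub>TA\<^esub> (x \<oplus>\<^bsub>TA\<^esub> y) = c \<odot>\<^bsub>TA\<^esub> x \<oplus>\<^bsub>TA\<^esub> c \<odot>\<^bsub>TA\<^esub> y"
    using TA_smult_hom by (fastforce simp: hom_def)
next
  fix a b x assume ab: "a \<in> carrier K" "b \<in> carrier K" and x: "x \<in> carrier TA"
  show "(a \<oplus>\<^bsub>K\<^esub> b) \<odot>\<^bsub>TA\<^esub> x = a \<odot>\<^bsub>TA\<^esub> x \<oplus>\<^bsub>TA\<^esub> b \<odot>\<^bsub>TA\<^esub> x"
    by (rule TA_additive_eqI[OF TA_abelian_group TA_smult_hom TA_hom_add[OF TA_smult_hom TA_smult_hom] _ x])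
      (use ab in \<open>simp_all add: TA_smult_pure M.smult_l_distr pure_add_left\<close>)
  show "(a \<otimes>\<^bsub>K\<^esub> b) \<odot>\<^bsub>TA\<^esub> x = a \<odot>\<^bsub>TA\<^esub> (b \<odot>\<^bsub>TA\<^esub> x)"
    by (rule TA_additive_eqI[OF TA_abelian_group TA_smult_hom hom_compose'[OF TA_smult_hom TA_smult_hom] _ x])
      (use ab in \<open>simp_all add: TA_smult_pure M.smult_assoc1\<close>)
next
  fix x assume x: "x \<in> carrier TA"
  show "\<one>\<^bsub>K\<^esub> \<odot>\<^bsub>TA\<^esub> x = x"
    by (rule TA_additive_eqI[OF TA_abelian_group TA_smult_hom hom_id _ x]) (simp_all add: TA_smult_pure)
next
  fix c x y assume c: "c \<in> carrier K" and xy: "x \<in> carrier TA" "y \<in> carrier TA"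
  show "(c \<odot>\<^bsub>TA\<^esub> x) \<otimes>\<^bsub>TA\<^esub> y = c \<odot>\<^bsub>TA\<^esub> (x \<otimes>\<^bsub>TA\<^esub> y)"
  proof (rule TA_biadditive_eqI[where F = "\<lambda>x y. (c \<odot>\<^bsub>TA\<^esub> x) \<otimes>\<^bsub>TA\<^esub> y" and G = "\<lambda>x y. c \<odot>\<^bsub>TA\<^esub> (x \<otimes>\<^bsub>TA\<^esub> y)",
      OF TA_abelian_group hom_compose'[OF TA_smult_hom[OF c] TA_mult_hom_left]
        hom_compose'[OF TA_mult_hom_left TA_smult_hom[OF c]] TA_mult_hom_right
        hom_compose'[OF TA_mult_hom_right TA_smult_hom[OF c]] _ xy])
    show "c \<odot>\<^bsub>TA\<^esub> x \<in> carrier TA" if "x \<in> carrier TA" for x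
      using TA_smult_hom[OF c] that by (auto simp: hom_def)
  qed (use c in \<open>simp_all add: TA_smult_pure pure_mult M.smult_assoc2\<close>)
qed

text \<open>With zero derivation on the first factor, the first and the weighted term of the tensor
  product derivation vanish, which leaves the identity tensored with \<open>dN\<close>.\<close>

lemma tensor_derivation_zero_left:
  assumes "mu \<in> carrier K" "dN \<in> linear_map K N N"
  defines "D \<equiv> tensor_derivation K M N mu (\<lambda>_. \<zero>\<^bsub>M\<^esub>) dN"
  shows tensor_derivation_hom: "D \<in> hom (add_monoid TA) (add_monoid TA)"
    and tensor_derivation_pure: "\<And>m n. \<lbrakk>m \<in> carrier M; n \<in> carrier N\<rbrakk> \<Longrightarrow> D (pure m n) = pure m (dN n)"
proof -
  interpret A: algebra K TA by (rule tensor_algebra_algebra)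
  obtain L where L: "L \<in> hom (add_monoid TA) (add_monoid TA)"
    "\<And>m n. \<lbrakk>m \<in> carrier M; n \<in> carrier N\<rbrakk> \<Longrightarrow> L (pure m n) = pure m (dN n)"
    using TA_ext_exists[OF linear_map_id assms(2)] by blast
  have zero: "pure \<zero>\<^bsub>M\<^esub> n = \<zero>\<^bsub>TA\<^esub>" if "n \<in> carrier N" for n
    using additive_zero[OF _ TA_abelian_group pure_hom_left[OF that]] M.M.abelian_group_axioms by simp
  have *: "D x = L x" if "x \<in> carrier TA" for x
    unfolding D_def tensor_derivation_def
    by (rule tensor_ext_eq[OF L(1) _ that])
      (use linear_map_closed[OF assms(2)] assms(1) in \<open>simp add: L(2) zero\<close>)
  show "D \<in> hom (add_monoid TA) (add_monoid TA)"
    using L(1) TA.a_closed by (simp add: hom_def Pi_iff *)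
  show "\<And>m n. \<lbrakk>m \<in> carrier M; n \<in> carrier N\<rbrakk> \<Longrightarrow> D (pure m n) = pure m (dN n)"
    using L(2) * by simp
qed

text \<open>On pure tensors the weight acts on the first factor by definition of the scalar action;
  balance moves it to the second factor, where the Leibniz rule of \<open>dN\<close> has it.\<close>

lemma tensor_derivation_mult:
  assumes mu: "mu \<in> carrier K" and dN: "dN \<in> linear_map K N N"
    and Leibniz: "\<And>x y. \<lbrakk>x \<in> carrier N; y \<in> carrier N\<rbrakk> \<Longrightarrow> dN (x \<otimes>\<^bsub>N\<^esub> y) =
      dN x \<otimes>\<^bsub>N\<^esub> y \<oplus>\<^bsub>N\<^esub> x \<otimes>\<^bsub>N\<^esub> dN y \<oplus>\<^bsub>N\<^esub> mu \<odot>\<^bsub>N\<^esub> (dN x \<otimes>\<^bsub>N\<^esub> dN y)"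
    and xy: "x \<in> carrier TA" "y \<in> carrier TA"
  defines "D \<equiv> tensor_derivation K M N mu (\<lambda>_. \<zero>\<^bsub>M\<^esub>) dN"
  shows "D (x \<otimes>\<^bsub>TA\<^esub> y) = D x \<otimes>\<^bsub>TA\<^esub> y \<oplus>\<^bsub>TA\<^esub> x \<otimes>\<^bsub>TA\<^esub> D y \<oplus>\<^bsub>TA\<^esub> mu \<odot>\<^bsub>TA\<^esub> (D x \<otimes>\<^bsub>TA\<^esub> D y)"
proof -
  interpret A: algebra K TA by (rule tensor_algebra_algebra)
  note D = tensor_derivation_zero_left[OF mu dN, folded D_def]
  have Dc: "D x \<in> carrier TA" if "x \<in> carrier TA" for x
    using D(1) that by (auto simp: hom_def)
  show ?thesis
  proof (rule TA_biadditive_eqI[where F = "\<lambda>x y. D (x \<otimes>\<^bsub>TA\<^esub> y)" and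
      G = "\<lambda>x y. D x \<otimes>\<^bsub>TA\<^esub> y \<oplus>\<^bsub>TA\<^esub> x \<otimes>\<^bsub>TA\<^esub> D y \<oplus>\<^bsub>TA\<^esub> mu \<odot>\<^bsub>TA\<^esub> (D x \<otimes>\<^bsub>TA\<^esub> D y)",
      OF TA_abelian_group hom_compose'[OF TA_mult_hom_left D(1)] _ hom_compose'[OF TA_mult_hom_right D(1)] _ _ xy])
    fix y assume y: "y \<in> carrier TA"
    show "(\<lambda>x. D x \<otimes>\<^bsub>TA\<^esub> y \<oplus>\<^bsub>TA\<^esub> x \<otimes>\<^bsub>TA\<^esub> D y \<oplus>\<^bsub>TA\<^esub> mu \<odot>\<^bsub>TA\<^esub> (D x \<otimes>\<^bsub>TA\<^esub> D y)) \<in> hom (add_monoid TA) (add_monoid TA)"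
      by (rule TA_hom_add[OF TA_hom_add[OF hom_compose'[OF D(1) TA_mult_hom_left[OF y]] TA_mult_hom_left[OF Dc[OF y]]]
        hom_compose'[OF hom_compose'[OF D(1) TA_mult_hom_left[OF Dc[OF y]]] TA_smult_hom[OF mu]]])
    show "(\<lambda>x. D y \<otimes>\<^bsub>TA\<^esub> x \<oplus>\<^bsub>TA\<^esub> y \<otimes>\<^bsub>TA\<^esub> D x \<oplus>\<^bsub>TA\<^esub> mu \<odot>\<^bsub>TA\<^esub> (D y \<otimes>\<^bsub>TA\<^esub> D x)) \<in> hom (add_monoid TA) (add_monoid TA)"
      by (rule TA_hom_add[OF TA_hom_add[OF TA_mult_hom_right[OF Dc[OF y]] hom_compose'[OF D(1) TA_mult_hom_right[OF y]]]
        hom_compose'[OF hom_compose'[OF D(1) TA_mult_hom_right[OF Dc[OF y]]] TA_smult_hom[OF mu]]])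
  next
    fix m n m' n' assume *: "m \<in> carrier M" "n \<in> carrier N" "m' \<in> carrier M" "n' \<in> carrier N"
    then show "D (pure m n \<otimes>\<^bsub>TA\<^esub> pure m' n') = D (pure m n) \<otimes>\<^bsub>TA\<^esub> pure m' n' \<oplus>\<^bsub>TA\<^esub> pure m n \<otimes>\<^bsub>TA\<^esub> D (pure m' n')
        \<oplus>\<^bsub>TA\<^esub> mu \<odot>\<^bsub>TA\<^esub> (D (pure m n) \<otimes>\<^bsub>TA\<^esub> D (pure m' n'))"
      using mu linear_map_closed[OF dN]
      by (simp add: pure_mult D(2) Leibniz pure_add_right TA_smult_pure tensor_pure_balanced)
  qed
qed

end

section \<open>The algebra \<open>ID(A)\<^sup>*\<close>\<close>

lemma restrict_scalars_simps [simp]: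
  "carrier (restrict_scalars phi M) = carrier M" "monoid.mult (restrict_scalars phi M) = monoid.mult M"
  "\<one>\<^bsub>restrict_scalars phi M\<^esub> = \<one>\<^bsub>M\<^esub>" "\<zero>\<^bsub>restrict_scalars phi M\<^esub> = \<zero>\<^bsub>M\<^esub>"
  "add (restrict_scalars phi M) = add M" "r \<odot>\<^bsub>restrict_scalars phi M\<^esub> x = phi r \<odot>\<^bsub>M\<^esub> x"
  by (simp_all add: restrict_scalars_def)

lemma restrict_scalars_algebra:
  assumes "algebra K M" "cring k" "phi \<in> ring_hom k K"
  shows "algebra k (restrict_scalars phi M)"
proof -
  interpret M: algebra K M by fact
  note phi = ring_hom_closed[OF assms(3)] ring_hom_add[OF assms(3)] ring_hom_mult[OF assms(3)] ring_hom_one[OF assms(3)]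
  show ?thesis
  proof (rule algebraI[OF assms(2)])
    show "cring (restrict_scalars phi M)"
    proof (rule cringI)
      show "abelian_group (restrict_scalars phi M)"
        by (rule abelian_groupI) (use M.M.l_neg M.M.a_inv_closed in \<open>auto simp: M.M.a_ac\<close>)
      show "comm_monoid (restrict_scalars phi M)"
        using M.M_cring by (intro comm_monoidI) (auto simp: M.m_assoc intro: M.m_comm)
    qed (simp add: M.l_distr)
  qed (simp_all add: phi M.smult_l_distr M.smult_r_distr M.smult_assoc1 M.smult_assoc2)
qed

context regular_diff_algebra
begin

sublocale TT: tensor_algebras K A_eps Sh_T
  by (intro tensor_algebras.intro A_eps_algebra Sh_T_algebra)

definition emb where
  "emb x = tensor_pure K A_eps Sh_T (Eps \<one>\<^bsub>A\<^esub>) x"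

lemma incl_eq: "incl w = emb (tens w)"
  by (simp add: incl_def emb_def)

lemma eps_eq: "eps a = tensor_pure K A_eps Sh_T (Eps a) \<one>\<^bsub>Sh\<^esub>"
  by (simp add: eps_def)

lemma ID_simps:
  "carrier ID = carrier TT.TA" "monoid.mult ID = monoid.mult TT.TA" "\<one>\<^bsub>ID\<^esub> = \<one>\<^bsub>TT.TA\<^esub>"
  "\<zero>\<^bsub>ID\<^esub> = \<zero>\<^bsub>TT.TA\<^esub>" "add ID = add TT.TA" "r \<odot>\<^bsub>ID\<^esub> x = (r \<odot>\<^bsub>A\<^esub> \<one>\<^bsub>A\<^esub>) \<odot>\<^bsub>TT.TA\<^esub> x"
  by (simp_all add: ID_def)

text \<open>\<open>d\<close> is linear over \<open>k\<close> and kills the unit. Hence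
  \<open>k\<close> acts on \<open>ID\<close> through \<open>K\<close>, and the weight is a scalar
  that the tensor product derivation can use.\<close>

lemma scalar_K: "r \<in> carrier k \<Longrightarrow> r \<odot>\<^bsub>A\<^esub> \<one>\<^bsub>A\<^esub> \<in> carrier K"
  by (simp add: d_smult d_one)

sublocale ID: algebra k ID
proof -
  have "(\<lambda>r. r \<odot>\<^bsub>A\<^esub> \<one>\<^bsub>A\<^esub>) \<in> ring_hom k K"
    by (rule ring_hom_memI) (simp_all add: d_smult d_one smult_l_distr smult_assoc1 smult_assoc2)
  then show "algebra k ID"
    unfolding ID_def by (rule restrict_scalars_algebra[OF TT.tensor_algebra_algebra R_cring])
qed

lemma hom_ID: "hom (add_monoid ID) H = hom (add_monoid TT.TA) H" "hom H' (add_monoid ID) = hom H' (add_monoid TT.TA)"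
  by (simp_all add: hom_def ID_simps)

lemma emb_closed: "x \<in> carrier Sh_T \<Longrightarrow> emb x \<in> carrier ID"
  by (simp add: emb_def ID_simps TT.pure_closed)

lemma eps_closed: "a \<in> carrier A \<Longrightarrow> eps a \<in> carrier ID"
  using Sh_T_one by (simp add: eps_eq ID_simps TT.pure_closed)

lemma pure_eq: "\<lbrakk>a \<in> carrier A; x \<in> carrier Sh_T\<rbrakk> \<Longrightarrow> tensor_pure K A_eps Sh_T (Eps a) x = eps a \<otimes>\<^bsub>ID\<^esub> emb x"
  using Sh_T_one Sh_T_closed by (simp add: eps_eq emb_def ID_simps TT.pure_mult)

lemma emb_add: "\<lbrakk>x \<in> carrier Sh_T; y \<in> carrier Sh_T\<rbrakk> \<Longrightarrow> emb (x \<oplus>\<^bsub>Sh\<^esub> y) = emb x \<oplus>\<^bsub>ID\<^esub> emb y"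
  using TT.pure_add_right[of "Eps \<one>\<^bsub>A\<^esub>" x y] by (simp add: emb_def ID_simps)

lemma emb_hom: "emb \<in> hom (add_monoid Sh_T) (add_monoid ID)"
  by (auto simp: hom_def emb_closed emb_add)

lemma emb_mult: "\<lbrakk>x \<in> carrier Sh_T; y \<in> carrier Sh_T\<rbrakk> \<Longrightarrow> emb (x \<otimes>\<^bsub>Sh\<^esub> y) = emb x \<otimes>\<^bsub>ID\<^esub> emb y"
  using TT.pure_mult[of "Eps \<one>\<^bsub>A\<^esub>" x "Eps \<one>\<^bsub>A\<^esub>" y] by (simp add: emb_def ID_simps)

lemma eps_add: "\<lbrakk>a \<in> carrier A; b \<in> carrier A\<rbrakk> \<Longrightarrow> eps (a \<oplus>\<^bsub>A\<^esub> b) = eps a \<oplus>\<^bsub>ID\<^esub> eps b"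
  using TT.pure_add_left[of "Eps a" "Eps b" "\<one>\<^bsub>Sh\<^esub>"] Sh_T_one by (simp add: eps_eq ID_simps)

lemma eps_mult: "\<lbrakk>a \<in> carrier A; b \<in> carrier A\<rbrakk> \<Longrightarrow> eps (a \<otimes>\<^bsub>A\<^esub> b) = eps a \<otimes>\<^bsub>ID\<^esub> eps b"
  using TT.pure_mult[of "Eps a" "\<one>\<^bsub>Sh\<^esub>" "Eps b" "\<one>\<^bsub>Sh\<^esub>"] Sh_T_one by (simp add: eps_eq ID_simps)

lemma eps_one: "eps \<one>\<^bsub>A\<^esub> = \<one>\<^bsub>ID\<^esub>" and emb_one: "emb \<one>\<^bsub>Sh\<^esub> = \<one>\<^bsub>ID\<^esub>"
  by (simp_all add: eps_eq emb_def ID_simps TT.TA_simps)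

lemma emb_zero: "emb \<zero>\<^bsub>Sh\<^esub> = \<zero>\<^bsub>ID\<^esub>"
  using additive_zero[OF _ ID.M.abelian_group_axioms emb_hom] TT.N.M.abelian_group_axioms by simp

lemma emb_uminus:
  assumes "x \<in> carrier Sh_T"
  shows "emb (\<ominus>\<^bsub>Sh\<^esub> x) = \<ominus>\<^bsub>ID\<^esub> emb x"
proof -
  have x: "\<ominus>\<^bsub>Sh\<^esub> x \<in> carrier Sh_T"
    using assms word_span_uminus[OF T_words_subset] by (simp add: Sh_T_carrier)
  have "emb (\<ominus>\<^bsub>Sh\<^esub> x) \<oplus>\<^bsub>ID\<^esub> emb x = \<zero>\<^bsub>ID\<^esub>"
    using emb_add[OF x assms] Sh_T_closed[OF assms] by (simp add: Sh.M.l_neg emb_zero)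
  then show ?thesis
    using ID.M.minus_equality[of "emb (\<ominus>\<^bsub>Sh\<^esub> x)" "emb x"] emb_closed x assms by simp
qed

text \<open>The balance relation of the tensor product over \<open>K\<close>, applied to the unit:
  it identifies the constants of the replica with the constants of \<open>A\<close>.\<close>

lemma eps_K: "c \<in> carrier K \<Longrightarrow> eps c = emb (tens [c])"
  using TT.tensor_pure_balanced[of c "Eps \<one>\<^bsub>A\<^esub>" "\<one>\<^bsub>Sh\<^esub>"] Sh_T_one
  by (simp add: eps_eq emb_def tens_single_closed)

text \<open>Scalars act through the replica, so an additive map that is linear over the replica is
  automatically linear over \<open>k\<close>. Linearity of \<open>d_ID\<close> and
  \<open>Pi_ID\<close> is obtained in this way.\<close>

lemma ID_smult: "\<lbrakk>r \<in> carrier k; x \<in> carrier ID\<rbrakk> \<Longrightarrow> r \<odot>\<^bsub>ID\<^esub> x = eps (r \<odot>\<^bsub>A\<^esub> \<one>\<^bsub>A\<^esub>) \<otimes>\<^bsub>ID\<^esub> x"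
proof -
  assume r: "r \<in> carrier k" and x: "x \<in> carrier ID"
  have "r \<odot>\<^bsub>ID\<^esub> \<one>\<^bsub>ID\<^esub> = eps (r \<odot>\<^bsub>A\<^esub> \<one>\<^bsub>A\<^esub>)"
    using TT.TA_smult_pure[of "r \<odot>\<^bsub>A\<^esub> \<one>\<^bsub>A\<^esub>" "Eps \<one>\<^bsub>A\<^esub>" "\<one>\<^bsub>Sh\<^esub>"] scalar_K[OF r] Sh_T_one r
    by (simp add: ID_simps eps_eq TT.TA_simps(4))
  then show ?thesis
    using ID.smult_eq_mult[OF r x] by simp
qed

lemma Sh_smult_single: "\<lbrakk>r \<in> carrier k; x \<in> carrier Sh\<rbrakk> \<Longrightarrow> r \<odot>\<^bsub>Sh\<^esub> x = tens [r \<odot>\<^bsub>A\<^esub> \<one>\<^bsub>A\<^esub>] \<otimes>\<^bsub>Sh\<^esub> x"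
  using Sh.smult_eq_mult[of r x] tens_head_smult[of r "\<one>\<^bsub>A\<^esub>" "[]"] by (simp add: tens_single_one)

lemma Sh_T_smult: "\<lbrakk>r \<in> carrier k; x \<in> carrier Sh_T\<rbrakk> \<Longrightarrow> r \<odot>\<^bsub>Sh\<^esub> x \<in> carrier Sh_T"
  using Sh_smult_single Sh_T_mult Sh_T_single Sh_T_closed by (simp add: Sh_T_carrier)

lemma emb_smult:
  assumes "r \<in> carrier k" "x \<in> carrier Sh_T"
  shows "emb (r \<odot>\<^bsub>Sh\<^esub> x) = r \<odot>\<^bsub>ID\<^esub> emb x"
proof -
  have "tens [r \<odot>\<^bsub>A\<^esub> \<one>\<^bsub>A\<^esub>] \<in> carrier Sh_T"
    using Sh_T_single assms(1) by (simp add: Sh_T_carrier)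
  then show ?thesis
    using assms Sh_T_closed[OF assms(2)]
    by (simp add: Sh_smult_single emb_mult ID_smult emb_closed eps_K scalar_K del: K_simps)
qed

text \<open>Pure tensors of the replica with \<open>Sh_T\<close> generate \<open>ID\<close>, the
  second factors are sums and differences of pure tensors of words in \<open>T_words\<close>, and a
  pure tensor is the product of its two embedded factors.\<close>

lemma ID_additive_eqI:
  assumes "abelian_group H" "L \<in> hom (add_monoid ID) (add_monoid H)" "L' \<in> hom (add_monoid ID) (add_monoid H)"
    and "\<And>a w. \<lbrakk>a \<in> carrier A; w \<in> T_words\<rbrakk> \<Longrightarrow> L (eps a \<otimes>\<^bsub>ID\<^esub> incl w) = L' (eps a \<otimes>\<^bsub>ID\<^esub> incl w)"
    and "x \<in> carrier ID"
  shows "L x = L' x"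
proof (rule TT.TA_additive_eqI[OF assms(1) assms(2,3)[unfolded hom_ID]])
  show "x \<in> carrier TT.TA"
    using assms(5) by (simp add: ID_simps)
  fix m n assume m: "m \<in> carrier A_eps" and n: "n \<in> carrier Sh_T"
  then obtain a where a: "a \<in> carrier A" "m = Eps a"
    by auto
  interpret H: abelian_group H by fact
  have hom: "(\<lambda>n. L'' (eps a \<otimes>\<^bsub>ID\<^esub> emb n)) \<in> hom (add_monoid Sh_T) (add_monoid H)"
    if "L'' \<in> hom (add_monoid ID) (add_monoid H)" for L''
    by (rule hom_compose'[OF hom_compose'[OF emb_hom linear_map_hom[OF ID.linear_map_mult_left]] that])
      (rule eps_closed[OF a(1)])
  note homs = hom[OF assms(2)] hom[OF assms(3)]
  have "L (eps a \<otimes>\<^bsub>ID\<^esub> emb n) = L' (eps a \<otimes>\<^bsub>ID\<^esub> emb n)"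
    using n[unfolded Sh_T_carrier]
  proof (induction rule: word_span_induct[OF T_words_subset, consumes 1, case_names tens zero add uminus])
    case (tens w)
    then show ?case
      using assms(4) a(1) by (simp add: incl_eq)
  next
    case zero
    show ?case
      using homs[THEN additive_zero[OF TT.N.M.abelian_group_axioms assms(1)]] by simp
  next
    case (add x y)
    then show ?case
      using homs[THEN hom_mult, of x y] by (simp add: Sh_T_carrier)
  next
    case (uminus x)
    have "\<ominus>\<^bsub>Sh_T\<^esub> x = \<ominus>\<^bsub>Sh\<^esub> x"
      using uminus(1) word_span_uminus[OF T_words_subset] word_span_closed[OF T_words_subset]
      by (intro TT.N.M.minus_equality) (simp_all add: Sh_T_carrier Sh.M.l_neg)
    then show ?case
      using homs[THEN additive_uminus[OF TT.N.M.abelian_group_axioms assms(1)], of x] uminus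
      by (simp add: Sh_T_carrier)
  qed
  then show "L (tensor_pure K A_eps Sh_T m n) = L' (tensor_pure K A_eps Sh_T m n)"
    using a n by (simp add: pure_eq)
qed

lemma incl_closed: "w \<in> T_words \<Longrightarrow> incl w \<in> carrier ID"
  using word_span_tens[OF T_words_subset] by (simp add: incl_eq emb_closed Sh_T_carrier)

section \<open>The derivation of ID(A)\<close>

lemma d_Sh_T_linear: "d_Sh \<in> linear_map K Sh_T Sh_T"
  unfolding linear_map_def
  using d_Sh_T d_Sh_add[OF Sh_T_closed Sh_T_closed] d_Sh_K_linear[OF _ Sh_T_closed] by simp

lemma lam_Sh_eq: "lam_Sh = tens [lam \<odot>\<^bsub>A\<^esub> \<one>\<^bsub>A\<^esub>]"
  using tens_head_smult[of lam "\<one>\<^bsub>A\<^esub>" "[]"] lam_closed by (simp add: lam_Sh_def tens_single_one)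

lemma d_ID_hom: "d_ID \<in> hom (add_monoid ID) (add_monoid ID)"
  using TT.tensor_derivation_hom[OF scalar_K[OF lam_closed] d_Sh_T_linear] by (simp add: d_ID_def hom_ID)

lemma d_ID_closed: "x \<in> carrier ID \<Longrightarrow> d_ID x \<in> carrier ID"
  and d_ID_add: "\<lbrakk>x \<in> carrier ID; y \<in> carrier ID\<rbrakk> \<Longrightarrow> d_ID (x \<oplus>\<^bsub>ID\<^esub> y) = d_ID x \<oplus>\<^bsub>ID\<^esub> d_ID y"
  using d_ID_hom by (auto simp: hom_def)

lemma d_ID_minus: "\<lbrakk>x \<in> carrier ID; y \<in> carrier ID\<rbrakk> \<Longrightarrow> d_ID (x \<ominus>\<^bsub>ID\<^esub> y) = d_ID x \<ominus>\<^bsub>ID\<^esub> d_ID y"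
  using additive_minus[OF ID.M.abelian_group_axioms ID.M.abelian_group_axioms d_ID_hom] .

lemma d_ID_emb: "x \<in> carrier Sh_T \<Longrightarrow> d_ID (emb x) = emb (d_Sh x)"
  using TT.tensor_derivation_pure[OF scalar_K[OF lam_closed] d_Sh_T_linear, of "Eps \<one>\<^bsub>A\<^esub>" x]
  by (simp add: d_ID_def emb_def)

lemma d_ID_eps:
  assumes "a \<in> carrier A"
  shows "d_ID (eps a) = \<zero>\<^bsub>ID\<^esub>"
proof -
  have "d_Sh \<one>\<^bsub>Sh\<^esub> = \<zero>\<^bsub>Sh\<^esub>"
    using d_Sh_single[of "\<one>\<^bsub>A\<^esub>"] tens_head_zero[of "[]"] d_one by (simp add: tens_single_one)
  then have "d_ID (eps a) = eps a \<otimes>\<^bsub>ID\<^esub> emb \<zero>\<^bsub>Sh\<^esub>"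
    using TT.tensor_derivation_pure[OF scalar_K[OF lam_closed] d_Sh_T_linear, of "Eps a" "\<one>\<^bsub>Sh\<^esub>"] assms Sh_T_one
      pure_eq[OF assms, of "\<zero>\<^bsub>Sh\<^esub>"] word_span_zero[OF T_words_subset]
    by (simp add: d_ID_def eps_eq Sh_T_carrier)
  then show ?thesis
    using assms eps_closed by (simp add: emb_zero)
qed

lemma d_ID_mult:
  assumes "x \<in> carrier ID" "y \<in> carrier ID"
  shows "d_ID (x \<otimes>\<^bsub>ID\<^esub> y) = d_ID x \<otimes>\<^bsub>ID\<^esub> y \<oplus>\<^bsub>ID\<^esub> x \<otimes>\<^bsub>ID\<^esub> d_ID y \<oplus>\<^bsub>ID\<^esub> lam \<odot>\<^bsub>ID\<^esub> (d_ID x \<otimes>\<^bsub>ID\<^esub> d_ID y)"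
  unfolding d_ID_def ID_simps A_eps_simps(4)[symmetric]
proof (rule TT.tensor_derivation_mult[OF scalar_K[OF lam_closed] d_Sh_T_linear])
  fix x y assume "x \<in> carrier Sh_T" "y \<in> carrier Sh_T"
  then show "d_Sh (x \<otimes>\<^bsub>Sh_T\<^esub> y) = d_Sh x \<otimes>\<^bsub>Sh_T\<^esub> y \<oplus>\<^bsub>Sh_T\<^esub> x \<otimes>\<^bsub>Sh_T\<^esub> d_Sh y
      \<oplus>\<^bsub>Sh_T\<^esub> (lam \<odot>\<^bsub>A\<^esub> \<one>\<^bsub>A\<^esub>) \<odot>\<^bsub>Sh_T\<^esub> (d_Sh x \<otimes>\<^bsub>Sh_T\<^esub> d_Sh y)"
    using d_Sh_mult[OF Sh_T_closed Sh_T_closed] by (simp add: lam_Sh_eq)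
qed (use assms in \<open>simp_all add: ID_simps\<close>)

lemma d_ID_eps_mult:
  assumes "a \<in> carrier A" "x \<in> carrier ID"
  shows "d_ID (eps a \<otimes>\<^bsub>ID\<^esub> x) = eps a \<otimes>\<^bsub>ID\<^esub> d_ID x"
  using d_ID_mult[OF eps_closed[OF assms(1)] assms(2)] assms d_ID_closed[OF assms(2)] eps_closed lam_closed
  by (simp add: d_ID_eps)

lemma d_ID_linear: "d_ID \<in> linear_map k ID ID"
  using d_ID_hom ID.smult_closed
  by (auto simp: linear_map_def hom_def ID_smult d_ID_closed d_ID_eps_mult)

lemma ID_diff_algebra: "comm_diff_algebra k ID lam d_ID"
proof (intro comm_diff_algebra.intro ID.algebra_axioms comm_diff_algebra_axioms.intro)
  show "d_ID \<one>\<^bsub>ID\<^esub> = \<zero>\<^bsub>ID\<^esub>"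
    using d_ID_eps[of "\<one>\<^bsub>A\<^esub>"] by (simp add: eps_one)
qed (fact lam_closed d_ID_linear d_ID_mult)+

text \<open>The hypothesis covers every first letter \<open>c\<close>, because the recursion for
  \<open>Pi_word\<close> replaces the two leading letters \<open>a\<close> and \<open>b\<close> by a
  product of \<open>b\<close> with \<open>Q a\<close> or with \<open>d (Q a)\<close>.\<close>

lemma T_words_induct [consumes 1, case_names single Cons]:
  assumes "w \<in> T_words" and "\<And>a. a \<in> carrier A \<Longrightarrow> P [a]"
    and "\<And>a b w. \<lbrakk>a \<in> carrier A; b \<in> A_T; set w \<subseteq> A_T; \<And>c. c \<in> carrier A \<Longrightarrow> P (c # w)\<rbrakk> \<Longrightarrow> P (a # b # w)"
  shows "P w"
proof -
  obtain a v where w: "w = a # v" "a \<in> carrier A" "set v \<subseteq> A_T"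
    using assms(1) by (auto simp: T_words_def)
  have "P (a # v)"
    using w(2,3) by (induction v arbitrary: a) (use assms(2,3) in auto)
  then show ?thesis
    by (simp add: w(1))
qed

lemma T_words_ConsI: "\<lbrakk>a \<in> carrier A; set w \<subseteq> A_T\<rbrakk> \<Longrightarrow> a # w \<in> T_words"
  by (auto simp: T_words_def)

lemma Pi_word_closed: "w \<in> T_words \<Longrightarrow> Pi_word w \<in> carrier ID"
proof (induction rule: T_words_induct)
  case (single a)
  then show ?case
    using T_in_A_T by (auto simp: T_words_ConsI intro!: incl_closed eps_closed ID.M.a_closed ID.M.minus_closed)
next
  case (Cons a b w)
  then show ?case
    using T_in_A_T[OF Cons(1)] A_T_closed[OF Cons(2)] lam_closed
    by (auto simp: T_words_ConsI intro!: incl_closed ID.M.a_closed ID.M.minus_closed ID.smult_closed)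
qed

end

section \<open>The operator \<open>\<Pi>\<^sub>A\<close>\<close>

context regular_diff_algebra
begin

text \<open>\<open>emb\<close> is additive and compatible with scalars on \<open>Sh_T\<close> only,
  so the values of \<open>g\<close> must lie there.\<close>

lemma multilinear_emb:
  assumes "multilinear k A S Sh g" "\<And>w. w \<in> S \<Longrightarrow> g w \<in> carrier Sh_T"
    and "\<And>u a v b. \<lbrakk>u @ a # v \<in> S; b \<in> carrier A\<rbrakk> \<Longrightarrow> u @ b # v \<in> S"
  shows "multilinear k A S ID (\<lambda>w. emb (g w))"
  unfolding multilinear_def
proof (intro conjI allI impI)
  show "(\<lambda>w. emb (g w)) \<in> S \<rightarrow> carrier ID"
    using assms(2) emb_closed by auto
next
  fix u v a b assume w: "u @ a # v \<in> S" "b \<in> carrier A"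
  then show "emb (g (u @ (a \<oplus>\<^bsub>A\<^esub> b) # v)) = emb (g (u @ a # v)) \<oplus>\<^bsub>ID\<^esub> emb (g (u @ b # v))"
    using assms(2)[OF w(1)] assms(2)[OF assms(3)[OF w]] by (simp add: multilinear_add[OF assms(1) w] emb_add)
next
  fix u v r a assume w: "u @ a # v \<in> S" "r \<in> carrier k"
  then show "emb (g (u @ (r \<odot>\<^bsub>A\<^esub> a) # v)) = r \<odot>\<^bsub>ID\<^esub> emb (g (u @ a # v))"
    using assms(2)[OF w(1)] by (simp add: multilinear_smult[OF assms(1) w] emb_smult)
qed

lemma map_T_A_T: "set w \<subseteq> carrier A \<Longrightarrow> set (map T w) \<subseteq> A_T"
  using T_in_A_T by auto

lemma tens_Cons_map_T_multilinear:
  assumes "c \<in> carrier A" "n > 0"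
  shows "multilinear k A (words A n) Sh (\<lambda>w. tens (c # map T w))"
proof -
  have "multilinear k A (words A n) Sh (\<lambda>w. tens (c # w))"
    using Sh_cons_multilinear[OF assms(1)] assms(2) unfolding multilinear_A_words_iff
    by (metis gr0_implies_Suc)
  then show ?thesis
    by (rule multilinear_map[OF _ T_linear])
qed

text \<open>Projecting the variable letters puts the word into \<open>T_words\<close>. The fixed
  prefix serves the two explicit terms of the recursion, in which the word is preceded by one or by
  two letters.\<close>

lemma incl_Cons_map_T_multilinear:
  assumes "set u \<subseteq> A_T" "c \<in> carrier A" "n > 0"
  shows "multilinear k A (words A n) ID (\<lambda>w. incl (c # u @ map T w))"
proof -
  have "multilinear k A (words A n) Sh (\<lambda>w. tens (u' @ map T w))" if "set u' \<subseteq> carrier A" "u' \<noteq> []" for u'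
    using that
  proof (induction u')
    case (Cons a u')
    show ?case
    proof (cases "u' = []")
      case True
      then show ?thesis
        using tens_Cons_map_T_multilinear[of a] assms(3) Cons(2) by simp
    next
      case False
      have "multilinear k A (words A n) Sh (\<lambda>w. Sh_cons a (tens (u' @ map T w)))"
        by (rule multilinear_linear_comp[OF Cons(1) Sh_cons_linear words_replace]) (use Cons(2) False in auto)
      then show ?thesis
      proof (rule multilinear_cong)
        fix w assume "w \<in> words A n"
        then have "set (map T w) \<subseteq> carrier A"
          using map_T_A_T[of w] A_T_subset unfolding words_def by blast
        then have "u' @ map T w \<in> A_words"
          using Cons(2) False by (simp del: set_map)
        then show "Sh_cons a (tens (u' @ map T w)) = tens ((a # u') @ map T w)"
          using Cons(2) by (simp add: Sh_cons_tens del: set_map)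
      qed
    qed
  qed simp
  from this[of "c # u"] have "multilinear k A (words A n) Sh (\<lambda>w. tens (c # u @ map T w))"
    using assms A_T_subset by auto
  moreover have "tens (c # u @ map T w) \<in> carrier Sh_T" if "w \<in> words A n" for w
    using that assms T_in_A_T unfolding Sh_T_carrier words_def
    by (intro word_span_tens[OF T_words_subset] T_words_ConsI) auto
  ultimately show ?thesis
    unfolding incl_eq by (rule multilinear_emb[OF _ _ words_replace])
qed

text \<open>
  Applying the projector \<open>T\<close> to all letters but the first extends the recursion for \<open>Pi_word\<close> to
  arbitrary words over \<open>A\<close>.  The result is \<open>k\<close>-multilinear, so it factors through \<open>Sh\<close>, and no
  universal property of the submodule \<open>Sh_T\<close> is needed.
\<close>

definition Pi_T where
  "Pi_T w = Pi_word (hd w # map T (tl w))"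

lemma Pi_T_single: "Pi_T [a] = incl [Q a] \<ominus>\<^bsub>ID\<^esub> eps (Q a) \<oplus>\<^bsub>ID\<^esub> incl [\<one>\<^bsub>A\<^esub>, T a]"
  by (simp add: Pi_T_def)

text \<open>The second letter is projected before it is multiplied into the head. The new head is
  not projected again, in agreement with the unrestricted first letter of the words in
  \<open>T_words\<close>.\<close>

lemma Pi_T_Cons:
  "w \<noteq> [] \<Longrightarrow> Pi_T (a # w) = incl (Q a # map T w)
    \<ominus>\<^bsub>ID\<^esub> Pi_T ((Q a \<otimes>\<^bsub>A\<^esub> T (hd w)) # tl w)
    \<ominus>\<^bsub>ID\<^esub> lam \<odot>\<^bsub>ID\<^esub> Pi_T ((d (Q a) \<otimes>\<^bsub>A\<^esub> T (hd w)) # tl w)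
    \<oplus>\<^bsub>ID\<^esub> incl (\<one>\<^bsub>A\<^esub> # T a # map T w)"
  by (cases w) (simp_all add: Pi_T_def)

lemma Pi_T_eq: "w \<in> T_words \<Longrightarrow> Pi_T w = Pi_word w"
proof -
  assume "w \<in> T_words"
  then obtain a v where w: "w = a # v" "set v \<subseteq> A_T"
    by (auto simp: T_words_def)
  then have "map T v = v"
    by (intro map_idI) (auto simp: T_A_T)
  then show ?thesis
    by (simp add: Pi_T_def w(1))
qed

lemma Pi_T_closed: "w \<in> A_words \<Longrightarrow> Pi_T w \<in> carrier ID"
  unfolding Pi_T_def using map_T_A_T by (cases w) (auto intro!: Pi_word_closed T_words_ConsI T_in_A_T)

lemma ID_minus_minus_plus:
  assumes "p \<in> carrier ID" "q \<in> carrier ID" "r \<in> carrier ID" "s \<in> carrier ID"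
    "p' \<in> carrier ID" "q' \<in> carrier ID" "r' \<in> carrier ID" "s' \<in> carrier ID"
  shows "(p \<oplus>\<^bsub>ID\<^esub> p') \<ominus>\<^bsub>ID\<^esub> (q \<oplus>\<^bsub>ID\<^esub> q') \<ominus>\<^bsub>ID\<^esub> (r \<oplus>\<^bsub>ID\<^esub> r') \<oplus>\<^bsub>ID\<^esub> (s \<oplus>\<^bsub>ID\<^esub> s') =
    (p \<ominus>\<^bsub>ID\<^esub> q \<ominus>\<^bsub>ID\<^esub> r \<oplus>\<^bsub>ID\<^esub> s) \<oplus>\<^bsub>ID\<^esub> (p' \<ominus>\<^bsub>ID\<^esub> q' \<ominus>\<^bsub>ID\<^esub> r' \<oplus>\<^bsub>ID\<^esub> s')"
  using assms by (simp add: ID.M.minus_eq ID.M.minus_add ID.M.a_ac)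

lemma incl_single_add:
  "\<lbrakk>a \<in> carrier A; b \<in> carrier A; set w \<subseteq> A_T\<rbrakk> \<Longrightarrow> incl ((a \<oplus>\<^bsub>A\<^esub> b) # w) = incl (a # w) \<oplus>\<^bsub>ID\<^esub> incl (b # w)"
  using A_T_subset word_span_tens[OF T_words_subset T_words_ConsI]
  by (auto simp: incl_eq tens_head_add emb_add Sh_T_carrier)

lemma incl_single_smult:
  "\<lbrakk>r \<in> carrier k; a \<in> carrier A; set w \<subseteq> A_T\<rbrakk> \<Longrightarrow> incl ((r \<odot>\<^bsub>A\<^esub> a) # w) = r \<odot>\<^bsub>ID\<^esub> incl (a # w)"
  using A_T_subset word_span_tens[OF T_words_subset T_words_ConsI]
  by (auto simp: incl_eq tens_head_smult emb_smult Sh_T_carrier)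

lemma incl_one_add:
  assumes "a \<in> A_T" "b \<in> A_T" "set w \<subseteq> A_T"
  shows "incl (\<one>\<^bsub>A\<^esub> # (a \<oplus>\<^bsub>A\<^esub> b) # w) = incl (\<one>\<^bsub>A\<^esub> # a # w) \<oplus>\<^bsub>ID\<^esub> incl (\<one>\<^bsub>A\<^esub> # b # w)"
proof -
  have "tens ([\<one>\<^bsub>A\<^esub>] @ (a \<oplus>\<^bsub>A\<^esub> b) # w) = tens ([\<one>\<^bsub>A\<^esub>] @ a # w) \<oplus>\<^bsub>Sh\<^esub> tens ([\<one>\<^bsub>A\<^esub>] @ b # w)"
    by (rule multilinear_add[OF tens_multilinear]) (use assms A_T_subset in auto)
  then show ?thesis
    using assms word_span_tens[OF T_words_subset T_words_ConsI[OF one_closed]]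
    by (simp add: incl_eq emb_add Sh_T_carrier)
qed

lemma incl_one_smult:
  assumes "r \<in> carrier k" "a \<in> A_T" "set w \<subseteq> A_T"
  shows "incl (\<one>\<^bsub>A\<^esub> # (r \<odot>\<^bsub>A\<^esub> a) # w) = r \<odot>\<^bsub>ID\<^esub> incl (\<one>\<^bsub>A\<^esub> # a # w)"
proof -
  have "tens ([\<one>\<^bsub>A\<^esub>] @ (r \<odot>\<^bsub>A\<^esub> a) # w) = r \<odot>\<^bsub>Sh\<^esub> tens ([\<one>\<^bsub>A\<^esub>] @ a # w)"
    by (rule multilinear_smult[OF tens_multilinear]) (use assms A_T_subset in auto)
  then show ?thesis
    using assms word_span_tens[OF T_words_subset T_words_ConsI[OF one_closed]]
    by (simp add: incl_eq emb_smult Sh_T_carrier)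
qed

lemma eps_smult: "\<lbrakk>r \<in> carrier k; a \<in> carrier A\<rbrakk> \<Longrightarrow> eps (r \<odot>\<^bsub>A\<^esub> a) = r \<odot>\<^bsub>ID\<^esub> eps a"
  using smult_eq_mult[of r a] by (simp add: ID_smult eps_closed eps_mult)

lemma T_add: "\<lbrakk>a \<in> carrier A; b \<in> carrier A\<rbrakk> \<Longrightarrow> T (a \<oplus>\<^bsub>A\<^esub> b) = T a \<oplus>\<^bsub>A\<^esub> T b"
  and T_smult: "\<lbrakk>r \<in> carrier k; a \<in> carrier A\<rbrakk> \<Longrightarrow> T (r \<odot>\<^bsub>A\<^esub> a) = r \<odot>\<^bsub>A\<^esub> T a"
  using T_linear by (auto simp: linear_map_def)

lemma words_SucD:
  assumes "w \<in> words A (Suc n)"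
  shows "w \<noteq> []" "set w \<subseteq> carrier A" "hd w \<in> carrier A" "set (tl w) \<subseteq> carrier A"
  using assms by (cases w; simp add: words_def)+

text \<open>In the first letter, the recursion depends on \<open>a\<close> through the linear maps
  \<open>Q\<close>, \<open>T\<close> and \<open>d\<close>. In the other letters, the explicit terms
  are multilinear, and the recursive ones are \<open>Pi_T\<close> on shorter words whose head has
  been changed by a linear map, namely \<open>T\<close> followed by multiplication.\<close>

lemma Pi_T_multilinear_words: "multilinear k A (words A (Suc n)) ID Pi_T"
proof (induction n)
  case 0
  show ?case
  proof (rule multilinear_words_ConsI)
    show "Pi_T w \<in> carrier ID" if "w \<in> words A (Suc 0)" for w
      using that by (intro Pi_T_closed) (auto simp: words_def)
    show "multilinear k A (words A 0) ID (\<lambda>w. Pi_T (a # w))" if "a \<in> carrier A" for a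
      using that by (intro multilinear_words_0 Pi_T_closed) auto
  next
    fix a b w assume ab: "a \<in> carrier A" "b \<in> carrier A" and "w \<in> words A 0"
    then have "w = []"
      by (simp add: words_def)
    have closed: "incl [Q c] \<in> carrier ID" "eps (Q c) \<in> carrier ID" "incl [\<one>\<^bsub>A\<^esub>, T c] \<in> carrier ID"
      if "c \<in> carrier A" for c
      using that T_in_A_T[OF that] by (auto intro!: incl_closed eps_closed T_words_ConsI)
    show "Pi_T ((a \<oplus>\<^bsub>A\<^esub> b) # w) = Pi_T (a # w) \<oplus>\<^bsub>ID\<^esub> Pi_T (b # w)"
      using closed[OF ab(1)] closed[OF ab(2)] ab T_in_A_T
      by (simp add: \<open>w = []\<close> Pi_T_single Q_add T_add incl_single_add eps_add incl_one_add
        ID.M.minus_eq ID.M.minus_add ID.M.a_ac)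
  next
    fix r a w assume r: "r \<in> carrier k" "a \<in> carrier A" and "w \<in> words A 0"
    then have "w = []"
      by (simp add: words_def)
    have closed: "incl [Q a] \<in> carrier ID" "eps (Q a) \<in> carrier ID" "incl [\<one>\<^bsub>A\<^esub>, T a] \<in> carrier ID"
      using r T_in_A_T by (auto intro!: incl_closed eps_closed T_words_ConsI)
    then show "Pi_T ((r \<odot>\<^bsub>A\<^esub> a) # w) = r \<odot>\<^bsub>ID\<^esub> Pi_T (a # w)"
      using r T_in_A_T
      by (simp add: \<open>w = []\<close> Pi_T_single Q_smult T_smult incl_single_smult eps_smult incl_one_smult
        ID.M.minus_eq ID.smult_r_distr ID.smult_r_minus)
  qed
next
  case (Suc n)
  have head: "(c \<otimes>\<^bsub>A\<^esub> T (hd w)) # tl w \<in> words A (Suc n)" if "w \<in> words A (Suc n)" "c \<in> carrier A" for w c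
    using that by (cases w) (auto simp: words_def)
  show ?case
  proof (rule multilinear_words_ConsI)
    show "Pi_T w \<in> carrier ID" if "w \<in> words A (Suc (Suc n))" for w
      using that by (intro Pi_T_closed) (auto simp: words_def)
  next
    fix a b w assume ab: "a \<in> carrier A" "b \<in> carrier A" and w: "w \<in> words A (Suc n)"
    note ne = words_SucD(1)[OF w] and T = map_T_A_T[OF words_SucD(2)[OF w]] and hd = words_SucD(3,4)[OF w]
    let ?p = "\<lambda>c. Pi_T ((c \<otimes>\<^bsub>A\<^esub> T (hd w)) # tl w)"
    have p: "?p c \<in> carrier ID" if "c \<in> carrier A" for c
      using that hd by (intro Pi_T_closed) auto
    have p_add: "?p (c \<oplus>\<^bsub>A\<^esub> e) = ?p c \<oplus>\<^bsub>ID\<^esub> ?p e" if "c \<in> carrier A" "e \<in> carrier A" for c e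
      using multilinear_add[OF Suc.IH, of "[]" "c \<otimes>\<^bsub>A\<^esub> T (hd w)" "tl w" "e \<otimes>\<^bsub>A\<^esub> T (hd w)"] that hd head[OF w that(1)]
      by (simp add: l_distr)
    have closed: "incl (Q c # map T w) \<in> carrier ID" "incl (\<one>\<^bsub>A\<^esub> # T c # map T w) \<in> carrier ID"
      if "c \<in> carrier A" for c
      using that T T_in_A_T by (auto intro!: incl_closed T_words_ConsI simp del: set_map)
    show "Pi_T ((a \<oplus>\<^bsub>A\<^esub> b) # w) = Pi_T (a # w) \<oplus>\<^bsub>ID\<^esub> Pi_T (b # w)"
      using closed[OF ab(1)] closed[OF ab(2)] ab p T_in_A_T T lam_closed
      by (simp add: Pi_T_Cons[OF ne] Q_add T_add d_add incl_single_add incl_one_add p_add ID.smult_r_distr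
        ID_minus_minus_plus del: set_map)
  next
    fix r a w assume r: "r \<in> carrier k" "a \<in> carrier A" and w: "w \<in> words A (Suc n)"
    note ne = words_SucD(1)[OF w] and T = map_T_A_T[OF words_SucD(2)[OF w]] and hd = words_SucD(3,4)[OF w]
    let ?p = "\<lambda>c. Pi_T ((c \<otimes>\<^bsub>A\<^esub> T (hd w)) # tl w)"
    have p: "?p c \<in> carrier ID" if "c \<in> carrier A" for c
      using that hd by (intro Pi_T_closed) auto
    have p_smult: "?p (r \<odot>\<^bsub>A\<^esub> c) = r \<odot>\<^bsub>ID\<^esub> ?p c" if "c \<in> carrier A" for c
      using multilinear_smult[OF Suc.IH, of "[]" "c \<otimes>\<^bsub>A\<^esub> T (hd w)" "tl w" r] that hd head[OF w that(1)] r(1)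
      by (simp add: smult_assoc2)
    have closed: "incl (Q a # map T w) \<in> carrier ID" "incl (\<one>\<^bsub>A\<^esub> # T a # map T w) \<in> carrier ID"
      using r T T_in_A_T by (auto intro!: incl_closed T_words_ConsI simp del: set_map)
    have "lam \<odot>\<^bsub>ID\<^esub> (r \<odot>\<^bsub>ID\<^esub> ?p c) = r \<odot>\<^bsub>ID\<^esub> (lam \<odot>\<^bsub>ID\<^esub> ?p c)" if "c \<in> carrier A" for c
      using p[OF that] r lam_closed by (simp add: R.m_comm flip: ID.smult_assoc1)
    then show "Pi_T ((r \<odot>\<^bsub>A\<^esub> a) # w) = r \<odot>\<^bsub>ID\<^esub> Pi_T (a # w)"
      using closed r p T_in_A_T T lam_closed
      by (simp add: Pi_T_Cons[OF ne] Q_smult T_smult d_smult incl_single_smult incl_one_smult p_smult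
        ID.M.minus_eq ID.smult_r_distr ID.smult_r_minus del: set_map)
  next
    fix a assume a: "a \<in> carrier A"
    have phi: "(\<lambda>b. c \<otimes>\<^bsub>A\<^esub> T b) \<in> linear_map k A A" if "c \<in> carrier A" for c
      by (rule linear_map_comp[OF T_linear linear_map_mult_left[OF that]])
    have 1: "multilinear k A (words A (Suc n)) ID (\<lambda>w. incl (Q a # [] @ map T w))"
      by (rule incl_Cons_map_T_multilinear) (use a in auto)
    have 2: "multilinear k A (words A (Suc n)) ID (\<lambda>w. Pi_T ((c \<otimes>\<^bsub>A\<^esub> T (hd w)) # tl w))"
      if "c \<in> carrier A" for c
      by (rule multilinear_head[OF Suc.IH phi[OF that]]) simp
    have 3: "multilinear k A (words A (Suc n)) ID (\<lambda>w. incl (\<one>\<^bsub>A\<^esub> # [T a] @ map T w))"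
      by (rule incl_Cons_map_T_multilinear) (use a T_in_A_T in auto)
    have "multilinear k A (words A (Suc n)) ID (\<lambda>w. incl (Q a # [] @ map T w)
        \<ominus>\<^bsub>ID\<^esub> Pi_T ((Q a \<otimes>\<^bsub>A\<^esub> T (hd w)) # tl w)
        \<ominus>\<^bsub>ID\<^esub> lam \<odot>\<^bsub>ID\<^esub> Pi_T ((d (Q a) \<otimes>\<^bsub>A\<^esub> T (hd w)) # tl w)
        \<oplus>\<^bsub>ID\<^esub> incl (\<one>\<^bsub>A\<^esub> # [T a] @ map T w))"
      unfolding a_minus_def
      by (rule ID.multilinear_plus[OF ID.multilinear_plus[OF ID.multilinear_plus[OF 1
            multilinear_linear_comp[OF 2 ID.linear_map_uminus words_replace] words_replace]
            multilinear_linear_comp[OF multilinear_linear_comp[OF 2 ID.linear_map_smult_self[OF lam_closed] words_replace]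
              ID.linear_map_uminus words_replace] words_replace] 3 words_replace]) (use a in auto)
    then show "multilinear k A (words A (Suc n)) ID (\<lambda>w. Pi_T (a # w))"
      by (rule multilinear_cong) (auto simp: Pi_T_Cons words_def simp flip: length_greater_0_conv)
  qed
qed

lemma Pi_T_multilinear: "multilinear k A A_words ID Pi_T"
  using Pi_T_multilinear_words by (simp add: multilinear_A_words_iff)

end

text \<open>With \<open>p\<close>, \<open>q\<close> and \<open>r\<close> the values of the integral
  after the derivation at \<open>x\<close>, \<open>y\<close> and their product, the left side is the
  hybrid Rota-Baxter identity and the right side is the multiplicativity of the evaluation.\<close>

lemma (in cring) mult_of_projections:
  assumes "x \<in> carrier R" "y \<in> carrier R" "p \<in> carrier R" "q \<in> carrier R" "r \<in> carrier R"
  shows "p \<otimes> q = p \<otimes> y \<oplus> x \<otimes> q \<ominus> r \<longleftrightarrow> (x \<ominus> p) \<otimes> (y \<ominus> q) = x \<otimes> y \<ominus> r"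
proof
  assume *: "p \<otimes> q = p \<otimes> y \<oplus> x \<otimes> q \<ominus> r"
  have "(x \<ominus> p) \<otimes> (y \<ominus> q) = x \<otimes> y \<ominus> (p \<otimes> y \<oplus> x \<otimes> q) \<oplus> p \<otimes> q"
    using assms by algebra
  also have "\<dots> = x \<otimes> y \<ominus> r"
    unfolding * using assms by algebra
  finally show "(x \<ominus> p) \<otimes> (y \<ominus> q) = x \<otimes> y \<ominus> r" .
next
  assume *: "(x \<ominus> p) \<otimes> (y \<ominus> q) = x \<otimes> y \<ominus> r"
  have "p \<otimes> q = p \<otimes> y \<oplus> x \<otimes> q \<ominus> x \<otimes> y \<oplus> (x \<ominus> p) \<otimes> (y \<ominus> q)"
    using assms by algebra
  also have "\<dots> = p \<otimes> y \<oplus> x \<otimes> q \<ominus> r"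
    unfolding * using assms by algebra
  finally show "p \<otimes> q = p \<otimes> y \<oplus> x \<otimes> q \<ominus> r" .
qed

context regular_diff_algebra
begin

lemma Sh_T_additive_eqI:
  assumes "abelian_group H" "L \<in> hom (add_monoid Sh) (add_monoid H)" "L' \<in> hom (add_monoid Sh) (add_monoid H)"
    and "\<And>w. w \<in> T_words \<Longrightarrow> L (tens w) = L' (tens w)" and "x \<in> carrier Sh_T"
  shows "L x = L' x"
proof (rule hom_eq_on_generate[OF Sh_group.is_group abelian_group.a_group[OF assms(1)]])
  show "L \<in> hom Sh_group (add_monoid H)" "L' \<in> hom Sh_group (add_monoid H)"
    using assms(2,3) by (simp_all add: hom_Sh_group_iff)
  show "x \<in> generate Sh_group (tens ` T_words)"
    using assms(5) by (simp add: Sh_T_carrier word_span_def)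
qed (use T_words_subset assms(4) in auto)

lemma d_ID_incl_single: "a \<in> carrier A \<Longrightarrow> d_ID (incl [a]) = incl [d a]"
  using d_ID_emb[of "tens [a]"] Sh_T_single by (simp add: incl_eq Sh_T_carrier d_Sh_single)

lemma d_ID_incl_Cons:
  assumes "a \<in> carrier A" "b \<in> A_T" "set w \<subseteq> A_T"
  shows "d_ID (incl (a # b # w)) = incl (d a # b # w) \<oplus>\<^bsub>ID\<^esub> incl ((a \<otimes>\<^bsub>A\<^esub> b) # w)
    \<oplus>\<^bsub>ID\<^esub> lam \<odot>\<^bsub>ID\<^esub> incl ((d a \<otimes>\<^bsub>A\<^esub> b) # w)"
proof -
  have mem: "tens (c # u) \<in> carrier Sh_T" if "c \<in> carrier A" "set u \<subseteq> A_T" for c u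
    using that word_span_tens[OF T_words_subset T_words_ConsI] by (simp add: Sh_T_carrier)
  have "d_Sh (tens (a # b # w)) = d_word (a # b # w)"
    using assms A_T_subset by (intro d_Sh_tens) auto
  moreover have "tens (d a # b # w) \<oplus>\<^bsub>Sh\<^esub> tens ((a \<otimes>\<^bsub>A\<^esub> b) # w) \<in> carrier Sh_T"
    using TT.N.M.a_closed[OF mem mem] assms A_T_closed by simp
  ultimately show ?thesis
    using d_ID_emb[OF mem, of a "b # w"] assms A_T_closed mem Sh_T_smult lam_closed
    by (simp add: incl_eq emb_add emb_smult)
qed

lemma incl_zero: "set w \<subseteq> A_T \<Longrightarrow> incl (\<zero>\<^bsub>A\<^esub> # w) = \<zero>\<^bsub>ID\<^esub>"
  using tens_head_zero[of w] A_T_subset by (simp add: incl_eq emb_zero)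

lemma eps_zero: "eps \<zero>\<^bsub>A\<^esub> = \<zero>\<^bsub>ID\<^esub>"
  using eps_K[of "\<zero>\<^bsub>A\<^esub>"] incl_zero[of "[]"] by (simp add: incl_eq)

lemma incl_mult_single: "\<lbrakk>a \<in> carrier A; b \<in> carrier A; set w \<subseteq> A_T\<rbrakk> \<Longrightarrow>
    incl ((a \<otimes>\<^bsub>A\<^esub> b) # w) = incl [a] \<otimes>\<^bsub>ID\<^esub> incl (b # w)"
  using emb_mult[of "tens [a]" "tens (b # w)"] A_T_subset Sh_T_single
    word_span_tens[OF T_words_subset T_words_ConsI, of b w]
  by (simp add: incl_eq Sh_T_carrier Sh_single_mult)

text \<open>The remainder is a constant because \<open>d Q d = d\<close>.\<close>

lemma K_decomposition:
  assumes "a \<in> carrier A"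
  shows "a \<ominus>\<^bsub>A\<^esub> Q (d a) \<in> carrier K" "a = Q (d a) \<oplus>\<^bsub>A\<^esub> (a \<ominus>\<^bsub>A\<^esub> Q (d a))"
proof -
  show "a \<ominus>\<^bsub>A\<^esub> Q (d a) \<in> carrier K"
    using assms by (simp add: d_minus d_Q_d)
  show "a = Q (d a) \<oplus>\<^bsub>A\<^esub> (a \<ominus>\<^bsub>A\<^esub> Q (d a))"
    using assms by (simp add: M.minus_eq M.a_lcomm[of "Q (d a)"] M.r_neg)
qed

section \<open>Existence of the operator on ID(A) and its first properties\<close>

context
  assumes well_defined: Pi_well_defined
begin

text \<open>The projected recursion yields a map on all of \<open>Sh\<close> that is linear over
  \<open>k\<close>. Its compatibility with constants can be asked only on \<open>Sh_T\<close>; there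
  it is tested on words, where it reads as \<open>Pi_well_defined\<close>.\<close>

lemma Pi_linear_exists:
  obtains L where "L \<in> linear_map k Sh ID" "\<And>w. w \<in> T_words \<Longrightarrow> L (tens w) = Pi_word w"
    "\<And>c x. \<lbrakk>c \<in> carrier K; x \<in> carrier Sh_T\<rbrakk> \<Longrightarrow> L (tens [c] \<otimes>\<^bsub>Sh\<^esub> x) = eps c \<otimes>\<^bsub>ID\<^esub> L x"
proof -
  obtain L where L: "L \<in> linear_map k Sh ID" "\<And>w. w \<in> A_words \<Longrightarrow> L (tens w) = Pi_T w"
    using Sh_linear_universal[OF ID.module_axioms Pi_T_multilinear] by blast
  have LT: "L (tens w) = Pi_word w" if "w \<in> T_words" for w
    using L(2)[of w] that T_words_subset Pi_T_eq by auto
  have "L (tens [c] \<otimes>\<^bsub>Sh\<^esub> x) = eps c \<otimes>\<^bsub>ID\<^esub> L x" if c: "c \<in> carrier K" and x: "x \<in> carrier Sh_T" for c x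
  proof -
    have cA: "c \<in> carrier A"
      using c by simp
    have 1: "(\<lambda>x. L (tens [c] \<otimes>\<^bsub>Sh\<^esub> x)) \<in> hom (add_monoid Sh) (add_monoid ID)"
      by (rule linear_map_hom[OF linear_map_comp[OF Sh.linear_map_mult_left[OF tens_single_closed[OF cA]] L(1)]])
    have 2: "(\<lambda>x. eps c \<otimes>\<^bsub>ID\<^esub> L x) \<in> hom (add_monoid Sh) (add_monoid ID)"
      by (rule linear_map_hom[OF linear_map_comp[OF L(1) ID.linear_map_mult_left[OF eps_closed[OF cA]]]])
    show ?thesis
    proof (rule Sh_T_additive_eqI[OF ID.M.abelian_group_axioms 1 2 _ x])
      fix w assume w: "w \<in> T_words"
      then obtain a v where v: "w = a # v" "a \<in> carrier A" "set v \<subseteq> A_T"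
        by (auto simp: T_words_def)
      have "L (tens [c] \<otimes>\<^bsub>Sh\<^esub> tens w) = Pi_word ((c \<otimes>\<^bsub>A\<^esub> a) # v)"
        using v cA A_T_subset by (auto simp: Sh_single_mult LT T_words_ConsI)
      also have "\<dots> = eps c \<otimes>\<^bsub>ID\<^esub> L (tens w)"
        using well_defined w c v(1) LT[OF w] unfolding Pi_well_defined_def by (auto simp del: K_simps)
      finally show "L (tens [c] \<otimes>\<^bsub>Sh\<^esub> tens w) = eps c \<otimes>\<^bsub>ID\<^esub> L (tens w)" .
    qed
  qed
  then show ?thesis
    using that L(1) LT by blast
qed

text \<open>The operator is the replica factor times the value of \<open>L\<close> at the second
  factor. It is the only candidate in the description of \<open>Pi_ID\<close>, since linearity over
  the replica and the values on words fix an additive map on the generators of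
  \<open>ID\<close>.\<close>

lemma Pi_ID_props:
  shows Pi_ID_hom: "Pi_ID \<in> hom (add_monoid ID) (add_monoid ID)"
    and Pi_ID_eps: "\<And>a x. \<lbrakk>a \<in> carrier A; x \<in> carrier ID\<rbrakk> \<Longrightarrow> Pi_ID (eps a \<otimes>\<^bsub>ID\<^esub> x) = eps a \<otimes>\<^bsub>ID\<^esub> Pi_ID x"
    and Pi_ID_incl: "\<And>w. w \<in> T_words \<Longrightarrow> Pi_ID (incl w) = Pi_word w"
proof -
  obtain L where L: "L \<in> linear_map k Sh ID" "\<And>w. w \<in> T_words \<Longrightarrow> L (tens w) = Pi_word w"
    "\<And>c x. \<lbrakk>c \<in> carrier K; x \<in> carrier Sh_T\<rbrakk> \<Longrightarrow> L (tens [c] \<otimes>\<^bsub>Sh\<^esub> x) = eps c \<otimes>\<^bsub>ID\<^esub> L x"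
    by (rule Pi_linear_exists) blast
  note Lc = linear_map_closed[OF L(1) Sh_T_closed]
  obtain P where P: "P \<in> hom (add_monoid TT.TA) (add_monoid ID)"
    "\<And>m x. \<lbrakk>m \<in> carrier A_eps; x \<in> carrier Sh_T\<rbrakk> \<Longrightarrow> P (tensor_pure K A_eps Sh_T m x) = eps (unEps m) \<otimes>\<^bsub>ID\<^esub> L x"
  proof (rule TT.TA_universal[OF ID.M.abelian_group_axioms, of "\<lambda>m x. eps (unEps m) \<otimes>\<^bsub>ID\<^esub> L x"])
    fix m n assume "m \<in> carrier A_eps" "n \<in> carrier Sh_T"
    then show "eps (unEps m) \<otimes>\<^bsub>ID\<^esub> L n \<in> carrier ID"
      using Lc by (auto intro!: eps_closed)
  next
    fix m m' n assume "m \<in> carrier A_eps" "m' \<in> carrier A_eps" "n \<in> carrier Sh_T"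
    then show "eps (unEps (m \<oplus>\<^bsub>A_eps\<^esub> m')) \<otimes>\<^bsub>ID\<^esub> L n = eps (unEps m) \<otimes>\<^bsub>ID\<^esub> L n \<oplus>\<^bsub>ID\<^esub> eps (unEps m') \<otimes>\<^bsub>ID\<^esub> L n"
      using Lc by (auto simp: eps_add ID.l_distr eps_closed)
  next
    fix m n n' assume "m \<in> carrier A_eps" "n \<in> carrier Sh_T" "n' \<in> carrier Sh_T"
    then show "eps (unEps m) \<otimes>\<^bsub>ID\<^esub> L (n \<oplus>\<^bsub>Sh_T\<^esub> n') = eps (unEps m) \<otimes>\<^bsub>ID\<^esub> L n \<oplus>\<^bsub>ID\<^esub> eps (unEps m) \<otimes>\<^bsub>ID\<^esub> L n'"
      using Lc Sh_T_closed by (auto simp: linear_map_add[OF L(1)] ID.r_distr eps_closed)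
  next
    \<comment> \<open>A constant acting on the replica becomes a factor \<open>eps c\<close>. Acting
      on \<open>Sh_T\<close> it becomes a one-letter factor, which the third property of
      \<open>L\<close> turns into the same \<open>eps c\<close>.\<close>
    fix c m n assume *: "c \<in> carrier K" "m \<in> carrier A_eps" "n \<in> carrier Sh_T"
    then obtain a where a: "m = Eps a" "a \<in> carrier A"
      by auto
    have c: "c \<in> carrier A"
      using *(1) by simp
    show "eps (unEps (c \<odot>\<^bsub>A_eps\<^esub> m)) \<otimes>\<^bsub>ID\<^esub> L n = eps (unEps m) \<otimes>\<^bsub>ID\<^esub> L (c \<odot>\<^bsub>Sh_T\<^esub> n)"
      using Lc[OF *(3)] a(2) c eps_closed by (simp add: a(1) L(3)[OF *(1,3)] eps_mult ID.m_ac)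
  qed blast
  have P_hom: "P \<in> hom (add_monoid ID) (add_monoid ID)"
    using P(1) by (simp add: hom_ID)
  have P_emb: "P (eps a \<otimes>\<^bsub>ID\<^esub> emb x) = eps a \<otimes>\<^bsub>ID\<^esub> L x" if "a \<in> carrier A" "x \<in> carrier Sh_T" for a x
    using P(2)[of "Eps a" x] that by (simp add: pure_eq)
  have mem: "tens w \<in> carrier Sh_T" if "w \<in> T_words" for w
    using that word_span_tens[OF T_words_subset] by (simp add: Sh_T_carrier)
  have P_incl: "P (incl w) = Pi_word w" if "w \<in> T_words" for w
    using P_emb[of "\<one>\<^bsub>A\<^esub>" "tens w"] mem[OF that] that L(2)[OF that] Pi_word_closed[OF that] incl_closed[OF that]
    by (simp add: eps_one incl_eq)
  have P_eps: "P (eps a \<otimes>\<^bsub>ID\<^esub> x) = eps a \<otimes>\<^bsub>ID\<^esub> P x" if a: "a \<in> carrier A" and x: "x \<in> carrier ID" for a x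
  proof (rule ID_additive_eqI[OF ID.M.abelian_group_axioms
      hom_compose'[OF linear_map_hom[OF ID.linear_map_mult_left[OF eps_closed[OF a]]] P_hom]
      hom_compose'[OF P_hom linear_map_hom[OF ID.linear_map_mult_left[OF eps_closed[OF a]]]] _ x])
    fix b w assume b: "b \<in> carrier A" and w: "w \<in> T_words"
    have "P (eps a \<otimes>\<^bsub>ID\<^esub> (eps b \<otimes>\<^bsub>ID\<^esub> incl w)) = P (eps (a \<otimes>\<^bsub>A\<^esub> b) \<otimes>\<^bsub>ID\<^esub> incl w)"
      using a b incl_closed[OF w] eps_closed by (simp add: eps_mult ID.m_assoc)
    also have "\<dots> = eps (a \<otimes>\<^bsub>A\<^esub> b) \<otimes>\<^bsub>ID\<^esub> L (tens w)"
      unfolding incl_eq using a b mem[OF w] by (intro P_emb) auto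
    also have "\<dots> = eps a \<otimes>\<^bsub>ID\<^esub> P (eps b \<otimes>\<^bsub>ID\<^esub> incl w)"
      using a b mem[OF w] Lc[OF mem[OF w]] eps_closed by (simp add: incl_eq P_emb eps_mult ID.m_assoc)
    finally show "P (eps a \<otimes>\<^bsub>ID\<^esub> (eps b \<otimes>\<^bsub>ID\<^esub> incl w)) = eps a \<otimes>\<^bsub>ID\<^esub> P (eps b \<otimes>\<^bsub>ID\<^esub> incl w)" .
  qed
  have Pi: "Pi_ID = restrict P (carrier ID)"
    unfolding Pi_ID_def
  proof (rule the_equality)
    show "restrict P (carrier ID) \<in> hom (add_monoid ID) (add_monoid ID) \<and> restrict P (carrier ID) \<in> extensional (carrier ID) \<and>
      (\<forall>a\<in>carrier A. \<forall>x\<in>carrier ID. restrict P (carrier ID) (eps a \<otimes>\<^bsub>ID\<^esub> x) = eps a \<otimes>\<^bsub>ID\<^esub> restrict P (carrier ID) x) \<and>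
      (\<forall>w\<in>T_words. restrict P (carrier ID) (incl w) = Pi_word w)"
      using P_hom P_eps P_incl incl_closed eps_closed by (auto simp: hom_def Pi_iff)
  next
    fix P' assume P': "P' \<in> hom (add_monoid ID) (add_monoid ID) \<and> P' \<in> extensional (carrier ID) \<and>
      (\<forall>a\<in>carrier A. \<forall>x\<in>carrier ID. P' (eps a \<otimes>\<^bsub>ID\<^esub> x) = eps a \<otimes>\<^bsub>ID\<^esub> P' x) \<and>
      (\<forall>w\<in>T_words. P' (incl w) = Pi_word w)"
    have "P' x = P x" if "x \<in> carrier ID" for x
      by (rule ID_additive_eqI[OF ID.M.abelian_group_axioms _ P_hom _ that])
        (use P' incl_closed in \<open>auto simp: P_eps P_incl\<close>)
    then show "P' = restrict P (carrier ID)"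
      using P' by (auto simp: fun_eq_iff extensional_def)
  qed
  show "Pi_ID \<in> hom (add_monoid ID) (add_monoid ID)"
    using P_hom by (auto simp: Pi hom_def Pi_iff)
  show "\<And>a x. \<lbrakk>a \<in> carrier A; x \<in> carrier ID\<rbrakk> \<Longrightarrow> Pi_ID (eps a \<otimes>\<^bsub>ID\<^esub> x) = eps a \<otimes>\<^bsub>ID\<^esub> Pi_ID x"
    by (simp add: Pi P_eps eps_closed)
  show "\<And>w. w \<in> T_words \<Longrightarrow> Pi_ID (incl w) = Pi_word w"
    by (simp add: Pi P_incl incl_closed)
qed

lemma Pi_ID_closed: "x \<in> carrier ID \<Longrightarrow> Pi_ID x \<in> carrier ID"
  using Pi_ID_hom by (auto simp: hom_def)

lemma Pi_ID_linear: "Pi_ID \<in> linear_map k ID ID"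
  using Pi_ID_hom ID.smult_closed
  by (auto simp: linear_map_def hom_def ID_smult Pi_ID_closed Pi_ID_eps)

text \<open>As \<open>Q b\<close> is zero and \<open>T b\<close> is \<open>b\<close>, every term of
  the recursion except the last has zero as first letter or as argument of
  \<open>eps\<close>.\<close>

lemma Pi_ID_A_T:
  assumes "b \<in> A_T" "set w \<subseteq> A_T"
  shows "Pi_ID (incl (b # w)) = incl (\<one>\<^bsub>A\<^esub> # b # w)"
proof -
  have b: "b \<in> carrier A" "Q b = \<zero>\<^bsub>A\<^esub>" "T b = b"
    using assms(1) T_A_T by (auto simp: A_T_def)
  \<comment> \<open>A word with zero first letter represents the zero tensor, so additivity of
    \<open>Pi_ID\<close> gives the value without unfolding the recursion.\<close>
  have zero: "Pi_word (\<zero>\<^bsub>A\<^esub> # v) = \<zero>\<^bsub>ID\<^esub>" if "set v \<subseteq> A_T" for v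
    using Pi_ID_incl[of "\<zero>\<^bsub>A\<^esub> # v"] that incl_zero[OF that]
      additive_zero[OF ID.M.abelian_group_axioms ID.M.abelian_group_axioms Pi_ID_hom] by (simp add: T_words_ConsI)
  have "incl (\<one>\<^bsub>A\<^esub> # b # w) \<in> carrier ID"
    using assms by (auto intro!: incl_closed T_words_ConsI)
  moreover have "Pi_ID (incl (b # w)) = Pi_word (b # w)"
    using Pi_ID_incl assms b by (simp add: T_words_ConsI)
  ultimately show ?thesis
    using assms b zero lam_closed A_T_closed
    by (cases w) (simp_all add: incl_zero eps_zero ID.M.minus_eq)
qed

text \<open>By the induction hypothesis, the two recursive terms cancel the merged terms that the
  derivation creates from \<open>Q a # b # w\<close>. What remains has first letters
  \<open>d (Q a)\<close> and \<open>T a\<close>, whose sum is \<open>a\<close>.\<close>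

lemma d_Pi_word: "w \<in> T_words \<Longrightarrow> d_ID (Pi_word w) = incl w"
proof (induction rule: T_words_induct)
  case (single a)
  note T = T_in_A_T[OF single]
  have closed: "incl [Q a] \<in> carrier ID" "eps (Q a) \<in> carrier ID" "incl [\<one>\<^bsub>A\<^esub>, T a] \<in> carrier ID"
    "incl [T a] \<in> carrier ID" "incl [d (Q a)] \<in> carrier ID"
    using single T by (auto intro!: incl_closed eps_closed T_words_ConsI)
  have "d_ID (incl [\<one>\<^bsub>A\<^esub>, T a]) = incl [T a]"
    using d_ID_incl_Cons[OF one_closed T, of "[]"] closed single T lam_closed by (simp add: d_one incl_zero)
  then have "d_ID (Pi_word [a]) = incl [d (Q a)] \<oplus>\<^bsub>ID\<^esub> incl [T a]"
    using closed single by (simp add: d_ID_add d_ID_minus d_ID_incl_single d_ID_eps) (simp add: ID.M.minus_eq)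
  also have "\<dots> = incl [a]"
    using incl_single_add[of "d (Q a)" "T a" "[]"] single by (simp add: T_def M.minus_eq M.a_lcomm[of "d (Q a)"] M.r_neg)
  finally show ?case .
next
  case (Cons a b w)
  note T = T_in_A_T[OF Cons(1)] and b = A_T_closed[OF Cons(2)]
  have qb: "Q a \<otimes>\<^bsub>A\<^esub> b \<in> carrier A" "d (Q a) \<otimes>\<^bsub>A\<^esub> b \<in> carrier A"
    using Cons(1) b by auto
  let ?p = "Pi_word ((Q a \<otimes>\<^bsub>A\<^esub> b) # w)" and ?q = "Pi_word ((d (Q a) \<otimes>\<^bsub>A\<^esub> b) # w)"
  have closed: "incl (Q a # b # w) \<in> carrier ID" "incl (\<one>\<^bsub>A\<^esub> # T a # b # w) \<in> carrier ID"
    "incl (T a # b # w) \<in> carrier ID" "incl (d (Q a) # b # w) \<in> carrier ID" "?p \<in> carrier ID" "?q \<in> carrier ID"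
    "incl ((Q a \<otimes>\<^bsub>A\<^esub> b) # w) \<in> carrier ID" "incl ((d (Q a) \<otimes>\<^bsub>A\<^esub> b) # w) \<in> carrier ID"
    using Cons(1-3) T qb by (auto intro!: incl_closed Pi_word_closed T_words_ConsI)
  have 1: "d_ID (incl (\<one>\<^bsub>A\<^esub> # T a # b # w)) = incl (T a # b # w)"
    using d_ID_incl_Cons[OF one_closed T, of "b # w"] closed Cons(1-3) T lam_closed by (simp add: d_one incl_zero)
  have 2: "d_ID (lam \<odot>\<^bsub>ID\<^esub> ?q) = lam \<odot>\<^bsub>ID\<^esub> incl ((d (Q a) \<otimes>\<^bsub>A\<^esub> b) # w)"
    using linear_map_smult[OF d_ID_linear lam_closed closed(6)] Cons(4)[OF qb(2)] by simp
  have "d_ID (Pi_word (a # b # w)) = incl (d (Q a) # b # w) \<oplus>\<^bsub>ID\<^esub> incl (T a # b # w)"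
  proof -
    let ?i = "incl ((Q a \<otimes>\<^bsub>A\<^esub> b) # w)" and ?j = "lam \<odot>\<^bsub>ID\<^esub> incl ((d (Q a) \<otimes>\<^bsub>A\<^esub> b) # w)"
    have j: "?j \<in> carrier ID" "lam \<odot>\<^bsub>ID\<^esub> ?q \<in> carrier ID"
      using closed lam_closed by auto
    have "d_ID (Pi_word (a # b # w)) = incl (d (Q a) # b # w) \<oplus>\<^bsub>ID\<^esub> ?i \<oplus>\<^bsub>ID\<^esub> ?j \<ominus>\<^bsub>ID\<^esub> ?i \<ominus>\<^bsub>ID\<^esub> ?j
        \<oplus>\<^bsub>ID\<^esub> incl (T a # b # w)"
      using closed j Cons(1-3) by (simp add: d_ID_add d_ID_minus 1 2 Cons(4)[OF qb(1)] d_ID_incl_Cons)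
    also have "\<dots> = incl (d (Q a) # b # w) \<oplus>\<^bsub>ID\<^esub> incl (T a # b # w)"
      using closed(3,4,7) j(1) by algebra
    finally show ?thesis .
  qed
  also have "\<dots> = incl (a # b # w)"
    using incl_single_add[of "d (Q a)" "T a" "b # w"] Cons(1-3)
    by (simp add: T_def M.minus_eq M.a_lcomm[of "d (Q a)"] M.r_neg)
  finally show ?case .
qed

lemma d_Pi_ID:
  assumes "x \<in> carrier ID"
  shows "d_ID (Pi_ID x) = x"
proof (rule ID_additive_eqI[OF ID.M.abelian_group_axioms hom_compose'[OF Pi_ID_hom d_ID_hom] hom_id _ assms])
  fix a w assume "a \<in> carrier A" "w \<in> T_words"
  then show "d_ID (Pi_ID (eps a \<otimes>\<^bsub>ID\<^esub> incl w)) = eps a \<otimes>\<^bsub>ID\<^esub> incl w"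
    by (simp add: Pi_ID_eps Pi_ID_incl incl_closed d_ID_eps_mult Pi_word_closed d_Pi_word)
qed

section \<open>The evaluation on ID(A) and its multiplicativity\<close>

definition ev where
  "ev x = x \<ominus>\<^bsub>ID\<^esub> Pi_ID (d_ID x)"

lemma ev_linear: "ev \<in> linear_map k ID ID"
proof -
  have "(\<lambda>x. x \<ominus>\<^bsub>ID\<^esub> Pi_ID (d_ID x)) \<in> linear_map k ID ID"
    by (intro ID.linear_map_diff linear_map_id linear_map_comp[OF d_ID_linear Pi_ID_linear])
  then show ?thesis
    by (simp add: ev_def[abs_def])
qed

lemma ev_hom: "ev \<in> hom (add_monoid ID) (add_monoid ID)"
  by (rule linear_map_hom[OF ev_linear])

lemma ev_closed: "x \<in> carrier ID \<Longrightarrow> ev x \<in> carrier ID"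
  and ev_add: "\<lbrakk>x \<in> carrier ID; y \<in> carrier ID\<rbrakk> \<Longrightarrow> ev (x \<oplus>\<^bsub>ID\<^esub> y) = ev x \<oplus>\<^bsub>ID\<^esub> ev y"
  using ev_linear by (auto simp: linear_map_def)

lemma ev_minus: "\<lbrakk>x \<in> carrier ID; y \<in> carrier ID\<rbrakk> \<Longrightarrow> ev (x \<ominus>\<^bsub>ID\<^esub> y) = ev x \<ominus>\<^bsub>ID\<^esub> ev y"
  by (rule linear_map_minus[OF ID.module_axioms ID.module_axioms ev_linear])

lemma ev_eps: "\<lbrakk>a \<in> carrier A; x \<in> carrier ID\<rbrakk> \<Longrightarrow> ev (eps a \<otimes>\<^bsub>ID\<^esub> x) = eps a \<otimes>\<^bsub>ID\<^esub> ev x"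
  using eps_closed[of a] d_ID_closed[of x] Pi_ID_closed[of "d_ID x"]
  by (simp add: ev_def d_ID_eps_mult Pi_ID_eps ID.M.minus_eq ID.r_distr ID.r_minus)

lemma ev_Pi: "x \<in> carrier ID \<Longrightarrow> ev (Pi_ID x) = \<zero>\<^bsub>ID\<^esub>"
  using Pi_ID_closed[of x] by (simp add: ev_def d_Pi_ID ID.M.minus_eq ID.M.r_neg)

lemma ev_one: "ev \<one>\<^bsub>ID\<^esub> = \<one>\<^bsub>ID\<^esub>"
  using d_ID_eps[of "\<one>\<^bsub>A\<^esub>"] additive_zero[OF ID.M.abelian_group_axioms ID.M.abelian_group_axioms Pi_ID_hom]
  by (simp add: eps_one ev_def ID.M.minus_eq)

lemma ev_eps_single: "a \<in> carrier A \<Longrightarrow> ev (eps a) = eps a"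
  using ev_eps[of a "\<one>\<^bsub>ID\<^esub>"] eps_closed[of a] by (simp add: ev_one)

text \<open>The recursion for the letter \<open>e\<close> is read as a formula for
  \<open>Q e\<close> modulo the image of \<open>Pi_ID\<close>: the term with \<open>T e\<close>
  belongs to that image by \<open>Pi_ID_A_T\<close>, so \<open>Q e\<close> is congruent to
  \<open>eps (Q e)\<close>, which the evaluation fixes.\<close>

lemma ev_incl_Q_single:
  assumes "e \<in> carrier A"
  shows "ev (incl [Q e]) = eps (Q e)"
proof -
  note T = T_in_A_T[OF assms]
  have closed: "incl [e] \<in> carrier ID" "incl [Q e] \<in> carrier ID" "eps (Q e) \<in> carrier ID" "incl [T e] \<in> carrier ID"
    "incl [\<one>\<^bsub>A\<^esub>, T e] \<in> carrier ID"
    using assms T by (auto intro!: incl_closed eps_closed T_words_ConsI)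
  have "Pi_ID (incl [e]) = incl [Q e] \<ominus>\<^bsub>ID\<^esub> eps (Q e) \<oplus>\<^bsub>ID\<^esub> Pi_ID (incl [T e])"
    using Pi_ID_incl[of "[e]"] Pi_ID_A_T[OF T, of "[]"] assms by (simp add: T_words_ConsI)
  then have "ev (Pi_ID (incl [e])) = ev (incl [Q e]) \<ominus>\<^bsub>ID\<^esub> eps (Q e) \<oplus>\<^bsub>ID\<^esub> \<zero>\<^bsub>ID\<^esub>"
    using closed Pi_ID_closed[OF closed(4)] assms by (simp add: ev_add ev_minus ev_Pi ev_eps_single)
  then have "ev (incl [Q e]) \<ominus>\<^bsub>ID\<^esub> eps (Q e) = \<zero>\<^bsub>ID\<^esub>"
    using closed ev_closed[OF closed(2)] by (simp add: ev_Pi)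
  then show ?thesis
    using closed ev_closed[OF closed(2)] by (simp add: ID.r_right_minus_eq)
qed

text \<open>
  By the recursion for \<open>Pi_word\<close>, the word \<open>Q e # b # w\<close> is congruent to zero modulo the image of
  \<open>Pi_ID\<close>, on which \<open>ev\<close> vanishes.
\<close>

lemma ev_incl_Q_Cons:
  assumes "e \<in> carrier A" "b \<in> A_T" "set w \<subseteq> A_T"
  shows "ev (incl (Q e # b # w)) = \<zero>\<^bsub>ID\<^esub>"
proof -
  note T = T_in_A_T[OF assms(1)] and b = A_T_closed[OF assms(2)]
  let ?i = "incl ((Q e \<otimes>\<^bsub>A\<^esub> b) # w)" and ?j = "incl ((d (Q e) \<otimes>\<^bsub>A\<^esub> b) # w)"
  have closed: "incl (e # b # w) \<in> carrier ID" "incl (Q e # b # w) \<in> carrier ID" "incl (T e # b # w) \<in> carrier ID"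
    "?i \<in> carrier ID" "?j \<in> carrier ID"
    using assms T b by (auto intro!: incl_closed T_words_ConsI)
  note Pc = closed[THEN Pi_ID_closed]
  have "Pi_ID (incl (e # b # w)) = incl (Q e # b # w) \<ominus>\<^bsub>ID\<^esub> Pi_ID ?i \<ominus>\<^bsub>ID\<^esub> lam \<odot>\<^bsub>ID\<^esub> Pi_ID ?j \<oplus>\<^bsub>ID\<^esub> Pi_ID (incl (T e # b # w))"
    using Pi_ID_incl[of "e # b # w"] Pi_ID_incl[of "(Q e \<otimes>\<^bsub>A\<^esub> b) # w"] Pi_ID_incl[of "(d (Q e) \<otimes>\<^bsub>A\<^esub> b) # w"]
      Pi_ID_A_T[OF T, of "b # w"] assms b by (simp add: T_words_ConsI)
  then have "ev (Pi_ID (incl (e # b # w))) = ev (incl (Q e # b # w)) \<ominus>\<^bsub>ID\<^esub> \<zero>\<^bsub>ID\<^esub> \<ominus>\<^bsub>ID\<^esub> lam \<odot>\<^bsub>ID\<^esub> \<zero>\<^bsub>ID\<^esub> \<oplus>\<^bsub>ID\<^esub> \<zero>\<^bsub>ID\<^esub>"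
    using closed Pc lam_closed by (simp add: ev_add ev_minus linear_map_smult[OF ev_linear] ev_Pi)
  then show ?thesis
    using closed ev_closed[OF closed(2)] lam_closed by (simp add: ev_Pi ID.M.minus_eq)
qed

text \<open>A constant first letter crosses the tensor sign and leaves a word headed by the unit.
  For nonempty \<open>w\<close> such a word is a value of \<open>Pi_ID\<close>.\<close>

lemma incl_K_mult:
  assumes "c \<in> carrier K" "set w \<subseteq> A_T"
  shows "incl (c # w) = eps c \<otimes>\<^bsub>ID\<^esub> incl (\<one>\<^bsub>A\<^esub> # w)"
  using incl_mult_single[of c "\<one>\<^bsub>A\<^esub>" w] eps_K[OF assms(1)] assms by (simp add: incl_eq)

lemma incl_decomposition:
  assumes "a \<in> carrier A" "set w \<subseteq> A_T"
  shows "incl (a # w) = incl (Q (d a) # w) \<oplus>\<^bsub>ID\<^esub> eps (a \<ominus>\<^bsub>A\<^esub> Q (d a)) \<otimes>\<^bsub>ID\<^esub> incl (\<one>\<^bsub>A\<^esub> # w)"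
proof -
  have "incl ((Q (d a) \<oplus>\<^bsub>A\<^esub> (a \<ominus>\<^bsub>A\<^esub> Q (d a))) # w) = incl (Q (d a) # w) \<oplus>\<^bsub>ID\<^esub> incl ((a \<ominus>\<^bsub>A\<^esub> Q (d a)) # w)"
    using assms by (intro incl_single_add) auto
  then show ?thesis
    using K_decomposition(2)[OF assms(1), symmetric] incl_K_mult[OF K_decomposition(1)[OF assms(1)] assms(2)] by simp
qed

lemma ev_incl_single:
  assumes "a \<in> carrier A"
  shows "ev (incl [a]) = eps a"
proof -
  let ?c = "a \<ominus>\<^bsub>A\<^esub> Q (d a)"
  have c: "?c \<in> carrier A"
    using assms by simp
  have one: "incl [\<one>\<^bsub>A\<^esub>] = \<one>\<^bsub>ID\<^esub>"
    by (simp add: incl_eq tens_single_one emb_one)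
  have closed: "incl [Q (d a)] \<in> carrier ID" "eps ?c \<in> carrier ID"
    using assms c by (auto intro!: incl_closed eps_closed T_words_ConsI)
  then have "ev (incl [a]) = eps (Q (d a)) \<oplus>\<^bsub>ID\<^esub> eps ?c"
    using incl_decomposition[OF assms, of "[]"] assms c
    by (simp add: one ev_add ev_incl_Q_single ev_eps_single)
  also have "\<dots> = eps a"
    using eps_add[of "Q (d a)" ?c] assms c K_decomposition(2)[OF assms] by simp
  finally show ?thesis .
qed

lemma ev_incl_Cons:
  assumes "a \<in> carrier A" "b \<in> A_T" "set w \<subseteq> A_T"
  shows "ev (incl (a # b # w)) = \<zero>\<^bsub>ID\<^esub>"
proof -
  let ?c = "a \<ominus>\<^bsub>A\<^esub> Q (d a)"
  have c: "?c \<in> carrier A"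
    using assms by simp
  have closed: "incl (Q (d a) # b # w) \<in> carrier ID" "eps ?c \<in> carrier ID" "incl (\<one>\<^bsub>A\<^esub> # b # w) \<in> carrier ID"
    "incl (b # w) \<in> carrier ID"
    using assms c A_T_closed by (auto intro!: incl_closed eps_closed T_words_ConsI)
  have "ev (incl (\<one>\<^bsub>A\<^esub> # b # w)) = \<zero>\<^bsub>ID\<^esub>"
    using ev_Pi[OF closed(4)] Pi_ID_A_T[OF assms(2,3)] by simp
  then show ?thesis
    using incl_decomposition[OF assms(1), of "b # w"] assms c closed
    by (simp add: ev_add ev_incl_Q_Cons ev_eps)
qed

lemma head_span_Sh_T: "\<lbrakk>c \<in> carrier A; x \<in> word_span tail_words\<rbrakk> \<Longrightarrow> Sh_cons c x \<in> carrier Sh_T"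
  using Sh_cons_tail word_span_mono[OF head_words_T_words] by (auto simp: Sh_T_carrier)

text \<open>Extends the vanishing on words of length at least two to their sums. The product of two
  such words has this form: a head from \<open>A\<close> followed by a combination of words over
  \<open>A_T\<close>.\<close>

lemma ev_emb_Sh_cons:
  assumes "c \<in> carrier A" "x \<in> word_span tail_words"
  shows "ev (emb (Sh_cons c x)) = \<zero>\<^bsub>ID\<^esub>"
  using assms(2)
proof (induction rule: word_span_induct[OF tail_words_subset, consumes 1, case_names tens zero add uminus])
  case (tens w)
  then obtain b v where "w = b # v" "b \<in> A_T" "set v \<subseteq> A_T"
    by (cases w) (auto simp: tail_words_def)
  then show ?case
    using ev_incl_Cons[of c b v] assms(1) tens tail_words_subset
    by (auto simp: Sh_cons_tens incl_eq)
next
  case zero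
  show ?case
    using linear_map_zero[OF Sh.module_axioms Sh.module_axioms Sh_cons_linear[OF assms(1)]]
      additive_zero[OF ID.M.abelian_group_axioms ID.M.abelian_group_axioms ev_hom] by (simp add: emb_zero)
next
  case (add x y)
  then show ?case
    using linear_map_add[OF Sh_cons_linear[OF assms(1)], of x y] head_span_Sh_T[OF assms(1)]
      word_span_closed[OF tail_words_subset] by (simp add: emb_add ev_add emb_closed)
next
  case (uminus x)
  then show ?case
    using additive_uminus[OF Sh.M.abelian_group_axioms Sh.M.abelian_group_axioms linear_map_hom[OF Sh_cons_linear[OF assms(1)]], of x]
      head_span_Sh_T[OF assms(1)] word_span_closed[OF tail_words_subset]
      additive_uminus[OF ID.M.abelian_group_axioms ID.M.abelian_group_axioms ev_hom emb_closed]
    by (simp add: emb_uminus)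
qed

text \<open>Two single letters multiply inside \<open>A\<close>, and \<open>eps\<close> is
  multiplicative. If one of the words is longer, the product consists of words of length at least
  two, so both sides are zero.\<close>

lemma ev_incl_mult:
  assumes "u \<in> T_words" "v \<in> T_words"
  shows "ev (incl u \<otimes>\<^bsub>ID\<^esub> incl v) = ev (incl u) \<otimes>\<^bsub>ID\<^esub> ev (incl v)"
proof -
  obtain a u' where u: "u = a # u'" "a \<in> carrier A" "set u' \<subseteq> A_T"
    using assms(1) by (auto simp: T_words_def)
  obtain b v' where v: "v = b # v'" "b \<in> carrier A" "set v' \<subseteq> A_T"
    using assms(2) by (auto simp: T_words_def)
  have ab: "a \<otimes>\<^bsub>A\<^esub> b \<in> carrier A"
    using u v by simp
  have "tens u \<in> carrier Sh_T" "tens v \<in> carrier Sh_T"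
    using assms word_span_tens[OF T_words_subset] by (simp_all add: Sh_T_carrier)
  moreover have "u \<in> A_words" "v \<in> A_words"
    using assms T_words_subset by auto
  ultimately have prod: "incl u \<otimes>\<^bsub>ID\<^esub> incl v = emb (shuffle u v)"
    unfolding incl_eq using emb_mult[of "tens u" "tens v"] Sh_mult_tens[of u v] by simp
  have ev0: "ev (incl (c # w)) = \<zero>\<^bsub>ID\<^esub>" if "c \<in> carrier A" "set w \<subseteq> A_T" "w \<noteq> []" for c w
    using that ev_incl_Cons[of c] by (cases w) auto
  note closed = ev_closed[OF incl_closed[OF assms(1)]] ev_closed[OF incl_closed[OF assms(2)]]
  consider "u' = []" "v' = []" | "u' = []" "v' \<noteq> []" | "u' \<noteq> []" "v' = []" | "u' \<noteq> []" "v' \<noteq> []"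
    by blast
  then show ?thesis
  proof cases
    case 1
    then show ?thesis
      unfolding prod using u v ab by (simp add: ev_incl_single eps_mult flip: incl_eq)
  next
    case 2
    then have "shuffle u v = tens ((a \<otimes>\<^bsub>A\<^esub> b) # v')"
      using u v by simp
    then show ?thesis
      unfolding prod using 2 u v ab closed ev0 by (simp flip: incl_eq)
  next
    case 3
    then have "shuffle u v = tens ((a \<otimes>\<^bsub>A\<^esub> b) # u')"
      using u v by (simp add: shuffle_single_right)
    then show ?thesis
      unfolding prod using 3 u v ab closed ev0 by (simp flip: incl_eq)
  next
    case 4
    then have tail: "u' \<in> tail_words" "v' \<in> tail_words"
      using u v by (auto simp: tail_words_def)
    then have "shuffle u v = Sh_cons (a \<otimes>\<^bsub>A\<^esub> b) (shuffle_sum u' v')"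
      unfolding u(1) v(1) using tail_words_subset by (intro shuffle_eq_Sh_cons) auto
    then have "ev (incl u \<otimes>\<^bsub>ID\<^esub> incl v) = \<zero>\<^bsub>ID\<^esub>"
      unfolding prod using ev_emb_Sh_cons[OF ab shuffle_sum_tail[OF tail]] by simp
    moreover have "ev (incl u) = \<zero>\<^bsub>ID\<^esub>"
      using ev0 u 4 by simp
    ultimately show ?thesis
      using closed by simp
  qed
qed

lemma ev_mult:
  assumes "x \<in> carrier ID" "y \<in> carrier ID"
  shows "ev (x \<otimes>\<^bsub>ID\<^esub> y) = ev x \<otimes>\<^bsub>ID\<^esub> ev y"
proof (rule ID_additive_eqI[OF ID.M.abelian_group_axioms
    hom_compose'[OF linear_map_hom[OF ID.linear_map_mult_right[OF assms(2)]] ev_hom]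
    hom_compose'[OF ev_hom linear_map_hom[OF ID.linear_map_mult_right[OF ev_closed[OF assms(2)]]]] _ assms(1)])
  fix a u assume a: "a \<in> carrier A" and u: "u \<in> T_words"
  define x where "x = eps a \<otimes>\<^bsub>ID\<^esub> incl u"
  have x: "x \<in> carrier ID"
    unfolding x_def by (intro ID.m_closed eps_closed incl_closed a u)
  have "ev (x \<otimes>\<^bsub>ID\<^esub> y) = ev x \<otimes>\<^bsub>ID\<^esub> ev y"
  proof (rule ID_additive_eqI[OF ID.M.abelian_group_axioms
      hom_compose'[OF linear_map_hom[OF ID.linear_map_mult_left[OF x]] ev_hom]
      hom_compose'[OF ev_hom linear_map_hom[OF ID.linear_map_mult_left[OF ev_closed[OF x]]]] _ assms(2)])
    fix b v assume b: "b \<in> carrier A" and v: "v \<in> T_words"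
    note closed = eps_closed[OF a] eps_closed[OF b] incl_closed[OF u] incl_closed[OF v]
      ev_closed[OF incl_closed[OF u]] ev_closed[OF incl_closed[OF v]]
    have "x \<otimes>\<^bsub>ID\<^esub> (eps b \<otimes>\<^bsub>ID\<^esub> incl v) = eps a \<otimes>\<^bsub>ID\<^esub> (eps b \<otimes>\<^bsub>ID\<^esub> (incl u \<otimes>\<^bsub>ID\<^esub> incl v))"
      unfolding x_def using closed by (simp add: ID.m_ac)
    then show "ev (x \<otimes>\<^bsub>ID\<^esub> (eps b \<otimes>\<^bsub>ID\<^esub> incl v)) = ev x \<otimes>\<^bsub>ID\<^esub> ev (eps b \<otimes>\<^bsub>ID\<^esub> incl v)"
      unfolding x_def using closed a b u v by (simp add: ev_eps ev_incl_mult) (simp add: ID.m_ac)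
  qed
  then show "ev ((eps a \<otimes>\<^bsub>ID\<^esub> incl u) \<otimes>\<^bsub>ID\<^esub> y) = ev (eps a \<otimes>\<^bsub>ID\<^esub> incl u) \<otimes>\<^bsub>ID\<^esub> ev y"
    by (simp add: x_def)
qed

lemma ID_integro_diff_algebra: "comm_integro_diff_algebra k ID lam d_ID Pi_ID"
proof (intro comm_integro_diff_algebra.intro ID_diff_algebra comm_integro_diff_algebra_axioms.intro Pi_ID_linear d_Pi_ID)
  fix x y assume xy: "x \<in> carrier ID" "y \<in> carrier ID"
  then have "(x \<ominus>\<^bsub>ID\<^esub> Pi_ID (d_ID x)) \<otimes>\<^bsub>ID\<^esub> (y \<ominus>\<^bsub>ID\<^esub> Pi_ID (d_ID y)) = x \<otimes>\<^bsub>ID\<^esub> y \<ominus>\<^bsub>ID\<^esub> Pi_ID (d_ID (x \<otimes>\<^bsub>ID\<^esub> y))"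
    using ev_mult[OF xy] by (simp add: ev_def)
  then show "Pi_ID (d_ID x) \<otimes>\<^bsub>ID\<^esub> Pi_ID (d_ID y) =
      Pi_ID (d_ID x) \<otimes>\<^bsub>ID\<^esub> y \<oplus>\<^bsub>ID\<^esub> x \<otimes>\<^bsub>ID\<^esub> Pi_ID (d_ID y) \<ominus>\<^bsub>ID\<^esub> Pi_ID (d_ID (x \<otimes>\<^bsub>ID\<^esub> y))"
    using xy d_ID_closed Pi_ID_closed by (subst ID.mult_of_projections) auto
qed

lemma i_A_diff_hom: "i_A \<in> diff_hom k A d ID d_ID"
proof -
  have "i_A a = incl [a]" for a
    by (simp add: i_A_def)
  moreover have "incl [a] \<in> carrier ID" if "a \<in> carrier A" for a
    using that by (intro incl_closed T_words_ConsI) auto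
  ultimately show ?thesis
    unfolding diff_hom_def alg_hom_def linear_map_def
    by (auto intro!: ring_hom_memI simp: incl_mult_single incl_single_add incl_single_smult d_ID_incl_single
      incl_eq[of "[\<one>\<^bsub>A\<^esub>]"] tens_single_one emb_one)
qed

end

end

section \<open>The universal property\<close>

lemma (in cring) minus_minus_cancel:
  "\<lbrakk>x \<in> carrier R; y \<in> carrier R\<rbrakk> \<Longrightarrow> x \<ominus> (x \<ominus> y) = y"
  by algebra

section \<open>Evaluation and integration by parts in an integro-differential algebra\<close>

context comm_integro_diff_algebra
begin

lemma D_closed [simp]: "x \<in> carrier R \<Longrightarrow> D x \<in> carrier R"
  using d_linear by (auto simp: linear_map_def)

lemma P_closed [simp]: "x \<in> carrier R \<Longrightarrow> P x \<in> carrier R"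
  and P_add: "\<lbrakk>x \<in> carrier R; y \<in> carrier R\<rbrakk> \<Longrightarrow> P (x \<oplus>\<^bsub>R\<^esub> y) = P x \<oplus>\<^bsub>R\<^esub> P y"
  and P_smult: "\<lbrakk>r \<in> carrier k; x \<in> carrier R\<rbrakk> \<Longrightarrow> P (r \<odot>\<^bsub>R\<^esub> x) = r \<odot>\<^bsub>R\<^esub> P x"
  using P_linear by (auto simp: linear_map_def)

lemma R_module: "module k R"
  by (rule module_axioms)

lemma P_zero [simp]: "P \<zero>\<^bsub>R\<^esub> = \<zero>\<^bsub>R\<^esub>"
  by (rule linear_map_zero[OF R_module R_module P_linear])

definition evaluation where
  "evaluation x = x \<ominus>\<^bsub>R\<^esub> P (D x)"

lemma evaluation_linear: "evaluation \<in> linear_map k R R"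
proof -
  have "(\<lambda>x. x \<ominus>\<^bsub>R\<^esub> P (D x)) \<in> linear_map k R R"
    by (intro linear_map_diff linear_map_id linear_map_comp[OF d_linear P_linear])
  then show ?thesis
    by (simp add: evaluation_def[abs_def])
qed

lemma evaluation_closed [simp]: "x \<in> carrier R \<Longrightarrow> evaluation x \<in> carrier R"
  and evaluation_add: "\<lbrakk>x \<in> carrier R; y \<in> carrier R\<rbrakk> \<Longrightarrow> evaluation (x \<oplus>\<^bsub>R\<^esub> y) = evaluation x \<oplus>\<^bsub>R\<^esub> evaluation y"
  and evaluation_smult: "\<lbrakk>r \<in> carrier k; x \<in> carrier R\<rbrakk> \<Longrightarrow> evaluation (r \<odot>\<^bsub>R\<^esub> x) = r \<odot>\<^bsub>R\<^esub> evaluation x"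
  using evaluation_linear by (auto simp: linear_map_def)

lemma evaluation_mult:
  assumes "x \<in> carrier R" "y \<in> carrier R"
  shows "evaluation (x \<otimes>\<^bsub>R\<^esub> y) = evaluation x \<otimes>\<^bsub>R\<^esub> evaluation y"
  using mult_of_projections[of x y "P (D x)" "P (D y)" "P (D (x \<otimes>\<^bsub>R\<^esub> y))"] hybrid_Rota_Baxter[OF assms] assms
  by (simp add: evaluation_def)

lemma evaluation_one: "evaluation \<one>\<^bsub>R\<^esub> = \<one>\<^bsub>R\<^esub>"
  by (simp add: evaluation_def d_one minus_eq)

lemma evaluation_P: "x \<in> carrier R \<Longrightarrow> evaluation (P x) = \<zero>\<^bsub>R\<^esub>"
  by (simp add: evaluation_def D_P)

lemma D_evaluation: "x \<in> carrier R \<Longrightarrow> D (evaluation x) = \<zero>\<^bsub>R\<^esub>"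
  using linear_map_minus[OF R_module R_module d_linear, of x "P (D x)"] by (simp add: evaluation_def D_P)

lemma P_D: "x \<in> carrier R \<Longrightarrow> P (D x) = x \<ominus>\<^bsub>R\<^esub> evaluation x"
  by (simp add: evaluation_def minus_minus_cancel)

text \<open>The evaluation is multiplicative and kills \<open>P x\<close>, hence kills the product
  with \<open>a\<close>; so the product equals the integral of its derivative. The Leibniz rule with
  \<open>D (P x) = x\<close> gives the integrand.\<close>

lemma integration_by_parts:
  assumes "a \<in> carrier R" "x \<in> carrier R"
  shows "a \<otimes>\<^bsub>R\<^esub> P x = P (D a \<otimes>\<^bsub>R\<^esub> P x \<oplus>\<^bsub>R\<^esub> a \<otimes>\<^bsub>R\<^esub> x \<oplus>\<^bsub>R\<^esub> lam \<odot>\<^bsub>R\<^esub> (D a \<otimes>\<^bsub>R\<^esub> x))"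
proof -
  have "evaluation (a \<otimes>\<^bsub>R\<^esub> P x) = \<zero>\<^bsub>R\<^esub>"
    using assms by (simp add: evaluation_mult evaluation_P)
  then have "a \<otimes>\<^bsub>R\<^esub> P x = P (D (a \<otimes>\<^bsub>R\<^esub> P x))"
    using assms P_D[of "a \<otimes>\<^bsub>R\<^esub> P x"] by (simp add: minus_eq)
  then show ?thesis
    using assms by (simp add: d_mult D_P)
qed

lemma Rota_Baxter:
  assumes "x \<in> carrier R" "y \<in> carrier R"
  shows "P x \<otimes>\<^bsub>R\<^esub> P y = P (x \<otimes>\<^bsub>R\<^esub> P y \<oplus>\<^bsub>R\<^esub> P x \<otimes>\<^bsub>R\<^esub> y \<oplus>\<^bsub>R\<^esub> lam \<odot>\<^bsub>R\<^esub> (x \<otimes>\<^bsub>R\<^esub> y))"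
  using integration_by_parts[of "P x" y] assms by (simp add: D_P)

lemma D_evaluation_mult: "\<lbrakk>a \<in> carrier R; x \<in> carrier R\<rbrakk> \<Longrightarrow> D (evaluation a \<otimes>\<^bsub>R\<^esub> x) = evaluation a \<otimes>\<^bsub>R\<^esub> D x"
  using d_mult[of "evaluation a" x] lam_closed by (simp add: D_evaluation)

text \<open>An evaluation has derivative zero, so integration by parts loses all terms but one. In
  \<open>R\<close> this is the counterpart of the linearity of \<open>Pi_ID\<close> over the
  replica.\<close>

lemma P_evaluation_mult: "\<lbrakk>a \<in> carrier R; x \<in> carrier R\<rbrakk> \<Longrightarrow> P (evaluation a \<otimes>\<^bsub>R\<^esub> x) = evaluation a \<otimes>\<^bsub>R\<^esub> P x"
  using integration_by_parts[of "evaluation a" x] lam_closed by (simp add: D_evaluation)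

end

section \<open>Iterated integrals and the induced map from Sh(A) to R\<close>

text \<open>There is one integration fewer than there are letters: the outermost letter stays
  outside all integrals, and the last letter is the innermost integrand.\<close>

fun iterated_integral where
  "iterated_integral R f P [] = \<zero>\<^bsub>R\<^esub>"
| "iterated_integral R f P [a] = f a"
| "iterated_integral R f P (a # b # w) = f a \<otimes>\<^bsub>R\<^esub> P (iterated_integral R f P (b # w))"

locale integro_diff_extension = regular_diff_algebra k A lam d Q + S: comm_integro_diff_algebra k R lam D P
  for k (structure) and A (structure) and lam and d and Q and R (structure) and D and P +
  fixes f
  assumes f_diff_hom: "f \<in> diff_hom k A d R D"
    and well_defined: Pi_well_defined
begin

lemma f_linear: "f \<in> linear_map k A R"
  and f_ring_hom: "f \<in> ring_hom A R"
  and f_d: "a \<in> carrier A \<Longrightarrow> f (d a) = D (f a)"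
  using f_diff_hom by (auto simp: diff_hom_def alg_hom_def)

lemma f_closed [simp]: "a \<in> carrier A \<Longrightarrow> f a \<in> carrier R"
  and f_add: "\<lbrakk>a \<in> carrier A; b \<in> carrier A\<rbrakk> \<Longrightarrow> f (a \<oplus>\<^bsub>A\<^esub> b) = f a \<oplus>\<^bsub>R\<^esub> f b"
  and f_smult: "\<lbrakk>r \<in> carrier k; a \<in> carrier A\<rbrakk> \<Longrightarrow> f (r \<odot>\<^bsub>A\<^esub> a) = r \<odot>\<^bsub>R\<^esub> f a"
  and f_mult: "\<lbrakk>a \<in> carrier A; b \<in> carrier A\<rbrakk> \<Longrightarrow> f (a \<otimes>\<^bsub>A\<^esub> b) = f a \<otimes>\<^bsub>R\<^esub> f b"
  and f_one: "f \<one>\<^bsub>A\<^esub> = \<one>\<^bsub>R\<^esub>"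
  using f_linear ring_hom_mult[OF f_ring_hom] ring_hom_one[OF f_ring_hom] by (auto simp: linear_map_def)

abbreviation J where "J \<equiv> iterated_integral R f P"

lemma J_Cons: "w \<noteq> [] \<Longrightarrow> J (a # w) = f a \<otimes>\<^bsub>R\<^esub> P (J w)"
  by (cases w) auto

lemma J_closed: "set w \<subseteq> carrier A \<Longrightarrow> J w \<in> carrier R"
proof (induction w)
  case (Cons a w)
  then show ?case by (cases w) auto
qed simp

lemma J_head_add: "\<lbrakk>a \<in> carrier A; b \<in> carrier A; set w \<subseteq> carrier A\<rbrakk> \<Longrightarrow>
    J ((a \<oplus>\<^bsub>A\<^esub> b) # w) = J (a # w) \<oplus>\<^bsub>R\<^esub> J (b # w)"
  using J_closed[of w] by (cases "w = []") (simp_all add: J_Cons f_add S.l_distr)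

lemma J_head_smult: "\<lbrakk>r \<in> carrier k; a \<in> carrier A; set w \<subseteq> carrier A\<rbrakk> \<Longrightarrow>
    J ((r \<odot>\<^bsub>A\<^esub> a) # w) = r \<odot>\<^bsub>R\<^esub> J (a # w)"
  using J_closed[of w] by (cases "w = []") (simp_all add: J_Cons f_smult S.smult_assoc2)

lemma J_head_mult: "\<lbrakk>a \<in> carrier A; b \<in> carrier A; set w \<subseteq> carrier A\<rbrakk> \<Longrightarrow>
    J ((a \<otimes>\<^bsub>A\<^esub> b) # w) = f a \<otimes>\<^bsub>R\<^esub> J (b # w)"
  using J_closed[of w] by (cases "w = []") (simp_all add: J_Cons f_mult S.m_assoc)

lemma J_multilinear: "multilinear k A A_words R J"
  unfolding multilinear_A_words_iff
proof
  fix n show "multilinear k A (words A (Suc n)) R J"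
  proof (induction n)
    case 0
    show ?case
    proof (rule multilinear_words_ConsI)
      show "multilinear k A (words A 0) R (\<lambda>w. J (a # w))" if "a \<in> carrier A" for a
        using that by (intro multilinear_words_0) simp
    qed (simp_all add: words_def J_closed f_add f_smult)
  next
    case (Suc n)
    show ?case
    proof (rule multilinear_words_ConsI)
      fix a assume a: "a \<in> carrier A"
      have "multilinear k A (words A (Suc n)) R (\<lambda>w. f a \<otimes>\<^bsub>R\<^esub> P (J w))"
        by (rule multilinear_linear_comp[OF Suc linear_map_comp[OF S.P_linear S.linear_map_mult_left[OF f_closed[OF a]]] words_replace])
      then show "multilinear k A (words A (Suc n)) R (\<lambda>w. J (a # w))"
        by (rule multilinear_cong) (auto simp: words_def J_Cons simp flip: length_greater_0_conv)
    qed (simp_all add: words_def J_closed J_head_add J_head_smult)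
  qed
qed

text \<open>The Rota-Baxter homomorphism out of \<open>Sh\<close> induced by \<open>f\<close>. Pure
  tensors determine it on the carrier, so the choice affects values outside the carrier
  only.\<close>

definition G where
  "G = (SOME G. G \<in> linear_map k Sh R \<and> (\<forall>w\<in>A_words. G (tens w) = J w))"

lemma G_linear: "G \<in> linear_map k Sh R"
  and G_tens: "w \<in> A_words \<Longrightarrow> G (tens w) = J w"
proof -
  have "\<exists>G. G \<in> linear_map k Sh R \<and> (\<forall>w\<in>A_words. G (tens w) = J w)"
    using Sh_linear_universal[OF S.module_axioms J_multilinear] by blast
  from someI_ex[OF this, folded G_def]
  show "G \<in> linear_map k Sh R" "w \<in> A_words \<Longrightarrow> G (tens w) = J w"
    by blast+
qed

lemma G_closed [simp]: "x \<in> carrier Sh \<Longrightarrow> G x \<in> carrier R"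
  and G_add: "\<lbrakk>x \<in> carrier Sh; y \<in> carrier Sh\<rbrakk> \<Longrightarrow> G (x \<oplus>\<^bsub>Sh\<^esub> y) = G x \<oplus>\<^bsub>R\<^esub> G y"
  and G_smult: "\<lbrakk>r \<in> carrier k; x \<in> carrier Sh\<rbrakk> \<Longrightarrow> G (r \<odot>\<^bsub>Sh\<^esub> x) = r \<odot>\<^bsub>R\<^esub> G x"
  using G_linear by (auto simp: linear_map_def)

lemma G_Sh_cons:
  assumes "c \<in> carrier A" "x \<in> carrier Sh"
  shows "G (Sh_cons c x) = f c \<otimes>\<^bsub>R\<^esub> P (G x)"
proof (rule Sh_additive_eqI[OF S.M.abelian_group_axioms
    linear_map_hom[OF linear_map_comp[OF Sh_cons_linear[OF assms(1)] G_linear]]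
    linear_map_hom[OF linear_map_comp[OF linear_map_comp[OF G_linear S.P_linear]
      S.linear_map_mult_left[OF f_closed[OF assms(1)]]]] _ assms(2)])
  fix w assume "w \<in> A_words"
  then show "G (Sh_cons c (tens w)) = f c \<otimes>\<^bsub>R\<^esub> P (G (tens w))"
    using assms(1) by (simp add: Sh_cons_tens G_tens J_Cons)
qed

lemma G_single_mult:
  assumes "c \<in> carrier A" "x \<in> carrier Sh"
  shows "G (tens [c] \<otimes>\<^bsub>Sh\<^esub> x) = f c \<otimes>\<^bsub>R\<^esub> G x"
proof (rule Sh_additive_eqI[OF S.M.abelian_group_axioms
    linear_map_hom[OF linear_map_comp[OF Sh.linear_map_mult_left[OF tens_single_closed[OF assms(1)]] G_linear]]
    linear_map_hom[OF linear_map_comp[OF G_linear S.linear_map_mult_left[OF f_closed[OF assms(1)]]]] _ assms(2)])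
  fix w assume "w \<in> A_words"
  then obtain b v where "w = b # v" "b \<in> carrier A" "set v \<subseteq> carrier A"
    by (cases w) auto
  then show "G (tens [c] \<otimes>\<^bsub>Sh\<^esub> tens w) = f c \<otimes>\<^bsub>R\<^esub> G (tens w)"
    using assms(1) by (simp add: Sh_single_mult G_tens J_head_mult)
qed

lemma G_one: "G \<one>\<^bsub>Sh\<^esub> = \<one>\<^bsub>R\<^esub>"
  using G_tens[of "[\<one>\<^bsub>A\<^esub>]"] by (simp add: tens_single_one f_one)

text \<open>The shuffle recursion is carried to the Rota-Baxter identity of \<open>P\<close>:
  prefixing the unit becomes integration, and the induction hypothesis evaluates the three shorter
  shuffles.\<close>

lemma G_mult_tens: "\<lbrakk>u \<in> A_words; v \<in> A_words\<rbrakk> \<Longrightarrow> G (tens u \<otimes>\<^bsub>Sh\<^esub> tens v) = J u \<otimes>\<^bsub>R\<^esub> J v"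
proof (induction "length u + length v" arbitrary: u v rule: less_induct)
  case less
  obtain a u' where u: "u = a # u'" "a \<in> carrier A" "set u' \<subseteq> carrier A"
    using less(2) by (cases u) auto
  obtain b v' where v: "v = b # v'" "b \<in> carrier A" "set v' \<subseteq> carrier A"
    using less(3) by (cases v) auto
  note Jc = J_closed[OF u(3)] J_closed[OF v(3)]
  show ?case
  proof (cases "u' = [] \<or> v' = []")
    case True
    then show ?thesis
    proof
      assume "u' = []"
      then show ?thesis
        using u v G_single_mult[OF u(2), of "tens v"] tens_closed'[of v] G_tens[OF less(3)] by simp
    next
      assume "v' = []"
      moreover have "tens u \<otimes>\<^bsub>Sh\<^esub> tens v = tens v \<otimes>\<^bsub>Sh\<^esub> tens u"
        using less(2,3) tens_closed' by (intro Sh.m_comm) auto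
      ultimately show ?thesis
        using u v G_single_mult[OF v(2), of "tens u"] tens_closed'[of u] G_tens[OF less(2)] J_closed[of u]
          S.m_comm[of "J u" "f b"] by simp
    qed
  next
    case False
    then have A: "u' \<in> A_words" "v' \<in> A_words"
      using u v by auto
    then have one: "\<one>\<^bsub>A\<^esub> # u' \<in> A_words" "\<one>\<^bsub>A\<^esub> # v' \<in> A_words"
      by auto
    have ab: "a \<otimes>\<^bsub>A\<^esub> b \<in> carrier A"
      using u v by simp
    have J1: "J (\<one>\<^bsub>A\<^esub> # u') = P (J u')" "J (\<one>\<^bsub>A\<^esub> # v') = P (J v')"
      using False Jc by (simp_all add: J_Cons f_one)
    have c: "shuffle u' (\<one>\<^bsub>A\<^esub> # v') \<in> carrier Sh" "shuffle (\<one>\<^bsub>A\<^esub> # u') v' \<in> carrier Sh" "shuffle u' v' \<in> carrier Sh"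
      using A one by (auto intro!: shuffle_closed)
    have IH: "G (shuffle u' (\<one>\<^bsub>A\<^esub> # v')) = J u' \<otimes>\<^bsub>R\<^esub> P (J v')" "G (shuffle (\<one>\<^bsub>A\<^esub> # u') v') = P (J u') \<otimes>\<^bsub>R\<^esub> J v'"
      "G (shuffle u' v') = J u' \<otimes>\<^bsub>R\<^esub> J v'"
      using less(1)[OF _ A(1) one(2)] less(1)[OF _ one(1) A(2)] less(1)[OF _ A] u(1) v(1) A one
      by (simp_all add: Sh_mult_tens J1)
    have "G (tens u \<otimes>\<^bsub>Sh\<^esub> tens v) = G (Sh_cons (a \<otimes>\<^bsub>A\<^esub> b) (shuffle_sum u' v'))"
      using Sh_mult_tens[OF less(2,3)] shuffle_eq_Sh_cons[OF A, of a b] u(1) v(1) by simp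
    also have "\<dots> = f (a \<otimes>\<^bsub>A\<^esub> b) \<otimes>\<^bsub>R\<^esub> P (G (shuffle_sum u' v'))"
      using c lam_closed by (intro G_Sh_cons ab) (simp add: shuffle_sum_def)
    also have "G (shuffle_sum u' v') = J u' \<otimes>\<^bsub>R\<^esub> P (J v') \<oplus>\<^bsub>R\<^esub> P (J u') \<otimes>\<^bsub>R\<^esub> J v' \<oplus>\<^bsub>R\<^esub> lam \<odot>\<^bsub>R\<^esub> (J u' \<otimes>\<^bsub>R\<^esub> J v')"
      using c lam_closed by (simp add: shuffle_sum_def G_add G_smult IH)
    also have "P \<dots> = P (J u') \<otimes>\<^bsub>R\<^esub> P (J v')"
      using S.Rota_Baxter[OF Jc] by simp
    also have "f (a \<otimes>\<^bsub>A\<^esub> b) \<otimes>\<^bsub>R\<^esub> (P (J u') \<otimes>\<^bsub>R\<^esub> P (J v')) = J u \<otimes>\<^bsub>R\<^esub> J v"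
      using False u v Jc by (simp add: J_Cons f_mult S.m_ac)
    finally show ?thesis .
  qed
qed

lemma G_mult:
  assumes "x \<in> carrier Sh" "y \<in> carrier Sh"
  shows "G (x \<otimes>\<^bsub>Sh\<^esub> y) = G x \<otimes>\<^bsub>R\<^esub> G y"
proof (rule Sh_biadditive_eqI[where F = "\<lambda>x y. G (x \<otimes>\<^bsub>Sh\<^esub> y)" and G = "\<lambda>x y. G x \<otimes>\<^bsub>R\<^esub> G y",
    OF S.M.abelian_group_axioms hom_compose'[OF Sh_mult_hom_left linear_map_hom[OF G_linear]]
      hom_compose'[OF linear_map_hom[OF G_linear] linear_map_hom[OF S.linear_map_mult_right[OF G_closed]]]
      hom_compose'[OF Sh_mult_hom_right linear_map_hom[OF G_linear]]
      hom_compose'[OF linear_map_hom[OF G_linear] linear_map_hom[OF S.linear_map_mult_left[OF G_closed]]] _ assms])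
qed (simp_all add: G_mult_tens G_tens)

text \<open>The three terms of \<open>d_tail\<close> become the three terms of the Leibniz rule for
  the product of \<open>f a\<close> with an integral, whose derivative is the integrand.\<close>

lemma G_d_Sh:
  assumes "x \<in> carrier Sh"
  shows "G (d_Sh x) = D (G x)"
proof (rule Sh_additive_eqI[OF S.M.abelian_group_axioms linear_map_hom[OF linear_map_comp[OF d_Sh_linear G_linear]]
    linear_map_hom[OF linear_map_comp[OF G_linear S.d_linear]] _ assms])
  fix w assume "w \<in> A_words"
  then show "G (d_Sh (tens w)) = D (G (tens w))"
  proof (cases rule: A_word_cases)
    case (single a)
    then show ?thesis
      using G_tens[of "[d a]"] G_tens[of "[a]"] by (simp add: d_Sh_single f_d)
  next
    case (Cons a v)
    have v: "tens v \<in> carrier Sh"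
      using Cons by (intro tens_closed') auto
    have c: "Sh_cons (d a) (tens v) \<in> carrier Sh"
      using linear_map_closed[OF Sh_cons_linear v] Cons by simp
    have "G (d_Sh (tens w)) = f (d a) \<otimes>\<^bsub>R\<^esub> P (G (tens v)) \<oplus>\<^bsub>R\<^esub> f a \<otimes>\<^bsub>R\<^esub> G (tens v)
        \<oplus>\<^bsub>R\<^esub> lam \<odot>\<^bsub>R\<^esub> (f (d a) \<otimes>\<^bsub>R\<^esub> G (tens v))"
      using Cons v c \<open>w \<in> A_words\<close> lam_closed tens_single_closed
      by (simp add: d_Sh_tens d_word_Cons d_tail_def G_add G_smult G_Sh_cons G_single_mult)
    also have "\<dots> = D (f a \<otimes>\<^bsub>R\<^esub> P (G (tens v)))"
      using Cons v by (simp add: S.d_mult f_d S.D_P)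
    also have "f a \<otimes>\<^bsub>R\<^esub> P (G (tens v)) = G (tens w)"
      using Cons by (simp add: G_tens J_Cons)
    finally show ?thesis .
  qed
qed

section \<open>Extension of f to ID(A)\<close>

text \<open>A constant of \<open>A\<close> goes to an element with derivative zero, so nothing is
  subtracted. Consequently \<open>c\<close> has the same image from the replica as from
  \<open>A\<close>, and this is what lets the extension be defined on a tensor product over
  \<open>K\<close>.\<close>

lemma evaluation_f_K:
  assumes "c \<in> carrier K"
  shows "S.evaluation (f c) = f c"
proof -
  have "D (f c) = \<zero>\<^bsub>R\<^esub>"
    using assms f_d[of c] linear_map_zero[OF A_module S.module_axioms f_linear] by simp
  then show ?thesis
    using assms by (simp add: S.evaluation_def S.minus_eq)
qed

text \<open>The replica is mapped by the evaluation of \<open>f\<close> and \<open>Sh_T\<close> by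
  \<open>G\<close>. Balance over \<open>K\<close> holds because a constant contributes the factor
  \<open>f c\<close> on either side.\<close>

lemma extension_exists:
  obtains g where "g \<in> hom (add_monoid ID) (add_monoid R)"
    "\<And>a x. \<lbrakk>a \<in> carrier A; x \<in> carrier Sh_T\<rbrakk> \<Longrightarrow> g (tensor_pure K A_eps Sh_T (Eps a) x) = S.evaluation (f a) \<otimes>\<^bsub>R\<^esub> G x"
proof (rule TT.TA_universal[OF S.M.abelian_group_axioms, of "\<lambda>m x. S.evaluation (f (unEps m)) \<otimes>\<^bsub>R\<^esub> G x"])
  fix g assume "g \<in> hom (add_monoid TT.TA) (add_monoid R)"
    "\<And>m x. \<lbrakk>m \<in> carrier A_eps; x \<in> carrier Sh_T\<rbrakk> \<Longrightarrow> g (TT.pure m x) = S.evaluation (f (unEps m)) \<otimes>\<^bsub>R\<^esub> G x"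
  then show ?thesis
    using that[of g] by (simp add: hom_ID)
next
  fix c m n assume *: "c \<in> carrier K" "m \<in> carrier A_eps" "n \<in> carrier Sh_T"
  then obtain a where a: "m = Eps a" "a \<in> carrier A"
    by auto
  have c: "c \<in> carrier A"
    using *(1) by simp
  show "S.evaluation (f (unEps (c \<odot>\<^bsub>A_eps\<^esub> m))) \<otimes>\<^bsub>R\<^esub> G n = S.evaluation (f (unEps m)) \<otimes>\<^bsub>R\<^esub> G (c \<odot>\<^bsub>Sh_T\<^esub> n)"
    using a c Sh_T_closed[OF *(3)]
    by (simp add: f_mult S.evaluation_mult evaluation_f_K[OF *(1)] G_single_mult S.m_ac)
qed (auto simp: Sh_T_closed f_add S.evaluation_add S.l_distr S.r_distr G_add)

context
  fixes g
  assumes g_hom: "g \<in> hom (add_monoid ID) (add_monoid R)"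
    and g_pure: "\<And>a x. \<lbrakk>a \<in> carrier A; x \<in> carrier Sh_T\<rbrakk> \<Longrightarrow>
      g (tensor_pure K A_eps Sh_T (Eps a) x) = S.evaluation (f a) \<otimes>\<^bsub>R\<^esub> G x"
begin

lemma g_closed: "x \<in> carrier ID \<Longrightarrow> g x \<in> carrier R"
  and g_add: "\<lbrakk>x \<in> carrier ID; y \<in> carrier ID\<rbrakk> \<Longrightarrow> g (x \<oplus>\<^bsub>ID\<^esub> y) = g x \<oplus>\<^bsub>R\<^esub> g y"
  using g_hom by (auto simp: hom_def)

lemma g_minus: "\<lbrakk>x \<in> carrier ID; y \<in> carrier ID\<rbrakk> \<Longrightarrow> g (x \<ominus>\<^bsub>ID\<^esub> y) = g x \<ominus>\<^bsub>R\<^esub> g y"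
  by (rule additive_minus[OF ID.M.abelian_group_axioms S.M.abelian_group_axioms g_hom])

lemma g_eps_emb: "\<lbrakk>a \<in> carrier A; x \<in> carrier Sh_T\<rbrakk> \<Longrightarrow> g (eps a \<otimes>\<^bsub>ID\<^esub> emb x) = S.evaluation (f a) \<otimes>\<^bsub>R\<^esub> G x"
  using g_pure[of a x] by (simp add: pure_eq)

lemma g_emb: "x \<in> carrier Sh_T \<Longrightarrow> g (emb x) = G x"
  using g_pure[of "\<one>\<^bsub>A\<^esub>" x] Sh_T_closed by (simp add: emb_def f_one S.evaluation_one)

lemma g_eps: "a \<in> carrier A \<Longrightarrow> g (eps a) = S.evaluation (f a)"
  using g_pure[of a "\<one>\<^bsub>Sh\<^esub>"] Sh_T_one by (simp add: eps_eq G_one)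

lemma g_incl: "w \<in> T_words \<Longrightarrow> g (incl w) = J w"
  using g_emb[of "tens w"] G_tens[of w] T_words_subset word_span_tens[OF T_words_subset]
  by (auto simp: incl_eq Sh_T_carrier)

lemma g_mult:
  assumes "x \<in> carrier ID" "y \<in> carrier ID"
  shows "g (x \<otimes>\<^bsub>ID\<^esub> y) = g x \<otimes>\<^bsub>R\<^esub> g y"
proof -
  note g_TA = g_hom[unfolded hom_ID]
  have gc: "g x \<in> carrier R" if "x \<in> carrier TT.TA" for x
    using that g_closed by (simp add: ID_simps)
  have "g (x \<otimes>\<^bsub>TT.TA\<^esub> y) = g x \<otimes>\<^bsub>R\<^esub> g y"
  proof (rule TT.TA_biadditive_eqI[where F = "\<lambda>x y. g (x \<otimes>\<^bsub>TT.TA\<^esub> y)" and G = "\<lambda>x y. g x \<otimes>\<^bsub>R\<^esub> g y",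
      OF S.M.abelian_group_axioms hom_compose'[OF TT.TA_mult_hom_left g_TA]
        hom_compose'[OF g_TA linear_map_hom[OF S.linear_map_mult_right[OF gc]]]
        hom_compose'[OF TT.TA_mult_hom_right g_TA]
        hom_compose'[OF g_TA linear_map_hom[OF S.linear_map_mult_left[OF gc]]] _ assms[unfolded ID_simps]])
    fix m n m' n' assume *: "m \<in> carrier A_eps" "n \<in> carrier Sh_T" "m' \<in> carrier A_eps" "n' \<in> carrier Sh_T"
    then obtain a a' where a: "m = Eps a" "m' = Eps a'" "a \<in> carrier A" "a' \<in> carrier A"
      by auto
    have "n \<otimes>\<^bsub>Sh\<^esub> n' \<in> carrier Sh_T"
      using *(2,4) Sh_T_mult by (simp add: Sh_T_carrier)
    then show "g (TT.pure m n \<otimes>\<^bsub>TT.TA\<^esub> TT.pure m' n') = g (TT.pure m n) \<otimes>\<^bsub>R\<^esub> g (TT.pure m' n')"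
      using * a Sh_T_closed
      by (simp add: TT.pure_mult g_pure f_mult S.evaluation_mult G_mult S.m_ac)
  qed
  then show ?thesis
    by (simp add: ID_simps)
qed

lemma g_one: "g \<one>\<^bsub>ID\<^esub> = \<one>\<^bsub>R\<^esub>"
  using g_eps[of "\<one>\<^bsub>A\<^esub>"] by (simp add: eps_one f_one S.evaluation_one)

lemma g_smult:
  assumes "r \<in> carrier k" "x \<in> carrier ID"
  shows "g (r \<odot>\<^bsub>ID\<^esub> x) = r \<odot>\<^bsub>R\<^esub> g x"
  using assms eps_closed[of "r \<odot>\<^bsub>A\<^esub> \<one>\<^bsub>A\<^esub>"] g_closed[OF assms(2)] S.smult_eq_mult[of r "g x"]
  by (simp add: ID_smult g_mult g_eps f_smult f_one S.evaluation_smult S.evaluation_one)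

text \<open>The images of the replica are evaluations, hence constants for \<open>D\<close>, just as
  \<open>d_ID\<close> vanishes on the replica; the second factor is covered by
  \<open>G_d_Sh\<close>.\<close>

lemma g_d_ID:
  assumes "x \<in> carrier ID"
  shows "g (d_ID x) = D (g x)"
proof (rule ID_additive_eqI[OF S.M.abelian_group_axioms hom_compose'[OF d_ID_hom g_hom]
    hom_compose'[OF g_hom linear_map_hom[OF S.d_linear]] _ assms])
  fix a w assume a: "a \<in> carrier A" and w: "w \<in> T_words"
  have w': "tens w \<in> carrier Sh_T"
    using word_span_tens[OF T_words_subset w] by (simp add: Sh_T_carrier)
  then show "g (d_ID (eps a \<otimes>\<^bsub>ID\<^esub> incl w)) = D (g (eps a \<otimes>\<^bsub>ID\<^esub> incl w))"
    using a Sh_T_closed[OF w'] d_Sh_T[OF w']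
    by (simp add: incl_eq d_ID_eps_mult emb_closed d_ID_emb g_eps_emb G_d_Sh S.D_evaluation_mult)
qed

text \<open>For one letter, \<open>f (Q a)\<close> minus its evaluation is the integral of
  \<open>f (d (Q a))\<close>. For longer words, the terms with \<open>Q a\<close> are integration by
  parts for \<open>f (Q a)\<close> against the integral of \<open>J (b # w)\<close>, solved for the
  term containing the derivative. In both cases the term with \<open>T a\<close> adds the missing
  summand, since \<open>d (Q a)\<close> and \<open>T a\<close> sum to \<open>a\<close>.\<close>

lemma g_Pi_word: "w \<in> T_words \<Longrightarrow> g (Pi_word w) = P (J w)"
proof (induction rule: T_words_induct)
  case (single a)
  note T = T_in_A_T[OF single]
  have mem: "[Q a] \<in> T_words" "[\<one>\<^bsub>A\<^esub>, T a] \<in> T_words"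
    using single T by (auto intro!: T_words_ConsI)
  note closed = mem[THEN incl_closed] eps_closed[OF Q_closed[OF single]]
  have "g (Pi_word [a]) = f (Q a) \<ominus>\<^bsub>R\<^esub> S.evaluation (f (Q a)) \<oplus>\<^bsub>R\<^esub> P (f (T a))"
    using closed single by (simp add: g_add g_minus g_incl mem g_eps f_one)
  also have "\<dots> = P (f (d (Q a))) \<oplus>\<^bsub>R\<^esub> P (f (T a))"
    using single by (simp add: f_d S.P_D)
  also have "\<dots> = P (f (d (Q a) \<oplus>\<^bsub>A\<^esub> T a))"
    using single by (simp add: f_add S.P_add)
  also have "d (Q a) \<oplus>\<^bsub>A\<^esub> T a = a"
    using single by (simp add: T_def M.minus_eq M.a_lcomm[of "d (Q a)"] M.r_neg)
  finally show ?case by simp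
next
  case (Cons a b w)
  note T = T_in_A_T[OF Cons(1)] and b = A_T_closed[OF Cons(2)]
  have qb: "Q a \<otimes>\<^bsub>A\<^esub> b \<in> carrier A" "d (Q a) \<otimes>\<^bsub>A\<^esub> b \<in> carrier A"
    using Cons(1) b by auto
  have mem: "Q a # b # w \<in> T_words" "\<one>\<^bsub>A\<^esub> # T a # b # w \<in> T_words" "(Q a \<otimes>\<^bsub>A\<^esub> b) # w \<in> T_words"
    "(d (Q a) \<otimes>\<^bsub>A\<^esub> b) # w \<in> T_words"
    using Cons(1-3) T qb by (auto intro!: T_words_ConsI)
  note closed = mem(1,2)[THEN incl_closed] mem(3,4)[THEN Pi_word_closed]
  define x where "x = J (b # w)"
  have wA: "set w \<subseteq> carrier A"
    using Cons(3) A_T_subset by blast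
  have x: "x \<in> carrier R"
    unfolding x_def using b wA by (intro J_closed) simp
  define q where "q = f (Q a)"
  define t where "t = f (T a)"
  have qt: "q \<in> carrier R" "t \<in> carrier R" "D q \<in> carrier R"
    using Cons(1) by (simp_all add: q_def t_def)
  have J: "J ((Q a \<otimes>\<^bsub>A\<^esub> b) # w) = q \<otimes>\<^bsub>R\<^esub> x" "J ((d (Q a) \<otimes>\<^bsub>A\<^esub> b) # w) = D q \<otimes>\<^bsub>R\<^esub> x"
    using Cons(1) b wA by (simp_all add: J_head_mult q_def x_def flip: f_d)
  have "g (Pi_word (a # b # w)) = q \<otimes>\<^bsub>R\<^esub> P x \<ominus>\<^bsub>R\<^esub> P (q \<otimes>\<^bsub>R\<^esub> x) \<ominus>\<^bsub>R\<^esub> lam \<odot>\<^bsub>R\<^esub> P (D q \<otimes>\<^bsub>R\<^esub> x) \<oplus>\<^bsub>R\<^esub> P (t \<otimes>\<^bsub>R\<^esub> P x)"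
    using closed lam_closed Cons(1) x qt
    by (simp add: g_add g_minus g_smult g_incl mem Cons(4)[OF qb(1)] Cons(4)[OF qb(2)] J f_one
      flip: x_def q_def t_def)
  also have "\<dots> = P (D q \<otimes>\<^bsub>R\<^esub> P x \<oplus>\<^bsub>R\<^esub> t \<otimes>\<^bsub>R\<^esub> P x)"
  proof -
    have "q \<otimes>\<^bsub>R\<^esub> P x = P (D q \<otimes>\<^bsub>R\<^esub> P x) \<oplus>\<^bsub>R\<^esub> P (q \<otimes>\<^bsub>R\<^esub> x) \<oplus>\<^bsub>R\<^esub> lam \<odot>\<^bsub>R\<^esub> P (D q \<otimes>\<^bsub>R\<^esub> x)"
      using S.integration_by_parts[OF qt(1) x] qt x lam_closed by (simp add: S.P_add S.P_smult)
    moreover have "p \<oplus>\<^bsub>R\<^esub> i \<oplus>\<^bsub>R\<^esub> j \<ominus>\<^bsub>R\<^esub> i \<ominus>\<^bsub>R\<^esub> j \<oplus>\<^bsub>R\<^esub> s = p \<oplus>\<^bsub>R\<^esub> s"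
      if "p \<in> carrier R" "i \<in> carrier R" "j \<in> carrier R" "s \<in> carrier R" for p i j s
      using that by algebra
    ultimately show ?thesis
      using qt x lam_closed by (simp add: S.P_add)
  qed
  also have "D q \<otimes>\<^bsub>R\<^esub> P x \<oplus>\<^bsub>R\<^esub> t \<otimes>\<^bsub>R\<^esub> P x = f (d (Q a) \<oplus>\<^bsub>A\<^esub> T a) \<otimes>\<^bsub>R\<^esub> P x"
    using Cons(1) x by (simp add: q_def t_def f_add f_d S.l_distr)
  also have "d (Q a) \<oplus>\<^bsub>A\<^esub> T a = a"
    using Cons(1) by (simp add: T_def M.minus_eq M.a_lcomm[of "d (Q a)"] M.r_neg)
  finally show ?case
    by (simp add: x_def)
qed

lemma g_Pi_ID:
  assumes "x \<in> carrier ID"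
  shows "g (Pi_ID x) = P (g x)"
proof (rule ID_additive_eqI[OF S.M.abelian_group_axioms hom_compose'[OF Pi_ID_hom[OF well_defined] g_hom]
    hom_compose'[OF g_hom linear_map_hom[OF S.P_linear]] _ assms])
  fix a w assume a: "a \<in> carrier A" and w: "w \<in> T_words"
  have "J w \<in> carrier R"
    using w T_words_subset by (intro J_closed) auto
  then show "g (Pi_ID (eps a \<otimes>\<^bsub>ID\<^esub> incl w)) = P (g (eps a \<otimes>\<^bsub>ID\<^esub> incl w))"
    using a w incl_closed[OF w] eps_closed[OF a] Pi_word_closed[OF w]
    by (simp add: Pi_ID_eps[OF well_defined] Pi_ID_incl[OF well_defined] g_mult g_eps g_incl g_Pi_word
      S.P_evaluation_mult)
qed

lemma g_integro_diff_hom: "restrict g (carrier ID) \<in> integro_diff_hom k ID d_ID Pi_ID R D P"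
  unfolding integro_diff_hom_def diff_hom_def alg_hom_def linear_map_def
  using g_closed g_add g_mult g_one g_smult g_d_ID g_Pi_ID d_ID_closed Pi_ID_closed[OF well_defined]
  by (auto intro!: ring_hom_memI)

lemma g_i_A: "a \<in> carrier A \<Longrightarrow> g (i_A a) = f a"
  using g_incl[of "[a]"] by (simp add: i_A_def T_words_ConsI)

end

section \<open>Uniqueness of the extension\<close>

text \<open>The elements \<open>eps a\<close> and \<open>incl w\<close> are obtained from the image
  of \<open>i_A\<close> by products, differences, \<open>d_ID\<close> and \<open>Pi_ID\<close>, all
  of which a homomorphism respects, and their products generate \<open>ID\<close>
  additively.\<close>

lemma extension_unique:
  assumes g: "g \<in> integro_diff_hom k ID d_ID Pi_ID R D P" "\<And>a. a \<in> carrier A \<Longrightarrow> g (i_A a) = f a"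
    and h: "h \<in> integro_diff_hom k ID d_ID Pi_ID R D P" "\<And>a. a \<in> carrier A \<Longrightarrow> h (i_A a) = f a"
    and x: "x \<in> carrier ID"
  shows "g x = h x"
proof (rule ID_additive_eqI[OF S.M.abelian_group_axioms _ _ _ x])
  have linear: "g \<in> linear_map k ID R" and ring_hom: "g \<in> ring_hom ID R"
    and d: "\<And>x. x \<in> carrier ID \<Longrightarrow> g (d_ID x) = D (g x)" and Pi: "\<And>x. x \<in> carrier ID \<Longrightarrow> g (Pi_ID x) = P (g x)"
    if "g \<in> integro_diff_hom k ID d_ID Pi_ID R D P" for g
    using that by (auto simp: integro_diff_hom_def diff_hom_def alg_hom_def)
  show "g \<in> hom (add_monoid ID) (add_monoid R)" "h \<in> hom (add_monoid ID) (add_monoid R)"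
    using linear_map_hom[OF linear[OF g(1)]] linear_map_hom[OF linear[OF h(1)]] .
  have single: "incl [a] \<in> carrier ID" if "a \<in> carrier A" for a
    using that by (intro incl_closed T_words_ConsI) auto
  have eps: "g (eps a) = S.evaluation (f a)" if "g \<in> integro_diff_hom k ID d_ID Pi_ID R D P"
    "\<And>a. a \<in> carrier A \<Longrightarrow> g (i_A a) = f a" "a \<in> carrier A" for g a
  proof -
    have "g (eps a) = g (incl [a] \<ominus>\<^bsub>ID\<^esub> Pi_ID (d_ID (incl [a])))"
      using ev_incl_single[OF well_defined that(3)] by (simp add: ev_def[OF well_defined])
    then show ?thesis
      using linear_map_minus[OF ID.module_axioms S.module_axioms linear[OF that(1)]] single[OF that(3)]
        Pi_ID_closed[OF well_defined] d_ID_closed d[OF that(1)] Pi[OF that(1)] that(2)[OF that(3)]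
      by (simp add: S.evaluation_def i_A_def)
  qed
  have incl: "g (incl w) = J w" if g: "g \<in> integro_diff_hom k ID d_ID Pi_ID R D P"
    "\<And>a. a \<in> carrier A \<Longrightarrow> g (i_A a) = f a" and w: "w \<in> T_words" for g w
    using w
  proof (induction rule: T_words_induct)
    case (single a)
    then show ?case
      using g(2) by (simp add: i_A_def)
  next
    case (Cons a b w)
    have b: "b # w \<in> T_words" "\<one>\<^bsub>A\<^esub> # b # w \<in> T_words"
      using Cons(2,3) A_T_closed by (auto intro!: T_words_ConsI)
    \<comment> \<open>As \<open>b\<close> lies in \<open>A_T\<close>, the word \<open>b # w\<close>
      preceded by the unit is the integral of \<open>b # w\<close>; this exhibits a word as a letter
      times the integral of a shorter word.\<close>
    have "incl (a # b # w) = incl [a] \<otimes>\<^bsub>ID\<^esub> Pi_ID (incl (b # w))"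
      using incl_mult_single[of a "\<one>\<^bsub>A\<^esub>" "b # w"] Pi_ID_A_T[OF well_defined Cons(2,3)] Cons(1-3) by simp
    then have "g (incl (a # b # w)) = g (incl [a]) \<otimes>\<^bsub>R\<^esub> P (g (incl (b # w)))"
      using ring_hom_mult[OF ring_hom[OF g(1)] single[OF Cons(1)] Pi_ID_closed[OF well_defined incl_closed[OF b(1)]]]
        Pi[OF g(1) incl_closed[OF b(1)]] by simp
    then show ?case
      using Cons(1,2,4) g(2)[OF Cons(1)] A_T_closed by (simp add: i_A_def)
  qed
  fix a w assume a: "a \<in> carrier A" and w: "w \<in> T_words"
  show "g (eps a \<otimes>\<^bsub>ID\<^esub> incl w) = h (eps a \<otimes>\<^bsub>ID\<^esub> incl w)"
    using ring_hom_mult[OF ring_hom[OF g(1)] eps_closed[OF a] incl_closed[OF w]]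
      ring_hom_mult[OF ring_hom[OF h(1)] eps_closed[OF a] incl_closed[OF w]]
      eps[OF g a] eps[OF h a] incl[OF g w] incl[OF h w] by simp
qed

text \<open>Homomorphisms are determined on the carrier only; extensionality selects one function
  among those that agree there, so that uniqueness can be asserted for functions.\<close>

lemma extension_unique_exists:
  "\<exists>!g. g \<in> integro_diff_hom k ID d_ID Pi_ID R D P \<and> g \<in> extensional (carrier ID) \<and>
    (\<forall>a\<in>carrier A. g (i_A a) = f a)"
proof -
  obtain g where g: "g \<in> hom (add_monoid ID) (add_monoid R)"
    "\<And>a x. \<lbrakk>a \<in> carrier A; x \<in> carrier Sh_T\<rbrakk> \<Longrightarrow> g (tensor_pure K A_eps Sh_T (Eps a) x) = S.evaluation (f a) \<otimes>\<^bsub>R\<^esub> G x"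
    by (rule extension_exists) (rule that)
  have i_A: "i_A a \<in> carrier ID" if "a \<in> carrier A" for a
    unfolding i_A_def using that by (intro incl_closed T_words_ConsI) auto
  show ?thesis
  proof (rule ex1I)
    show "restrict g (carrier ID) \<in> integro_diff_hom k ID d_ID Pi_ID R D P \<and>
        restrict g (carrier ID) \<in> extensional (carrier ID) \<and>
        (\<forall>a\<in>carrier A. restrict g (carrier ID) (i_A a) = f a)"
      by (intro conjI ballI g_integro_diff_hom[OF g]) (simp_all add: i_A g_i_A[OF g])
    fix h assume h: "h \<in> integro_diff_hom k ID d_ID Pi_ID R D P \<and> h \<in> extensional (carrier ID) \<and>
      (\<forall>a\<in>carrier A. h (i_A a) = f a)"
    show "h = restrict g (carrier ID)"
    proof (rule extensionalityI[of _ "carrier ID"])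
      fix x assume x: "x \<in> carrier ID"
      have h_i_A: "h (i_A a) = f a" and g_i_A: "restrict g (carrier ID) (i_A a) = f a" if "a \<in> carrier A" for a
        using h that by (simp_all add: i_A g_i_A[OF g])
      show "h x = restrict g (carrier ID) x"
        by (rule extension_unique[OF conjunct1[OF h] h_i_A g_integro_diff_hom[OF g] g_i_A x])
    qed (use h in simp_all)
  qed
qed

end

theorem theorem4p6:
  fixes k :: "('k, 'x) ring_scheme" and A :: "('k, 'a, 'y) module_scheme"
    and lam :: 'k and d Q :: "'a \<Rightarrow> 'a"
  defines "ID \<equiv> regular_diff_algebra.ID k A lam d Q"
    and "d_ID \<equiv> regular_diff_algebra.d_ID k A lam d Q"
    and "Pi_ID \<equiv> regular_diff_algebra.Pi_ID k A lam d Q"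
    and "i_A \<equiv> regular_diff_algebra.i_A k A lam d Q"
  assumes "regular_diff_algebra k A lam d Q"
    and "regular_diff_algebra.Pi_well_defined k A lam d Q"
  shows "comm_integro_diff_algebra k ID lam d_ID Pi_ID \<and>
    i_A \<in> diff_hom k A d ID d_ID \<and>
    (\<forall>(R :: ('k, 'r, 'z) module_scheme) D P f.
      comm_integro_diff_algebra k R lam D P \<longrightarrow> f \<in> diff_hom k A d R D \<longrightarrow>
      (\<exists>!g. g \<in> integro_diff_hom k ID d_ID Pi_ID R D P \<and> g \<in> extensional (carrier ID) \<and>
        (\<forall>a\<in>carrier A. g (i_A a) = f a)))"
proof -
  interpret regular_diff_algebra k A lam d Q by fact
  show ?thesis
    unfolding assms(1-4)
  proof (intro conjI allI impI)
    fix R :: "('k, 'r, 'z) module_scheme" and D P f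
    assume "comm_integro_diff_algebra k R lam D P" "f \<in> diff_hom k A d R D"
    then interpret integro_diff_extension k A lam d Q R D P f
      using assms(5,6)
      by (intro integro_diff_extension.intro integro_diff_extension_axioms.intro)
    show "\<exists>!g. g \<in> integro_diff_hom k (regular_diff_algebra.ID k A lam d Q) (regular_diff_algebra.d_ID k A lam d Q)
        (regular_diff_algebra.Pi_ID k A lam d Q) R D P \<and>
        g \<in> extensional (carrier (regular_diff_algebra.ID k A lam d Q)) \<and>
        (\<forall>a\<in>carrier A. g (regular_diff_algebra.i_A k A lam d Q a) = f a)"
      by (rule extension_unique_exists)
  qed (fact ID_integro_diff_algebra[OF assms(6)] i_A_diff_hom[OF assms(6)])+
qed

end
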